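(* Let $f\in[H^{1,1}_{;,0}(Q)]'$ and $g\in\mathcal H_{0,}(\Sigma)$. Then the Dirichlet initial boundary value problem $\Box u=f$ in $Q$, $u=g$ on $\Sigma$, $u=\partial_tu=0$ on $\Omega\times\{0\}$ has a unique solution $u\in\mathcal H_{;0,}(Q)$, in the sense that $\gamma_\Sigma^iu=g$ and $\langle\Box\widetilde u,\mathcal Ev\rangle_{Q_-}=\langle f,v\rangle_Q$ for all $v\in H^{1,1}_{0;,0}(Q)$. Moreover, if $u_g\in\mathcal H_{;0,}(Q)$ is an extension of $g$ ($\gamma_\Sigma^iu_g=g$) with $\|u_g\|_{\mathcal H(Q)}=\|g\|_{\mathcal H_{0,}(\Sigma)}$, then $u_0:=u-u_g\in\mathcal H_{0;0,}(Q)$ satisfies $$\|\Box\widetilde u_0\|_{[H^1_0(Q_-)]'}\le\|f\|_{[H^{1,1}_{0;,0}(Q)]'}+\|\mathcal E\|_{H^{1,1}_{0;,0}(Q),H^1_0(Q_-)}\,\|g\|_{\mathcal H_{0,}(\Sigma)}.$$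
   Context: Let $n\in\{1,2,3\}$, $\Omega\subset\mathbb R^n$ a bounded interval ($n=1$) or bounded Lipschitz domain ($n=2,3$), $\Gamma=\partial\Omega$, $0<T<\infty$, $Q=\Omega\times(0,T)$, $\Sigma=\Gamma\times[0,T]$, $Q_-=\Omega\times(-T,T)$, $\Box=\partial_{tt}-\Delta_x$. Pairings $\langle\cdot,\cdot\rangle_Q,\langle\cdot,\cdot\rangle_{Q_-}$ extend the $L^2$ inner products; $X'$ is the dual of $X$ with dual norm. $H^{1,1}_{;0,}(Q)$ (resp. $H^{1,1}_{;,0}(Q)$) is the set of $v\in L^2(0,T;H^1(\Omega))\cap H^1(0,T;L^2(\Omega))$ with $v(\cdot,0)=0$ (resp. $v(\cdot,T)=0$), norm $(\|\partial_tv\|_{L^2(Q)}^2+\|\nabla_xv\|_{L^2(Q)}^2)^{1/2}$; $H^{1,1}_{0;0,}(Q)$ and $H^{1,1}_{0;,0}(Q)$ are the respective subspaces with zero trace on $\Sigma$ (i.e. with $H^1_0(\Omega)$ in place of $H^1(\Omega)$). $H^1_0(Q_-)$ has norm $(\|\partial_t\phi\|^2_{L^2(Q_-)}+\|\nabla_x\phi\|^2_{L^2(Q_-)})^{1/2}$. For $u\in L^2(Q)$, $\widetilde u$ is the extension by zero to $Q_-$, and $\Box\widetilde u$ is a distribution on $Q_-$. $\mathcal E:H^{1,1}_{0;,0}(Q)\to H^1_0(Q_-)$ is a fixed continuous injective extension operator (with $(\mathcal Ev)_{|Q}=v$), with operator norm $\|\mathcal E\|_{H^{1,1}_{0;,0}(Q),H^1_0(Q_-)}$.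 $\mathcal H(Q)=\{u=\widetilde u_{|Q}:\widetilde u\in L^2(Q_-),\ \widetilde u=0\text{ on }\Omega\times(-T,0),\ \Box\widetilde u\in[H^1_0(Q_-)]'\}$, norm $\|u\|_{\mathcal H(Q)}=(\|u\|_{L^2(Q)}^2+\|\Box\widetilde u\|_{[H^1_0(Q_-)]'}^2)^{1/2}$, where $\|\Box\widetilde u\|_{[H^1_0(Q_-)]'}=\sup_{0\ne v\in H^{1,1}_{0;,0}(Q)}|\langle\Box\widetilde u,\mathcal Ev\rangle_{Q_-}|/\|v\|_{H^{1,1}_{0;,0}(Q)}$. $\mathcal H_{;0,}(Q)$ and $\mathcal H_{0;0,}(Q)$ are the closures in $\mathcal H(Q)$ of $H^{1,1}_{;0,}(Q)$ and $H^{1,1}_{0;0,}(Q)$. $\gamma_\Sigma^i$ is the continuous extension of $u\mapsto u_{|\Sigma}$ from the interior; $\mathcal H_{0,}(\Sigma)=\gamma_\Sigma^i(\mathcal H_{;0,}(Q))$ with $\|v\|_{\mathcal H_{0,}(\Sigma)}=\inf\{\|V\|_{\mathcal H(Q)}:V\in\mathcal H_{;0,}(Q),\gamma_\Sigma^iV=v\}$. *)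

theory Defs
  imports "HOL-Analysis.Analysis"
begin

text \<open>
  Elements of the function spaces below are represented by real functions on the whole ambient
  type; only their values on the domain in question matter, and two functions represent the same
  element iff they agree almost everywhere there. Space-time points are pairs \<open>(x, t)\<close>.
\<close>

section \<open>Domains\<close>

text \<open>Near each boundary point, in coordinates adapted to some unit vector \<open>e\<close>,
  \<open>\<Omega>\<close> is the strict epigraph of a Lipschitz function on the hyperplane orthogonal to \<open>e\<close>.\<close>

definition lipschitz_boundary :: "'a::euclidean_space set \<Rightarrow> bool" where
  "lipschitz_boundary \<Omega> \<longleftrightarrow>
     (\<forall>p\<in>frontier \<Omega>. \<exists>e r h L. \<exists>\<psi>::'a \<Rightarrow> real.
        norm e = 1 \<and> r > 0 \<and> h > 0 \<and> L-lipschitz_on {y. y \<bullet> e = 0} \<psi> \<and>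
        (\<forall>y s. y \<bullet> e = 0 \<and> norm y < r \<and> \<bar>s\<bar> < h \<longrightarrow>
           (p + y + s *\<^sub>R e \<in> \<Omega> \<longleftrightarrow> \<psi> y < s)))"

definition bounded_lipschitz_domain :: "'a::euclidean_space set \<Rightarrow> bool" where
  "bounded_lipschitz_domain \<Omega> \<longleftrightarrow>
     open \<Omega> \<and> connected \<Omega> \<and> \<Omega> \<noteq> {} \<and> bounded \<Omega> \<and> lipschitz_boundary \<Omega>"

definition admissible_domain :: "'a::euclidean_space set \<Rightarrow> bool" where
  "admissible_domain \<Omega> \<longleftrightarrow>
     (DIM('a) = 1 \<and> \<Omega> \<noteq> {} \<and> (\<exists>a b. \<Omega> = box a b)) \<or>
     (DIM('a) \<in> {2, 3} \<and> bounded_lipschitz_domain \<Omega>)"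

definition cylQ :: "'a::euclidean_space set \<Rightarrow> real \<Rightarrow> ('a \<times> real) set" where
  "cylQ \<Omega> T = \<Omega> \<times> {0<..<T}"

definition cylQm :: "'a::euclidean_space set \<Rightarrow> real \<Rightarrow> ('a \<times> real) set" where
  "cylQm \<Omega> T = \<Omega> \<times> {-T<..<T}"

definition lateral :: "'a::euclidean_space set \<Rightarrow> real \<Rightarrow> ('a \<times> real) set" where
  "lateral \<Omega> T = frontier \<Omega> \<times> {0..T}"

definition ae_eq_on :: "'a::euclidean_space set \<Rightarrow> ('a \<Rightarrow> real) \<Rightarrow> ('a \<Rightarrow> real) \<Rightarrow> bool" where
  "ae_eq_on U u v \<longleftrightarrow> (AE x in lborel. x \<in> U \<longrightarrow> u x = v x)"

section \<open>Test functions and weak derivatives\<close>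

definition pderiv_dir :: "'a::euclidean_space \<Rightarrow> ('a \<Rightarrow> real) \<Rightarrow> 'a \<Rightarrow> real" where
  "pderiv_dir b \<phi> x = frechet_derivative \<phi> (at x) b"

fun C_diff :: "nat \<Rightarrow> ('a::euclidean_space \<Rightarrow> real) \<Rightarrow> bool" where
  "C_diff 0 \<phi> \<longleftrightarrow> continuous_on UNIV \<phi>"
| "C_diff (Suc k) \<phi> \<longleftrightarrow>
     (\<forall>x. \<phi> differentiable (at x)) \<and> (\<forall>b\<in>Basis. C_diff k (pderiv_dir b \<phi>))"

definition test_fun :: "'a::euclidean_space set \<Rightarrow> ('a \<Rightarrow> real) set" where
  "test_fun U = {\<phi>. (\<forall>k. C_diff k \<phi>) \<and>
      compact (closure {x. \<phi> x \<noteq> 0}) \<and> closure {x. \<phi> x \<noteq> 0} \<subseteq> U}"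

definition L2 :: "'a::euclidean_space set \<Rightarrow> ('a \<Rightarrow> real) set" where
  "L2 U = {u. set_borel_measurable lborel U u \<and> set_integrable lborel U (\<lambda>x. (u x)\<^sup>2)}"

definition L2_norm :: "'a::euclidean_space set \<Rightarrow> ('a \<Rightarrow> real) \<Rightarrow> real" where
  "L2_norm U u = sqrt (LINT x:U|lborel. (u x)\<^sup>2)"

definition has_weak_deriv ::
    "'a::euclidean_space set \<Rightarrow> ('a \<Rightarrow> real) \<Rightarrow> 'a \<Rightarrow> ('a \<Rightarrow> real) \<Rightarrow> bool" where
  "has_weak_deriv U u b g \<longleftrightarrow>
     (\<forall>\<phi>\<in>test_fun U.
        (LINT x:U|lborel. u x * pderiv_dir b \<phi> x) = - (LINT x:U|lborel. g x * \<phi> x))"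

definition weak_deriv :: "'a::euclidean_space set \<Rightarrow> ('a \<Rightarrow> real) \<Rightarrow> 'a \<Rightarrow> 'a \<Rightarrow> real" where
  "weak_deriv U u b = (SOME g. g \<in> L2 U \<and> has_weak_deriv U u b g)"

section \<open>Sobolev spaces\<close>

definition H1 :: "'a::euclidean_space set \<Rightarrow> ('a \<Rightarrow> real) set" where
  "H1 U = {u \<in> L2 U. \<forall>b\<in>Basis. \<exists>g\<in>L2 U. has_weak_deriv U u b g}"

definition H1_norm :: "'a::euclidean_space set \<Rightarrow> ('a \<Rightarrow> real) \<Rightarrow> real" where
  "H1_norm U u = sqrt ((L2_norm U u)\<^sup>2 + (\<Sum>b\<in>Basis. (L2_norm U (weak_deriv U u b))\<^sup>2))"

definition H10 :: "'a::euclidean_space set \<Rightarrow> ('a \<Rightarrow> real) set" where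
  "H10 U = {u \<in> H1 U. \<exists>\<phi>. (\<forall>k. \<phi> k \<in> test_fun U) \<and>
      (\<lambda>k. H1_norm U (\<lambda>x. \<phi> k x - u x)) \<longlonglongrightarrow> 0}"

text \<open>\<open>(\<parallel>\<partial>\<^sub>t v\<parallel>\<^sup>2 + \<parallel>\<nabla>\<^sub>x v\<parallel>\<^sup>2)\<^sup>1\<^sup>/\<^sup>2\<close> on a space-time domain \<open>U\<close>; this is the norm both of the
  anisotropic spaces on \<open>Q\<close> and of \<open>H\<^sub>0\<^sup>1(Q\<^sub>-)\<close>.\<close>

definition energy_norm :: "('a::euclidean_space \<times> real) set \<Rightarrow> ('a \<times> real \<Rightarrow> real) \<Rightarrow> real" where
  "energy_norm U v = sqrt ((L2_norm U (weak_deriv U v (0, 1)))\<^sup>2 +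
     (\<Sum>b\<in>Basis. (L2_norm U (weak_deriv U v (b, 0)))\<^sup>2))"

text \<open>\<open>L\<^sup>2(0,T;X)\<close> for \<open>X = H\<^sup>1(\<Omega>)\<close> or \<open>X = H\<^sub>0\<^sup>1(\<Omega>)\<close>, with \<open>L\<^sup>2(0,T;L\<^sup>2(\<Omega>))\<close> identified
  with \<open>L\<^sup>2(Q)\<close>: almost every time slice is in \<open>X\<close>, and its gradient is square integrable in time.
  Joint measurability of \<open>v\<close> and \<open>G\<close> gives strong measurability of \<open>t \<mapsto> v(\<cdot>,t) \<in> X\<close>.\<close>

definition L2_time ::
    "('a::euclidean_space \<Rightarrow> real) set \<Rightarrow> 'a set \<Rightarrow> real \<Rightarrow> ('a \<times> real \<Rightarrow> real) set" where
  "L2_time X \<Omega> T = {v \<in> L2 (cylQ \<Omega> T).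
     (AE t in lborel. t \<in> {0<..<T} \<longrightarrow> (\<lambda>x. v (x, t)) \<in> X) \<and>
     (\<exists>G. \<forall>b\<in>Basis. G b \<in> L2 (cylQ \<Omega> T) \<and>
        (AE t in lborel. t \<in> {0<..<T} \<longrightarrow>
           has_weak_deriv \<Omega> (\<lambda>x. v (x, t)) b (\<lambda>x. G b (x, t))))}"

text \<open>\<open>H\<^sup>1(0,T;L\<^sup>2(\<Omega>))\<close>: the defining identity \<open>\<integral> v \<eta>' dt = - \<integral> D \<eta> dt\<close> is an identity
  in \<open>L\<^sup>2(\<Omega>)\<close>, i.e. for almost every \<open>x\<close>.\<close>

definition H1_time :: "'a::euclidean_space set \<Rightarrow> real \<Rightarrow> ('a \<times> real \<Rightarrow> real) set" where
  "H1_time \<Omega> T = {v \<in> L2 (cylQ \<Omega> T). \<exists>D\<in>L2 (cylQ \<Omega> T). \<forall>\<eta>\<in>test_fun {0<..<T}.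
      ae_eq_on \<Omega>
        (\<lambda>x. LINT t:{0<..<T}|lborel. v (x, t) * deriv \<eta> t)
        (\<lambda>x. - (LINT t:{0<..<T}|lborel. D (x, t) * \<eta> t))}"

text \<open>\<open>v(\<cdot>,s) = 0\<close>, for the representative of \<open>v\<close> in \<open>C([0,T];L\<^sup>2(\<Omega>))\<close>.\<close>

definition vanishes_at ::
    "'a::euclidean_space set \<Rightarrow> real \<Rightarrow> real \<Rightarrow> ('a \<times> real \<Rightarrow> real) \<Rightarrow> bool" where
  "vanishes_at \<Omega> T s v \<longleftrightarrow> (\<exists>w :: real \<Rightarrow> 'a \<Rightarrow> real.
     (\<forall>t\<in>{0..T}. w t \<in> L2 \<Omega> \<and>
        ((\<lambda>\<tau>. L2_norm \<Omega> (\<lambda>x. w \<tau> x - w t x)) \<longlongrightarrow> 0) (at t within {0..T})) \<and>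
     (AE t in lborel. t \<in> {0<..<T} \<longrightarrow> ae_eq_on \<Omega> (w t) (\<lambda>x. v (x, t))) \<and>
     ae_eq_on \<Omega> (w s) (\<lambda>x. 0))"

text \<open>The spaces \<open>H\<^sup>1\<^sup>,\<^sup>1\<close> on \<open>Q\<close> with zero initial (\<open>init\<close>) or terminal (\<open>term\<close>) values; the
  prefix \<open>0\<close> stands for zero lateral trace, imposed through \<open>H\<^sub>0\<^sup>1(\<Omega>)\<close>.\<close>

definition H11_init :: "'a::euclidean_space set \<Rightarrow> real \<Rightarrow> ('a \<times> real \<Rightarrow> real) set" where
  "H11_init \<Omega> T = {v \<in> L2_time (H1 \<Omega>) \<Omega> T \<inter> H1_time \<Omega> T. vanishes_at \<Omega> T 0 v}"

definition H11_term :: "'a::euclidean_space set \<Rightarrow> real \<Rightarrow> ('a \<times> real \<Rightarrow> real) set" where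
  "H11_term \<Omega> T = {v \<in> L2_time (H1 \<Omega>) \<Omega> T \<inter> H1_time \<Omega> T. vanishes_at \<Omega> T T v}"

definition H11_0init :: "'a::euclidean_space set \<Rightarrow> real \<Rightarrow> ('a \<times> real \<Rightarrow> real) set" where
  "H11_0init \<Omega> T = {v \<in> L2_time (H10 \<Omega>) \<Omega> T \<inter> H1_time \<Omega> T. vanishes_at \<Omega> T 0 v}"

definition H11_0term :: "'a::euclidean_space set \<Rightarrow> real \<Rightarrow> ('a \<times> real \<Rightarrow> real) set" where
  "H11_0term \<Omega> T = {v \<in> L2_time (H10 \<Omega>) \<Omega> T \<inter> H1_time \<Omega> T. vanishes_at \<Omega> T T v}"

section \<open>Duality and bounded operators\<close>

text \<open>Here \<open>N\<close> is a norm on classes, so \<open>N v = 0\<close> iff \<open>v\<close> represents zero; bounded functionals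
  therefore do not depend on representatives.\<close>

definition dual_space ::
    "('b \<Rightarrow> real) set \<Rightarrow> (('b \<Rightarrow> real) \<Rightarrow> real) \<Rightarrow> (('b \<Rightarrow> real) \<Rightarrow> real) set" where
  "dual_space V N = {F.
     (\<forall>v\<in>V. \<forall>w\<in>V. F (\<lambda>x. v x + w x) = F v + F w) \<and>
     (\<forall>c. \<forall>v\<in>V. F (\<lambda>x. c * v x) = c * F v) \<and>
     (\<exists>C. \<forall>v\<in>V. \<bar>F v\<bar> \<le> C * N v)}"

definition dual_norm ::
    "('b \<Rightarrow> real) set \<Rightarrow> (('b \<Rightarrow> real) \<Rightarrow> real) \<Rightarrow> (('b \<Rightarrow> real) \<Rightarrow> real) \<Rightarrow> real" where
  "dual_norm V N F = (SUP v\<in>{v \<in> V. N v \<noteq> 0}. \<bar>F v\<bar> / N v)"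

definition extension_operator :: "'a::euclidean_space set \<Rightarrow> real \<Rightarrow>
    (('a \<times> real \<Rightarrow> real) \<Rightarrow> ('a \<times> real \<Rightarrow> real)) \<Rightarrow> bool" where
  "extension_operator \<Omega> T E \<longleftrightarrow>
     (\<forall>v\<in>H11_0term \<Omega> T. E v \<in> H10 (cylQm \<Omega> T)) \<and>
     (\<forall>v\<in>H11_0term \<Omega> T. \<forall>w\<in>H11_0term \<Omega> T.
        ae_eq_on (cylQm \<Omega> T) (E (\<lambda>p. v p + w p)) (\<lambda>p. E v p + E w p)) \<and>
     (\<forall>c. \<forall>v\<in>H11_0term \<Omega> T. ae_eq_on (cylQm \<Omega> T) (E (\<lambda>p. c * v p)) (\<lambda>p. c * E v p)) \<and>
     (\<exists>C. \<forall>v\<in>H11_0term \<Omega> T.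
        energy_norm (cylQm \<Omega> T) (E v) \<le> C * energy_norm (cylQ \<Omega> T) v) \<and>
     (\<forall>v\<in>H11_0term \<Omega> T. \<forall>w\<in>H11_0term \<Omega> T.
        ae_eq_on (cylQm \<Omega> T) (E v) (E w) \<longrightarrow> ae_eq_on (cylQ \<Omega> T) v w) \<and>
     (\<forall>v\<in>H11_0term \<Omega> T. ae_eq_on (cylQ \<Omega> T) (E v) v)"

definition extension_norm :: "'a::euclidean_space set \<Rightarrow> real \<Rightarrow>
    (('a \<times> real \<Rightarrow> real) \<Rightarrow> ('a \<times> real \<Rightarrow> real)) \<Rightarrow> real" where
  "extension_norm \<Omega> T E =
     (SUP v\<in>{v \<in> H11_0term \<Omega> T. energy_norm (cylQ \<Omega> T) v \<noteq> 0}.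
        energy_norm (cylQm \<Omega> T) (E v) / energy_norm (cylQ \<Omega> T) v)"

section \<open>The wave operator and the solution space\<close>

definition zero_ext ::
    "'a::euclidean_space set \<Rightarrow> real \<Rightarrow> ('a \<times> real \<Rightarrow> real) \<Rightarrow> 'a \<times> real \<Rightarrow> real" where
  "zero_ext \<Omega> T u p = (if p \<in> cylQ \<Omega> T then u p else 0)"

definition wave_op :: "('a::euclidean_space \<times> real \<Rightarrow> real) \<Rightarrow> 'a \<times> real \<Rightarrow> real" where
  "wave_op \<phi> p = pderiv_dir (0, 1) (pderiv_dir (0, 1) \<phi>) p -
     (\<Sum>b\<in>Basis. pderiv_dir (b, 0) (pderiv_dir (b, 0) \<phi>) p)"

text \<open>\<open>F \<in> [H\<^sub>0\<^sup>1(Q\<^sub>-)]'\<close> and \<open>F\<close> is the distribution \<open>\<box>\<close> applied to the zero extension of \<open>u\<close>.\<close>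

definition represents_wave :: "'a::euclidean_space set \<Rightarrow> real \<Rightarrow> ('a \<times> real \<Rightarrow> real) \<Rightarrow>
    (('a \<times> real \<Rightarrow> real) \<Rightarrow> real) \<Rightarrow> bool" where
  "represents_wave \<Omega> T u F \<longleftrightarrow>
     F \<in> dual_space (H10 (cylQm \<Omega> T)) (energy_norm (cylQm \<Omega> T)) \<and>
     (\<forall>\<phi>\<in>test_fun (cylQm \<Omega> T).
        F \<phi> = (LINT p:cylQm \<Omega> T|lborel. zero_ext \<Omega> T u p * wave_op \<phi> p))"

text \<open>The duality pairing of \<open>\<box>\<close> of the zero extension of \<open>u\<close> with \<open>w \<in> H\<^sub>0\<^sup>1(Q\<^sub>-)\<close>; test functions
  are dense, so the choice is unique on \<open>H\<^sub>0\<^sup>1(Q\<^sub>-)\<close>.\<close>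

definition wave_pair :: "'a::euclidean_space set \<Rightarrow> real \<Rightarrow> ('a \<times> real \<Rightarrow> real) \<Rightarrow>
    ('a \<times> real \<Rightarrow> real) \<Rightarrow> real" where
  "wave_pair \<Omega> T u = (SOME F. represents_wave \<Omega> T u F)"

definition wave_norm :: "'a::euclidean_space set \<Rightarrow> real \<Rightarrow>
    (('a \<times> real \<Rightarrow> real) \<Rightarrow> ('a \<times> real \<Rightarrow> real)) \<Rightarrow> ('a \<times> real \<Rightarrow> real) \<Rightarrow> real" where
  "wave_norm \<Omega> T E u =
     dual_norm (H11_0term \<Omega> T) (energy_norm (cylQ \<Omega> T)) (\<lambda>v. wave_pair \<Omega> T u (E v))"

definition HQ :: "'a::euclidean_space set \<Rightarrow> real \<Rightarrow> ('a \<times> real \<Rightarrow> real) set" where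
  "HQ \<Omega> T = {u \<in> L2 (cylQ \<Omega> T). \<exists>F. represents_wave \<Omega> T u F}"

definition HQ_norm :: "'a::euclidean_space set \<Rightarrow> real \<Rightarrow>
    (('a \<times> real \<Rightarrow> real) \<Rightarrow> ('a \<times> real \<Rightarrow> real)) \<Rightarrow> ('a \<times> real \<Rightarrow> real) \<Rightarrow> real" where
  "HQ_norm \<Omega> T E u = sqrt ((L2_norm (cylQ \<Omega> T) u)\<^sup>2 + (wave_norm \<Omega> T E u)\<^sup>2)"

definition HQ_tends :: "'a::euclidean_space set \<Rightarrow> real \<Rightarrow>
    (('a \<times> real \<Rightarrow> real) \<Rightarrow> ('a \<times> real \<Rightarrow> real)) \<Rightarrow>
    (nat \<Rightarrow> 'a \<times> real \<Rightarrow> real) \<Rightarrow> ('a \<times> real \<Rightarrow> real) \<Rightarrow> bool" where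
  "HQ_tends \<Omega> T E V u \<longleftrightarrow> (\<lambda>k. HQ_norm \<Omega> T E (\<lambda>p. V k p - u p)) \<longlonglongrightarrow> 0"

definition HQ_closure :: "'a::euclidean_space set \<Rightarrow> real \<Rightarrow>
    (('a \<times> real \<Rightarrow> real) \<Rightarrow> ('a \<times> real \<Rightarrow> real)) \<Rightarrow>
    ('a \<times> real \<Rightarrow> real) set \<Rightarrow> ('a \<times> real \<Rightarrow> real) set" where
  "HQ_closure \<Omega> T E S = {u \<in> HQ \<Omega> T. \<exists>V. (\<forall>k. V k \<in> S \<inter> HQ \<Omega> T) \<and> HQ_tends \<Omega> T E V u}"

definition HQ_init :: "'a::euclidean_space set \<Rightarrow> real \<Rightarrow>
    (('a \<times> real \<Rightarrow> real) \<Rightarrow> ('a \<times> real \<Rightarrow> real)) \<Rightarrow> ('a \<times> real \<Rightarrow> real) set" where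
  "HQ_init \<Omega> T E = HQ_closure \<Omega> T E (H11_init \<Omega> T)"

definition HQ_0init :: "'a::euclidean_space set \<Rightarrow> real \<Rightarrow>
    (('a \<times> real \<Rightarrow> real) \<Rightarrow> ('a \<times> real \<Rightarrow> real)) \<Rightarrow> ('a \<times> real \<Rightarrow> real) set" where
  "HQ_0init \<Omega> T E = HQ_closure \<Omega> T E (H11_0init \<Omega> T)"

section \<open>The lateral trace\<close>

text \<open>The continuous extension of \<open>V \<mapsto> V|\<^sub>\<Sigma>\<close>, from functions continuous up to the boundary to
  \<open>HQ_init\<close>. Its values lie in the completion of the space of restrictions \<open>V|\<^sub>\<Sigma>\<close> with respect to
  the quotient norm of \<open>HQ_norm\<close>. A point of the completion is represented, as usual, by an
  equivalence class of Cauchy sequences: the trace of \<open>u\<close> is the class of all sequences of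
  restrictions \<open>V\<^sub>k|\<^sub>\<Sigma>\<close> with \<open>V\<^sub>k \<rightarrow> u\<close>.\<close>

type_synonym 'a lateral_datum = "(nat \<Rightarrow> 'a \<times> real \<Rightarrow> real) set"

definition lateral_trace :: "'a::euclidean_space set \<Rightarrow> real \<Rightarrow>
    (('a \<times> real \<Rightarrow> real) \<Rightarrow> ('a \<times> real \<Rightarrow> real)) \<Rightarrow> ('a \<times> real \<Rightarrow> real) \<Rightarrow> 'a lateral_datum" where
  "lateral_trace \<Omega> T E u = {w. \<exists>V.
     (\<forall>k. V k \<in> H11_init \<Omega> T \<and> continuous_on (closure (cylQ \<Omega> T)) (V k)) \<and>
     HQ_tends \<Omega> T E V u \<and> (\<forall>k. w k = restrict (V k) (lateral \<Omega> T))}"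

definition HSigma :: "'a::euclidean_space set \<Rightarrow> real \<Rightarrow>
    (('a \<times> real \<Rightarrow> real) \<Rightarrow> ('a \<times> real \<Rightarrow> real)) \<Rightarrow> 'a lateral_datum set" where
  "HSigma \<Omega> T E = lateral_trace \<Omega> T E ` HQ_init \<Omega> T E"

definition HSigma_norm :: "'a::euclidean_space set \<Rightarrow> real \<Rightarrow>
    (('a \<times> real \<Rightarrow> real) \<Rightarrow> ('a \<times> real \<Rightarrow> real)) \<Rightarrow> 'a lateral_datum \<Rightarrow> real" where
  "HSigma_norm \<Omega> T E g =
     (INF V\<in>{V \<in> HQ_init \<Omega> T E. lateral_trace \<Omega> T E V = g}. HQ_norm \<Omega> T E V)"

section \<open>The Dirichlet problem\<close>

definition dirichlet_solution :: "'a::euclidean_space set \<Rightarrow> real \<Rightarrow>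
    (('a \<times> real \<Rightarrow> real) \<Rightarrow> ('a \<times> real \<Rightarrow> real)) \<Rightarrow> (('a \<times> real \<Rightarrow> real) \<Rightarrow> real) \<Rightarrow>
    'a lateral_datum \<Rightarrow> ('a \<times> real \<Rightarrow> real) \<Rightarrow> bool" where
  "dirichlet_solution \<Omega> T E f g u \<longleftrightarrow>
     u \<in> HQ_init \<Omega> T E \<and> lateral_trace \<Omega> T E u = g \<and>
     (\<forall>v\<in>H11_0term \<Omega> T. wave_pair \<Omega> T u (E v) = f v)"

end

theory Submission
 imports Defs
begin

text \<open>The wave form \<open>a(u, v) = \<integral>\<^sub>Q \<nabla>u \<cdot> \<nabla>v - \<partial>\<^sub>tu \<partial>\<^sub>tv\<close> satisfies an inf-sup estimate: for \<open>\<psi>\<close> with zero lateral and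
 terminal values, \<open>J(\<cdot>, t) = \<integral>\<^sub>0\<^sup>t (T + r) \<psi>(\<cdot>, r) dr\<close> satisfies \<open>\<parallel>\<psi>\<parallel>\<^sup>2 \<le> 2 a(J, \<psi>)\<close> and
 \<open>|J|\<^sup>2 \<le> 8 T\<^sup>2 a(J, \<psi>)\<close> in the energy norm. Hence no element of the completed test space is annihilated by all
 \<open>a(u, \<cdot>)\<close>, and these functionals are dense in its dual. Reversing time, the same estimate bounds \<open>\<parallel>u\<parallel>\<close>
 by \<open>4 T\<close> times the dual norm of \<open>a(u, \<cdot>)\<close>; so approximate solutions of \<open>\<box>u = f - \<box>u\<^sub>g\<close> with zero initial and
 lateral values converge in \<open>H(Q)\<close>, and adding \<open>u\<^sub>g\<close> solves the problem.

 Two elements with the same trace are limits of functions continuous up to the boundary that agree on \<open>\<Sigma>\<close>. Their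
 differences have slices in \<open>H\<^sub>0\<^sup>1(\<Omega>)\<close> and are limits of test functions (through the extension operator), so the
 a priori bound gives uniqueness. Such approximations exist for every element: translate into \<open>\<Omega>\<close> and
 forward in time, then mollify. The final estimate holds because \<open>\<box>(u - u\<^sub>g) = f - \<box>u\<^sub>g\<close> on the test space
 and the extension operator has norm at least 1.\<close>

text \<open>The obstacle is the opposite end conditions: solutions vanish at t = 0, test functions
  at t = T, so the form cannot be tested with the solution itself and each test function needs a
  partner J. Positivity of the weight T + r gives the end terms their sign, its growth gives both
  quadratic remainders theirs, and T + r \<le> 2 T produces the factor 8 T^2. All computations take
  place in the smooth classes \<open>C_init\<close> and \<open>C_term\<close>: time reversal
  exchanges them, J maps the second into the first, and \<open>C_term\<close> contains the test
  functions on \<open>Qm\<close>, which are free at t = 0. The initial condition enters through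
  \<open>init_reg\<close>, saying that the zero extension to earlier times is weakly differentiable,
  so that integration by parts leaves no term at t = 0. As completions are not formed, injectivity
  is phrased for Cauchy sequences, and closability of the gradient shows that such a sequence
  tending to 0 in L2 represents zero. A trace is a class of approximating sequences, hence equality
  of traces is informative only for nonempty classes; this is where the geometry of the boundary
  enters.\<close>

abbreviation "pd \<equiv> pderiv_dir"
abbreviation "wd \<equiv> weak_deriv"
abbreviation "L2_dist U u v \<equiv> L2_norm U (%x. u x - v x)"

section \<open>Directional derivatives\<close>

lemma pd_eq:
 assumes "(f has_derivative D) (at x)"
 shows "pd b f x = D b"
 using frechet_derivative_at[OF assms] by (simp add: pderiv_dir_def)

lemma has_derivative_pd:
 assumes "f differentiable (at x)"
 shows "(f has_derivative (%h. pd h f x)) (at x)"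
 using assms by (simp add: pderiv_dir_def frechet_derivative_works)

lemma pd_expand:
 fixes f :: "'a::euclidean_space => real"
 assumes "f differentiable (at x)"
 shows "pd v f x = (\<Sum>c\<in>Basis. (v \<bullet> c) * pd c f x)"
proof -
 have lin: "linear (%h. pd h f x)"
  using has_derivative_pd[OF assms] has_derivative_linear by blast
 have "pd v f x = pd (\<Sum>c\<in>Basis. (v \<bullet> c) *\<^sub>R c) f x"
  by (simp add: euclidean_representation)
 also have "\<dots> = (\<Sum>c\<in>Basis. (v \<bullet> c) * pd c f x)"
  by (subst linear_sum[OF lin]) (simp only: linear_scale[OF lin] real_scaleR_def)
 finally show ?thesis .
qed

lemma C_diff_Suc_imp: "C_diff (Suc k) f ==> C_diff k f"
proof (induction k arbitrary: f)
 case 0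
 then show ?case
  by (auto intro!: continuous_at_imp_continuous_on differentiable_imp_continuous_within)
next
 case (Suc k)
 then show ?case by auto
qed

lemma C_diff_mono: "C_diff k f ==> j \<le> k ==> C_diff j f"
 by (induction k) (use C_diff_Suc_imp le_Suc_eq in blast)+

lemma C_diff_continuous: "C_diff k f ==> continuous_on UNIV f"
 using C_diff_mono[of k f 0] by simp

lemma C_diff_differentiable: "C_diff (Suc k) f ==> f differentiable (at x)"
 by simp

lemma C_diff_const: "C_diff k (%x. c)"
proof (induction k arbitrary: c)
 case (Suc k)
 have "pd b (%x::'a. c) = (%x. 0)" for b
  by (rule ext, rule pd_eq) (auto intro!: derivative_eq_intros)
 with Suc show ?case by simp
qed simp

lemma pd_add:
 assumes "f differentiable (at x)" "g differentiable (at x)"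
 shows "pd b (%x. f x + g x) x = pd b f x + pd b g x"
 by (rule pd_eq) (intro has_derivative_add has_derivative_pd assms)

lemma pd_diff:
 assumes "f differentiable (at x)" "g differentiable (at x)"
 shows "pd b (%x. f x - g x) x = pd b f x - pd b g x"
 by (rule pd_eq) (intro has_derivative_diff has_derivative_pd assms)

lemma pd_mult:
 assumes "f differentiable (at x)" "g differentiable (at x)"
 shows "pd b (%x. f x * g x) x = pd b f x * g x + f x * pd b g x"
 using pd_eq[OF has_derivative_mult[OF has_derivative_pd[OF assms(1)]
    has_derivative_pd[OF assms(2)]], of b]
 by simp

lemma C_diff_add: "C_diff k f ==> C_diff k g ==> C_diff k (%x. f x + g x)"
proof (induction k arbitrary: f g)
 case 0 then show ?case by (auto intro: continuous_intros)
next
 case (Suc k)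
 have "pd b (%x. f x + g x) = (%x. pd b f x + pd b g x)" for b
  using Suc.prems by (intro ext pd_add) auto
 with Suc show ?case by simp
qed

lemma C_diff_mult: "C_diff k f ==> C_diff k g ==> C_diff k (%x. f x * g x)"
proof (induction k arbitrary: f g)
 case 0 then show ?case by (auto intro: continuous_intros)
next
 case (Suc k)
 have "pd b (%x. f x * g x) = (%x. pd b f x * g x + f x * pd b g x)" for b
  using Suc.prems by (intro ext pd_mult) auto
 moreover have "C_diff k f" "C_diff k g"
  using Suc.prems by (auto intro: C_diff_Suc_imp simp del: C_diff.simps)
 ultimately show ?case using Suc by (simp add: C_diff_add)
qed

lemma C_diff_cmult: "C_diff k f ==> C_diff k (%x. c * f x)"
 by (intro C_diff_mult C_diff_const)

lemma C_diff_diff: "C_diff k f ==> C_diff k g ==> C_diff k (%x. f x - g x)"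
 using C_diff_add[OF _ C_diff_cmult, of k f g "-1"] by simp

lemma C_diff_sum: "(\<And>i. i \<in> I ==> C_diff k (f i)) ==> C_diff k (%x. \<Sum>i\<in>I. f i x)"
 by (induction I rule: infinite_finite_induct) (auto intro: C_diff_const C_diff_add)

lemma pd_compose_affine:
 assumes "bounded_linear L" "f differentiable (at (a + L x))"
 shows "pd b (%x. f (a + L x)) x = pd (L b) f (a + L x)"
proof (rule pd_eq)
 have "((%x. a + L x) has_derivative L) (at x)"
  using assms(1) by (auto intro!: derivative_eq_intros bounded_linear_imp_has_derivative)
 from has_derivative_compose[OF this has_derivative_pd[OF assms(2)]]
 show "((%x. f (a + L x)) has_derivative (%h. pd (L h) f (a + L x))) (at x)" .
qed

lemma C_diff_compose_affine:
 fixes f :: "'a::euclidean_space => real" and L :: "'b::euclidean_space => 'a"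
 assumes L: "bounded_linear L"
 shows "C_diff k f ==> C_diff k (%x. f (a + L x))"
proof (induction k arbitrary: f)
 case 0
 then show ?case
  using continuous_on_compose2[of UNIV f UNIV "%x. a + L x"]
   continuous_on_add[OF continuous_on_const linear_continuous_on[OF L]] by simp
next
 case (Suc k)
 have d: "f differentiable (at y)" for y using Suc.prems by simp
 have D: "((%x. a + L x) has_derivative L) (at x)" for x
  using L by (auto intro!: derivative_eq_intros bounded_linear_imp_has_derivative)
 have "(%x. f (a + L x)) differentiable (at x)" for x
  using has_derivative_compose[OF D[of x] has_derivative_pd[OF d]]
  by (auto simp: differentiable_def)
 moreover have "pd b (%x. f (a + L x)) =
   (%x. \<Sum>c\<in>Basis. (L b \<bullet> c) * pd c f (a + L x))" for b
  by (rule ext) (rule trans[OF pd_compose_affine[OF L d] pd_expand[OF d]])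
 ultimately show ?case
  using Suc by (auto intro!: C_diff_sum C_diff_cmult)
qed

lemma C_diff_inner: "C_diff k (%x. x \<bullet> v)"
proof (cases k)
 case 0 then show ?thesis by (auto intro!: continuous_intros)
next
 case (Suc j)
 have D: "((%x. x \<bullet> v) has_derivative (%h. h \<bullet> v)) (at x)" for x
  by (auto intro!: derivative_eq_intros)
 have "pd b (%x. x \<bullet> v) = (%x. b \<bullet> v)" for b
  by (rule ext, rule pd_eq[OF D])
 with Suc D show ?thesis by (auto simp: differentiable_def C_diff_const)
qed

lemma C_diff_compose_real:
 fixes F :: "nat => real => real" and f :: "'a::euclidean_space => real"
 assumes F: "\<And>i s. (F i has_real_derivative F (Suc i) s) (at s)"
  and f: "\<And>k. C_diff k f"
 shows "C_diff k (%x. F i (f x))"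
proof (induction k arbitrary: i)
 case 0
 have "continuous_on UNIV (F i)"
  using F by (meson DERIV_continuous_on has_field_derivative_at_within)
 moreover have "continuous_on UNIV f" using f[of 0] by simp
 ultimately show ?case by (auto intro: continuous_on_compose2)
next
 case (Suc k)
 have d: "f differentiable (at y)" for y using f[of 1] by simp
 have D: "((%x. F i (f x)) has_derivative (%h. F (Suc i) (f x) * pd h f x)) (at x)" for x
  using has_derivative_compose[OF has_derivative_pd[OF d[of x]], of "F i" "%h. F (Suc i) (f x) * h"]
   F[of i "f x"] by (simp add: has_field_derivative_def)
 have "pd b (%x. F i (f x)) = (%x. F (Suc i) (f x) * pd b f x)" for b
  by (rule ext, rule pd_eq[OF D])
 moreover have "C_diff k (pd b f)" if "b \<in> Basis" for b
  using f[of "Suc k"] that by simp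
 ultimately show ?case
  using D Suc by (auto intro!: C_diff_mult simp: differentiable_def)
qed

section \<open>The space $L^2$\<close>

text \<open>One discriminant argument serves the Cauchy-Schwarz inequalities for \<open>ip\<close>
  and \<open>B\<close> and the near-maximiser estimate. The case C = 0 is genuine, because these
  forms are only semidefinite on representatives.\<close>

lemma quadratic_nonneg_imp_discriminant:
 fixes A B C :: real
 assumes "\<And>t. 0 \<le> A + 2 * t * B + t\<^sup>2 * C" and C: "0 \<le> C"
 shows "\<bar>B\<bar> \<le> sqrt A * sqrt C"
proof -
 have A: "0 \<le> A" using assms(1)[of 0] by simp
 have "B\<^sup>2 \<le> A * C"
 proof (cases "C = 0")
  case True
  have "B = 0"
  proof (rule ccontr)
   assume "B \<noteq> 0"
   \<comment> \<open>For C = 0 the polynomial is affine in t, and at this t it equals -1.\<close>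
   with assms(1)[of "- (A + 1) / (2 * B)"] True show False by (simp add: field_simps)
  qed
  then show ?thesis using True by simp
 next
  case False
  then have "C > 0" using C by simp
  then show ?thesis using assms(1)[of "- B / C"]
   by (simp add: field_simps power2_eq_square)
 qed
 then have "sqrt (B\<^sup>2) \<le> sqrt (A * C)" by (rule real_sqrt_le_mono)
 then show ?thesis by (simp add: real_sqrt_mult)
qed

lemma indicator_mult_square: "indicator U x * a\<^sup>2 = (indicator U x * a :: real)\<^sup>2"
 by (auto simp: indicator_def)

text \<open>Representatives are arbitrary outside \<open>U\<close>, so measurability arguments pass
  to the total function \<open>indicator U x * u x\<close>.\<close>

lemma L2_iff:
 "u \<in> L2 U \<longleftrightarrow> (%x. indicator U x * u x) \<in> borel_measurable lborel \<and>
   integrable lborel (%x. (indicator U x * u x)\<^sup>2)"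
proof -
 have "(%x. (indicator U x * u x)\<^sup>2) = (%x. indicator U x * (u x)\<^sup>2)"
  by (auto simp: indicator_def fun_eq_iff)
 then show ?thesis
  by (simp add: L2_def set_borel_measurable_def set_integrable_def)
qed

lemma L2_mult_integrable:
 assumes u: "u \<in> L2 U" and v: "v \<in> L2 U"
 shows "set_integrable lborel U (%x. u x * v x)"
 unfolding set_integrable_def
proof (rule Bochner_Integration.integrable_bound)
 note [measurable] = u[unfolded L2_iff, THEN conjunct1] v[unfolded L2_iff, THEN conjunct1]
 show "integrable lborel (%x. (indicator U x * u x)\<^sup>2 + (indicator U x * v x)\<^sup>2)"
  using u v by (auto simp: L2_iff)
 have eq: "(%x. indicator U x *\<^sub>R (u x * v x)) = (%x. (indicator U x * u x) * (indicator U x * v x))"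
  by (auto simp: indicator_def fun_eq_iff)
 show "(%x. indicator U x *\<^sub>R (u x * v x)) \<in> borel_measurable lborel"
  unfolding eq by measurable
 have "\<bar>a * b\<bar> \<le> a\<^sup>2 + b\<^sup>2" for a b :: real
  using sum_squares_bound[of a b] sum_squares_bound[of a "-b"]
   zero_le_power2[of a] zero_le_power2[of b] unfolding abs_le_iff by (auto simp: abs_mult)
 then show "AE x in lborel. norm (indicator U x *\<^sub>R (u x * v x)) \<le>
   norm ((indicator U x * u x)\<^sup>2 + (indicator U x * v x)\<^sup>2)"
  by (auto simp: indicator_def)
qed

lemma L2_add: "u \<in> L2 U ==> v \<in> L2 U ==> (%x. u x + v x) \<in> L2 U"
proof -
 assume u: "u \<in> L2 U" and v: "v \<in> L2 U"
 have "integrable lborel (%x. (indicator U x * u x)\<^sup>2 + (indicator U x * v x)\<^sup>2 +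
   2 * (indicator U x *\<^sub>R (u x * v x)))"
  using u v L2_mult_integrable[OF u v] by (auto simp: L2_iff set_integrable_def)
 also have "(%x. (indicator U x * u x)\<^sup>2 + (indicator U x * v x)\<^sup>2 +
   2 * (indicator U x *\<^sub>R (u x * v x))) = (%x. (indicator U x * (u x + v x))\<^sup>2)"
  by (auto simp: indicator_def fun_eq_iff power2_eq_square algebra_simps)
 finally show ?thesis
  using u v by (auto simp: L2_iff distrib_left)
qed

lemma L2_cmult: "u \<in> L2 U ==> (%x. c * u x) \<in> L2 U"
proof -
 assume u: "u \<in> L2 U"
 have 1: "(%x. indicator U x * (c * u x)) = (%x. c * (indicator U x * u x))" by auto
 have 2: "(%x. (indicator U x * (c * u x))\<^sup>2) = (%x. c\<^sup>2 * (indicator U x * u x)\<^sup>2)"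
  by (auto simp: power_mult_distrib)
 show ?thesis using u unfolding L2_iff 1 2 by auto
qed

lemma L2_uminus: "u \<in> L2 U ==> (%x. - u x) \<in> L2 U"
 using L2_cmult[of u U "-1"] by simp

lemma L2_diff: "u \<in> L2 U ==> v \<in> L2 U ==> (%x. u x - v x) \<in> L2 U"
 using L2_add[of u U "%x. - v x"] by (simp add: L2_uminus)

lemma L2_zero: "(%x. 0) \<in> L2 U"
 by (simp add: L2_iff)

lemma L2_sum: "(\<And>i. i \<in> I ==> f i \<in> L2 U) ==> (%x. \<Sum>i\<in>I. f i x) \<in> L2 U"
 by (induction I rule: infinite_finite_induct) (auto intro: L2_zero L2_add)

lemma L2_cong: "(\<And>x. x \<in> U ==> u x = v x) ==> u \<in> L2 U \<longleftrightarrow> v \<in> L2 U"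
proof -
 assume "\<And>x. x \<in> U ==> u x = v x"
 then have "indicator U x * u x = indicator U x * v x" for x
  by (auto simp: indicator_def)
 then show ?thesis unfolding L2_iff by presburger
qed

lemma L2_subset:
 assumes "u \<in> L2 U" "V \<subseteq> U" "V \<in> sets borel"
 shows "u \<in> L2 V"
proof -
 have 1: "(%x. indicator V x * u x) = (%x. indicator V x * (indicator U x * u x))"
  using assms(2) by (auto simp: indicator_def fun_eq_iff)
 note [measurable] = assms(1)[unfolded L2_iff, THEN conjunct1] assms(3)
 have [measurable]: "(%x. indicator V x * u x) \<in> borel_measurable lborel"
  unfolding 1 by measurable
 have "integrable lborel (%x. (indicator V x * u x)\<^sup>2)"
 proof (rule Bochner_Integration.integrable_bound[OF assms(1)[unfolded L2_iff, THEN conjunct2]])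
  show "AE x in lborel. norm ((indicator V x * u x)\<^sup>2) \<le> norm ((indicator U x * u x)\<^sup>2)"
   using assms(2) by (auto simp: indicator_def)
 qed measurable
 then show ?thesis by (simp add: L2_iff)
qed

lemma L2_indicator:
 assumes "U \<in> sets borel"
 shows "(%x. indicator U x * u x) \<in> L2 UNIV \<longleftrightarrow> u \<in> L2 U"
 by (simp add: L2_iff)

definition ip :: "'a::euclidean_space set => ('a => real) => ('a => real) => real" where
 "ip U u v = (LINT x:U|lborel. u x * v x)"

lemma ip_commute: "ip U u v = ip U v u"
 by (simp add: ip_def mult.commute)

lemma ip_add_left: "u \<in> L2 U ==> v \<in> L2 U ==> w \<in> L2 U ==>
  ip U (%x. u x + v x) w = ip U u w + ip U v w"
 unfolding ip_def by (simp add: distrib_right L2_mult_integrable)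

lemma ip_diff_left: "u \<in> L2 U ==> v \<in> L2 U ==> w \<in> L2 U ==>
  ip U (%x. u x - v x) w = ip U u w - ip U v w"
 unfolding ip_def by (simp add: left_diff_distrib L2_mult_integrable)

lemma ip_cmult_left: "ip U (%x. c * u x) w = c * ip U u w"
 unfolding ip_def by (simp add: mult.assoc)

lemma ip_minus_left: "ip U (%x. - u x) w = - ip U u w"
 using ip_cmult_left[of U "-1" u w] by simp

lemma ip_add_right: "u \<in> L2 U ==> v \<in> L2 U ==> w \<in> L2 U ==>
  ip U w (%x. u x + v x) = ip U w u + ip U w v"
 by (simp add: ip_commute[of U w] ip_add_left)

lemma ip_diff_right: "u \<in> L2 U ==> v \<in> L2 U ==> w \<in> L2 U ==>
  ip U w (%x. u x - v x) = ip U w u - ip U w v"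
 by (simp add: ip_commute[of U w] ip_diff_left)

lemma ip_cmult_right: "ip U w (%x. c * u x) = c * ip U w u"
 by (simp add: ip_commute[of U w] ip_cmult_left)

lemma ip_self_nonneg: "0 \<le> ip U u u"
 unfolding ip_def set_lebesgue_integral_def by (intro integral_nonneg_AE) auto

lemma L2_norm_ip: "L2_norm U u = sqrt (ip U u u)"
 by (simp add: L2_norm_def ip_def power2_eq_square)

lemma L2_norm_nonneg: "0 \<le> L2_norm U u"
 by (simp add: L2_norm_ip ip_self_nonneg)

lemma L2_norm_sq: "(L2_norm U u)\<^sup>2 = ip U u u"
 by (simp add: L2_norm_ip ip_self_nonneg)

lemma ip_add_self:
 assumes "u \<in> L2 U" "v \<in> L2 U"
 shows "ip U (%x. u x + v x) (%x. u x + v x) = ip U u u + 2 * ip U u v + ip U v v"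
 using assms by (simp add: ip_add_left ip_add_right L2_add ip_commute[of U v u])

lemma ip_CS:
 assumes "u \<in> L2 U" "v \<in> L2 U"
 shows "\<bar>ip U u v\<bar> \<le> L2_norm U u * L2_norm U v"
 unfolding L2_norm_ip
proof (rule quadratic_nonneg_imp_discriminant)
 fix t
 have "0 \<le> ip U (%x. u x + t * v x) (%x. u x + t * v x)" by (rule ip_self_nonneg)
 then show "0 \<le> ip U u u + 2 * t * ip U u v + t\<^sup>2 * ip U v v"
  using assms
  by (simp add: ip_add_self L2_cmult ip_cmult_left ip_cmult_right power2_eq_square algebra_simps)
qed (rule ip_self_nonneg)

lemma L2_norm_triangle:
 assumes "u \<in> L2 U" "v \<in> L2 U"
 shows "L2_norm U (%x. u x + v x) \<le> L2_norm U u + L2_norm U v"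
proof (rule power2_le_imp_le)
 have "(L2_norm U (%x. u x + v x))\<^sup>2 = ip U u u + 2 * ip U u v + ip U v v"
  by (simp add: L2_norm_sq ip_add_self assms)
 also have "\<dots> \<le> (L2_norm U u)\<^sup>2 + 2 * (L2_norm U u * L2_norm U v) + (L2_norm U v)\<^sup>2"
  using ip_CS[OF assms] by (simp add: L2_norm_sq)
 finally show "(L2_norm U (%x. u x + v x))\<^sup>2 \<le> (L2_norm U u + L2_norm U v)\<^sup>2"
  by (simp add: power2_sum)
qed (simp add: L2_norm_nonneg)

lemma L2_norm_cmult: "L2_norm U (%x. c * u x) = \<bar>c\<bar> * L2_norm U u"
 by (simp add: L2_norm_ip ip_cmult_left ip_cmult_right real_sqrt_mult flip: mult.assoc)

lemma L2_norm_minus: "L2_norm U (%x. - u x) = L2_norm U u"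
 using L2_norm_cmult[of U "-1" u] by simp

lemma L2_norm_minus_commute: "L2_dist U u v = L2_dist U v u"
 using L2_norm_minus[of U "%x. u x - v x"] by simp

lemma L2_norm_zero: "L2_norm U (%x. 0) = 0"
 by (simp add: L2_norm_def)

lemma L2_norm_triangle_diff:
 assumes "u \<in> L2 U" "v \<in> L2 U"
 shows "L2_dist U u v \<le> L2_norm U u + L2_norm U v"
 using L2_norm_triangle[OF assms(1) L2_uminus[OF assms(2)]] by (simp add: L2_norm_minus)

lemma L2_norm_triangle3:
 assumes "u \<in> L2 U" "v \<in> L2 U" "w \<in> L2 U"
 shows "L2_dist U u w \<le> L2_dist U u v + L2_dist U v w"
 using L2_norm_triangle[of "%x. u x - v x" U "%x. v x - w x"] assms by (simp add: L2_diff)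

lemma set_integral_AE_cong:
 assumes "(%x. indicator U x * u x) \<in> borel_measurable lborel"
  "(%x. indicator U x * v x) \<in> borel_measurable lborel"
  and "AE x in lborel. x \<in> U \<longrightarrow> u x = v x"
 shows "(LINT x:U|lborel. u x) = (LINT x:U|lborel. (v x :: real))"
 unfolding set_lebesgue_integral_def
 by (rule integral_cong_AE) (use assms in \<open>auto simp: indicator_def elim!: eventually_mono\<close>)

lemma L2_measurable: "u \<in> L2 U ==> (%x. indicator U x * u x) \<in> borel_measurable lborel"
 by (simp add: L2_iff)

lemma ip_cong_AE:
 assumes "u \<in> L2 U" "u' \<in> L2 U" "v \<in> L2 U" "ae_eq_on U u u'"
 shows "ip U u v = ip U u' v"
proof -
 have *: "indicator U x * (f x * v x) = (indicator U x * f x) * (indicator U x * v x)"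
  for f :: "'a => real" and x by (auto simp: indicator_def)
 show ?thesis unfolding ip_def
  by (rule set_integral_AE_cong)
   (use assms[unfolded ae_eq_on_def] L2_measurable[OF assms(1)] L2_measurable[OF assms(2)]
    L2_measurable[OF assms(3)] in \<open>auto simp: * elim!: eventually_mono\<close>)
qed

lemma ae_eq_on_sym: "ae_eq_on U u v ==> ae_eq_on U v u"
 by (auto simp: ae_eq_on_def elim!: eventually_mono)

lemma ae_eq_on_refl: "ae_eq_on U u u"
 by (auto simp: ae_eq_on_def)

lemma L2_norm_cong_AE:
 assumes "u \<in> L2 U" "v \<in> L2 U" "ae_eq_on U u v"
 shows "L2_norm U u = L2_norm U v"
proof -
 have "ip U u u = ip U v u" by (rule ip_cong_AE) (use assms in auto)
 also have "\<dots> = ip U u v" by (rule ip_commute)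
 also have "\<dots> = ip U v v" by (rule ip_cong_AE) (use assms in auto)
 finally show ?thesis by (simp add: L2_norm_ip)
qed

lemma L2_norm_eq_0_iff:
 assumes "u \<in> L2 U"
 shows "L2_norm U u = 0 \<longleftrightarrow> ae_eq_on U u (%x. 0)"
proof -
 have i: "integrable lborel (%x. (indicator U x * u x)\<^sup>2)" using assms by (simp add: L2_iff)
 have "L2_norm U u = 0 \<longleftrightarrow> integral\<^sup>L lborel (%x. (indicator U x * u x)\<^sup>2) = 0"
  by (simp add: L2_norm_def set_lebesgue_integral_def indicator_mult_square)
 also have "\<dots> \<longleftrightarrow> (AE x in lborel. (indicator U x * u x)\<^sup>2 = 0)"
  by (rule integral_nonneg_eq_0_iff_AE[OF i]) auto
 also have "\<dots> \<longleftrightarrow> ae_eq_on U u (%x. 0)"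
  unfolding ae_eq_on_def by (auto simp: indicator_def elim!: eventually_mono)
 finally show ?thesis .
qed

lemma L2_norm_diff_eq_0_iff:
 assumes "u \<in> L2 U" "v \<in> L2 U"
 shows "L2_dist U u v = 0 \<longleftrightarrow> ae_eq_on U u v"
 using L2_norm_eq_0_iff[OF L2_diff[OF assms]] by (simp add: ae_eq_on_def)

lemma L2_norm_subset:
 assumes "u \<in> L2 U" "V \<subseteq> U" "V \<in> sets borel"
 shows "L2_norm V u \<le> L2_norm U u"
proof -
 have "integrable lborel (%x. indicator U x *\<^sub>R (u x)\<^sup>2)"
  "integrable lborel (%x. indicator V x *\<^sub>R (u x)\<^sup>2)"
  using assms(1) L2_subset[OF assms] by (auto simp: L2_def set_integrable_def)
 then have "integral\<^sup>L lborel (%x. indicator V x *\<^sub>R (u x)\<^sup>2) \<le> integral\<^sup>L lborel (%x. indicator U x *\<^sub>R (u x)\<^sup>2)"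
  by (intro integral_mono) (use assms(2) in \<open>auto simp: indicator_def\<close>)
 then show ?thesis
  by (simp add: L2_norm_def set_lebesgue_integral_def)
qed

lemma L2_dominated_convergence:
 assumes s: "\<And>k. s k \<in> L2 U" and u: "u \<in> L2 U" and w: "w \<in> L2 U"
  and lim: "AE x in lborel. x \<in> U \<longrightarrow> (%k. s k x) \<longlonglongrightarrow> u x"
  and dom: "\<And>k. AE x in lborel. x \<in> U \<longrightarrow> \<bar>s k x - u x\<bar> \<le> w x"
 shows "(%k. L2_dist U (s k) u) \<longlonglongrightarrow> 0"
proof -
 note [measurable] = L2_diff[OF s u, THEN L2_measurable]
 have "(%k. LINT x|lborel. (indicator U x * (s k x - u x))\<^sup>2) \<longlonglongrightarrow> (LINT x|(lborel::'a measure). 0)"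
 proof (rule integral_dominated_convergence)
  show "integrable lborel (%x. (indicator U x * w x)\<^sup>2)" using w by (simp add: L2_iff)
  show "AE x in lborel. (%k. (indicator U x * (s k x - u x))\<^sup>2) \<longlonglongrightarrow> 0"
   using lim
  proof eventually_elim
   case (elim x)
   note h = elim
   show ?case
   proof (cases "x \<in> U")
    case True
    then have "(%k. (s k x - u x)\<^sup>2) \<longlonglongrightarrow> (u x - u x)\<^sup>2"
     using h by (intro tendsto_intros) auto
    then show ?thesis using True by simp
   qed simp
  qed
  show "AE x in lborel. norm ((indicator U x * (s k x - u x))\<^sup>2) \<le> (indicator U x * w x)\<^sup>2" for k
   using dom[of k]
  proof eventually_elim
   fix x assume "x \<in> U \<longrightarrow> \<bar>s k x - u x\<bar> \<le> w x"
   then show "norm ((indicator U x * (s k x - u x))\<^sup>2) \<le> (indicator U x * w x)\<^sup>2"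
    using power_mono[of "\<bar>s k x - u x\<bar>" "w x" 2] by (auto simp: indicator_def)
  qed
 qed auto
 then have "(%k. sqrt (LINT x|lborel. (indicator U x * (s k x - u x))\<^sup>2)) \<longlonglongrightarrow> sqrt 0"
  by (intro tendsto_real_sqrt) simp
 then show ?thesis
  by (simp add: L2_norm_def set_lebesgue_integral_def indicator_mult_square)
qed

lemma finite_measure_L2_const:
 assumes "U \<in> sets borel" "emeasure lborel U < \<infinity>"
 shows "(%x. c) \<in> L2 U"
proof -
 have "(%x. (indicator U x * c)\<^sup>2) = (%x. indicator U x * c\<^sup>2)" by (auto simp: indicator_def)
 then show ?thesis using assms by (simp add: L2_iff)
qed

lemma L2_bound:
 assumes "(%x. indicator U x * f x) \<in> borel_measurable lborel" "g \<in> L2 U" "\<And>x. x \<in> U ==> \<bar>f x\<bar> \<le> \<bar>g x\<bar>"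
 shows "f \<in> L2 U"
proof -
 have "integrable lborel (%x. (indicator U x * g x)\<^sup>2)" using assms(2) by (simp add: L2_iff)
 then have "integrable lborel (%x. (indicator U x * f x)\<^sup>2)"
  by (rule Bochner_Integration.integrable_bound)
    (use assms(1,3) in \<open>auto simp: indicator_def abs_le_square_iff intro!: borel_measurable_power\<close>)
 with assms(1) show ?thesis by (simp add: L2_iff)
qed

lemma L2_abs:
 assumes f: "f \<in> L2 U"
 shows "(%x. \<bar>f x\<bar>) \<in> L2 U"
 by (rule L2_bound[OF _ f]) (use borel_measurable_abs[OF L2_measurable[OF f]] in \<open>simp_all add: abs_mult\<close>)

lemma L2_norm_cong:
 assumes "\<And>x. x \<in> U ==> f x = g x"
 shows "L2_norm U f = L2_norm U g"
proof -
 have "indicator U x *\<^sub>R (f x)\<^sup>2 = indicator U x *\<^sub>R (g x)\<^sup>2" for x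
  using assms by (auto simp: indicator_def)
 then show ?thesis unfolding L2_norm_def set_lebesgue_integral_def by presburger
qed

lemma L2_norm_mono:
 assumes "f \<in> L2 U" "g \<in> L2 U" "\<And>x. x \<in> U ==> \<bar>f x\<bar> \<le> \<bar>g x\<bar>"
 shows "L2_norm U f \<le> L2_norm U g"
proof -
 have "(f x)\<^sup>2 \<le> (g x)\<^sup>2" if "x \<in> U" for x using assms(3)[OF that] by (simp add: abs_le_square_iff)
 then have "(LINT x:U|lborel. (f x)\<^sup>2) \<le> (LINT x:U|lborel. (g x)\<^sup>2)"
  using assms(1,2) by (intro set_integral_mono) (auto simp: L2_def)
 then show ?thesis by (simp add: L2_norm_def)
qed

lemma L2_norm_tendsto_0:
 assumes "\<And>n. L2_norm U (f n) \<le> h n" "h \<longlonglongrightarrow> 0"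
 shows "(%n. L2_norm U (f n)) \<longlonglongrightarrow> 0"
 by (rule Lim_null_comparison[OF always_eventually assms(2)]) (simp add: assms(1) L2_norm_nonneg)

text \<open>Riesz-Fischer. Finite measure turns an L2 Cauchy sequence into an L1 one by pairing with
  the constant 1; this supplies an almost everywhere convergent subsequence, and Fatou's lemma
  recovers the L2 distance to its limit.\<close>

lemma L2_complete:
 assumes U: "U \<in> sets borel" "emeasure lborel U < \<infinity>"
  and s: "\<And>k. s k \<in> L2 U"
  and C: "\<And>e. e > 0 ==> \<exists>N. \<forall>i\<ge>N. \<forall>j\<ge>N. L2_dist U (s i) (s j) < e"
 shows "\<exists>u\<in>L2 U. (%k. L2_dist U (s k) u) \<longlonglongrightarrow> 0"
proof -
 let ?s = "%k x. indicator U x * s k x"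
 note [measurable] = s[THEN L2_measurable]
 have one: "(%x. c) \<in> L2 U" for c using finite_measure_L2_const[OF U] .
 have int: "integrable lborel (?s k)" for k
  using L2_mult_integrable[OF one[of 1] s[of k]] by (simp add: set_integrable_def)
 have absn: "L2_norm U (%x. \<bar>f x\<bar>) = L2_norm U f" for f by (simp add: L2_norm_def)
 have L1: "(LINT x|lborel. norm (?s i x - ?s j x)) \<le> L2_norm U (%x. 1) * L2_dist U (s i) (s j)" for i j
 proof -
  have "(LINT x|lborel. norm (?s i x - ?s j x)) = ip U (%x. 1) (%x. \<bar>s i x - s j x\<bar>)"
   unfolding ip_def set_lebesgue_integral_def
   by (rule Bochner_Integration.integral_cong) (auto simp: indicator_def)
  also have "\<dots> \<le> L2_norm U (%x. 1) * L2_norm U (%x. \<bar>s i x - s j x\<bar>)"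
   using ip_CS[OF one[of 1] L2_abs[OF L2_diff[OF s[of i] s[of j]]]] by linarith
  finally show ?thesis by (simp add: absn)
 qed
 have "\<exists>N. \<forall>i\<ge>N. \<forall>j\<ge>N. (LINT x|lborel. norm (?s i x - ?s j x)) < e" if e: "e > 0" for e
 proof -
  \<comment> \<open>Adding 1 keeps the divisor positive when \<open>U\<close> has measure
    zero.\<close>
  let ?c = "L2_norm U (%x. 1) + 1"
  have c: "?c > 0" using L2_norm_nonneg[of U "%x. 1"] by linarith
  obtain N where N: "\<forall>i\<ge>N. \<forall>j\<ge>N. L2_dist U (s i) (s j) < e / ?c"
   using C[of "e / ?c"] e c by auto
  have "(LINT x|lborel. norm (?s i x - ?s j x)) < e" if "i \<ge> N" "j \<ge> N" for i j
  proof -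
   have "(LINT x|lborel. norm (?s i x - ?s j x)) \<le> ?c * L2_dist U (s i) (s j)"
    using L1[of i j] L2_norm_nonneg[of U "%x. s i x - s j x"] by (simp add: distrib_right)
   also have "\<dots> < ?c * (e / ?c)" using N that c by (intro mult_strict_left_mono) auto
   finally show ?thesis using c by simp
  qed
  then show ?thesis by blast
 qed
 from cauchy_L1_AE_cauchy_subseq[OF int this]
 obtain r where r: "strict_mono r" and ae: "AE x in lborel. Cauchy (%i. ?s (r i) x)" by metis
 \<comment> \<open>The default 0 at points where the subsequence diverges keeps \<open>u\<close>
   measurable everywhere.\<close>
 define u where "u x = (if Cauchy (%i. ?s (r i) x) then lim (%i. ?s (r i) x) else 0)" for x
 have um[measurable]: "u \<in> borel_measurable lborel"
  unfolding u_def by measurable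
 have ulim: "AE x in lborel. (%i. ?s (r i) x) \<longlonglongrightarrow> u x"
  using ae by eventually_elim (simp add: u_def Cauchy_convergent_iff convergent_LIMSEQ_iff)
 \<comment> \<open>Fatou in the subsequence index with k fixed: the Cauchy bound passes to the
   distance between \<open>s k\<close> and the limit, and also puts \<open>u\<close> into
   L2.\<close>
 have est: "(%x. u x - s k x) \<in> L2 U \<and> L2_dist U u (s k) \<le> e"
  if N: "\<forall>i\<ge>N. \<forall>j\<ge>N. L2_dist U (s i) (s j) < e" and k: "k \<ge> N" for e N k
 proof -
  have e: "e > 0" using N k L2_norm_nonneg[of U "%x. s k x - s k x"] by (meson le_less_trans)
  have m: "(%x. (indicator U x * (u x - s k x))\<^sup>2) \<in> borel_measurable lborel"
  proof -
   have "(%x. (indicator U x * (u x - s k x))\<^sup>2) = (%x. (indicator U x * u x - ?s k x)\<^sup>2)"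
    by (auto simp: right_diff_distrib)
   also have "\<dots> \<in> borel_measurable lborel" using U(1) by measurable
   finally show ?thesis .
  qed
  have "(\<integral>\<^sup>+x. ennreal ((indicator U x * (u x - s k x))\<^sup>2) \<partial>lborel) =
    (\<integral>\<^sup>+x. liminf (%i. ennreal ((indicator U x * (s (r i) x - s k x))\<^sup>2)) \<partial>lborel)"
  proof (rule nn_integral_cong_AE, use ulim in eventually_elim)
   fix x assume h: "(%i. ?s (r i) x) \<longlonglongrightarrow> u x"
   have "(%i. (indicator U x * (s (r i) x - s k x))\<^sup>2) \<longlonglongrightarrow> (indicator U x * (u x - s k x))\<^sup>2"
   proof (cases "x \<in> U")
    case True
    then show ?thesis using h by (auto intro!: tendsto_intros)
   qed simp
   then have "(%i. ennreal ((indicator U x * (s (r i) x - s k x))\<^sup>2)) \<longlonglongrightarrow> ennreal ((indicator U x * (u x - s k x))\<^sup>2)"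
    by (rule tendsto_ennrealI)
   then show "ennreal ((indicator U x * (u x - s k x))\<^sup>2) = liminf (%i. ennreal ((indicator U x * (s (r i) x - s k x))\<^sup>2))"
    using lim_imp_Liminf[OF trivial_limit_sequentially] by metis
  qed
  also have "\<dots> \<le> liminf (%i. \<integral>\<^sup>+x. ennreal ((indicator U x * (s (r i) x - s k x))\<^sup>2) \<partial>lborel)"
  proof (rule nn_integral_liminf)
   fix i
   show "(%x. ennreal ((indicator U x * (s (r i) x - s k x))\<^sup>2)) \<in> borel_measurable lborel"
    using L2_measurable[OF L2_diff[OF s s], of "r i" k] by measurable
  qed
  also have "\<dots> \<le> ennreal (e\<^sup>2)"
  proof (rule order_trans[OF Liminf_le_Limsup[OF trivial_limit_sequentially]], rule Limsup_bounded,
    rule eventually_mono[OF eventually_ge_at_top[of N]])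
   fix i assume i: "N \<le> i"
   then have ri: "N \<le> r i" using seq_suble[OF r, of i] by linarith
   have "integrable lborel (%x. (indicator U x * (s (r i) x - s k x))\<^sup>2)"
    using L2_diff[OF s s] by (simp add: L2_iff)
   then have "(\<integral>\<^sup>+x. ennreal ((indicator U x * (s (r i) x - s k x))\<^sup>2) \<partial>lborel) =
     ennreal (LINT x|lborel. (indicator U x * (s (r i) x - s k x))\<^sup>2)"
    by (intro nn_integral_eq_integral) auto
   also have "(LINT x|lborel. (indicator U x * (s (r i) x - s k x))\<^sup>2) = (L2_dist U (s (r i)) (s k))\<^sup>2"
    unfolding L2_norm_sq ip_def set_lebesgue_integral_def
    by (rule Bochner_Integration.integral_cong) (auto simp: indicator_def power2_eq_square)
   also have "\<dots> \<le> e\<^sup>2" using N ri k by (intro power_mono L2_norm_nonneg) (auto simp: less_imp_le)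
   finally show "(\<integral>\<^sup>+x. ennreal ((indicator U x * (s (r i) x - s k x))\<^sup>2) \<partial>lborel) \<le> ennreal (e\<^sup>2)"
    by (simp add: ennreal_leI)
  qed
  finally have le: "(\<integral>\<^sup>+x. ennreal ((indicator U x * (u x - s k x))\<^sup>2) \<partial>lborel) \<le> ennreal (e\<^sup>2)" .
  have int2: "integrable lborel (%x. (indicator U x * (u x - s k x))\<^sup>2)"
   by (rule integrableI_bounded[OF m]) (use le in \<open>auto intro: le_less_trans\<close>)
  have m1: "(%x. indicator U x * (u x - s k x)) \<in> borel_measurable lborel"
   unfolding right_diff_distrib using U(1) by measurable
  have mem: "(%x. u x - s k x) \<in> L2 U" using m1 int2 by (simp add: L2_iff)
  have "ennreal (LINT x|lborel. (indicator U x * (u x - s k x))\<^sup>2) \<le> ennreal (e\<^sup>2)"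
   using le nn_integral_eq_integral[OF int2] by simp
  then have "(LINT x|lborel. (indicator U x * (u x - s k x))\<^sup>2) \<le> e\<^sup>2"
   by (simp add: ennreal_le_iff)
  also have "(LINT x|lborel. (indicator U x * (u x - s k x))\<^sup>2) = (L2_dist U u (s k))\<^sup>2"
   unfolding L2_norm_sq ip_def set_lebesgue_integral_def
   by (rule Bochner_Integration.integral_cong) (auto simp: indicator_def power2_eq_square)
  finally have "L2_dist U u (s k) \<le> e"
   using e by (simp add: power_mono_iff L2_norm_nonneg)
  with mem show ?thesis by simp
 qed
 obtain N1 where N1: "\<forall>i\<ge>N1. \<forall>j\<ge>N1. L2_dist U (s i) (s j) < 1"
  using C[of 1] by auto
 have "(%x. u x - s N1 x) \<in> L2 U" using est[OF N1, of N1] by simp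
 from L2_add[OF this s[of N1]] have uL: "u \<in> L2 U" by simp
 have "(%k. L2_dist U (s k) u) \<longlonglongrightarrow> 0"
 proof (rule LIMSEQ_I)
  fix e :: real assume e: "0 < e"
  obtain N where N: "\<forall>i\<ge>N. \<forall>j\<ge>N. L2_dist U (s i) (s j) < e / 2"
   using C[of "e / 2"] e by auto
  have "norm (L2_dist U (s k) u - 0) < e" if "k \<ge> N" for k
   using est[OF N that] e L2_norm_nonneg[of U "%x. s k x - u x"]
   by (simp add: L2_norm_minus_commute[of U "s k" u])
  then show "\<exists>N. \<forall>k\<ge>N. norm (L2_dist U (s k) u - 0) < e" by blast
 qed
 with uL show ?thesis by blast
qed

section \<open>Test functions and mollification\<close>

lemma continuous_compact_support_bounded:
 fixes f :: "'a::euclidean_space => real"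
 assumes "continuous_on UNIV f" "compact K" "\<And>x. x \<notin> K ==> f x = 0"
 shows "\<exists>B>0. \<forall>x. \<bar>f x\<bar> \<le> B"
proof -
 have "bounded (f ` K)"
  using assms by (intro compact_imp_bounded compact_continuous_image) (auto intro: continuous_on_subset)
 then obtain B where B: "B > 0" "\<And>x. x \<in> K ==> \<bar>f x\<bar> \<le> B"
  by (auto simp: bounded_pos)
 have "\<bar>f x\<bar> \<le> B" for x using B assms(3)[of x] by (cases "x \<in> K") auto
 with B(1) show ?thesis by blast
qed

lemma integrable_continuous_compact_support:
 fixes f :: "'a::euclidean_space => real"
 assumes "continuous_on UNIV f" "compact K" "\<And>x. x \<notin> K ==> f x = 0"
 shows "integrable lborel f"
proof -
 have "integrable lborel (%x. indicator K x *\<^sub>R f x)"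
  by (rule borel_integrable_compact) (use assms in \<open>auto intro: continuous_on_subset\<close>)
 also have "(%x. indicator K x *\<^sub>R f x) = f"
  using assms(3) by (auto simp: indicator_def fun_eq_iff)
 finally show ?thesis .
qed

lemma L2_continuous_compact_support:
 fixes f :: "'a::euclidean_space => real"
 assumes "continuous_on UNIV f" "compact K" "\<And>x. x \<notin> K ==> f x = 0"
  and "V \<in> sets borel"
 shows "f \<in> L2 V"
proof -
 have "f \<in> borel_measurable lborel" using assms(1) by (simp add: borel_measurable_continuous_onI)
 moreover have "integrable lborel (%x. (f x)\<^sup>2)"
  by (rule integrable_continuous_compact_support[of _ K])
    (use assms in \<open>auto intro!: continuous_intros\<close>)
 ultimately have "f \<in> L2 UNIV" by (simp add: L2_iff)
 then show ?thesis by (rule L2_subset) (use assms in auto)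
qed

lemma L2_continuous_bounded_set:
 fixes f :: "'a::euclidean_space => real"
 assumes "continuous_on UNIV f" "bounded U" "U \<in> sets borel"
 shows "f \<in> L2 U"
proof -
 have c: "compact (closure U)" using assms(2) by simp
 have "f \<in> borel_measurable lborel" using assms(1) by (simp add: borel_measurable_continuous_onI)
 then have "(%x. indicator (closure U) x * f x) \<in> borel_measurable lborel"
  by measurable
 moreover have "integrable lborel (%x. indicator (closure U) x *\<^sub>R (f x)\<^sup>2)"
  by (rule borel_integrable_compact[OF c]) (intro continuous_intros continuous_on_subset[OF assms(1)], auto)
 ultimately have "f \<in> L2 (closure U)"
  by (simp add: L2_iff indicator_mult_square)
 then show ?thesis by (rule L2_subset) (use assms closure_subset in auto)
qed

lemma L2_mult_bounded:
 assumes u: "u \<in> L2 U" and m: "m \<in> borel_measurable borel" and b: "\<And>x. x \<in> U ==> \<bar>m x\<bar> \<le> B"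
 shows "(%x. m x * u x) \<in> L2 U" and "L2_norm U (%x. m x * u x) \<le> B * L2_norm U u"
proof -
 have le: "\<bar>m x * u x\<bar> \<le> \<bar>B * u x\<bar>" if "x \<in> U" for x
  using b[OF that] by (auto simp: abs_mult intro!: mult_right_mono)
 have "(%x. m x * (indicator U x * u x)) \<in> borel_measurable lborel"
  by (rule borel_measurable_times) (use L2_measurable[OF u] m in simp_all)
 then show 1: "(%x. m x * u x) \<in> L2 U"
  using L2_bound[OF _ L2_cmult[OF u] le] by (simp add: mult.left_commute)
 show "L2_norm U (%x. m x * u x) \<le> B * L2_norm U u"
 proof (cases "U = {}")
  case False
  then have "B \<ge> 0" using b by force
  then show ?thesis using L2_norm_mono[OF 1 L2_cmult[OF u] le] by (simp add: L2_norm_cmult)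
 qed (simp add: L2_norm_def set_lebesgue_integral_def)
qed

lemma lborel_integral_translation:
 fixes f :: "'a::euclidean_space => real"
 assumes "f \<in> borel_measurable borel"
 shows "(LINT x|lborel. f (a + x)) = (LINT x|lborel. f x)"
proof -
 have "(LINT x|lborel. f x) = (LINT x|distr lborel borel ((+) a). f x)"
  by (simp add: lborel_distr_plus)
 also have "\<dots> = (LINT x|lborel. f (a + x))"
  by (rule integral_distr) (use assms in auto)
 finally show ?thesis by simp
qed

lemma lborel_distr_reflect: "distr lborel borel (%x. a - x) = (lborel :: 'a::euclidean_space measure)"
 using lborel_affine[of "-1" a] by (simp add: density_1)

lemma lborel_integral_reflect:
 fixes f :: "'a::euclidean_space => real"
 assumes "f \<in> borel_measurable borel"
 shows "(LINT x|lborel. f (a - x)) = (LINT x|lborel. f x)"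
proof -
 have "(LINT x|lborel. f x) = (LINT x|distr lborel borel (%x. a - x). f x)"
  by (simp add: lborel_distr_reflect)
 also have "\<dots> = (LINT x|lborel. f (a - x))"
  by (rule integral_distr) (use assms in auto)
 finally show ?thesis by simp
qed

lemma lborel_integrable_translation:
 fixes f :: "'a::euclidean_space => real"
 assumes "integrable lborel f"
 shows "integrable lborel (%x. f (a + x))"
proof -
 have "integrable (distr lborel borel ((+) a)) f" using assms by (simp add: lborel_distr_plus)
 then show ?thesis using integrable_distr[of "(+) a" lborel borel f] by simp
qed

section \<open>Directional derivatives of compactly supported functions and integration by
  parts\<close>

lemma C_diff_1_directional:
 fixes h :: "'a::euclidean_space => real"
 assumes "C_diff 1 h"
 shows "((%s. h (x + s *\<^sub>R b)) has_real_derivative pd b h (x + s *\<^sub>R b)) (at s)"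
proof -
 have d: "h differentiable (at (x + s *\<^sub>R b))" using assms by simp
 have D: "((%s. x + s *\<^sub>R b) has_derivative (%t. t *\<^sub>R b)) (at s)"
  by (auto intro!: derivative_eq_intros)
 have lin: "linear (%v. pd v h (x + s *\<^sub>R b))"
  using has_derivative_pd[OF d] has_derivative_linear by blast
 have "((%s. h (x + s *\<^sub>R b)) has_derivative (%t. pd (t *\<^sub>R b) h (x + s *\<^sub>R b))) (at s)"
  by (rule has_derivative_compose[OF D has_derivative_pd[OF d]])
 also have "(%t. pd (t *\<^sub>R b) h (x + s *\<^sub>R b)) = (*) (pd b h (x + s *\<^sub>R b))"
  using linear_scale[OF lin] by (auto simp: fun_eq_iff)
 finally show ?thesis by (simp add: has_field_derivative_def)
qed

lemma pd_zero_outside: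
 fixes h :: "'a::euclidean_space => real"
 assumes "closed K" "\<And>x. x \<notin> K ==> h x = 0" "x \<notin> K"
 shows "pd b h x = 0"
proof (rule pd_eq)
 show "(h has_derivative (%b. 0)) (at x)"
  by (rule has_derivative_transform_within_open[of "%x. 0" "%b. 0" x UNIV "- K"])
    (use assms in auto)
qed

lemma pd_lipschitz_bound:
 fixes h :: "'a::euclidean_space => real"
 assumes h: "C_diff 1 h" and M: "\<And>x. \<bar>pd b h x\<bar> \<le> M"
 shows "\<bar>h (x + s *\<^sub>R b) - h x\<bar> \<le> M * \<bar>s\<bar>"
proof -
 have "norm (h (x + s *\<^sub>R b) - h (x + 0 *\<^sub>R b)) \<le> M * norm (s - 0)"
  by (rule field_differentiable_bound[of UNIV "%s. h (x + s *\<^sub>R b)" "%s. pd b h (x + s *\<^sub>R b)"])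
    (use C_diff_1_directional[OF h] M in auto)
 then show ?thesis by simp
qed

text \<open>The difference quotients have integral zero by translation invariance, and they converge
  to the derivative under a common integrable bound. This takes the place of integrating along
  lines.\<close>

lemma integral_pd_eq_0:
 fixes h :: "'a::euclidean_space => real"
 assumes h: "C_diff 1 h" and K: "compact K" "\<And>x. x \<notin> K ==> h x = 0" and b: "b \<in> Basis"
 shows "(LINT x|lborel. pd b h x) = 0"
proof -
 have cont: "continuous_on UNIV h" by (rule C_diff_continuous[OF h])
 have contd: "continuous_on UNIV (pd b h)" using h b by simp
 have z: "pd b h x = 0" if "x \<notin> K" for x
  by (rule pd_zero_outside[OF compact_imp_closed[OF K(1)] K(2) that])
 have "\<exists>M>0. \<forall>x. \<bar>pd b h x\<bar> \<le> M"
  by (rule continuous_compact_support_bounded[OF contd K(1) z])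
 then obtain M where M: "M > 0" "\<And>x. \<bar>pd b h x\<bar> \<le> M" by blast
 \<comment> \<open>All quotients have step at most 1, so this compact set contains the support of
   each of them.\<close>
 define K' where "K' = (%(x, s). x - s *\<^sub>R b) ` (K \<times> {0..1::real})"
 have K': "compact K'" unfolding K'_def
  by (intro compact_continuous_image compact_Times K(1) compact_Icc)
    (auto intro!: continuous_intros simp: case_prod_beta)
 define D where "D n x = real (Suc n) * (h (x + (1 / real (Suc n)) *\<^sub>R b) - h x)" for n x
 have lim: "(%n. LINT x|lborel. D n x) \<longlonglongrightarrow> (LINT x|lborel. pd b h x)"
 proof (rule integral_dominated_convergence)
  show "integrable lborel (%x. M * indicator K' x)"
   using borel_integrable_compact[OF K' continuous_on_const[of K' M]] by (simp add: mult.commute)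
  show "AE x in lborel. (%n. D n x) \<longlonglongrightarrow> pd b h x"
  proof (rule AE_I2)
   fix x
   have "((%s. (h (x + s *\<^sub>R b) - h x) / s) \<longlongrightarrow> pd b h x) (at 0)"
    using C_diff_1_directional[OF h, of x b 0] by (simp add: has_field_derivative_iff)
   then have "(%n. (h (x + (1 / real (Suc n)) *\<^sub>R b) - h x) / (1 / real (Suc n))) \<longlonglongrightarrow> pd b h x"
    by (rule filterlim_compose) (intro filterlim_atI LIMSEQ_Suc[OF lim_1_over_n] always_eventually, simp)
   then show "(%n. D n x) \<longlonglongrightarrow> pd b h x"
    by (simp add: D_def mult.commute)
  qed
  show "AE x in lborel. norm (D n x) \<le> M * indicator K' x" for n
  proof (rule AE_I2)
   fix x
   let ?s = "1 / real (Suc n)"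
   show "norm (D n x) \<le> M * indicator K' x"
   proof (cases "x \<in> K'")
    case True
    have "\<bar>h (x + ?s *\<^sub>R b) - h x\<bar> \<le> M * \<bar>?s\<bar>"
     by (rule pd_lipschitz_bound[OF h M(2)])
    then have "real (Suc n) * \<bar>h (x + ?s *\<^sub>R b) - h x\<bar> \<le> real (Suc n) * (M * \<bar>?s\<bar>)"
     by (intro mult_left_mono) auto
    then show ?thesis using True by (simp add: D_def abs_mult)
   next
    case False
    have "x \<notin> K"
    proof
     assume "x \<in> K"
     then have "x \<in> K'" unfolding K'_def by (intro image_eqI[of _ _ "(x, 0)"]) auto
     with False show False by simp
    qed
    moreover have "x + ?s *\<^sub>R b \<notin> K"
    proof
     assume "x + ?s *\<^sub>R b \<in> K"
     then have "x \<in> K'" unfolding K'_def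
      by (intro image_eqI[of _ _ "(x + ?s *\<^sub>R b, ?s)"]) auto
     with False show False by simp
    qed
    ultimately show ?thesis using False K(2) by (simp add: D_def)
   qed
  qed
  show "pd b h \<in> borel_measurable lborel" "D n \<in> borel_measurable lborel" for n
  proof -
   show "pd b h \<in> borel_measurable lborel" using contd by (simp add: borel_measurable_continuous_onI)
   have "continuous_on UNIV (D n)" unfolding D_def
    by (intro continuous_intros continuous_on_compose2[OF cont]) auto
   then show "D n \<in> borel_measurable lborel" by (simp add: borel_measurable_continuous_onI)
  qed
 qed
 have hi: "integrable lborel h" by (rule integrable_continuous_compact_support[OF cont K])
 have "(LINT x|lborel. D n x) = 0" for n
 proof -
  let ?a = "(1 / real (Suc n)) *\<^sub>R b"
  have "(LINT x|lborel. D n x) = (LINT x|lborel. real (Suc n) * (h (?a + x) - h x))"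
   by (simp only: D_def add.commute[of _ ?a])
  also have "\<dots> = real (Suc n) * (LINT x|lborel. h (?a + x) - h x)"
   by (rule integral_mult_right_zero)
  also have "(LINT x|lborel. h (?a + x) - h x) = (LINT x|lborel. h (?a + x)) - (LINT x|lborel. h x)"
   by (rule Bochner_Integration.integral_diff[OF lborel_integrable_translation[OF hi] hi])
  also have "(LINT x|lborel. h (?a + x)) = (LINT x|lborel. h x)"
   by (rule lborel_integral_translation) (use cont in \<open>simp add: borel_measurable_continuous_onI\<close>)
  finally show ?thesis by simp
 qed
 with lim have "(%n. 0) \<longlonglongrightarrow> (LINT x|lborel. pd b h x)" by simp
 then show ?thesis by (simp add: LIMSEQ_const_iff)
qed

lemma test_funD:
 assumes "\<phi> \<in> test_fun U"
 shows "C_diff k \<phi>" "compact (closure {x. \<phi> x \<noteq> 0})" "closure {x. \<phi> x \<noteq> 0} \<subseteq> U"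
  "\<And>x. x \<notin> closure {x. \<phi> x \<noteq> 0} ==> \<phi> x = 0" "\<And>x. x \<notin> U ==> \<phi> x = 0"
  "continuous_on UNIV \<phi>" "\<phi> differentiable (at x)"
proof -
 show k: "C_diff k \<phi>" for k using assms by (simp add: test_fun_def)
 show "compact (closure {x. \<phi> x \<noteq> 0})" "closure {x. \<phi> x \<noteq> 0} \<subseteq> U"
  using assms by (auto simp: test_fun_def)
 show o: "\<phi> x = 0" if "x \<notin> closure {x. \<phi> x \<noteq> 0}" for x
  using that closure_subset[of "{x. \<phi> x \<noteq> 0}"] by blast
 show "\<phi> x = 0" if "x \<notin> U" for x
  using o[of x] that assms by (auto simp: test_fun_def)
 show "continuous_on UNIV \<phi>" by (rule C_diff_continuous[OF k])
 show "\<phi> differentiable (at x)" using k[of 1] by simp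
qed

lemma test_fun_support:
 assumes "\<phi> \<in> test_fun U"
 shows "\<exists>K. compact K \<and> K \<subseteq> U \<and> (\<forall>x. x \<notin> K \<longrightarrow> \<phi> x = 0)"
 by (intro exI[of _ "closure {x. \<phi> x \<noteq> 0}"] conjI allI impI test_funD[OF assms])

lemma test_funI:
 assumes "\<And>k. C_diff k \<phi>" "compact K" "K \<subseteq> U" "\<And>x. x \<notin> K ==> \<phi> x = 0"
 shows "\<phi> \<in> test_fun U"
proof -
 have "closure {x. \<phi> x \<noteq> 0} \<subseteq> K"
  by (rule closure_minimal) (use assms compact_imp_closed in auto)
 moreover have "compact (closure {x. \<phi> x \<noteq> 0})"
  using compact_Int_closed[OF assms(2) closed_closure[of "{x. \<phi> x \<noteq> 0}"]] calculation
  by (simp add: Int_absorb1)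
 ultimately show ?thesis using assms by (auto simp: test_fun_def)
qed

lemma test_fun_mono: "\<phi> \<in> test_fun U ==> U \<subseteq> V ==> \<phi> \<in> test_fun V"
 by (auto simp: test_fun_def)

lemma test_fun_pd:
 assumes "\<phi> \<in> test_fun U" "b \<in> Basis"
 shows "pd b \<phi> \<in> test_fun U"
proof (rule test_funI[OF _ test_funD(2,3)[OF assms(1)]])
 show "C_diff k (pd b \<phi>)" for k using test_funD(1)[OF assms(1), of "Suc k"] assms(2) by simp
 show "pd b \<phi> x = 0" if "x \<notin> closure {x. \<phi> x \<noteq> 0}" for x
  by (rule pd_zero_outside[OF closed_closure _ that]) (rule test_funD(4)[OF assms(1)])
qed

lemma test_fun_mult:
 assumes "\<phi> \<in> test_fun U" "\<And>k. C_diff k \<psi>"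
 shows "(%x. \<psi> x * \<phi> x) \<in> test_fun U"
proof (rule test_funI[OF _ test_funD(2,3)[OF assms(1)]])
 show "C_diff k (%x. \<psi> x * \<phi> x)" for k
  by (rule C_diff_mult[OF assms(2) test_funD(1)[OF assms(1)]])
 show "\<psi> x * \<phi> x = 0" if "x \<notin> closure {x. \<phi> x \<noteq> 0}" for x
  using test_funD(4)[OF assms(1) that] by simp
qed

lemma test_fun_add:
 assumes "\<phi> \<in> test_fun U" "\<psi> \<in> test_fun U"
 shows "(%x. \<phi> x + \<psi> x) \<in> test_fun U"
proof (rule test_funI)
 show "C_diff k (%x. \<phi> x + \<psi> x)" for k using assms by (intro C_diff_add test_funD(1))
 show "compact (closure {x. \<phi> x \<noteq> 0} \<union> closure {x. \<psi> x \<noteq> 0})"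
  using assms by (intro compact_Un test_funD(2))
 show "closure {x. \<phi> x \<noteq> 0} \<union> closure {x. \<psi> x \<noteq> 0} \<subseteq> U"
  using test_funD(3)[OF assms(1)] test_funD(3)[OF assms(2)] by blast
 show "\<phi> x + \<psi> x = 0" if "x \<notin> closure {x. \<phi> x \<noteq> 0} \<union> closure {x. \<psi> x \<noteq> 0}" for x
  using test_funD(4)[OF assms(1), of x] test_funD(4)[OF assms(2), of x] that by force
qed

lemma test_fun_cmult: "\<phi> \<in> test_fun U ==> (%x. c * \<phi> x) \<in> test_fun U"
 by (rule test_fun_mult[OF _ C_diff_const])

lemma test_fun_bounded:
 assumes "\<phi> \<in> test_fun U"
 shows "\<exists>B>0. \<forall>x. \<bar>\<phi> x\<bar> \<le> B"
 by (rule continuous_compact_support_bounded[OF test_funD(6,2,4)[OF assms]])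

lemma test_fun_L2:
 assumes "\<phi> \<in> test_fun U" "V \<in> sets borel"
 shows "\<phi> \<in> L2 V"
 by (rule L2_continuous_compact_support[OF test_funD(6,2,4)[OF assms(1)] assms(2)])

text \<open>The product of \<open>h\<close> and \<phi> has compact support inside \<open>U\<close>,
  so the integral extends to the whole space and no boundary term can arise, however
  \<open>h\<close> behaves near the boundary.\<close>

lemma integration_by_parts:
 fixes h :: "'a::euclidean_space => real"
 assumes h: "C_diff 1 h" and \<phi>: "\<phi> \<in> test_fun U" and b: "b \<in> Basis"
 shows "(LINT x:U|lborel. h x * pd b \<phi> x) = - (LINT x:U|lborel. pd b h x * \<phi> x)"
proof -
 obtain K where K: "compact K" "\<And>x. x \<notin> K ==> \<phi> x = 0" and KU: "K \<subseteq> U"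
  using test_fun_support[OF \<phi>] by blast
 have \<phi>1: "C_diff 1 \<phi>" using \<phi> by (rule test_funD)
 have d\<phi>: "pd b \<phi> x = 0" if "x \<notin> K" for x
  by (rule pd_zero_outside[OF compact_imp_closed[OF K(1)] K(2) that])
 have c: "continuous_on UNIV h" "continuous_on UNIV \<phi>" "continuous_on UNIV (pd b h)"
  "continuous_on UNIV (pd b \<phi>)"
  using h \<phi>1 b C_diff_continuous[OF h] C_diff_continuous[OF \<phi>1] by auto
 have U: "(LINT x:U|lborel. f x) = (LINT x|lborel. f x)" if "\<And>x. x \<notin> U ==> f x = 0" for f :: "'a => real"
  unfolding set_lebesgue_integral_def
  by (rule Bochner_Integration.integral_cong) (use that in \<open>auto simp: indicator_def\<close>)
 have out: "x \<notin> K" if "x \<notin> U" for x using that KU by blast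
 have i: "integrable lborel (%x. pd b h x * \<phi> x)" "integrable lborel (%x. h x * pd b \<phi> x)"
  by (rule integrable_continuous_compact_support[OF continuous_on_mult[OF c(3,2)] K(1)], simp add: K(2))
   (rule integrable_continuous_compact_support[OF continuous_on_mult[OF c(1,4)] K(1)], simp add: d\<phi>)
 have "0 = (LINT x|lborel. pd b (%x. h x * \<phi> x) x)"
  by (rule sym, rule integral_pd_eq_0[OF C_diff_mult[OF h \<phi>1] K(1) _ b]) (use K(2) in auto)
 also have "\<dots> = (LINT x|lborel. pd b h x * \<phi> x + h x * pd b \<phi> x)"
  using h \<phi>1 by (simp add: pd_mult)
 also have "\<dots> = (LINT x|lborel. pd b h x * \<phi> x) + (LINT x|lborel. h x * pd b \<phi> x)"
  by (rule Bochner_Integration.integral_add[OF i])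
 finally show ?thesis
  using out d\<phi> K(2) by (subst (1 2) U) auto
qed

section \<open>Smooth bump functions and mollifiers\<close>

fun bump_poly :: "nat => real poly" where
 "bump_poly 0 = 1"
| "bump_poly (Suc i) = [:0, 0, 1:] * (bump_poly i - pderiv (bump_poly i))"

text \<open>The i-th derivative of exp (-1/s), continued by 0: for s > 0 and y = 1/s each derivative
  is a polynomial in y times exp (-y), and differentiating P(y) exp (-y) in s yields y^2 (P - P')
  exp (-y), the recursion of \<open>bump_poly\<close>. Carrying all derivatives at once makes
  smoothness an induction.\<close>

definition bump_fun :: "nat => real => real" where
 "bump_fun i s = (if s > 0 then poly (bump_poly i) (1 / s) * exp (- (1 / s)) else 0)"

lemma poly_div_exp_tendsto_0:
 fixes p :: "real poly"
 shows "((%y. poly p y * exp (- y)) \<longlongrightarrow> 0) at_top"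
proof -
 have "((%y. \<Sum>i\<le>degree p. coeff p i * (y ^ i / exp y)) \<longlongrightarrow> (\<Sum>i\<le>degree p. coeff p i * 0)) at_top"
  by (intro tendsto_intros tendsto_power_div_exp_0)
 then show ?thesis
  by (simp add: poly_altdef exp_minus divide_inverse sum_distrib_right mult.assoc)
qed

lemma bump_fun_derivative: "(bump_fun i has_real_derivative bump_fun (Suc i) s) (at s)"
proof -
 consider "s > 0" | "s < 0" | "s = 0" by linarith
 then show ?thesis
 proof cases
  case 1
  have D: "((%s. poly (bump_poly i) (1 / s) * exp (- (1 / s))) has_real_derivative bump_fun (Suc i) s) (at s)"
   using 1 by (auto intro!: derivative_eq_intros DERIV_chain2[OF poly_DERIV]
     simp: bump_fun_def field_simps power2_eq_square)
  show ?thesis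
   by (rule has_field_derivative_transform_within_open[OF D, of "{0<..}"])
     (use 1 in \<open>auto simp: bump_fun_def\<close>)
 next
  case 2
  have D: "((%s. 0) has_real_derivative bump_fun (Suc i) s) (at s)"
   using 2 by (simp add: bump_fun_def)
  show ?thesis
   by (rule has_field_derivative_transform_within_open[OF D, of "{..<0}"])
     (use 2 in \<open>auto simp: bump_fun_def\<close>)
 next
  case 3
  have "((%s. bump_fun i s / s) \<longlongrightarrow> 0) (at 0)"
  proof (rule filterlim_split_at)
   show "((%s. bump_fun i s / s) \<longlongrightarrow> 0) (at_left 0)"
    by (rule tendsto_eventually) (auto simp: eventually_at_filter bump_fun_def)
   \<comment> \<open>The additional factor X is the 1/s of the difference quotient at 0.\<close>
   have "((%s. poly ([:0, 1:] * bump_poly i) (inverse s) * exp (- inverse s)) \<longlongrightarrow> 0) (at_right 0)"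
    by (rule filterlim_compose[OF poly_div_exp_tendsto_0 filterlim_inverse_at_top_right])
   then show "((%s. bump_fun i s / s) \<longlongrightarrow> 0) (at_right 0)"
    by (rule Lim_transform_eventually)
      (auto simp: eventually_at_filter bump_fun_def field_simps)
  qed
  then show ?thesis using 3 by (simp add: has_field_derivative_iff bump_fun_def)
 qed
qed

lemma C_diff_bump: "C_diff k (%x::'a::euclidean_space. bump_fun i (r - x \<bullet> x))"
proof (rule C_diff_compose_real[of bump_fun, OF bump_fun_derivative])
 fix k
 have "C_diff k (%x::'a. r - (\<Sum>b\<in>Basis. (x \<bullet> b) * (x \<bullet> b)))"
  by (intro C_diff_diff C_diff_const C_diff_sum C_diff_mult C_diff_inner)
 then show "C_diff k (%x::'a. r - x \<bullet> x)" by (simp add: euclidean_inner[symmetric])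
qed

lemma mollifier_exists:
 assumes "\<epsilon> > 0"
 shows "\<exists>\<eta>::'a::euclidean_space => real. \<eta> \<in> test_fun (ball 0 \<epsilon>) \<and> (\<forall>x. 0 \<le> \<eta> x) \<and> (LINT x|lborel. \<eta> x) = 1"
proof -
 define r where "r = (\<epsilon> / 2)\<^sup>2"
 define f where "f x = bump_fun 0 (r - x \<bullet> x)" for x :: 'a
 have pos: "f x > 0" if "norm x < \<epsilon> / 2" for x
 proof -
  have "(norm x)\<^sup>2 < r" unfolding r_def using that by (intro power_strict_mono) auto
  then show ?thesis by (simp add: f_def bump_fun_def dot_square_norm)
 qed
 have zero: "f x = 0" if "x \<notin> cball 0 (\<epsilon> / 2)" for x
 proof -
  have "r \<le> (norm x)\<^sup>2" unfolding r_def using that assms by (intro power_mono) auto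
  then show ?thesis by (simp add: f_def bump_fun_def dot_square_norm)
 qed
 have nn: "f x \<ge> 0" for x by (simp add: f_def bump_fun_def)
 have test: "f \<in> test_fun (ball 0 \<epsilon>)"
  by (rule test_funI[of _ "cball 0 (\<epsilon> / 2)"])
    (use assms zero in \<open>auto simp: f_def[abs_def] C_diff_bump simp del: C_diff.simps\<close>)
 have int: "integrable lborel f"
  by (rule integrable_continuous_compact_support[OF test_funD(6)[OF test], of "cball 0 (\<epsilon> / 2)"])
    (use zero in auto)
 have "(LINT x|lborel. f x) \<noteq> 0"
 proof
  assume "(LINT x|lborel. f x) = 0"
  then have "AE x in lborel. f x = 0"
   using integral_nonneg_eq_0_iff_AE[OF int] nn by simp
  then have "AE x in lborel. x \<notin> ball (0::'a) (\<epsilon> / 2)"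
  proof eventually_elim
   fix x assume "f x = 0" then show "x \<notin> ball (0::'a) (\<epsilon> / 2)" using pos[of x] by auto
  qed
  then have "ball (0::'a) (\<epsilon> / 2) \<in> null_sets lborel"
   using AE_iff_null_sets[of "ball (0::'a) (\<epsilon> / 2)" lborel] by simp
  then have "negligible (ball (0::'a) (\<epsilon> / 2))"
   by (simp add: negligible_iff_null_sets null_sets_completionI)
  then show False using open_not_negligible[of "ball (0::'a) (\<epsilon> / 2)"] assms by simp
 qed
 moreover have "(LINT x|lborel. f x) \<ge> 0" using nn by (simp add: integral_nonneg_AE)
 ultimately have I: "(LINT x|lborel. f x) > 0" by simp
 show ?thesis
  by (rule exI[of _ "%x. (1 / (LINT x|lborel. f x)) * f x"])
    (intro conjI test_fun_cmult[OF test], use I nn in auto)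
qed

section \<open>Continuity of translations in L2\<close>

lemma L2_translate:
 assumes "f \<in> L2 UNIV"
 shows "(%x. f (x - z)) \<in> L2 UNIV" "L2_norm UNIV (%x. f (x - z)) = L2_norm UNIV f"
proof -
 have f: "f \<in> borel_measurable borel" "integrable lborel (%x. (f x)\<^sup>2)"
  using assms by (auto simp: L2_iff)
 have "(%x. f (x - z)) \<in> borel_measurable borel" using f(1) by measurable
 moreover have "integrable lborel (%x. (f (x - z))\<^sup>2)"
  using lborel_integrable_translation[OF f(2), of "- z"] by simp
 ultimately show "(%x. f (x - z)) \<in> L2 UNIV" by (simp add: L2_iff)
 show "L2_norm UNIV (%x. f (x - z)) = L2_norm UNIV f"
  using lborel_integral_translation[of "%x. (f x)\<^sup>2" "- z"] f(1)
  by (simp add: L2_norm_def set_lebesgue_integral_def)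
qed

lemma L2_reflect:
 assumes "f \<in> L2 UNIV"
 shows "(%z. f (x - z)) \<in> L2 UNIV"
proof -
 have f: "f \<in> borel_measurable borel" "integrable lborel (%x. (f x)\<^sup>2)"
  using assms by (auto simp: L2_iff)
 have "(%z. f (x - z)) \<in> borel_measurable borel" using f(1) by measurable
 moreover have "integrable (distr lborel borel (%z. x - z)) (%x. (f x)\<^sup>2)"
  using f(2) by (simp add: lborel_distr_reflect)
 then have "integrable lborel (%z. (f (x - z))\<^sup>2)"
  using integrable_distr[of "%z. x - z" lborel borel "%x. (f x)\<^sup>2"] by simp
 ultimately show ?thesis by (simp add: L2_iff)
qed

text \<open>Being closed under sums, multiples and L2 limits, the property has to be checked only
  for indicators of compact sets.\<close>

definition transl_cont :: "('a::euclidean_space => real) => bool" where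
 "transl_cont f \<longleftrightarrow> f \<in> L2 UNIV \<and>
   (\<forall>e>0. \<exists>d>0. \<forall>z. norm z < d \<longrightarrow> L2_norm UNIV (%x. f (x - z) - f x) < e)"

lemma transl_cont_add:
 assumes "transl_cont f" "transl_cont g"
 shows "transl_cont (%x. f x + g x)"
 unfolding transl_cont_def
proof (intro conjI allI impI)
 have f: "f \<in> L2 UNIV" and g: "g \<in> L2 UNIV" using assms by (auto simp: transl_cont_def)
 then show "(%x. f x + g x) \<in> L2 UNIV" by (rule L2_add)
 fix e :: real assume "e > 0"
 then have "e / 2 > 0" by simp
 then obtain d1 where d1: "d1 > 0" "\<And>z. norm z < d1 ==> L2_norm UNIV (%x. f (x - z) - f x) < e / 2"
  using assms(1) unfolding transl_cont_def by blast
 obtain d2 where d2: "d2 > 0" "\<And>z. norm z < d2 ==> L2_norm UNIV (%x. g (x - z) - g x) < e / 2"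
  using assms(2) \<open>e / 2 > 0\<close> unfolding transl_cont_def by blast
 have "L2_norm UNIV (%x. f (x - z) + g (x - z) - (f x + g x)) < e" if "norm z < min d1 d2" for z
 proof -
  have "L2_norm UNIV (%x. (f (x - z) - f x) + (g (x - z) - g x)) \<le>
    L2_norm UNIV (%x. f (x - z) - f x) + L2_norm UNIV (%x. g (x - z) - g x)"
   by (rule L2_norm_triangle[OF L2_diff[OF L2_translate(1)[OF f] f] L2_diff[OF L2_translate(1)[OF g] g]])
  also have "\<dots> < e" using d1(2)[of z] d2(2)[of z] that by simp
  finally show ?thesis by (simp add: algebra_simps)
 qed
 then show "\<exists>d>0. \<forall>z. norm z < d \<longrightarrow> L2_norm UNIV (%x. f (x - z) + g (x - z) - (f x + g x)) < e"
  using d1(1) d2(1) by (intro exI[of _ "min d1 d2"]) auto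
qed

lemma transl_cont_limit:
 assumes f: "f \<in> L2 UNIV"
  and lim: "\<And>e. e > 0 ==> \<exists>g. transl_cont g \<and> L2_dist UNIV g f < e"
 shows "transl_cont f"
 unfolding transl_cont_def
proof (intro conjI allI impI f)
 fix e :: real assume e: "e > 0"
 then have "e / 3 > 0" by simp
 then obtain g where g: "transl_cont g" "L2_dist UNIV g f < e / 3"
  using lim by blast
 have gL: "g \<in> L2 UNIV" using g by (simp add: transl_cont_def)
 obtain d where d: "d > 0" "\<And>z. norm z < d ==> L2_norm UNIV (%x. g (x - z) - g x) < e / 3"
  using g(1) \<open>e / 3 > 0\<close> unfolding transl_cont_def by blast
 have "L2_norm UNIV (%x. f (x - z) - f x) < e" if z: "norm z < d" for z
 proof -
  have "L2_norm UNIV (%x. f (x - z) - f x) \<le>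
    L2_norm UNIV (%x. f (x - z) - g (x - z)) + L2_norm UNIV (%x. g (x - z) - f x)"
   by (rule L2_norm_triangle3[OF L2_translate(1)[OF f] L2_translate(1)[OF gL] f])
  also have "L2_norm UNIV (%x. g (x - z) - f x) \<le>
    L2_norm UNIV (%x. g (x - z) - g x) + L2_dist UNIV g f"
   by (rule L2_norm_triangle3[OF L2_translate(1)[OF gL] gL f])
  also have "L2_norm UNIV (%x. f (x - z) - g (x - z)) = L2_dist UNIV g f"
   using L2_translate(2)[OF L2_diff[OF f gL], of z]
   by (simp add: L2_norm_minus_commute[of UNIV f g])
  finally show ?thesis using d(2)[OF z] g(2) by simp
 qed
 then show "\<exists>d>0. \<forall>z. norm z < d \<longrightarrow> L2_norm UNIV (%x. f (x - z) - f x) < e"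
  using d(1) by blast
qed

lemma L2_indicator_finite:
 assumes "A \<in> sets borel" "emeasure lborel A < \<infinity>"
 shows "(indicator A :: 'a::euclidean_space => real) \<in> L2 UNIV"
  "L2_norm UNIV (indicator A :: 'a => real) = sqrt (measure lborel A)"
proof -
 have sq: "(%x. (indicator A x :: real)\<^sup>2) = indicator A" by (auto simp: indicator_def)
 show "(indicator A :: 'a => real) \<in> L2 UNIV"
  using assms by (simp add: L2_iff sq)
 show "L2_norm UNIV (indicator A :: 'a => real) = sqrt (measure lborel A)"
  using assms by (simp add: L2_norm_def set_lebesgue_integral_def sq)
qed

text \<open>Outer regularity places K in an open O' with little excess. A short translate of K stays
  inside O', so the two indicators differ only on \<open>O' - K\<close> and its translate.\<close>

lemma transl_cont_compact:
 assumes K: "compact (K :: 'a::euclidean_space set)"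
 shows "transl_cont (indicator K)"
 unfolding transl_cont_def
proof (intro conjI allI impI)
 have Kb: "K \<in> sets borel" using K by (simp add: borel_compact)
 show "(indicator K :: 'a => real) \<in> L2 UNIV"
  by (rule L2_indicator_finite) (use K Kb emeasure_compact_finite in auto)
 fix e :: real assume e: "e > 0"
 \<comment> \<open>The squared norm will be at most twice the measure of \<open>O' - K\<close>, so a
   quarter of e^2 leaves room for the strict inequality.\<close>
 define c where "c = e\<^sup>2 / 4"
 have c: "c > 0" using e by (simp add: c_def)
 obtain O' where O': "open O'" "K \<subseteq> O'" "emeasure lborel (O' - K) < c"
  using outer_regular_lborel[OF Kb c] by metis
 let ?D = "O' - K"
 have Db: "?D \<in> sets borel" using O' Kb by auto
 have Dfin: "emeasure lborel ?D < \<infinity>" using order_less_trans[OF O'(3) ennreal_less_top] by simp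
 have Dm: "measure lborel ?D < c"
  using O'(3) Dfin by (simp add: emeasure_eq_ennreal_measure less_top ennreal_less_iff)
 obtain d where d: "d > 0" "\<And>x y. x \<in> K ==> norm (y - x) < d ==> y \<in> O'"
 proof -
  obtain d where "d > 0" "\<And>x. x \<in> K ==> ball x d \<subseteq> O'"
   using compact_subset_open_imp_ball_epsilon_subset[OF K O'(1,2)] by (metis UN_subset_iff)
  then show ?thesis using that[of d] by (auto simp: subset_eq dist_norm norm_minus_commute)
 qed
 have "L2_norm UNIV (%x. indicator K (x - z) - indicator K x) < e" if z: "norm z < d" for z
 proof -
  have ID: "integrable lborel (indicator ?D :: 'a => real)" using Db Dfin by simp
  have ID': "integrable lborel (%x. indicator ?D (x - z) :: real)"
   using lborel_integrable_translation[OF ID, of "- z"] by simp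
  have b: "(indicator K (x - z) - indicator K x :: real)\<^sup>2 \<le> indicator ?D x + indicator ?D (x - z)" for x
  proof -
   have 1: "x \<in> O'" if "x - z \<in> K" using d(2)[OF that, of x] z by simp
   have 2: "x - z \<in> O'" if "x \<in> K" using d(2)[OF that, of "x - z"] z by simp
   show ?thesis using 1 2 by (auto simp: indicator_def)
  qed
  have m: "(%x. (indicator K (x - z) - indicator K x :: real)\<^sup>2) \<in> borel_measurable lborel"
   using Kb by measurable
  have i: "integrable lborel (%x. (indicator K (x - z) - indicator K x :: real)\<^sup>2)"
   by (rule Bochner_Integration.integrable_bound[OF Bochner_Integration.integrable_add[OF ID ID'] m])
     (use b in \<open>simp add: abs_of_nonneg\<close>)
  have "(LINT x|lborel. (indicator K (x - z) - indicator K x :: real)\<^sup>2) \<le>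
    (LINT x|lborel. indicator ?D x + indicator ?D (x - z))"
   by (rule integral_mono[OF i Bochner_Integration.integrable_add[OF ID ID'] b])
  also have "\<dots> = 2 * measure lborel ?D"
   using ID ID' lborel_integral_translation[of "indicator ?D" "- z"] Db Dfin by simp
  also have "\<dots> < e\<^sup>2" using Dm measure_nonneg[of lborel ?D] unfolding c_def by linarith
  finally show ?thesis
   using e by (auto simp: L2_norm_def set_lebesgue_integral_def intro!: real_less_lsqrt)
 qed
 then show "\<exists>d>0. \<forall>z. norm z < d \<longrightarrow> L2_norm UNIV (%x. indicator K (x - z) - indicator K x) < e"
  using d(1) by blast
qed

text \<open>Inner regularity exhausts A by compact sets, and the L2 distance of two nested
  indicators is the root of the measure of their difference.\<close>

lemma transl_cont_indicator:
 assumes A: "A \<in> sets borel" "emeasure lborel (A :: 'a::euclidean_space set) < \<infinity>"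
 shows "transl_cont (indicator A)"
proof (rule transl_cont_limit)
 show "(indicator A :: 'a => real) \<in> L2 UNIV" by (rule L2_indicator_finite[OF A])
 fix e :: real assume e: "e > 0"
 \<comment> \<open>Restricting Lebesgue measure to A makes it finite, as inner regularity
   requires.\<close>
 let ?M = "density lborel (indicator A)"
 have M: "emeasure ?M B = emeasure lborel (A \<inter> B)" if "B \<in> sets borel" for B
  by (rule emeasure_restricted) (use A that in auto)
 have "emeasure ?M A = (SUP K \<in> {K. K \<subseteq> A \<and> compact K}. emeasure ?M K)"
  by (rule inner_regular) (use A M in auto)
 then have S: "emeasure lborel A = (SUP K \<in> {K. K \<subseteq> A \<and> compact K}. emeasure ?M K)"
  using M[OF A(1)] by simp
 obtain K where K: "K \<subseteq> A" "compact K" "measure lborel A < measure lborel K + e\<^sup>2"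
 \<comment> \<open>If A is small the empty set will do; otherwise the difference with e^2 is
   nonnegative, so nothing is truncated in passing to \<open>ennreal\<close>.\<close>
 proof (cases "measure lborel A < e\<^sup>2")
  case True
  then show ?thesis by (intro that[of "{}"]) auto
 next
  case False
  have "ennreal (measure lborel A - e\<^sup>2) < emeasure lborel A"
   using False A(2) e by (simp add: emeasure_eq_ennreal_measure less_top ennreal_less_iff)
  then obtain K where K: "K \<subseteq> A" "compact K" "ennreal (measure lborel A - e\<^sup>2) < emeasure ?M K"
   unfolding S less_SUP_iff by blast
  have "emeasure ?M K = emeasure lborel K"
   using M[of K] K by (simp add: borel_compact Int_absorb1)
  also have "\<dots> = ennreal (measure lborel K)"
   using emeasure_compact_finite[OF K(2)] by (intro emeasure_eq_ennreal_measure) auto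
  finally have "measure lborel A - e\<^sup>2 < measure lborel K"
   using K(3) False by (simp add: ennreal_less_iff)
  with K show ?thesis by (intro that) auto
 qed
 have Kb: "K \<in> sets borel" using K by (simp add: borel_compact)
 have Kf: "emeasure lborel K < \<infinity>" using K emeasure_compact_finite by auto
 note K(3)
 moreover have "measure lborel (A - K) = measure lborel A - measure lborel K"
  by (rule measure_Diff) (use A Kb K Kf in auto)
 ultimately have lt: "measure lborel (A - K) < e\<^sup>2" by simp
 have AKf: "emeasure lborel (A - K) < \<infinity>"
  using emeasure_mono[of "A - K" A lborel] A by (auto intro: le_less_trans)
 have "(%x. indicator K x - indicator A x) = (%x. - indicator (A - K) x :: real)"
  using K(1) by (auto simp: indicator_def fun_eq_iff)
 then have "L2_norm UNIV (%x. indicator K x - indicator A x :: real) = sqrt (measure lborel (A - K))"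
  using L2_indicator_finite(2)[of "A - K"] A Kb AKf by (simp add: L2_norm_minus)
 also have "\<dots> < e" using lt e by (simp add: real_less_lsqrt)
 finally show "\<exists>g. transl_cont g \<and> L2_dist UNIV g (indicator A) < e"
  using transl_cont_compact[OF K(2)] by blast
qed

lemma transl_cont_cmult:
 assumes "transl_cont f"
 shows "transl_cont (%x. c * f x)"
proof (cases "c = 0")
 case True
 then show ?thesis by (auto simp: transl_cont_def L2_zero L2_norm_zero intro: exI[of _ 1])
next
 case False
 show ?thesis unfolding transl_cont_def
 proof (intro conjI allI impI)
  show "(%x. c * f x) \<in> L2 UNIV" using assms by (simp add: transl_cont_def L2_cmult)
  fix e :: real assume "e > 0"
  then have "e / \<bar>c\<bar> > 0" using False by simp
  then obtain d where d: "d > 0" "\<And>z. norm z < d ==> L2_norm UNIV (%x. f (x - z) - f x) < e / \<bar>c\<bar>"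
   using assms unfolding transl_cont_def by metis
  have "L2_norm UNIV (%x. c * f (x - z) - c * f x) < e" if "norm z < d" for z
   using d(2)[OF that] L2_norm_cmult[of UNIV c "%x. f (x - z) - f x"] False
   by (simp add: right_diff_distrib field_simps)
  then show "\<exists>d>0. \<forall>z. norm z < d \<longrightarrow> L2_norm UNIV (%x. c * f (x - z) - c * f x) < e"
   using d(1) by blast
 qed
qed

lemma transl_cont_sum:
 "finite I ==> (\<And>i. i \<in> I ==> transl_cont (f i)) ==> transl_cont (%x. \<Sum>i\<in>I. f i x)"
proof (induction I rule: finite_induct)
 case empty
 then show ?case by (auto simp: transl_cont_def L2_zero L2_norm_zero intro: exI[of _ 1])
next
 case (insert i I)
 then show ?case by (simp add: transl_cont_add)
qed

text \<open>Simple functions bounded by 2 |f| converge to f pointwise, hence in L2 by domination,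
  and each is a finite combination of indicators of sets of finite measure.\<close>

theorem L2_translation_continuous:
 assumes f: "f \<in> L2 UNIV"
 shows "transl_cont f"
proof -
 have fm: "f \<in> borel_measurable lborel" using f by (simp add: L2_iff)
 obtain F where F: "\<And>i. simple_function lborel (F i)" "\<And>x. (%i. F i x) \<longlonglongrightarrow> f x"
  "\<And>i x. dist (F i x) 0 \<le> 2 * dist (f x) 0"
  using borel_measurable_implies_sequence_metric[OF fm, of 0] by auto
 have Fm: "F i \<in> borel_measurable lborel" for i
  using F(1)[of i] by (rule borel_measurable_simple_function)
 have F2: "integrable lborel (%x. (F i x)\<^sup>2)" for i
 proof (rule Bochner_Integration.integrable_bound)
  show "integrable lborel (%x. 4 * (f x)\<^sup>2)" using f by (simp add: L2_iff)
  show "AE x in lborel. norm ((F i x)\<^sup>2) \<le> norm (4 * (f x)\<^sup>2)"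
  proof (rule AE_I2)
   fix x
   have "(F i x)\<^sup>2 \<le> (2 * \<bar>f x\<bar>)\<^sup>2"
    using F(3)[of i x] by (intro abs_le_square_iff[THEN iffD1]) (simp add: dist_real_def)
   then show "norm ((F i x)\<^sup>2) \<le> norm (4 * (f x)\<^sup>2)" by (simp add: power_mult_distrib)
  qed
 qed (use Fm in measurable)
 have FL: "F i \<in> L2 UNIV" for i using Fm[of i] F2[of i] by (simp add: L2_iff)
 have tF: "transl_cont (F i)" for i
 proof -
  let ?S = "F i ` UNIV"
  have fin: "finite ?S" using F(1)[of i] by (simp add: simple_function_def)
  have "transl_cont (%x. y * indicator (F i -` {y}) x)" if "y \<in> ?S" for y
  proof (cases "y = 0")
   case True
   then show ?thesis by (auto simp: transl_cont_def L2_zero L2_norm_zero intro: exI[of _ 1])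
  next
   case False
   have Ab: "F i -` {y} \<in> sets borel"
    using measurable_sets[OF Fm[of i], of "{y}"] by simp
   \<comment> \<open>Chebyshev: on the level set of y \<noteq> 0 the indicator is at most F^2 / y^2,
     so the level set has finite measure.\<close>
   have "integrable lborel (indicator (F i -` {y}) :: 'a => real)"
   proof (rule Bochner_Integration.integrable_bound)
    show "integrable lborel (%x. (F i x)\<^sup>2 / y\<^sup>2)" using F2 by simp
    show "AE x in lborel. norm (indicator (F i -` {y}) x :: real) \<le> norm ((F i x)\<^sup>2 / y\<^sup>2)"
     using False by (auto simp: indicator_def)
   qed (use Ab in measurable)
   then have "emeasure lborel (F i -` {y}) < \<infinity>"
    using Ab integrable_indicator_iff[of lborel "F i -` {y}"] by simp
   then show ?thesis by (intro transl_cont_cmult transl_cont_indicator Ab)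
  qed
  then have "transl_cont (%x. \<Sum>y\<in>?S. y * indicator (F i -` {y}) x)"
   by (intro transl_cont_sum fin)
  also have "(%x. \<Sum>y\<in>?S. y * indicator (F i -` {y}) x) = F i"
  proof
   fix x
   have "(\<Sum>y\<in>?S. y * indicator (F i -` {y}) x) = (\<Sum>y\<in>?S. if F i x = y then y else 0)"
    by (intro sum.cong) (auto simp: indicator_def)
   also have "\<dots> = F i x" using fin by (simp add: sum.delta')
   finally show "(\<Sum>y\<in>?S. y * indicator (F i -` {y}) x) = F i x" .
  qed
  finally show ?thesis .
 qed
 \<comment> \<open>The factor 3 is 2 for \<open>F i\<close> plus 1 for f.\<close>
 have absf: "(%x. 3 * \<bar>f x\<bar>) \<in> L2 UNIV"
  by (intro L2_cmult L2_abs f)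
 have "(%i. L2_dist UNIV (F i) f) \<longlonglongrightarrow> 0"
 proof (rule L2_dominated_convergence[OF FL f absf])
  show "AE x in lborel. x \<in> UNIV \<longrightarrow> \<bar>F k x - f x\<bar> \<le> 3 * \<bar>f x\<bar>" for k
   using F(3)[of k] by (intro AE_I2 impI) (smt (verit) dist_real_def)
 qed (use F(2) in auto)
 then have "\<exists>i. L2_dist UNIV (F i) f < e" if "e > 0" for e
  using LIMSEQ_D[of _ 0, OF _ that] by (fastforce simp: abs_of_nonneg L2_norm_nonneg)
 then show ?thesis
  using tF by (intro transl_cont_limit[OF f]) blast
qed

section \<open>Convolution with smooth kernels\<close>

definition conv :: "('a::euclidean_space => real) => ('a => real) => 'a => real" where
 "conv f k x = (LINT y|lborel. f y * k (x - y))"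

lemma conv_integrable:
 assumes "f \<in> L2 UNIV" "k \<in> L2 UNIV"
 shows "integrable lborel (%y. f y * k (x - y))"
 using L2_mult_integrable[OF assms(1) L2_reflect[OF assms(2)]] by (simp add: set_integrable_def)

lemma conv_alt:
 assumes "f \<in> borel_measurable borel" "k \<in> borel_measurable borel"
 shows "conv f k x = (LINT z|lborel. k z * f (x - z))"
proof -
 have m: "(%y. f y * k (x - y)) \<in> borel_measurable borel" using assms by measurable
 show ?thesis
  using lborel_integral_reflect[OF m, of x] by (simp add: conv_def mult.commute)
qed

lemma L2_borel: "f \<in> L2 UNIV ==> f \<in> borel_measurable borel"
 by (simp add: L2_iff)

lemma conv_zero:
 assumes "\<And>y. f y \<noteq> 0 ==> k (x - y) = 0"
 shows "conv f k x = 0"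
proof -
 have "(%y. f y * k (x - y)) = (%y. 0)" using assms by fastforce
 then show ?thesis by (simp only: conv_def integral_zero)
qed

text \<open>\<open>k\<close> is a probability density, so Jensen bounds the squared error at x by
  the average over z of the squared translation error; exchanging the integrals leaves an average of
  numbers at most e^2.\<close>

lemma conv_L2_estimate:
 fixes f :: "'a::euclidean_space => real"
 assumes f: "f \<in> L2 UNIV" and kc: "continuous_on UNIV k" and k0: "\<And>z. 0 \<le> k z"
  and ks: "\<And>z. d \<le> norm z ==> k z = 0" and k1: "(LINT z|lborel. k z) = 1"
  and e: "0 \<le> e" "\<And>z. norm z < d ==> L2_norm UNIV (%x. f (x - z) - f x) \<le> e"
 shows "(%x. conv f k x - f x) \<in> L2 UNIV \<and> L2_dist UNIV (conv f k) f \<le> e"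
proof -
 have fm[measurable]: "f \<in> borel_measurable borel" by (rule L2_borel[OF f])
 have km[measurable]: "k \<in> borel_measurable borel" using kc by (rule borel_measurable_continuous_onI)
 have ks': "k z = 0" if "z \<notin> cball 0 d" for z using ks[of z] that by auto
 have ki: "integrable lborel k" by (rule integrable_continuous_compact_support[OF kc compact_cball ks'])
 have kL: "k \<in> L2 UNIV" by (rule L2_continuous_compact_support[OF kc compact_cball[of 0 d]]) (use ks' in auto)
 have "\<exists>B>0. \<forall>x. \<bar>k x\<bar> \<le> B" by (rule continuous_compact_support_bounded[OF kc compact_cball ks'])
 then obtain B where B0: "B > 0" and B: "\<And>x. \<bar>k x\<bar> \<le> B" by blast
 define h where "h x z = f (x - z) - f x" for x z
 define a where "a x = conv f k x - f x" for x
 have i1: "integrable lborel (%z. k z * f (x - z))" for x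
  using L2_mult_integrable[OF kL L2_reflect[OF f]] by (simp add: set_integrable_def)
 have i2: "integrable lborel (%z. k z * (f (x - z))\<^sup>2)" for x
 proof (rule Bochner_Integration.integrable_bound)
  show "integrable lborel (%z. B * (f (x - z))\<^sup>2)"
   using L2_reflect[OF f, of x] by (simp add: L2_iff)
  show "AE z in lborel. norm (k z * (f (x - z))\<^sup>2) \<le> norm (B * (f (x - z))\<^sup>2)"
  proof (rule AE_I2)
   fix z
   have "\<bar>k z\<bar> * (f (x - z))\<^sup>2 \<le> B * (f (x - z))\<^sup>2" by (rule mult_right_mono[OF B]) simp
   then show "norm (k z * (f (x - z))\<^sup>2) \<le> norm (B * (f (x - z))\<^sup>2)"
    using B0 by (simp add: abs_mult)
  qed
 qed measurable
 have a_eq: "a x = (LINT z|lborel. k z * h x z)" for x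
 proof -
  have "(LINT z|lborel. k z * h x z) = (LINT z|lborel. k z * f (x - z) - f x * k z)"
   by (simp add: h_def algebra_simps)
  also have "\<dots> = (LINT z|lborel. k z * f (x - z)) - (LINT z|lborel. f x * k z)"
   by (rule Bochner_Integration.integral_diff[OF i1]) (use ki in simp)
  finally show ?thesis by (simp add: a_def conv_alt k1)
 qed
 have ikh: "integrable lborel (%z. k z * h x z)" for x
 proof -
  have "integrable lborel (%z. k z * f (x - z) - f x * k z)" using i1 ki by simp
  then show ?thesis by (simp add: h_def algebra_simps)
 qed
 have ikh2: "integrable lborel (%z. k z * (h x z)\<^sup>2)" for x
 proof -
  have "integrable lborel (%z. k z * (f (x - z))\<^sup>2 - 2 * f x * (k z * f (x - z)) + (f x)\<^sup>2 * k z)"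
   using i1 i2 ki by simp
  also have "(%z. k z * (f (x - z))\<^sup>2 - 2 * f x * (k z * f (x - z)) + (f x)\<^sup>2 * k z) = (%z. k z * (h x z)\<^sup>2)"
   by (simp add: h_def fun_eq_iff power2_eq_square algebra_simps)
  finally show ?thesis .
 qed
 \<comment> \<open>Nonnegativity of the variance: \<open>a x\<close> is the mean of
   \<open>h x\<close> under the density \<open>k\<close>.\<close>
 have jensen: "(a x)\<^sup>2 \<le> (LINT z|lborel. k z * (h x z)\<^sup>2)" for x
 proof -
  have "0 \<le> (LINT z|lborel. k z * (h x z - a x)\<^sup>2)" using k0 by (intro integral_nonneg_AE) auto
  also have "\<dots> = (LINT z|lborel. k z * (h x z)\<^sup>2 - 2 * a x * (k z * h x z) + (a x)\<^sup>2 * k z)"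
   by (rule Bochner_Integration.integral_cong) (auto simp: power2_eq_square algebra_simps)
  also have "\<dots> = (LINT z|lborel. k z * (h x z)\<^sup>2) - 2 * a x * (LINT z|lborel. k z * h x z) + (a x)\<^sup>2 * (LINT z|lborel. k z)"
   using ikh ikh2 ki by simp
  finally show ?thesis by (simp add: a_eq[symmetric] k1 power2_eq_square)
 qed
 have am: "a \<in> borel_measurable lborel"
 proof -
  have "(%x. LINT z|lborel. k z * f (x - z)) \<in> borel_measurable lborel"
   by (rule lborel.borel_measurable_lebesgue_integral) measurable
  then show ?thesis by (simp add: a_def[abs_def] conv_alt)
 qed
 have meas: "(%(x, z). ennreal (k z * (h x z)\<^sup>2)) \<in> borel_measurable (lborel \<Otimes>\<^sub>M lborel)"
  unfolding h_def by measurable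
 have "(\<integral>\<^sup>+x. ennreal ((a x)\<^sup>2) \<partial>lborel) \<le> (\<integral>\<^sup>+x. \<integral>\<^sup>+z. ennreal (k z * (h x z)\<^sup>2) \<partial>lborel \<partial>lborel)"
 proof (rule nn_integral_mono)
  fix x
  have "(\<integral>\<^sup>+z. ennreal (k z * (h x z)\<^sup>2) \<partial>lborel) = ennreal (LINT z|lborel. k z * (h x z)\<^sup>2)"
   using ikh2 k0 by (intro nn_integral_eq_integral) auto
  then show "ennreal ((a x)\<^sup>2) \<le> (\<integral>\<^sup>+z. ennreal (k z * (h x z)\<^sup>2) \<partial>lborel)"
   using jensen[of x] by (simp add: ennreal_leI)
 qed
 also have "\<dots> = (\<integral>\<^sup>+z. \<integral>\<^sup>+x. ennreal (k z * (h x z)\<^sup>2) \<partial>lborel \<partial>lborel)"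
  using lborel_pair.Fubini'[OF meas] by simp
 also have "\<dots> \<le> (\<integral>\<^sup>+z. ennreal (k z * e\<^sup>2) \<partial>lborel)"
 proof (rule nn_integral_mono)
  fix z
  have hL: "(%x. h x z) \<in> L2 UNIV" unfolding h_def by (rule L2_diff[OF L2_translate(1)[OF f] f])
  show "(\<integral>\<^sup>+x. ennreal (k z * (h x z)\<^sup>2) \<partial>lborel) \<le> ennreal (k z * e\<^sup>2)"
  proof (cases "norm z < d")
   case True
   have "(\<integral>\<^sup>+x. ennreal (k z * (h x z)\<^sup>2) \<partial>lborel) = ennreal (LINT x|lborel. k z * (h x z)\<^sup>2)"
    using hL k0 by (intro nn_integral_eq_integral) (auto simp: L2_iff)
   also have "(LINT x|lborel. k z * (h x z)\<^sup>2) = k z * (L2_norm UNIV (%x. h x z))\<^sup>2"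
    unfolding L2_norm_sq ip_def set_lebesgue_integral_def by (simp add: power2_eq_square)
   also have "\<dots> \<le> k z * e\<^sup>2"
    using e(2)[OF True] k0 by (intro mult_left_mono power_mono) (auto simp: h_def L2_norm_nonneg)
   finally show ?thesis by (simp add: ennreal_leI)
  next
   case False
   then show ?thesis using ks[of z] by simp
  qed
 qed
 also have "\<dots> = ennreal (LINT z|lborel. k z * e\<^sup>2)"
  using ki k0 by (intro nn_integral_eq_integral) auto
 finally have le: "(\<integral>\<^sup>+x. ennreal ((a x)\<^sup>2) \<partial>lborel) \<le> ennreal (e\<^sup>2)" by (simp add: k1)
 have i: "integrable lborel (%x. (a x)\<^sup>2)"
  by (rule integrableI_bounded) (use am le in \<open>auto intro: le_less_trans\<close>)
 have aL: "a \<in> L2 UNIV" using am i by (simp add: L2_iff)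
 have "ennreal (LINT x|lborel. (a x)\<^sup>2) \<le> ennreal (e\<^sup>2)"
  using le nn_integral_eq_integral[OF i] by simp
 then have "(L2_norm UNIV a)\<^sup>2 \<le> e\<^sup>2"
  unfolding L2_norm_sq ip_def set_lebesgue_integral_def by (simp add: power2_eq_square)
 then have "L2_norm UNIV a \<le> e" using e(1) by (rule power2_le_imp_le)
 with aL show ?thesis by (simp add: a_def[abs_def])
qed

text \<open>The radius d depends on f and e but not on the kernel, so one kernel can later serve
  several functions.\<close>

lemma conv_L2_approx:
 fixes f :: "'a::euclidean_space => real"
 assumes f: "f \<in> L2 UNIV" and e: "e > 0"
 shows "\<exists>d>0. \<forall>k. continuous_on UNIV k \<and> (\<forall>z. 0 \<le> k z) \<and> (\<forall>z. d \<le> norm z \<longrightarrow> k z = 0) \<and>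
   (LINT z|lborel. k z) = 1 \<longrightarrow> conv f k \<in> L2 UNIV \<and> L2_dist UNIV (conv f k) f < e"
proof -
 have "e / 2 > 0" using e by simp
 then obtain d where d: "d > 0" "\<And>z. norm z < d ==> L2_norm UNIV (%x. f (x - z) - f x) < e / 2"
  using L2_translation_continuous[OF f] unfolding transl_cont_def by blast
 have "conv f k \<in> L2 UNIV \<and> L2_dist UNIV (conv f k) f < e"
  if "continuous_on UNIV k" "\<forall>z. 0 \<le> k z" "\<forall>z. d \<le> norm z \<longrightarrow> k z = 0" "(LINT z|lborel. k z) = 1" for k
 proof -
  have *: "(%x. conv f k x - f x) \<in> L2 UNIV \<and> L2_dist UNIV (conv f k) f \<le> e / 2"
   by (rule conv_L2_estimate[OF f that(1), of d]) (use that d(2) e in \<open>auto simp: less_imp_le\<close>)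
  then show ?thesis using L2_add[OF conjunct1[OF *] f] e by simp
 qed
 with d(1) show ?thesis by blast
qed

lemma C_diff_1_lipschitz:
 fixes \<eta> :: "'a::euclidean_space => real"
 assumes \<eta>: "\<eta> \<in> test_fun U"
 shows "\<exists>M>0. \<forall>x h. \<bar>\<eta> (x + h) - \<eta> x\<bar> \<le> M * norm h \<and>
  \<bar>\<Sum>c\<in>Basis. (h \<bullet> c) * pd c \<eta> x\<bar> \<le> M * norm h"
proof -
 have "\<forall>c\<in>Basis. \<exists>B>0. \<forall>x. \<bar>pd c \<eta> x\<bar> \<le> B"
  by (intro ballI test_fun_bounded[OF test_fun_pd[OF \<eta>]])
 then obtain B where B: "\<And>c. c \<in> Basis ==> 0 < B c" "\<And>c x. c \<in> Basis ==> \<bar>pd c \<eta> x\<bar> \<le> B c"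
  by metis
 define M where "M = (\<Sum>c\<in>Basis. B c)"
 have M: "M > 0" unfolding M_def by (rule sum_pos) (auto simp: B)
 have D: "\<bar>\<Sum>c\<in>Basis. (h \<bullet> c) * pd c \<eta> x\<bar> \<le> M * norm h" for x h
 proof -
  have "\<bar>\<Sum>c\<in>Basis. (h \<bullet> c) * pd c \<eta> x\<bar> \<le> (\<Sum>c\<in>Basis. norm h * B c)"
   by (rule order_trans[OF sum_abs], rule sum_mono)
     (use B Basis_le_norm in \<open>auto simp: abs_mult intro!: mult_mono\<close>)
  then show ?thesis by (simp add: M_def sum_distrib_left mult.commute)
 qed
 have "\<bar>\<eta> (x + h) - \<eta> x\<bar> \<le> M * norm h" for x h
 proof -
  have "norm (\<eta> (x + h) - \<eta> x) \<le> M * norm (x + h - x)"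
  proof (rule differentiable_bound[of UNIV \<eta> "%x h. pd h \<eta> x"])
   fix x
   show "(\<eta> has_derivative (%h. pd h \<eta> x)) (at x within UNIV)"
    by (rule has_derivative_pd[OF test_funD(7)[OF \<eta>]])
   have "norm (pd h \<eta> x) \<le> M * norm h" for h
    unfolding real_norm_def by (subst pd_expand[OF test_funD(7)[OF \<eta>]]) (rule D)
   then show "onorm (%h. pd h \<eta> x) \<le> M"
    by (rule onorm_le)
  qed auto
  then show ?thesis by simp
 qed
 with D M show ?thesis by blast
qed

text \<open>The Taylor remainder of the kernel, divided by the norm of the increment, tends to 0
  pointwise, is bounded by 2 M and lives in one fixed ball; dominated convergence along sequences of
  increments gives the derivative.\<close>

lemma conv_has_derivative:
 fixes f :: "'a::euclidean_space => real"
 assumes f: "f \<in> L2 UNIV" and \<eta>: "\<eta> \<in> test_fun UNIV"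
 shows "(conv f \<eta> has_derivative (%h. \<Sum>c\<in>Basis. (h \<bullet> c) * conv f (pd c \<eta>) x)) (at x)"
proof -
 obtain K where K: "compact K" "\<And>z. z \<notin> K ==> \<eta> z = 0"
  using test_fun_support[OF \<eta>] by blast
 obtain R where R: "R > 0" "\<And>z. z \<in> K ==> norm z \<le> R"
  using compact_imp_bounded[OF K(1)] by (auto simp: bounded_pos)
 from C_diff_1_lipschitz[OF \<eta>] obtain M where MM: "M > 0 \<and> (\<forall>x h. \<bar>\<eta> (x + h) - \<eta> x\<bar> \<le> M * norm h \<and>
  \<bar>\<Sum>c\<in>Basis. (h \<bullet> c) * pd c \<eta> x\<bar> \<le> M * norm h)" ..
 have M: "M > 0" "\<bar>\<eta> (x + h) - \<eta> x\<bar> \<le> M * norm h"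
  "\<bar>\<Sum>c\<in>Basis. (h \<bullet> c) * pd c \<eta> x\<bar> \<le> M * norm h" for x h
  by (rule conjunct1[OF MM], rule conjunct1[OF conjunct2[OF MM, rule_format]], rule conjunct2[OF conjunct2[OF MM, rule_format]])
 have fm[measurable]: "f \<in> borel_measurable borel" by (rule L2_borel[OF f])
 have \<eta>L: "\<eta> \<in> L2 UNIV" by (rule test_fun_L2[OF \<eta>]) auto
 have dL: "pd c \<eta> \<in> L2 UNIV" if "c \<in> Basis" for c
  by (rule test_fun_L2[OF test_fun_pd[OF \<eta> that]]) auto
 define D where "D h = (\<Sum>c\<in>Basis. (h \<bullet> c) * conv f (pd c \<eta>) x)" for h
 define R' where "R' h z = \<eta> (z + h) - \<eta> z - (\<Sum>c\<in>Basis. (h \<bullet> c) * pd c \<eta> z)" for h z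
 have Rz: "R' h z = 0" if "R + norm h < norm z" for h z
 proof -
  have "z \<notin> K" using R(2)[of z] that norm_ge_zero[of h] by linarith
  moreover have "z + h \<notin> K"
   using R(2)[of "z + h"] that norm_triangle_ineq4[of "z + h" h] by auto
  moreover have "pd c \<eta> z = 0" for c
   by (rule pd_zero_outside[OF compact_imp_closed[OF K(1)] K(2) \<open>z \<notin> K\<close>])
  ultimately show ?thesis by (simp add: R'_def K(2))
 qed
 have eq: "conv f \<eta> (x + h) - conv f \<eta> x - D h = (LINT y|lborel. f y * R' h (x - y))" for h
 proof -
  have i: "integrable lborel (%y. f y * \<eta> (x + h - y))" "integrable lborel (%y. f y * \<eta> (x - y))"
   by (rule conv_integrable[OF f \<eta>L])+
  have j: "integrable lborel (%y. (h \<bullet> c) * (f y * pd c \<eta> (x - y)))" if "c \<in> Basis" for c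
   by (rule integrable_mult_right) (rule conv_integrable[OF f dL[OF that]])
  have "D h = (LINT y|lborel. (\<Sum>c\<in>Basis. (h \<bullet> c) * (f y * pd c \<eta> (x - y))))"
   using j by (subst Bochner_Integration.integral_sum) (auto simp: D_def conv_def)
  then have "conv f \<eta> (x + h) - conv f \<eta> x - D h =
    (LINT y|lborel. f y * \<eta> (x + h - y) - f y * \<eta> (x - y) - (\<Sum>c\<in>Basis. (h \<bullet> c) * (f y * pd c \<eta> (x - y))))"
   using i j by (subst Bochner_Integration.integral_diff) (auto simp: conv_def)
  also have "\<dots> = (LINT y|lborel. f y * R' h (x - y))"
   by (rule Bochner_Integration.integral_cong)
     (auto simp: R'_def algebra_simps sum_distrib_left)
  finally show ?thesis .
 qed
 have "((%h. norm (conv f \<eta> (x + h) - conv f \<eta> x - D h) / norm h) \<longlongrightarrow> 0) (at 0)"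
  unfolding tendsto_at_iff_sequentially
 proof (intro allI impI)
  fix X :: "nat => 'a"
  assume X0: "\<forall>i. X i \<in> UNIV - {0}" and X: "X \<longlonglongrightarrow> 0"
  obtain H where H: "\<And>i. norm (X i) \<le> H"
   using convergent_imp_Bseq[of X] X by (auto simp: convergent_def Bseq_def)
  have "(%i. LINT y|lborel. f y * (R' (X i) (x - y) / norm (X i))) \<longlonglongrightarrow> (LINT y|(lborel::'a measure). 0)"
  proof (rule integral_dominated_convergence)
   have L: "(%y. indicator (cball x (R + H)) y :: real) \<in> L2 UNIV"
    by (rule L2_indicator_finite) (use emeasure_compact_finite[OF compact_cball[of x "R + H"]] in auto)
   show "integrable lborel (%y. 2 * M * (\<bar>f y\<bar> * indicator (cball x (R + H)) y))"
    using L2_mult_integrable[OF L2_abs[OF f] L] by (simp add: set_integrable_def)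
   show "AE y in lborel. (%i. f y * (R' (X i) (x - y) / norm (X i))) \<longlonglongrightarrow> 0"
   proof (rule AE_I2)
    fix y
    have "(\<eta> has_derivative (%h. \<Sum>c\<in>Basis. (h \<bullet> c) * pd c \<eta> (x - y))) (at (x - y))"
     by (rule has_derivative_eq_rhs[OF has_derivative_pd[OF test_funD(7)[OF \<eta>]]])
       (rule ext, rule pd_expand[OF test_funD(7)[OF \<eta>]])
    then have "((%h. norm (R' h (x - y)) / norm h) \<longlongrightarrow> 0) (at 0)"
     by (simp add: has_derivative_at R'_def)
    then have "(%i. norm (R' (X i) (x - y)) / norm (X i)) \<longlonglongrightarrow> 0"
     using X0 X unfolding tendsto_at_iff_sequentially by (auto simp: o_def)
    then have "(%i. norm (R' (X i) (x - y) / norm (X i))) \<longlonglongrightarrow> 0"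
     by (simp add: norm_divide)
    then have "(%i. R' (X i) (x - y) / norm (X i)) \<longlonglongrightarrow> 0"
     by (rule tendsto_norm_zero_cancel)
    then show "(%i. f y * (R' (X i) (x - y) / norm (X i))) \<longlonglongrightarrow> 0"
     by (rule tendsto_mult_right_zero)
   qed
   show "AE y in lborel. norm (f y * (R' (X i) (x - y) / norm (X i))) \<le> 2 * M * (\<bar>f y\<bar> * indicator (cball x (R + H)) y)" for i
   proof (rule AE_I2)
    fix y
    show "norm (f y * (R' (X i) (x - y) / norm (X i))) \<le> 2 * M * (\<bar>f y\<bar> * indicator (cball x (R + H)) y)"
    proof (cases "y \<in> cball x (R + H)")
     case True
     have "\<bar>R' (X i) (x - y)\<bar> \<le> 2 * M * norm (X i)"
      using M(2)[of "x - y" "X i"] M(3)[of "X i" "x - y"] unfolding R'_def by linarith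
     then have "\<bar>R' (X i) (x - y) / norm (X i)\<bar> \<le> 2 * M"
      using X0 by (simp add: field_simps)
     then have "\<bar>f y\<bar> * \<bar>R' (X i) (x - y) / norm (X i)\<bar> \<le> \<bar>f y\<bar> * (2 * M)"
      by (intro mult_left_mono) auto
     then show ?thesis using True by (simp add: abs_mult mult_ac)
    next
     case False
     then have "R + norm (X i) < norm (x - y)" using H[of i] by (auto simp: dist_norm)
     then show ?thesis using False by (simp add: Rz)
    qed
   qed
   have "continuous_on UNIV (R' (X i))" for i unfolding R'_def
    by (intro continuous_intros continuous_on_compose2[OF test_funD(6)[OF \<eta>]]
      test_funD(6)[OF test_fun_pd[OF \<eta>]]) auto
   then have [measurable]: "R' (X i) \<in> borel_measurable borel" for i by (rule borel_measurable_continuous_onI)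
   show "(%y. f y * (R' (X i) (x - y) / norm (X i))) \<in> borel_measurable lborel" for i
    by measurable
  qed auto
  then have "(%i. (conv f \<eta> (x + X i) - conv f \<eta> x - D (X i)) / norm (X i)) \<longlonglongrightarrow> 0"
   by (simp add: eq)
  then have "(%i. norm ((conv f \<eta> (x + X i) - conv f \<eta> x - D (X i)) / norm (X i))) \<longlonglongrightarrow> 0"
   by (rule tendsto_norm_zero)
  then show "((%h. norm (conv f \<eta> (x + h) - conv f \<eta> x - D h) / norm h) \<circ> X) \<longlonglongrightarrow> 0"
   by (simp add: o_def norm_divide)
 qed
 moreover have "bounded_linear D"
  unfolding D_def by (intro bounded_linear_sum bounded_linear_mult_const bounded_linear_inner_left)
 ultimately have "(conv f \<eta> has_derivative D) (at x)" by (simp add: has_derivative_at)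
 then show ?thesis by (simp add: D_def[abs_def])
qed

lemma pd_conv:
 assumes "f \<in> L2 UNIV" "\<eta> \<in> test_fun UNIV" "b \<in> Basis"
 shows "pd b (conv f \<eta>) = conv f (pd b \<eta>)"
proof
 fix x
 show "pd b (conv f \<eta>) x = conv f (pd b \<eta>) x"
  unfolding pd_eq[OF conv_has_derivative[OF assms(1,2)]]
  using assms(3) by (simp add: inner_Basis if_distrib[of "%a. a * _"] sum.delta' cong: if_cong)
qed

lemma C_diff_conv: "f \<in> L2 UNIV ==> \<eta> \<in> test_fun UNIV ==> C_diff k (conv f \<eta>)"
proof (induction k arbitrary: \<eta>)
 case 0
 then show ?case
  by (auto intro!: continuous_at_imp_continuous_on has_derivative_continuous[OF conv_has_derivative])
next
 case (Suc k)
 then show ?case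
  using conv_has_derivative[OF Suc.prems]
  by (auto simp: pd_conv differentiable_def intro!: Suc.IH test_fun_pd)
qed

lemma pd_minus:
 assumes "f differentiable (at x)"
 shows "pd (- b) f x = - pd b f x"
 by (simp add: pd_expand[OF assms, of "- b"] pd_expand[OF assms, of b] sum_negf)

lemma test_fun_reflect:
 assumes \<eta>: "\<eta> \<in> test_fun (ball 0 \<epsilon>)" and U: "ball x \<epsilon> \<subseteq> U"
 shows "(%y. \<eta> (x - y)) \<in> test_fun U"
  "pd b (%y. \<eta> (x - y)) y = - pd b \<eta> (x - y)"
proof -
 obtain K where K: "compact K" "K \<subseteq> ball 0 \<epsilon>" "\<And>z. z \<notin> K ==> \<eta> z = 0"
  using test_fun_support[OF \<eta>] by blast
 have bl: "bounded_linear (%y::'a. - y)" by (rule bounded_linear_minus[OF bounded_linear_ident])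
 show "(%y. \<eta> (x - y)) \<in> test_fun U"
 proof (rule test_funI)
  show "C_diff k (%y. \<eta> (x - y))" for k
   using C_diff_compose_affine[OF bl test_funD(1)[OF \<eta>], of k x] by simp
  show "compact ((%z. x - z) ` K)" by (intro compact_continuous_image K continuous_intros)
  show "(%z. x - z) ` K \<subseteq> U" using K(2) U by (force simp: dist_norm)
  show "\<eta> (x - y) = 0" if "y \<notin> (%z. x - z) ` K" for y
   using K(3)[of "x - y"] that by (metis diff_diff_eq2 add_diff_cancel_left' image_eqI)
 qed
 show "pd b (%y. \<eta> (x - y)) y = - pd b \<eta> (x - y)"
  using pd_compose_affine[OF bl, of \<eta> x y b] test_funD(7)[OF \<eta>]
  by (simp add: pd_minus)
qed

text \<open>The reflected kernel centred at x is itself an admissible test function once its ball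
  lies in \<open>U\<close>, and the sign of the reflection cancels that of integration by parts. The
  statement is local in x, which permits evaluation at shifted points.\<close>

lemma conv_weak_deriv:
 assumes w: "has_weak_deriv U u b g" and \<eta>: "\<eta> \<in> test_fun (ball 0 \<epsilon>)" and U: "ball x \<epsilon> \<subseteq> U"
 shows "conv (%y. indicator U y * u y) (pd b \<eta>) x = conv (%y. indicator U y * g y) \<eta> x"
proof -
 have "(LINT y:U|lborel. u y * pd b (%y. \<eta> (x - y)) y) = - (LINT y:U|lborel. g y * \<eta> (x - y))"
  using w test_fun_reflect(1)[OF \<eta> U] unfolding has_weak_deriv_def by blast
 then show ?thesis
  by (simp add: test_fun_reflect(2)[OF \<eta> U] conv_def set_lebesgue_integral_def mult.assoc)
qed

lemma L2_AE_subseq: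
 assumes s: "\<And>k. s k \<in> L2 U" and u: "u \<in> L2 U" and lim: "(%k. L2_dist U (s k) u) \<longlonglongrightarrow> 0"
 shows "\<exists>r::nat=>nat. strict_mono r \<and> (AE x in lborel. x \<in> U \<longrightarrow> (%k. s (r k) x) \<longlonglongrightarrow> u x)"
proof -
 let ?f = "%k x. (indicator U x * (s k x - u x))\<^sup>2 :: real"
 have i: "integrable lborel (?f k)" for k using L2_diff[OF s u] by (simp add: L2_iff)
 have "(LINT x|lborel. norm (?f k x)) = (L2_dist U (s k) u)\<^sup>2" for k
  by (simp add: L2_norm_sq ip_def set_lebesgue_integral_def indicator_mult_square flip: power2_eq_square)
 then have "(%k. LINT x|lborel. norm (?f k x)) \<longlonglongrightarrow> 0"
  using tendsto_power[OF lim, of 2] by simp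
 from tendsto_L1_AE_subseq[OF i this]
 obtain r where r: "strict_mono r" "AE x in lborel. (%n. ?f (r n) x) \<longlonglongrightarrow> 0" by blast
 from r(2) have "AE x in lborel. x \<in> U \<longrightarrow> (%k. s (r k) x) \<longlonglongrightarrow> u x"
 proof eventually_elim
  case (elim x)
  note h = elim
  show ?case
  proof
   assume "x \<in> U"
   then have "(%n. (s (r n) x - u x)\<^sup>2) \<longlonglongrightarrow> 0" using h by simp
   then have "(%n. sqrt ((s (r n) x - u x)\<^sup>2)) \<longlonglongrightarrow> sqrt 0" by (rule tendsto_real_sqrt)
   then have "(%n. s (r n) x - u x) \<longlonglongrightarrow> 0" by (simp add: tendsto_rabs_zero_iff)
   then show "(%k. s (r k) x) \<longlonglongrightarrow> u x" by (rule LIM_zero_cancel)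
  qed
 qed
 with r(1) show ?thesis by blast
qed

text \<open>A function and its weak derivatives must be smoothed by the same kernels, hence one
  sequence for a finite family.\<close>

lemma mollifier_sequence:
 fixes f :: "'i => 'a::euclidean_space => real"
 assumes f: "\<And>i. i \<in> I ==> f i \<in> L2 UNIV" and I: "finite I" and d: "\<delta> > 0"
 shows "\<exists>\<eta>. (\<forall>n::nat. \<eta> n \<in> test_fun (ball 0 (\<delta> / Suc n)) \<and> (\<forall>z. 0 \<le> \<eta> n z) \<and> (LINT z|lborel. \<eta> n z) = 1) \<and>
   (\<forall>i\<in>I. (\<forall>n. conv (f i) (\<eta> n) \<in> L2 UNIV) \<and> (%n. L2_dist UNIV (conv (f i) (\<eta> n)) (f i)) \<longlonglongrightarrow> 0)"
proof -
 have "\<exists>\<eta>. \<eta> \<in> test_fun (ball 0 (\<delta> / Suc n)) \<and> (\<forall>z. 0 \<le> \<eta> z) \<and> (LINT z|lborel. \<eta> z) = 1 \<and>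
   (\<forall>i\<in>I. conv (f i) \<eta> \<in> L2 UNIV \<and> L2_dist UNIV (conv (f i) \<eta>) (f i) < 1 / Suc n)" for n
 proof -
  have "\<forall>i\<in>I. \<exists>d>0. \<forall>k. continuous_on UNIV k \<and> (\<forall>z. 0 \<le> k z) \<and> (\<forall>z. d \<le> norm z \<longrightarrow> k z = 0) \<and>
   (LINT z|lborel. k z) = 1 \<longrightarrow> conv (f i) k \<in> L2 UNIV \<and> L2_dist UNIV (conv (f i) k) (f i) < 1 / Suc n"
   by (intro ballI conv_L2_approx f) auto
  from bchoice[OF this] obtain d where dd: "\<And>i. i \<in> I ==> d i > 0"
   "\<And>i k. i \<in> I ==> continuous_on UNIV k ==> (\<forall>z. 0 \<le> k z) ==> (\<forall>z. d i \<le> norm z \<longrightarrow> k z = 0) ==>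
   (LINT z|lborel. k z) = 1 ==> conv (f i) k \<in> L2 UNIV \<and> L2_dist UNIV (conv (f i) k) (f i) < 1 / Suc n"
   by blast
  define m where "m = Min (insert (\<delta> / Suc n) (d ` I))"
  have m0: "m > 0" unfolding m_def using I dd(1) d by (subst Min_gr_iff) auto
  have m2: "m \<le> d i" if "i \<in> I" for i
   unfolding m_def using I that by auto
  have m1': "m \<le> \<delta> / Suc n" unfolding m_def using I by auto
  obtain \<eta> :: "'a => real" where \<eta>: "\<eta> \<in> test_fun (ball 0 m)" "\<forall>z. 0 \<le> \<eta> z" "(LINT z|lborel. \<eta> z) = 1"
   using mollifier_exists[OF m0] by blast
  have z: "\<eta> z = 0" if "m \<le> norm z" for z by (rule test_funD(5)[OF \<eta>(1)]) (use that in auto)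
  have "\<eta> \<in> test_fun (ball 0 (\<delta> / Suc n))"
   by (rule test_fun_mono[OF \<eta>(1)]) (use m1' in auto)
  moreover have "conv (f i) \<eta> \<in> L2 UNIV \<and> L2_dist UNIV (conv (f i) \<eta>) (f i) < 1 / Suc n" if "i \<in> I" for i
   by (rule dd(2)[OF that test_funD(6)[OF \<eta>(1)] \<eta>(2) _ \<eta>(3)]) (use z m2[OF that] in auto)
  ultimately show ?thesis using \<eta> by blast
 qed
 then have "\<forall>n. \<exists>\<eta>. \<eta> \<in> test_fun (ball 0 (\<delta> / Suc n)) \<and> (\<forall>z. 0 \<le> \<eta> z) \<and> (LINT z|lborel. \<eta> z) = 1 \<and>
   (\<forall>i\<in>I. conv (f i) \<eta> \<in> L2 UNIV \<and> L2_dist UNIV (conv (f i) \<eta>) (f i) < 1 / Suc n)" by blast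
 from choice[OF this] obtain \<eta> where \<eta>: "\<And>n. \<eta> n \<in> test_fun (ball 0 (\<delta> / Suc n)) \<and> (\<forall>z. 0 \<le> \<eta> n z) \<and> (LINT z|lborel. \<eta> n z) = 1 \<and>
   (\<forall>i\<in>I. conv (f i) (\<eta> n) \<in> L2 UNIV \<and> L2_dist UNIV (conv (f i) (\<eta> n)) (f i) < 1 / Suc n)" by blast
 have "(%n. L2_dist UNIV (conv (f i) (\<eta> n)) (f i)) \<longlonglongrightarrow> 0" if i: "i \<in> I" for i
  by (rule L2_norm_tendsto_0[OF _ LIMSEQ_Suc[OF lim_1_over_n]]) (use \<eta> i in \<open>blast intro: less_imp_le\<close>)
 with \<eta> show ?thesis by blast
qed

text \<open>At a point of \<open>U\<close> the mollifications are eventually integrals against test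
  functions, hence 0, while a subsequence converges almost everywhere to g.\<close>

lemma fundamental_lemma:
 assumes U: "open U" and g: "g \<in> L2 U" and z: "\<And>\<phi>. \<phi> \<in> test_fun U ==> (LINT x:U|lborel. g x * \<phi> x) = 0"
 shows "ae_eq_on U g (%x. 0)"
proof -
 define G where "G y = indicator U y * g y" for y
 have Ub: "U \<in> sets borel" using U by simp
 have G: "G \<in> L2 UNIV" using g L2_indicator[OF Ub, of g] by (simp add: G_def[abs_def])
 have "\<exists>\<eta>. (\<forall>n::nat. \<eta> n \<in> test_fun (ball 0 (1 / Suc n)) \<and> (\<forall>z. 0 \<le> \<eta> n z) \<and> (LINT z|lborel. \<eta> n z) = 1) \<and>
   (\<forall>i\<in>{0::nat}. (\<forall>n. conv G (\<eta> n) \<in> L2 UNIV) \<and> (%n. L2_dist UNIV (conv G (\<eta> n)) G) \<longlonglongrightarrow> 0)"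
  by (rule mollifier_sequence) (use G in auto)
 then obtain \<eta> where \<eta>: "\<And>n::nat. \<eta> n \<in> test_fun (ball 0 (1 / Suc n))"
  "\<And>n. conv G (\<eta> n) \<in> L2 UNIV" "(%n. L2_dist UNIV (conv G (\<eta> n)) G) \<longlonglongrightarrow> 0"
  by blast
 have "\<exists>r::nat => nat. strict_mono r \<and> (AE x in lborel. x \<in> UNIV \<longrightarrow> (%n. conv G (\<eta> (r n)) x) \<longlonglongrightarrow> G x)"
  by (rule L2_AE_subseq[of "%n. conv G (\<eta> n)" UNIV G]) (rule \<eta>(2) G \<eta>(3))+
 then obtain r :: "nat => nat"
  where r': "strict_mono r \<and> (AE x in lborel. x \<in> UNIV \<longrightarrow> (%n. conv G (\<eta> (r n)) x) \<longlonglongrightarrow> G x)" ..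
 note r = conjunct1[OF r'] conjunct2[OF r']
 have ev: "\<forall>\<^sub>F n in sequentially. conv G (\<eta> (r n)) x = 0" if "x \<in> U" for x
 proof -
  obtain e where e: "e > 0" "ball x e \<subseteq> U" using openE[OF U \<open>x \<in> U\<close>] by blast
  obtain N :: nat where N: "1 / Suc N < e" using reals_Archimedean[OF e(1)] by (auto simp: inverse_eq_divide)
  have "conv G (\<eta> (r n)) x = 0" if "n \<ge> N" for n
  proof -
   have "N \<le> r n" using seq_suble[OF r(1), of n] that by linarith
   then have "1 / real (Suc (r n)) \<le> 1 / real (Suc N)" by (intro divide_left_mono) auto
   then have b: "ball x (1 / Suc (r n)) \<subseteq> U" using N e(2) by (meson less_imp_le order_trans subset_ball)
   have "(LINT y:U|lborel. g y * \<eta> (r n) (x - y)) = 0"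
    by (rule z) (rule test_fun_reflect(1)[OF \<eta>(1) b])
   then show ?thesis by (simp add: conv_def G_def set_lebesgue_integral_def mult.assoc)
  qed
  then show ?thesis by (auto simp: eventually_sequentially)
 qed
 from r(2) show ?thesis unfolding ae_eq_on_def
 proof eventually_elim
  case (elim x)
  note h = elim
  show ?case
  proof
   assume x: "x \<in> U"
   have "(%n. conv G (\<eta> (r n)) x) \<longlonglongrightarrow> 0" using ev[OF x] by (rule tendsto_eventually)
   with h have "G x = 0" using LIMSEQ_unique by blast
   then show "g x = 0" using x by (simp add: G_def)
  qed
 qed
qed

section \<open>Sobolev spaces\<close>

lemma has_weak_deriv_unique:
 assumes U: "open U" and g: "g \<in> L2 U" "g' \<in> L2 U"
  and w: "has_weak_deriv U u b g" "has_weak_deriv U u b g'"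
 shows "ae_eq_on U g g'"
proof -
 have Ub: "U \<in> sets borel" using U by simp
 have "ae_eq_on U (%x. g x - g' x) (%x. 0)"
 proof (rule fundamental_lemma[OF U L2_diff[OF g]])
  fix \<phi> assume \<phi>: "\<phi> \<in> test_fun U"
  have "ip U g \<phi> = ip U g' \<phi>" using w \<phi> by (simp add: has_weak_deriv_def ip_def)
  then have "ip U (%x. g x - g' x) \<phi> = 0"
   using ip_diff_left[OF g test_fun_L2[OF \<phi> Ub]] by simp
  then show "(LINT x:U|lborel. (g x - g' x) * \<phi> x) = 0" by (simp add: ip_def)
 qed
 then show ?thesis by (simp add: ae_eq_on_def)
qed

lemma has_weak_deriv_ip:
 "has_weak_deriv U u b g \<longleftrightarrow> (\<forall>\<phi>\<in>test_fun U. ip U u (pd b \<phi>) = - ip U g \<phi>)"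
 by (simp add: has_weak_deriv_def ip_def)

lemma weak_deriv_H1:
 assumes "u \<in> H1 U" "b \<in> Basis"
 shows "wd U u b \<in> L2 U" "has_weak_deriv U u b (wd U u b)"
proof -
 have "\<exists>g. g \<in> L2 U \<and> has_weak_deriv U u b g" using assms by (auto simp: H1_def)
 then have "wd U u b \<in> L2 U \<and> has_weak_deriv U u b (wd U u b)"
  unfolding weak_deriv_def by (rule someI_ex)
 then show "wd U u b \<in> L2 U" "has_weak_deriv U u b (wd U u b)" by auto
qed

lemma weak_deriv_eq:
 assumes U: "open U" and g: "g \<in> L2 U" "has_weak_deriv U u b g"
 shows "ae_eq_on U (wd U u b) g" "wd U u b \<in> L2 U"
proof -
 have "\<exists>g. g \<in> L2 U \<and> has_weak_deriv U u b g" using g by (intro exI[of _ g]) simp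
 then have *: "wd U u b \<in> L2 U \<and> has_weak_deriv U u b (wd U u b)"
  unfolding weak_deriv_def by (rule someI_ex)
 then show "wd U u b \<in> L2 U" by simp
 show "ae_eq_on U (wd U u b) g"
  using * g by (intro has_weak_deriv_unique[OF U, of _ _ u b]) auto
qed

lemma H1_L2: "u \<in> H1 U ==> u \<in> L2 U"
 by (simp add: H1_def)

lemma H1I: "u \<in> L2 U ==> (\<And>b. b \<in> Basis ==> g b \<in> L2 U) ==>
  (\<And>b. b \<in> Basis ==> has_weak_deriv U u b (g b)) ==> u \<in> H1 U"
 unfolding H1_def by blast

lemma has_weak_deriv_add:
 assumes U: "U \<in> sets borel" and b: "b \<in> Basis" and L: "u \<in> L2 U" "v \<in> L2 U" "f \<in> L2 U" "g \<in> L2 U"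
  and w: "has_weak_deriv U u b f" "has_weak_deriv U v b g"
 shows "has_weak_deriv U (%x. u x + v x) b (%x. f x + g x)"
 unfolding has_weak_deriv_ip
proof
 fix \<phi> assume \<phi>: "\<phi> \<in> test_fun U"
 have "\<phi> \<in> L2 U" "pd b \<phi> \<in> L2 U"
  using test_fun_L2[OF \<phi> U] test_fun_L2[OF test_fun_pd[OF \<phi> b] U] by auto
 then show "ip U (%x. u x + v x) (pd b \<phi>) = - ip U (%x. f x + g x) \<phi>"
  using w \<phi> by (simp add: has_weak_deriv_ip ip_add_left L)
qed

lemma has_weak_deriv_cmult:
 assumes "has_weak_deriv U u b f"
 shows "has_weak_deriv U (%x. c * u x) b (%x. c * f x)"
 using assms by (simp add: has_weak_deriv_ip ip_cmult_left)

lemma has_weak_deriv_diff: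
 assumes U: "U \<in> sets borel" and b: "b \<in> Basis" and L: "u \<in> L2 U" "v \<in> L2 U" "f \<in> L2 U" "g \<in> L2 U"
  and w: "has_weak_deriv U u b f" "has_weak_deriv U v b g"
 shows "has_weak_deriv U (%x. u x - v x) b (%x. f x - g x)"
 using has_weak_deriv_add[OF U b L(1) L2_cmult[OF L(2), of "-1"] L(3) L2_cmult[OF L(4), of "-1"] w(1)
   has_weak_deriv_cmult[OF w(2), of "-1"]] by simp

lemma weak_deriv_add:
 assumes U: "open U" and u: "u \<in> H1 U" and v: "v \<in> H1 U" and b: "b \<in> Basis"
 shows "ae_eq_on U (wd U (%x. u x + v x) b) (%x. wd U u b x + wd U v b x)"
  "wd U (%x. u x + v x) b \<in> L2 U"
 by (rule weak_deriv_eq[OF U L2_add[OF weak_deriv_H1(1)[OF u b] weak_deriv_H1(1)[OF v b]]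
    has_weak_deriv_add[OF _ b H1_L2[OF u] H1_L2[OF v] weak_deriv_H1(1)[OF u b] weak_deriv_H1(1)[OF v b]
     weak_deriv_H1(2)[OF u b] weak_deriv_H1(2)[OF v b]]]; use U in simp)+

lemma weak_deriv_cmult:
 assumes U: "open U" and u: "u \<in> H1 U" and b: "b \<in> Basis"
 shows "ae_eq_on U (wd U (%x. c * u x) b) (%x. c * wd U u b x)"
  "wd U (%x. c * u x) b \<in> L2 U"
 by (rule weak_deriv_eq[OF U L2_cmult[OF weak_deriv_H1(1)[OF u b]] has_weak_deriv_cmult[OF weak_deriv_H1(2)[OF u b]]])+

lemma H1_add:
 assumes U: "open U" and u: "u \<in> H1 U" and v: "v \<in> H1 U"
 shows "(%x. u x + v x) \<in> H1 U"
proof (rule H1I[OF L2_add[OF H1_L2[OF u] H1_L2[OF v]]])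
 fix b :: 'a assume b: "b \<in> Basis"
 note d = weak_deriv_H1[OF u b] weak_deriv_H1[OF v b]
 show "(%x. wd U u b x + wd U v b x) \<in> L2 U" by (rule L2_add[OF d(1,3)])
 show "has_weak_deriv U (%x. u x + v x) b (%x. wd U u b x + wd U v b x)"
  by (rule has_weak_deriv_add[OF _ b H1_L2[OF u] H1_L2[OF v] d(1,3) d(2,4)]) (use U in simp)
qed

lemma H1_cmult:
 assumes u: "u \<in> H1 U"
 shows "(%x. c * u x) \<in> H1 U"
proof (rule H1I[OF L2_cmult[OF H1_L2[OF u]]])
 fix b :: 'a assume b: "b \<in> Basis"
 show "(%x. c * wd U u b x) \<in> L2 U" by (rule L2_cmult[OF weak_deriv_H1(1)[OF u b]])
 show "has_weak_deriv U (%x. c * u x) b (%x. c * wd U u b x)"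
  by (rule has_weak_deriv_cmult[OF weak_deriv_H1(2)[OF u b]])
qed

lemma H1_diff: "open U ==> u \<in> H1 U ==> v \<in> H1 U ==> (%x. u x - v x) \<in> H1 U"
 using H1_add[OF _ _ H1_cmult[of v U "-1"]] by simp

lemma has_weak_deriv_subset:
 assumes w: "has_weak_deriv U u b g" and V: "V \<subseteq> U"
 shows "has_weak_deriv V u b g"
 unfolding has_weak_deriv_def
proof
 fix \<phi> assume \<phi>: "\<phi> \<in> test_fun V"
 obtain K where K: "compact K" "K \<subseteq> V" "\<And>x. x \<notin> K ==> \<phi> x = 0"
  using test_fun_support[OF \<phi>] by blast
 have o: "\<phi> x = 0" "pd b \<phi> x = 0" if "x \<notin> V" for x
 proof -
  have "x \<notin> K" using that K(2) by blast
  then show "\<phi> x = 0" "pd b \<phi> x = 0"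
   using K(3) pd_zero_outside[OF compact_imp_closed[OF K(1)] K(3)] by auto
 qed
 have eq: "(LINT x:V|lborel. f x * \<phi> x) = (LINT x:U|lborel. f x * \<phi> x)"
  "(LINT x:V|lborel. f x * pd b \<phi> x) = (LINT x:U|lborel. f x * pd b \<phi> x)" for f :: "'a => real"
  unfolding set_lebesgue_integral_def
  by (intro Bochner_Integration.integral_cong refl; use V o in \<open>force simp: indicator_def\<close>)+
 show "(LINT x:V|lborel. u x * pd b \<phi> x) = - (LINT x:V|lborel. g x * \<phi> x)"
  using w test_fun_mono[OF \<phi> V] by (simp add: eq has_weak_deriv_def)
qed

lemma has_weak_deriv_cong_AE:
 assumes U: "U \<in> sets borel" and b: "b \<in> Basis" and L: "u \<in> L2 U" "v \<in> L2 U" "ae_eq_on U u v"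
  and w: "has_weak_deriv U u b g"
 shows "has_weak_deriv U v b g"
 unfolding has_weak_deriv_ip
proof
 fix \<phi> assume \<phi>: "\<phi> \<in> test_fun U"
 have "ip U v (pd b \<phi>) = ip U u (pd b \<phi>)"
  by (rule ip_cong_AE[OF L(2,1) test_fun_L2[OF test_fun_pd[OF \<phi> b] U] ae_eq_on_sym[OF L(3)]])
 then show "ip U v (pd b \<phi>) = - ip U g \<phi>" using w \<phi> by (simp add: has_weak_deriv_ip)
qed

lemma has_weak_deriv_C_diff:
 assumes "C_diff 1 h" "b \<in> Basis"
 shows "has_weak_deriv U h b (pd b h)"
 unfolding has_weak_deriv_def using integration_by_parts[OF assms(1) _ assms(2)] by blast

lemma ip_tendsto:
 assumes s: "\<And>k. s k \<in> L2 U" and u: "u \<in> L2 U" and w: "w \<in> L2 U"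
  and lim: "(%k. L2_dist U (s k) u) \<longlonglongrightarrow> 0"
 shows "(%k. ip U (s k) w) \<longlonglongrightarrow> ip U u w"
proof (rule LIM_zero_cancel, rule Lim_null_comparison)
 show "\<forall>\<^sub>F k in sequentially. norm (ip U (s k) w - ip U u w) \<le> L2_dist U (s k) u * L2_norm U w"
  using ip_CS[OF L2_diff[OF s u] w] by (intro always_eventually allI) (simp add: ip_diff_left s u w)
 show "(%k. L2_dist U (s k) u * L2_norm U w) \<longlonglongrightarrow> 0"
  using tendsto_mult_right[OF lim, of "L2_norm U w"] by simp
qed

text \<open>Weak differentiation is closed: against a fixed test function both sides of its defining
  identity are continuous in L2.\<close>

lemma has_weak_deriv_limit:
 assumes U: "U \<in> sets borel" and b: "b \<in> Basis"
  and s: "\<And>k. s k \<in> L2 U" "u \<in> L2 U" "(%k. L2_dist U (s k) u) \<longlonglongrightarrow> 0"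
  and d: "\<And>k. d k \<in> L2 U" "g \<in> L2 U" "(%k. L2_dist U (d k) g) \<longlonglongrightarrow> 0"
  and w: "\<And>k. has_weak_deriv U (s k) b (d k)"
 shows "has_weak_deriv U u b g"
 unfolding has_weak_deriv_ip
proof
 fix \<phi> assume \<phi>: "\<phi> \<in> test_fun U"
 have L: "\<phi> \<in> L2 U" "pd b \<phi> \<in> L2 U"
  using test_fun_L2[OF \<phi> U] test_fun_L2[OF test_fun_pd[OF \<phi> b] U] by auto
 have "ip U (s k) (pd b \<phi>) = - ip U (d k) \<phi>" for k
  using w \<phi> by (simp add: has_weak_deriv_ip)
 then have "(%k. - ip U (d k) \<phi>) \<longlonglongrightarrow> ip U u (pd b \<phi>)"
  using ip_tendsto[OF s(1,2) L(2) s(3)] by simp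
 moreover have "(%k. - ip U (d k) \<phi>) \<longlonglongrightarrow> - ip U g \<phi>"
  by (rule tendsto_minus[OF ip_tendsto[OF d(1,2) L(1) d(3)]])
 ultimately show "ip U u (pd b \<phi>) = - ip U g \<phi>" by (rule LIMSEQ_unique)
qed

section \<open>The gradient norm and weighted gradient forms\<close>

definition gnorm :: "'a::euclidean_space set => ('a => real) => real" where
 "gnorm U v = L2_set (%b. L2_norm U (wd U v b)) Basis"

text \<open>Weights 1 give the gradient inner product and \<open>tsign\<close> gives the weak wave
  operator; with general weights bilinearity and Cauchy-Schwarz are proved once.\<close>

definition wform :: "('a::euclidean_space => real) => 'a set => ('a => real) => ('a => real) => real" where
 "wform \<sigma> U u v = (\<Sum>b\<in>Basis. \<sigma> b * ip U (wd U u b) (wd U v b))"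

abbreviation "gdist U u v \<equiv> gnorm U (%x. u x - v x)"

lemma gnorm_nonneg: "0 \<le> gnorm U v"
 by (simp add: gnorm_def L2_set_nonneg)

lemma gnorm_sq: "(gnorm U v)\<^sup>2 = wform (%_. 1) U v v"
 by (simp add: gnorm_def L2_set_def wform_def sum_nonneg L2_norm_sq ip_self_nonneg)

lemma gnorm_le_sum: "gnorm U v \<le> (\<Sum>b\<in>Basis. L2_norm U (wd U v b))"
 unfolding gnorm_def by (rule L2_set_le_sum) (simp add: L2_norm_nonneg)

lemma L2_norm_weak_deriv_le: "b \<in> Basis ==> L2_norm U (wd U v b) \<le> gnorm U v"
 unfolding gnorm_def by (rule member_le_L2_set) (auto simp: L2_norm_nonneg)

lemma H1_norm_eq: "H1_norm U u = sqrt ((L2_norm U u)\<^sup>2 + (gnorm U u)\<^sup>2)"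
 by (simp add: H1_norm_def gnorm_def L2_set_def sum_nonneg)

lemma H1_norm_bounds:
 "L2_norm U u \<le> H1_norm U u" "gnorm U u \<le> H1_norm U u" "H1_norm U u \<le> L2_norm U u + gnorm U u"
 unfolding H1_norm_eq using L2_norm_nonneg[of U u] gnorm_nonneg[of U u]
 by (auto intro: real_le_rsqrt sqrt_sum_squares_le_sum)

lemma gnorm_eq:
 assumes "open U" "\<And>b. b \<in> Basis ==> g b \<in> L2 U" "\<And>b. b \<in> Basis ==> has_weak_deriv U u b (g b)"
 shows "gnorm U u = L2_set (%b. L2_norm U (g b)) Basis"
 unfolding gnorm_def by (rule L2_set_cong) (auto intro!: L2_norm_cong_AE weak_deriv_eq assms)

lemma gnorm_diff_le_sum:
 assumes U: "open U" and u: "u \<in> L2 U" "\<And>b. b \<in> Basis ==> f b \<in> L2 U" "\<And>b. b \<in> Basis ==> has_weak_deriv U u b (f b)"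
  and v: "v \<in> L2 U" "\<And>b. b \<in> Basis ==> g b \<in> L2 U" "\<And>b. b \<in> Basis ==> has_weak_deriv U v b (g b)"
 shows "gdist U u v \<le> (\<Sum>b\<in>Basis. L2_dist U (f b) (g b))"
proof -
 have "gdist U u v = L2_set (%b. L2_dist U (f b) (g b)) Basis"
  by (rule gnorm_eq[OF U L2_diff[OF u(2) v(2)] has_weak_deriv_diff[OF _ _ u(1) v(1) u(2) v(2) u(3) v(3)]]) (use U in auto)
 also have "\<dots> \<le> (\<Sum>b\<in>Basis. L2_dist U (f b) (g b))" by (rule L2_set_le_sum) (simp add: L2_norm_nonneg)
 finally show ?thesis .
qed

lemma gnorm_triangle:
 assumes U: "open U" and u: "u \<in> H1 U" and v: "v \<in> H1 U"
 shows "gnorm U (%x. u x + v x) \<le> gnorm U u + gnorm U v"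
proof -
 have "gnorm U (%x. u x + v x) = L2_set (%b. L2_norm U (%x. wd U u b x + wd U v b x)) Basis"
  unfolding gnorm_def
  by (rule L2_set_cong) (auto intro!: L2_norm_cong_AE weak_deriv_add[OF U u v] L2_add weak_deriv_H1[OF u] weak_deriv_H1[OF v])
 also have "\<dots> \<le> L2_set (%b. L2_norm U (wd U u b) + L2_norm U (wd U v b)) Basis"
  by (rule L2_set_mono) (auto intro!: L2_norm_triangle L2_norm_nonneg weak_deriv_H1[OF u] weak_deriv_H1[OF v])
 also have "\<dots> \<le> gnorm U u + gnorm U v" unfolding gnorm_def by (rule L2_set_triangle_ineq)
 finally show ?thesis .
qed

lemma gnorm_cmult:
 assumes U: "open U" and u: "u \<in> H1 U"
 shows "gnorm U (%x. c * u x) = \<bar>c\<bar> * gnorm U u"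
proof -
 have "gnorm U (%x. c * u x) = L2_set (%b. \<bar>c\<bar> * L2_norm U (wd U u b)) Basis"
  unfolding gnorm_def L2_norm_cmult[symmetric]
  by (rule L2_set_cong) (auto intro!: L2_norm_cong_AE weak_deriv_cmult[OF U u] L2_cmult weak_deriv_H1[OF u])
 then show ?thesis by (simp add: gnorm_def L2_set_right_distrib)
qed

lemma gnorm_triangle3:
 assumes U: "open U" and u: "u \<in> H1 U" and v: "v \<in> H1 U" and w: "w \<in> H1 U"
 shows "gdist U u w \<le> gdist U u v + gdist U v w"
 using gnorm_triangle[OF U H1_diff[OF U u v] H1_diff[OF U v w]] by simp

lemma wform_add_left:
 assumes U: "open U" and u: "u \<in> H1 U" and v: "v \<in> H1 U" and w: "w \<in> H1 U"
 shows "wform \<sigma> U (%x. u x + v x) w = wform \<sigma> U u w + wform \<sigma> U v w"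
proof -
 have "ip U (wd U (%x. u x + v x) b) (wd U w b) =
   ip U (wd U u b) (wd U w b) + ip U (wd U v b) (wd U w b)" if b: "b \<in> Basis" for b
  using ip_cong_AE[OF weak_deriv_add(2)[OF U u v b] L2_add[OF weak_deriv_H1(1)[OF u b] weak_deriv_H1(1)[OF v b]]
    weak_deriv_H1(1)[OF w b] weak_deriv_add(1)[OF U u v b]]
   ip_add_left[OF weak_deriv_H1(1)[OF u b] weak_deriv_H1(1)[OF v b] weak_deriv_H1(1)[OF w b]] by simp
 then show ?thesis by (simp add: wform_def distrib_left sum.distrib)
qed

lemma wform_cmult_left:
 assumes U: "open U" and u: "u \<in> H1 U" and w: "w \<in> H1 U"
 shows "wform \<sigma> U (%x. c * u x) w = c * wform \<sigma> U u w"
proof -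
 have "ip U (wd U (%x. c * u x) b) (wd U w b) =
   c * ip U (wd U u b) (wd U w b)" if b: "b \<in> Basis" for b
  using ip_cong_AE[OF weak_deriv_cmult(2)[OF U u b] L2_cmult[OF weak_deriv_H1(1)[OF u b]]
    weak_deriv_H1(1)[OF w b] weak_deriv_cmult(1)[OF U u b]] by (simp add: ip_cmult_left)
 then show ?thesis by (simp add: wform_def sum_distrib_left mult_ac)
qed

lemma wform_commute: "wform \<sigma> U u w = wform \<sigma> U w u"
 by (simp add: wform_def ip_commute[of U "wd U u b" for b])

lemma wform_diff_left:
 assumes U: "open U" and u: "u \<in> H1 U" and v: "v \<in> H1 U" and w: "w \<in> H1 U"
 shows "wform \<sigma> U (%x. u x - v x) w = wform \<sigma> U u w - wform \<sigma> U v w"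
 using wform_add_left[OF U u H1_cmult[OF v, of "-1"] w] wform_cmult_left[OF U v w, of \<sigma> "-1"] by simp

lemma wform_CS:
 assumes u: "u \<in> H1 U" and v: "v \<in> H1 U" and \<sigma>: "\<And>b. b \<in> Basis ==> \<bar>\<sigma> b\<bar> \<le> 1"
 shows "\<bar>wform \<sigma> U u v\<bar> \<le> gnorm U u * gnorm U v"
proof -
 have "\<bar>wform \<sigma> U u v\<bar> \<le> (\<Sum>b\<in>Basis. \<bar>L2_norm U (wd U u b)\<bar> * \<bar>L2_norm U (wd U v b)\<bar>)"
  unfolding wform_def
 proof (rule order_trans[OF sum_abs], rule sum_mono)
  fix b :: 'a assume b: "b \<in> Basis"
  have "\<bar>\<sigma> b\<bar> * \<bar>ip U (wd U u b) (wd U v b)\<bar> \<le>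
    1 * (L2_norm U (wd U u b) * L2_norm U (wd U v b))"
   using \<sigma>[OF b] ip_CS[OF weak_deriv_H1(1)[OF u b] weak_deriv_H1(1)[OF v b]]
   by (intro mult_mono) auto
  then show "\<bar>\<sigma> b * ip U (wd U u b) (wd U v b)\<bar> \<le>
    \<bar>L2_norm U (wd U u b)\<bar> * \<bar>L2_norm U (wd U v b)\<bar>"
   by (simp add: abs_mult L2_norm_nonneg)
 qed
 also have "\<dots> \<le> gnorm U u * gnorm U v" unfolding gnorm_def by (rule L2_set_mult_ineq)
 finally show ?thesis .
qed

section \<open>Approximation by test functions\<close>

lemma test_fun_H1:
 assumes U: "open U" and \<phi>: "\<phi> \<in> test_fun V"
 shows "\<phi> \<in> H1 U"
proof (rule H1I)
 have Ub: "U \<in> sets borel" using U by simp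
 show "\<phi> \<in> L2 U" by (rule test_fun_L2[OF \<phi> Ub])
 show "pd b \<phi> \<in> L2 U" if "b \<in> Basis" for b
  by (rule test_fun_L2[OF test_fun_pd[OF \<phi> that] Ub])
 show "has_weak_deriv U \<phi> b (pd b \<phi>)" if "b \<in> Basis" for b
  by (rule has_weak_deriv_C_diff[OF test_funD(1)[OF \<phi>] that])
qed

lemma H10_iff:
 assumes U: "open U"
 shows "u \<in> H10 U \<longleftrightarrow> u \<in> H1 U \<and>
  (\<forall>e>0. \<exists>\<phi>\<in>test_fun U. L2_dist U \<phi> u < e \<and> gdist U \<phi> u < e)"
  (is "_ \<longleftrightarrow> _ \<and> ?R")
proof
 assume "u \<in> H10 U"
 then obtain \<phi> where u: "u \<in> H1 U" and \<phi>: "\<forall>k. \<phi> k \<in> test_fun U"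
  and lim: "(%k. H1_norm U (%x. \<phi> k x - u x)) \<longlonglongrightarrow> 0" by (auto simp: H10_def)
 have ?R
 proof (intro allI impI)
  fix e :: real assume "e > 0"
  then obtain k where "norm (H1_norm U (%x. \<phi> k x - u x) - 0) < e"
   using LIMSEQ_D[OF lim] by blast
  then have "H1_norm U (%x. \<phi> k x - u x) < e" by simp
  then have "L2_dist U (\<phi> k) u < e \<and> gdist U (\<phi> k) u < e"
   using H1_norm_bounds[of U "%x. \<phi> k x - u x"] by linarith
  with \<phi> show "\<exists>\<phi>\<in>test_fun U. L2_dist U \<phi> u < e \<and> gdist U \<phi> u < e"
   by (intro bexI[of _ "\<phi> k"]) auto
 qed
 with u show "u \<in> H1 U \<and> ?R" by simp
next
 assume R: "u \<in> H1 U \<and> ?R"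
 have "\<forall>k::nat. \<exists>\<phi>. \<phi> \<in> test_fun U \<and> L2_dist U \<phi> u < 1 / Suc k \<and> gdist U \<phi> u < 1 / Suc k"
 proof
  fix k :: nat
  have "1 / real (Suc k) > 0" by simp
  with R have "\<exists>\<phi>\<in>test_fun U. L2_dist U \<phi> u < 1 / Suc k \<and> gdist U \<phi> u < 1 / Suc k" by blast
  then show "\<exists>\<phi>. \<phi> \<in> test_fun U \<and> L2_dist U \<phi> u < 1 / Suc k \<and> gdist U \<phi> u < 1 / Suc k" by blast
 qed
 from choice[OF this] obtain \<phi> where \<phi>: "\<forall>k::nat. \<phi> k \<in> test_fun U \<and> L2_dist U (\<phi> k) u < 1 / Suc k \<and> gdist U (\<phi> k) u < 1 / Suc k" ..
 have "(%k. H1_norm U (%x. \<phi> k x - u x)) \<longlonglongrightarrow> 0"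
 proof (rule tendsto_sandwich[OF _ _ tendsto_const])
  show "\<forall>\<^sub>F k in sequentially. 0 \<le> H1_norm U (%x. \<phi> k x - u x)"
   using H1_norm_bounds(1) L2_norm_nonneg by (meson always_eventually order_trans)
  show "\<forall>\<^sub>F k in sequentially. H1_norm U (%x. \<phi> k x - u x) \<le> 2 * (1 / Suc k)"
  proof (intro always_eventually allI)
   fix k
   have "L2_dist U (\<phi> k) u < 1 / Suc k" "gdist U (\<phi> k) u < 1 / Suc k" using \<phi> by auto
   then show "H1_norm U (%x. \<phi> k x - u x) \<le> 2 * (1 / Suc k)"
    using H1_norm_bounds(3)[of U "%x. \<phi> k x - u x"] by linarith
  qed
  show "(%k. 2 * (1 / real (Suc k))) \<longlonglongrightarrow> 0"
   using tendsto_mult_right_zero[OF LIMSEQ_Suc[OF lim_1_over_n]] by blast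
 qed
 with R \<phi> show "u \<in> H10 U" by (auto simp: H10_def)
qed

lemma H10_H1: "u \<in> H10 U ==> u \<in> H1 U"
 by (simp add: H10_def)

lemma H10_approx:
 assumes "open U" "u \<in> H10 U" "e > 0"
 shows "\<exists>\<phi>. \<phi> \<in> test_fun U \<and> L2_dist U \<phi> u < e \<and> gdist U \<phi> u < e"
proof -
 have "\<forall>e>0. \<exists>\<phi>\<in>test_fun U. L2_dist U \<phi> u < e \<and> gdist U \<phi> u < e"
  using assms(2) by (simp add: H10_iff[OF assms(1)])
 with assms(3) show ?thesis by blast
qed

lemma test_fun_H10:
 assumes U: "open U" and \<phi>: "\<phi> \<in> test_fun U"
 shows "\<phi> \<in> H10 U"
 unfolding H10_iff[OF U]
proof (intro conjI allI impI test_fun_H1[OF U \<phi>])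
 fix e :: real assume e: "e > 0"
 have "gnorm U (%x. 0) = 0"
  using gnorm_cmult[OF U test_fun_H1[OF U \<phi>], of 0] by simp
 then show "\<exists>\<phi>'\<in>test_fun U. L2_dist U \<phi>' \<phi> < e \<and> gdist U \<phi>' \<phi> < e"
  using e \<phi> by (intro bexI[of _ \<phi>]) (auto simp: L2_norm_zero)
qed

lemma H10_limit:
 assumes U: "open U" and u: "u \<in> H1 U"
  and lim: "\<And>e. e > 0 ==> \<exists>w\<in>H10 U. L2_dist U w u < e \<and> gdist U w u < e"
 shows "u \<in> H10 U"
 unfolding H10_iff[OF U]
proof (intro conjI allI impI u)
 fix e :: real assume "e > 0"
 then have e: "e / 2 > 0" by simp
 from lim[OF e] obtain w where w: "w \<in> H10 U" "L2_dist U w u < e / 2" "gdist U w u < e / 2" by (elim bexE conjE)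
 from H10_approx[OF U w(1) e] obtain \<phi> where \<phi>: "\<phi> \<in> test_fun U" "L2_dist U \<phi> w < e / 2" "gdist U \<phi> w < e / 2"
  by (elim exE conjE)
 have H: "\<phi> \<in> H1 U" "w \<in> H1 U" using test_fun_H1[OF U \<phi>(1)] H10_H1[OF w(1)] by auto
 have "L2_dist U \<phi> u < e" "gdist U \<phi> u < e"
  using L2_norm_triangle3[OF H1_L2[OF H(1)] H1_L2[OF H(2)] H1_L2[OF u]] gnorm_triangle3[OF U H u] w \<phi> by linarith+
 with \<phi>(1) show "\<exists>\<phi>\<in>test_fun U. L2_dist U \<phi> u < e \<and> gdist U \<phi> u < e" by blast
qed

lemma H10_add:
 assumes U: "open U" and u: "u \<in> H10 U" and v: "v \<in> H10 U"
 shows "(%x. u x + v x) \<in> H10 U"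
 unfolding H10_iff[OF U]
proof (intro conjI allI impI H1_add[OF U H10_H1[OF u] H10_H1[OF v]])
 fix e :: real assume "e > 0"
 then have e: "e / 2 > 0" by simp
 from H10_approx[OF U u e] obtain \<phi> where \<phi>: "\<phi> \<in> test_fun U" "L2_dist U \<phi> u < e / 2" "gdist U \<phi> u < e / 2"
  by (elim exE conjE)
 from H10_approx[OF U v e] obtain \<psi> where \<psi>: "\<psi> \<in> test_fun U" "L2_dist U \<psi> v < e / 2" "gdist U \<psi> v < e / 2"
  by (elim exE conjE)
 have H: "(%x. \<phi> x - u x) \<in> H1 U" "(%x. \<psi> x - v x) \<in> H1 U"
  using test_fun_H1[OF U \<phi>(1)] test_fun_H1[OF U \<psi>(1)] H10_H1[OF u] H10_H1[OF v] by (auto intro: H1_diff[OF U])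
 have "(%x. \<phi> x + \<psi> x - (u x + v x)) = (%x. (\<phi> x - u x) + (\<psi> x - v x))" by auto
 then have "L2_norm U (%x. \<phi> x + \<psi> x - (u x + v x)) < e" "gnorm U (%x. \<phi> x + \<psi> x - (u x + v x)) < e"
  using L2_norm_triangle[OF H1_L2[OF H(1)] H1_L2[OF H(2)]] gnorm_triangle[OF U H] \<phi> \<psi> by auto
 with test_fun_add[OF \<phi>(1) \<psi>(1)]
 show "\<exists>\<phi>\<in>test_fun U. L2_norm U (%x. \<phi> x - (u x + v x)) < e \<and> gnorm U (%x. \<phi> x - (u x + v x)) < e"
  by (intro bexI[of _ "%x. \<phi> x + \<psi> x"] conjI)
qed

lemma H10_cmult:
 assumes U: "open U" and u: "u \<in> H10 U"
 shows "(%x. c * u x) \<in> H10 U"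
 unfolding H10_iff[OF U]
proof (intro conjI allI impI H1_cmult[OF H10_H1[OF u]])
 fix e :: real assume "e > 0"
 then have e: "e / (\<bar>c\<bar> + 1) > 0" by simp
 from H10_approx[OF U u e] obtain \<phi> where \<phi>: "\<phi> \<in> test_fun U" "L2_dist U \<phi> u < e / (\<bar>c\<bar> + 1)" "gdist U \<phi> u < e / (\<bar>c\<bar> + 1)"
  by (elim exE conjE)
 have H: "(%x. \<phi> x - u x) \<in> H1 U"
  by (rule H1_diff[OF U test_fun_H1[OF U \<phi>(1)] H10_H1[OF u]])
 have *: "\<bar>c\<bar> * a < e" if "a < e / (\<bar>c\<bar> + 1)" "0 \<le> a" for a
 proof -
  have "\<bar>c\<bar> * a \<le> (\<bar>c\<bar> + 1) * a" using that by (intro mult_right_mono) auto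
  also have "\<dots> < e" using that(1) by (simp add: field_simps)
  finally show ?thesis .
 qed
 have "L2_norm U (%x. c * \<phi> x - c * u x) < e" "gnorm U (%x. c * \<phi> x - c * u x) < e"
  using *[OF \<phi>(2) L2_norm_nonneg] *[OF \<phi>(3) gnorm_nonneg] L2_norm_cmult[of U c "%x. \<phi> x - u x"]
   gnorm_cmult[OF U H, of c] by (simp_all add: right_diff_distrib)
 with test_fun_cmult[OF \<phi>(1), of c]
 show "\<exists>\<phi>\<in>test_fun U. L2_norm U (%x. \<phi> x - c * u x) < e \<and> gnorm U (%x. \<phi> x - c * u x) < e"
  by (intro bexI[of _ "%x. c * \<phi> x"] conjI)
qed

lemma H10_diff:
 assumes U: "open U" and u: "u \<in> H10 U" and v: "v \<in> H10 U"
 shows "(%x. u x - v x) \<in> H10 U"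
 using H10_add[OF U u H10_cmult[OF U v, of "-1"]] by simp

section \<open>Cutoffs, the chain rule and zero boundary values\<close>

lemma has_weak_deriv_cong:
 assumes "\<And>x. x \<in> U ==> u x = v x" "\<And>x. x \<in> U ==> g x = h x"
 shows "has_weak_deriv U u b g \<longleftrightarrow> has_weak_deriv U v b h"
proof -
 have "indicator U x *\<^sub>R (u x * a) = indicator U x *\<^sub>R (v x * a)"
  "indicator U x *\<^sub>R (g x * a) = indicator U x *\<^sub>R (h x * a)" for x a
  using assms by (auto simp: indicator_def)
 then show ?thesis unfolding has_weak_deriv_def set_lebesgue_integral_def by presburger
qed

text \<open>Mollifying the indicator of a neighbourhood of K. The value 1 on a whole neighbourhood
  of K matters: multiplication by \<kappa> then leaves derivatives at points of K unchanged.\<close>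

lemma smooth_cutoff:
 fixes K :: "'a::euclidean_space set"
 assumes K: "compact K" and U: "open U" "K \<subseteq> U"
 shows "\<exists>\<kappa> \<delta>. \<kappa> \<in> test_fun U \<and> (\<forall>x. 0 \<le> \<kappa> x \<and> \<kappa> x \<le> 1) \<and> \<delta> > 0 \<and>
  (\<forall>x\<in>K. \<forall>z. norm z < \<delta> \<longrightarrow> \<kappa> (x + z) = 1)"
proof -
 obtain e where e: "e > 0" "(\<Union>x\<in>K. ball x e) \<subseteq> U"
  using compact_subset_open_imp_ball_epsilon_subset[OF K U] by blast
 \<comment> \<open>The indicator has radius 2 d and the kernel d, so the result is 1 up to distance
   d, vanishes beyond 3 d, and 3 d < e stays in \<open>U\<close>.\<close>
 define d where "d = e / 4"
 have d: "d > 0" using e by (simp add: d_def)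
 define A where "A = (%(x, z). x + z) ` (K \<times> cball 0 (2 * d))"
 define B where "B = (%(x, z). x + z) ` (K \<times> cball 0 (3 * d))"
 have comp: "compact ((%(x, z). x + z) ` (K \<times> cball (0::'a) r))" for r
  by (intro compact_continuous_image compact_Times K compact_cball)
    (auto intro!: continuous_intros simp: case_prod_beta)
 have A: "compact A" "A \<in> sets borel" and B: "compact B"
  unfolding A_def B_def using comp by (auto intro: borel_compact)
 have BU: "B \<subseteq> U"
 proof
  fix y assume "y \<in> B"
  then obtain x z where "x \<in> K" "norm z \<le> 3 * d" "y = x + z" by (auto simp: B_def)
  then have "y \<in> ball x e" using d by (simp add: dist_norm d_def)
  then show "y \<in> U" using e(2) \<open>x \<in> K\<close> by blast
 qed
 obtain \<eta> :: "'a => real" where \<eta>: "\<eta> \<in> test_fun (ball 0 d)" "\<forall>x. 0 \<le> \<eta> x" "(LINT x|lborel. \<eta> x) = 1"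
  using mollifier_exists[OF d] by blast
 have \<eta>0: "\<eta> z = 0" if "d \<le> norm z" for z by (rule test_funD(5)[OF \<eta>(1)]) (use that in auto)
 have AL: "(indicator A :: 'a => real) \<in> L2 UNIV"
  by (rule L2_indicator_finite) (use A emeasure_compact_finite in auto)
 have \<eta>U: "\<eta> \<in> test_fun UNIV" by (rule test_fun_mono[OF \<eta>(1)]) simp
 have \<eta>L: "\<eta> \<in> L2 UNIV" by (rule test_fun_L2[OF \<eta>U]) simp
 have \<eta>i: "integrable lborel (%y. \<eta> (x - y))" and \<eta>1: "(LINT y|lborel. \<eta> (x - y)) = 1" for x
 proof -
  have m: "\<eta> \<in> borel_measurable borel" by (rule L2_borel[OF \<eta>L])
  show "(LINT y|lborel. \<eta> (x - y)) = 1" using lborel_integral_reflect[OF m, of x] \<eta>(3) by simp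
  then show "integrable lborel (%y. \<eta> (x - y))"
   by (metis not_integrable_integral_eq zero_neq_one)
 qed
 have ci: "integrable lborel (%y. indicator A y * \<eta> (x - y))" for x
  by (rule conv_integrable[OF AL \<eta>L])
 define \<kappa> where "\<kappa> = conv (indicator A) \<eta>"
 have "\<kappa> \<in> test_fun U"
 proof (rule test_funI[OF _ B BU])
  show "C_diff k \<kappa>" for k unfolding \<kappa>_def by (rule C_diff_conv[OF AL \<eta>U])
  show "\<kappa> x = 0" if x: "x \<notin> B" for x
   unfolding \<kappa>_def
  proof (rule conv_zero)
   fix y assume "indicator A y \<noteq> (0::real)"
   then have "y \<in> A" by (simp add: indicator_def split: if_splits)
   then obtain k z where k: "k \<in> K" "norm z \<le> 2 * d" "y = k + z" by (auto simp: A_def)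
   show "\<eta> (x - y) = 0"
   proof (rule \<eta>0, rule ccontr)
    assume "\<not> d \<le> norm (x - y)"
    then have "norm (x - k) \<le> 3 * d"
     using norm_triangle_ineq[of "x - y" z] k by (simp add: algebra_simps)
    then have "x \<in> B" unfolding B_def using k(1) by (intro image_eqI[of _ _ "(k, x - k)"]) auto
    with x show False by simp
   qed
  qed
 qed
 moreover have "0 \<le> \<kappa> x" for x unfolding \<kappa>_def conv_def using \<eta>(2) by (intro integral_nonneg_AE) auto
 moreover have "\<kappa> x \<le> 1" for x
 proof -
  have "\<kappa> x \<le> (LINT y|lborel. \<eta> (x - y))" unfolding \<kappa>_def conv_def
   by (rule integral_mono[OF ci \<eta>i]) (use \<eta>(2) in \<open>auto simp: indicator_def\<close>)
  then show ?thesis by (simp add: \<eta>1)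
 qed
 moreover have "\<kappa> (x + z) = 1" if x: "x \<in> K" and z: "norm z < d" for x z
 proof -
  have eq: "indicator A y * \<eta> (x + z - y) = \<eta> (x + z - y)" for y
  proof (cases "d \<le> norm (x + z - y)")
   case True then show ?thesis by (simp add: \<eta>0)
  next
   case False
   have "norm (y - x) \<le> 2 * d"
    using False z norm_triangle_ineq4[of z "x + z - y"] by (simp add: algebra_simps)
   then have "y \<in> A" unfolding A_def using x by (intro image_eqI[of _ _ "(x, y - x)"]) auto
   then show ?thesis by simp
  qed
  show ?thesis by (simp only: \<kappa>_def conv_def eq \<eta>1)
 qed
 ultimately show ?thesis using d by (intro exI[of _ \<kappa>] exI[of _ d]) auto
qed

text \<open>The factor \<theta> is moved onto the test function, where the classical product rule
  applies.\<close>

lemma has_weak_deriv_mult_smooth: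
 assumes U: "U \<in> sets borel" and b: "b \<in> Basis" and L: "u \<in> L2 U" "g \<in> L2 U"
  and w: "has_weak_deriv U u b g" and \<theta>: "\<And>k. C_diff k \<theta>"
 shows "has_weak_deriv U (%x. \<theta> x * u x) b (%x. \<theta> x * g x + pd b \<theta> x * u x)"
 unfolding has_weak_deriv_def
proof
 fix \<phi> assume \<phi>: "\<phi> \<in> test_fun U"
 have d: "\<theta> differentiable (at x)" "\<phi> differentiable (at x)" for x
  using \<theta>[of 1] test_funD(7)[OF \<phi>] by auto
 have cd: "C_diff k (pd b \<theta>)" for k using \<theta>[of "Suc k"] b by simp
 note t1 = test_fun_mult[OF \<phi> \<theta>]
 note t2 = test_fun_mult[OF test_fun_pd[OF \<phi> b] \<theta>]
 note t3 = test_fun_mult[OF \<phi> cd]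
 have "ip U u (pd b (%x. \<theta> x * \<phi> x)) = - ip U g (%x. \<theta> x * \<phi> x)"
  using w t1 by (simp add: has_weak_deriv_ip)
 also have "pd b (%x. \<theta> x * \<phi> x) = (%x. pd b \<theta> x * \<phi> x + \<theta> x * pd b \<phi> x)"
  using d by (simp add: fun_eq_iff pd_mult)
 also have "ip U u (%x. pd b \<theta> x * \<phi> x + \<theta> x * pd b \<phi> x) =
   ip U u (%x. pd b \<theta> x * \<phi> x) + ip U u (%x. \<theta> x * pd b \<phi> x)"
  by (rule ip_add_right[OF test_fun_L2[OF t3 U] test_fun_L2[OF t2 U] L(1)])
 finally have 1: "ip U u (%x. \<theta> x * pd b \<phi> x) =
   - (ip U g (%x. \<theta> x * \<phi> x) + ip U u (%x. pd b \<theta> x * \<phi> x))" by simp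
 have "(LINT x:U|lborel. \<theta> x * u x * pd b \<phi> x) = ip U u (%x. \<theta> x * pd b \<phi> x)"
  by (simp add: ip_def mult_ac)
 also note 1
 also have "ip U g (%x. \<theta> x * \<phi> x) + ip U u (%x. pd b \<theta> x * \<phi> x) =
   (LINT x:U|lborel. g x * (\<theta> x * \<phi> x) + u x * (pd b \<theta> x * \<phi> x))"
  unfolding ip_def
  by (rule set_integral_add(2)[symmetric, OF L2_mult_integrable[OF L(2) test_fun_L2[OF t1 U]]
     L2_mult_integrable[OF L(1) test_fun_L2[OF t3 U]]])
 finally show "(LINT x:U|lborel. \<theta> x * u x * pd b \<phi> x) =
   - (LINT x:U|lborel. (\<theta> x * g x + pd b \<theta> x * u x) * \<phi> x)"
  by (simp add: algebra_simps)
qed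

text \<open>The zero extension of \<open>u\<close> is weakly differentiable on the whole space, and
  its mollifications with small kernels keep compact support in \<open>U\<close>.\<close>

lemma H10_compact_support:
 fixes u :: "'a::euclidean_space => real"
 assumes U: "open U" and uH: "u \<in> H1 U" and K: "compact K" "K \<subseteq> U" "\<And>x. x \<in> U ==> x \<notin> K ==> u x = 0"
 shows "u \<in> H10 U"
proof (rule H10_limit[OF U uH])
 have Ub: "U \<in> sets borel" using U by simp
 note uL = H1_L2[OF uH]
 from smooth_cutoff[OF K(1) U K(2)] obtain \<kappa> d where \<kappa>: "\<kappa> \<in> test_fun U" "\<forall>x. 0 \<le> \<kappa> x \<and> \<kappa> x \<le> 1" "d > 0"
  "\<forall>x\<in>K. \<forall>z. norm z < d \<longrightarrow> \<kappa> (x + z) = 1" by (elim exE conjE)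
 obtain e where e: "e > 0" "(\<Union>x\<in>K. ball x e) \<subseteq> U"
  using compact_subset_open_imp_ball_epsilon_subset[OF K(1) U K(2)] by blast
 \<comment> \<open>For a test function \<phi> on the whole space, \<phi> times \<kappa> is one on
   \<open>U\<close>, and as \<kappa> is 1 near K the factor is invisible to \<open>u\<close>. The
   price is the factor \<kappa> in the derivative, which makes its zero extension the derivative of
   that of \<open>u\<close>.\<close>
 define g where "g b x = \<kappa> x * wd U u b x" for b x
 have gL: "g b \<in> L2 U" if "b \<in> Basis" for b unfolding g_def
  by (rule L2_mult_bounded(1)[OF weak_deriv_H1(1)[OF uH that], of _ 1])
    (use \<kappa>(2) borel_measurable_continuous_onI[OF test_funD(6)[OF \<kappa>(1)]] in \<open>auto simp: abs_le_iff intro: order_trans[of _ 0]\<close>)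
 define ut where "ut x = indicator U x * u x" for x
 define gt where "gt b x = indicator U x * g b x" for b x
 have utL: "ut \<in> L2 UNIV" unfolding ut_def using L2_indicator[OF Ub] uL by blast
 have gtL: "gt b \<in> L2 UNIV" if "b \<in> Basis" for b
  unfolding gt_def using L2_indicator[OF Ub] gL[OF that] by blast
 have ut0: "ut x = 0" if "x \<notin> K" for x using K(3)[of x] that by (cases "x \<in> U") (auto simp: ut_def)
 have wt: "has_weak_deriv UNIV ut b (gt b)" if b: "b \<in> Basis" for b
  unfolding has_weak_deriv_def
 proof
  fix \<phi> :: "'a => real" assume \<phi>: "\<phi> \<in> test_fun UNIV"
  have t: "(%x. \<phi> x * \<kappa> x) \<in> test_fun U" by (rule test_fun_mult[OF \<kappa>(1) test_funD(1)[OF \<phi>]])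
  have eqx: "u x * pd b (%x. \<phi> x * \<kappa> x) x = u x * pd b \<phi> x" if "x \<in> U" for x
  proof (cases "x \<in> K")
   case True
   have "((%x. \<phi> x * \<kappa> x) has_derivative (%h. pd h \<phi> x)) (at x)"
   proof (rule has_derivative_transform_within_open[OF has_derivative_pd[OF test_funD(7)[OF \<phi>]], of "ball x d"])
    fix y assume "y \<in> ball x d"
    then have "norm (y - x) < d" by (simp add: dist_norm norm_minus_commute)
    then have "\<kappa> (x + (y - x)) = 1" using \<kappa>(4) True by blast
    then show "\<phi> y = \<phi> y * \<kappa> y" by simp
   qed (use \<kappa>(3) in auto)
   from pd_eq[OF this] show ?thesis by simp
  next
   case False
   then show ?thesis using K(3)[OF that] by simp
  qed
  have "(LINT x:U|lborel. u x * pd b \<phi> x) = (LINT x:U|lborel. u x * pd b (%x. \<phi> x * \<kappa> x) x)"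
   by (intro set_lebesgue_integral_cong allI impI eqx[symmetric]) (use U in simp)
  also have "\<dots> = - (LINT x:U|lborel. wd U u b x * (\<phi> x * \<kappa> x))"
   using weak_deriv_H1(2)[OF uH b] t by (simp add: has_weak_deriv_def)
  finally show "(LINT x:UNIV|lborel. ut x * pd b \<phi> x) = - (LINT x:UNIV|lborel. gt b x * \<phi> x)"
   by (simp add: ut_def gt_def g_def set_lebesgue_integral_def mult_ac)
 qed
 have wU: "has_weak_deriv U u b (g b)" if b: "b \<in> Basis" for b
 proof -
  have "has_weak_deriv U ut b (gt b)" by (rule has_weak_deriv_subset[OF wt[OF b]]) simp
  then show ?thesis
   using has_weak_deriv_cong[of U ut u "gt b" "g b" b] by (simp add: ut_def gt_def)
 qed
 \<comment> \<open>\<open>None\<close> stands for the function and \<open>Some b\<close> for its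
   derivatives, so that all of them share one mollifier sequence.\<close>
 define F where "F b = (case b of None => ut | Some b => gt b)" for b
 have "\<exists>\<eta>. (\<forall>n::nat. \<eta> n \<in> test_fun (ball 0 (e / 2 / Suc n)) \<and> (\<forall>z. 0 \<le> \<eta> n z) \<and> (LINT z|lborel. \<eta> n z) = 1) \<and>
   (\<forall>i\<in>insert None (Some ` Basis). (\<forall>n. conv (F i) (\<eta> n) \<in> L2 UNIV) \<and>
    (%n. L2_dist UNIV (conv (F i) (\<eta> n)) (F i)) \<longlonglongrightarrow> 0)"
  by (rule mollifier_sequence) (use utL gtL e(1) in \<open>auto simp: F_def\<close>)
 then obtain \<eta> where \<eta>: "(\<forall>n::nat. \<eta> n \<in> test_fun (ball 0 (e / 2 / Suc n)) \<and> (\<forall>z. 0 \<le> \<eta> n z) \<and> (LINT z|lborel. \<eta> n z) = 1) \<and>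
   (\<forall>i\<in>insert None (Some ` Basis). (\<forall>n. conv (F i) (\<eta> n) \<in> L2 UNIV) \<and>
    (%n. L2_dist UNIV (conv (F i) (\<eta> n)) (F i)) \<longlonglongrightarrow> 0)" ..
 have \<eta>t: "\<eta> n \<in> test_fun (ball 0 (e / 2 / Suc n))" for n using \<eta> by blast
 have \<eta>U: "\<eta> n \<in> test_fun UNIV" for n by (rule test_fun_mono[OF \<eta>t]) simp
 have c0: "conv ut (\<eta> n) \<in> L2 UNIV" "(%n. L2_dist UNIV (conv ut (\<eta> n)) ut) \<longlonglongrightarrow> 0" for n
  using conjunct2[OF \<eta>, rule_format, of None] by (auto simp: F_def)
 have c1: "conv (gt b) (\<eta> n) \<in> L2 UNIV" "(%n. L2_dist UNIV (conv (gt b) (\<eta> n)) (gt b)) \<longlonglongrightarrow> 0"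
  if "b \<in> Basis" for b n
  using conjunct2[OF \<eta>, rule_format, of "Some b"] that by (auto simp: F_def)
 have test: "conv ut (\<eta> n) \<in> test_fun U" for n
 proof (rule test_funI)
  let ?B = "(%(x, z). x + z) ` (K \<times> cball 0 (e / 2))"
  show "C_diff k (conv ut (\<eta> n))" for k by (rule C_diff_conv[OF utL \<eta>U])
  show "compact ?B"
   by (intro compact_continuous_image compact_Times K compact_cball)
     (auto intro!: continuous_intros simp: case_prod_beta)
  show "?B \<subseteq> U"
  proof
   fix y assume "y \<in> ?B"
   then obtain x z where "x \<in> K" "norm z \<le> e / 2" "y = x + z" by auto
   then have "y \<in> ball x e" using e(1) by (simp add: dist_norm)
   then show "y \<in> U" using e(2) \<open>x \<in> K\<close> by blast
  qed
  show "conv ut (\<eta> n) x = 0" if x: "x \<notin> ?B" for x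
  proof (rule conv_zero)
   fix y assume "ut y \<noteq> 0"
   then have y: "y \<in> K" using ut0 by blast
   show "\<eta> n (x - y) = 0"
   proof (rule test_funD(5)[OF \<eta>t], rule ccontr)
    assume "\<not> x - y \<notin> ball 0 (e / 2 / Suc n)"
    then have "norm (x - y) < e / 2 / Suc n" by simp
    also have "\<dots> \<le> e / 2 / 1" using e(1) by (intro divide_left_mono) auto
    finally have "x \<in> ?B" using y by (intro image_eqI[of _ _ "(y, x - y)"]) auto
    with x show False by simp
   qed
  qed
 qed
 have d: "pd b (conv ut (\<eta> n)) x = conv (gt b) (\<eta> n) x" if b: "b \<in> Basis" for b n x
  using conv_weak_deriv[OF wt[OF b] \<eta>t[of n], of x]
  by (simp add: pd_conv[OF utL \<eta>U b])
 have L: "L2_dist U (conv ut (\<eta> n)) u \<le> L2_dist UNIV (conv ut (\<eta> n)) ut" for n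
 proof -
  have "L2_dist U (conv ut (\<eta> n)) u = L2_dist U (conv ut (\<eta> n)) ut"
   by (rule L2_norm_cong) (simp add: ut_def)
  also have "\<dots> \<le> L2_dist UNIV (conv ut (\<eta> n)) ut"
   by (rule L2_norm_subset[OF L2_diff[OF c0(1) utL]]) (use U in auto)
  finally show ?thesis .
 qed
 have G: "gdist U (conv ut (\<eta> n)) u \<le> (\<Sum>b\<in>Basis. L2_dist UNIV (conv (gt b) (\<eta> n)) (gt b))" for n
 proof -
  have "gdist U (conv ut (\<eta> n)) u \<le> (\<Sum>b\<in>Basis. L2_dist U (pd b (conv ut (\<eta> n))) (g b))"
   by (intro gnorm_diff_le_sum U uL gL wU has_weak_deriv_C_diff test_funD(1)[OF test] test_fun_L2[OF test Ub]
     test_fun_L2[OF test_fun_pd[OF test] Ub])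
  also have "\<dots> \<le> (\<Sum>b\<in>Basis. L2_dist UNIV (conv (gt b) (\<eta> n)) (gt b))"
  proof (rule sum_mono)
   fix b :: 'a assume b: "b \<in> Basis"
   have "L2_dist U (pd b (conv ut (\<eta> n))) (g b) = L2_dist U (conv (gt b) (\<eta> n)) (gt b)"
    by (rule L2_norm_cong) (simp add: gt_def d[OF b])
   also have "\<dots> \<le> L2_dist UNIV (conv (gt b) (\<eta> n)) (gt b)"
    by (rule L2_norm_subset[OF L2_diff[OF c1(1)[OF b] gtL[OF b]]]) (use U in auto)
   finally show "L2_dist U (pd b (conv ut (\<eta> n))) (g b) \<le> L2_dist UNIV (conv (gt b) (\<eta> n)) (gt b)" .
  qed
  finally show ?thesis .
 qed
 have G0: "(%n. \<Sum>b\<in>Basis. L2_dist UNIV (conv (gt b) (\<eta> n)) (gt b)) \<longlonglongrightarrow> 0"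
  by (rule tendsto_null_sum) (rule c1(2))
 show "\<exists>w\<in>H10 U. L2_dist U w u < \<epsilon> \<and> gdist U w u < \<epsilon>" if \<epsilon>: "\<epsilon> > 0" for \<epsilon>
 proof -
  have "\<forall>\<^sub>F n in sequentially. L2_dist UNIV (conv ut (\<eta> n)) ut < \<epsilon> \<and>
    (\<Sum>b\<in>Basis. L2_dist UNIV (conv (gt b) (\<eta> n)) (gt b)) < \<epsilon>"
   by (intro eventually_conj order_tendstoD(2)[OF c0(2) \<epsilon>] order_tendstoD(2)[OF G0 \<epsilon>])
  then obtain n where n: "L2_dist UNIV (conv ut (\<eta> n)) ut < \<epsilon> \<and>
    (\<Sum>b\<in>Basis. L2_dist UNIV (conv (gt b) (\<eta> n)) (gt b)) < \<epsilon>"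
   using eventually_happens[of _ sequentially] by auto
  show ?thesis
   by (rule bexI[OF _ test_fun_H10[OF U test[of n]]])
     (use n L[of n] G[of n] in linarith)
 qed
qed

text \<open>Near the support of a test function v can be mollified, and the classical chain rule
  holds for the mollifications. The limit uses L2 convergence for G and almost everywhere
  convergence of a subsequence for G'.\<close>

lemma has_weak_deriv_chain:
 fixes v :: "'a::euclidean_space => real"
 assumes U: "open U" and b: "b \<in> Basis" and v: "v \<in> L2 U" "g \<in> L2 U"
  and w: "has_weak_deriv U v b g"
  and G: "\<And>s. (G has_real_derivative G' s) (at s)" "continuous_on UNIV G'" "\<And>s. \<bar>G' s\<bar> \<le> 1" "G 0 = 0"
 shows "has_weak_deriv U (%x. G (v x)) b (%x. G' (v x) * g x)" "(%x. G (v x)) \<in> L2 U" "(%x. G' (v x) * g x) \<in> L2 U"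
proof -
 have Ub: "U \<in> sets borel" using U by simp
 have Gc: "continuous_on UNIV G" using G(1) by (meson DERIV_continuous_on has_field_derivative_at_within)
 have Gm[measurable]: "G \<in> borel_measurable borel" "G' \<in> borel_measurable borel"
  using Gc G(2) by (auto intro: borel_measurable_continuous_onI)
 have lip: "\<bar>G s - G t\<bar> \<le> \<bar>s - t\<bar>" for s t
  using field_differentiable_bound[of UNIV G G' 1 s t] G by auto
 have GL: "(%x. G (f x)) \<in> L2 U" if f: "f \<in> L2 U" for f
 proof -
  note [measurable] = L2_measurable[OF f]
  \<comment> \<open>\<open>G 0 = 0\<close> lets G commute with extension by zero.\<close>
  have eq: "indicator U x * G (f x) = G (indicator U x * f x)" for x by (auto simp: indicator_def G(4))
  show ?thesis by (rule L2_bound[OF _ f]) (use lip[of _ 0] in \<open>auto simp: eq G(4)\<close>)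
 qed
 have G'L: "(%x. G' (f x) * h x) \<in> L2 U" if f: "f \<in> L2 U" and h: "h \<in> L2 U" for f h
 proof -
  note [measurable] = L2_measurable[OF f] L2_measurable[OF h]
  have eq: "indicator U x * (G' (f x) * h x) = G' (indicator U x * f x) * (indicator U x * h x)" for x
   by (auto simp: indicator_def)
  show ?thesis by (rule L2_bound[OF _ h]) (use G(3) in \<open>auto simp: eq abs_mult intro: mult_left_le_one_le\<close>)
 qed
 show "(%x. G (v x)) \<in> L2 U" by (rule GL[OF v(1)])
 show "(%x. G' (v x) * g x) \<in> L2 U" by (rule G'L[OF v])
 show "has_weak_deriv U (%x. G (v x)) b (%x. G' (v x) * g x)"
  unfolding has_weak_deriv_ip
 proof
  fix \<phi> assume \<phi>: "\<phi> \<in> test_fun U"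
  obtain K where K: "compact K" "K \<subseteq> U" "\<And>x. x \<notin> K ==> \<phi> x = 0"
   using test_fun_support[OF \<phi>] by blast
  obtain e where e: "e > 0" "(\<Union>x\<in>K. ball x e) \<subseteq> U"
   using compact_subset_open_imp_ball_epsilon_subset[OF K(1) U K(2)] by blast
  define vt where "vt x = indicator U x * v x" for x
  define gt where "gt x = indicator U x * g x" for x
  have vtL: "vt \<in> L2 UNIV" and gtL: "gt \<in> L2 UNIV"
   unfolding vt_def gt_def using L2_indicator[OF Ub] v by blast+
  define F where "F c = (if c then vt else gt)" for c
  have "\<exists>\<eta>. (\<forall>n::nat. \<eta> n \<in> test_fun (ball 0 (e / Suc n)) \<and> (\<forall>z. 0 \<le> \<eta> n z) \<and> (LINT z|lborel. \<eta> n z) = 1) \<and>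
   (\<forall>i\<in>{True, False}. (\<forall>n. conv (F i) (\<eta> n) \<in> L2 UNIV) \<and>
    (%n. L2_dist UNIV (conv (F i) (\<eta> n)) (F i)) \<longlonglongrightarrow> 0)"
   by (rule mollifier_sequence) (use vtL gtL e(1) in \<open>auto simp: F_def\<close>)
  then obtain \<eta> where \<eta>: "(\<forall>n::nat. \<eta> n \<in> test_fun (ball 0 (e / Suc n)) \<and> (\<forall>z. 0 \<le> \<eta> n z) \<and> (LINT z|lborel. \<eta> n z) = 1) \<and>
   (\<forall>i\<in>{True, False}. (\<forall>n. conv (F i) (\<eta> n) \<in> L2 UNIV) \<and>
    (%n. L2_dist UNIV (conv (F i) (\<eta> n)) (F i)) \<longlonglongrightarrow> 0)" ..
  define vn where "vn n = conv vt (\<eta> n)" for n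
  define gn where "gn n = conv gt (\<eta> n)" for n
  have \<eta>t: "\<eta> n \<in> test_fun (ball 0 (e / Suc n))" for n using \<eta> by blast
  have \<eta>U: "\<eta> n \<in> test_fun UNIV" for n by (rule test_fun_mono[OF \<eta>t]) simp
  have cv: "vn n \<in> L2 UNIV" "(%n. L2_dist UNIV (vn n) vt) \<longlonglongrightarrow> 0"
   "gn n \<in> L2 UNIV" "(%n. L2_dist UNIV (gn n) gt) \<longlonglongrightarrow> 0" for n
   using \<eta> by (auto simp: F_def vn_def gn_def)
  have vnU: "vn n \<in> L2 U" and gnU: "gn n \<in> L2 U" for n
   using L2_subset[OF cv(1) _ Ub] L2_subset[OF cv(3) _ Ub] by auto
  have to0: "(%n. L2_dist U (f n) h) \<longlonglongrightarrow> 0"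
   if "\<And>n. f n \<in> L2 UNIV" "ht \<in> L2 UNIV" "(%n. L2_dist UNIV (f n) ht) \<longlonglongrightarrow> 0" "\<And>x. x \<in> U ==> ht x = h x"
   for f :: "nat => 'a => real" and h ht
  proof (rule L2_norm_tendsto_0[OF _ that(3)])
   have "L2_dist U (f n) h = L2_dist U (f n) ht" for n
    by (rule L2_norm_cong) (simp add: that(4))
   then show "L2_dist U (f n) h \<le> L2_dist UNIV (f n) ht" for n
    using L2_norm_subset[OF L2_diff[OF that(1,2)] subset_UNIV Ub] by simp
  qed
  have v0: "(%n. L2_dist U (vn n) v) \<longlonglongrightarrow> 0"
   by (rule to0[OF cv(1) vtL cv(2)]) (simp add: vt_def)
  have g0: "(%n. L2_dist U (gn n) g) \<longlonglongrightarrow> 0"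
   by (rule to0[OF cv(3) gtL cv(4)]) (simp add: gt_def)
  have "\<exists>r::nat => nat. strict_mono r \<and> (AE x in lborel. x \<in> U \<longrightarrow> (%k. vn (r k) x) \<longlonglongrightarrow> v x)"
   by (rule L2_AE_subseq[OF vnU v(1) v0])
  then obtain r :: "nat => nat" where r: "strict_mono r \<and> (AE x in lborel. x \<in> U \<longrightarrow> (%k. vn (r k) x) \<longlonglongrightarrow> v x)" ..
  have v0r: "(%k. L2_dist U (vn (r k)) v) \<longlonglongrightarrow> 0"
   using LIMSEQ_subseq_LIMSEQ[OF v0 conjunct1[OF r]] by (simp add: o_def)
  have g0r: "(%k. L2_dist U (gn (r k)) g) \<longlonglongrightarrow> 0"
   using LIMSEQ_subseq_LIMSEQ[OF g0 conjunct1[OF r]] by (simp add: o_def)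
  have \<phi>L: "\<phi> \<in> L2 U" and d\<phi>L: "pd b \<phi> \<in> L2 U"
   using test_fun_L2[OF \<phi> Ub] test_fun_L2[OF test_fun_pd[OF \<phi> b] Ub] by auto
  have ibp: "ip U (%x. G (vn n x)) (pd b \<phi>) = - ip U (%x. G' (vn n x) * gn n x) \<phi>" for n
  proof -
   have C: "C_diff 1 (vn n)" unfolding vn_def by (rule C_diff_conv[OF vtL \<eta>U])
   then have dv: "vn n differentiable (at x)" for x by simp
   have D: "((%x. G (vn n x)) has_derivative (%h. G' (vn n x) * pd h (vn n) x)) (at x)" for x
    using has_derivative_compose[OF has_derivative_pd[OF dv[of x]], of G "%h. G' (vn n x) * h"]
     G(1)[of "vn n x"] by (simp add: has_field_derivative_def)
   have pd: "pd c (%x. G (vn n x)) = (%x. G' (vn n x) * pd c (vn n) x)" for c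
    by (rule ext) (rule pd_eq[OF D])
   have "C_diff 1 (%x. G (vn n x))"
    using D C C_diff_continuous[OF C]
    by (auto simp: pd differentiable_def intro!: continuous_on_mult continuous_on_compose2[OF G(2)])
   from integration_by_parts[OF this \<phi> b]
   have "ip U (%x. G (vn n x)) (pd b \<phi>) = - (LINT x:U|lborel. G' (vn n x) * pd b (vn n) x * \<phi> x)"
    by (simp add: ip_def pd)
   also have "(LINT x:U|lborel. G' (vn n x) * pd b (vn n) x * \<phi> x) = (LINT x:U|lborel. G' (vn n x) * gn n x * \<phi> x)"
   proof (rule set_lebesgue_integral_cong)
    show "\<forall>x. x \<in> U \<longrightarrow> G' (vn n x) * pd b (vn n) x * \<phi> x = G' (vn n x) * gn n x * \<phi> x"
    proof (intro allI impI)
     fix x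
     show "G' (vn n x) * pd b (vn n) x * \<phi> x = G' (vn n x) * gn n x * \<phi> x"
     proof (cases "x \<in> K")
      case True
      have "e / Suc n \<le> e / 1" using e(1) by (intro divide_left_mono) auto
      then have "ball x (e / Suc n) \<subseteq> ball x e" by (intro subset_ball) simp
      also have "ball x e \<subseteq> U" using e(2) True by blast
      finally have "conv vt (pd b (\<eta> n)) x = gn n x"
       unfolding vt_def gn_def gt_def by (rule conv_weak_deriv[OF w \<eta>t])
      then show ?thesis by (simp add: vn_def pd_conv[OF vtL \<eta>U b])
     next
      case False then show ?thesis by (simp add: K(3))
     qed
    qed
   qed (use U in simp)
   finally show ?thesis by (simp add: ip_def)
  qed
  have "(%k. L2_norm U (%x. G (vn (r k) x) - G (v x))) \<longlonglongrightarrow> 0"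
   by (rule L2_norm_tendsto_0[OF _ v0r]) (intro L2_norm_mono L2_diff GL vnU v lip)
  from ip_tendsto[OF GL[OF vnU] GL[OF v(1)] d\<phi>L this]
  have lim1: "(%k. ip U (%x. G (vn (r k) x)) (pd b \<phi>)) \<longlonglongrightarrow> ip U (%x. G (v x)) (pd b \<phi>)" .
  \<comment> \<open>G' is merely continuous, so convergence comes from the almost everywhere
    convergent subsequence, dominated by 2 |g|.\<close>
  have a0: "(%k. L2_norm U (%x. G' (vn (r k) x) * g x - G' (v x) * g x)) \<longlonglongrightarrow> 0"
  proof (rule L2_dominated_convergence[OF G'L[OF vnU v(2)] G'L[OF v] L2_cmult[OF L2_abs[OF v(2)], of 2]])
   show "AE x in lborel. x \<in> U \<longrightarrow> (%k. G' (vn (r k) x) * g x) \<longlonglongrightarrow> G' (v x) * g x"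
    using conjunct2[OF r]
   proof eventually_elim
    fix x assume h: "x \<in> U \<longrightarrow> (%k. vn (r k) x) \<longlonglongrightarrow> v x"
    have "isCont G' (v x)" using G(2) by (simp add: continuous_on_eq_continuous_at)
    show "x \<in> U \<longrightarrow> (%k. G' (vn (r k) x) * g x) \<longlonglongrightarrow> G' (v x) * g x"
     using h by (intro impI tendsto_mult_right isCont_tendsto_compose[OF \<open>isCont G' (v x)\<close>]) simp
   qed
   fix k
   show "AE x in lborel. x \<in> U \<longrightarrow> \<bar>G' (vn (r k) x) * g x - G' (v x) * g x\<bar> \<le> 2 * \<bar>g x\<bar>"
   proof (intro AE_I2 impI)
    fix x
    have "\<bar>G' (vn (r k) x) - G' (v x)\<bar> * \<bar>g x\<bar> \<le> 2 * \<bar>g x\<bar>"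
     using G(3)[of "vn (r k) x"] G(3)[of "v x"] by (intro mult_right_mono) auto
    then show "\<bar>G' (vn (r k) x) * g x - G' (v x) * g x\<bar> \<le> 2 * \<bar>g x\<bar>"
     by (simp add: left_diff_distrib[symmetric] abs_mult)
   qed
  qed
  \<comment> \<open>The error splits into G'(v_n) (g_n - g), small because |G'| \<le> 1, and
    (G'(v_n) - G'(v)) g, treated just before.\<close>
  have "(%k. L2_norm U (%x. G' (vn (r k) x) * gn (r k) x - G' (v x) * g x)) \<longlonglongrightarrow> 0"
  proof (rule L2_norm_tendsto_0)
   show "(%k. L2_dist U (gn (r k)) g + L2_norm U (%x. G' (vn (r k) x) * g x - G' (v x) * g x)) \<longlonglongrightarrow> 0"
    using tendsto_add[OF g0r a0] by simp
   fix k
   have "L2_norm U (%x. G' (vn (r k) x) * gn (r k) x - G' (vn (r k) x) * g x) \<le> L2_dist U (gn (r k)) g"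
    by (rule L2_norm_mono[OF L2_diff[OF G'L[OF vnU gnU] G'L[OF vnU v(2)]] L2_diff[OF gnU v(2)]])
      (simp add: right_diff_distrib[symmetric] abs_mult G(3) mult_left_le_one_le)
   then show "L2_norm U (%x. G' (vn (r k) x) * gn (r k) x - G' (v x) * g x) \<le>
     L2_dist U (gn (r k)) g + L2_norm U (%x. G' (vn (r k) x) * g x - G' (v x) * g x)"
    using L2_norm_triangle3[OF G'L[OF vnU gnU] G'L[OF vnU v(2)] G'L[OF v], of "r k" "r k" "r k"] by linarith
  qed
  from ip_tendsto[OF G'L[OF vnU gnU] G'L[OF v] \<phi>L this]
  have lim2: "(%k. ip U (%x. G' (vn (r k) x) * gn (r k) x) \<phi>) \<longlonglongrightarrow> ip U (%x. G' (v x) * g x) \<phi>" .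
  show "ip U (%x. G (v x)) (pd b \<phi>) = - ip U (%x. G' (v x) * g x) \<phi>"
   by (rule LIMSEQ_unique[OF lim1]) (unfold ibp, rule tendsto_minus[OF lim2])
 qed
qed

text \<open>A rational \<open>C^1\<close> substitute for the positive part: t^2 / (t + \<epsilon>)
  for t > 0, quadratic at 0 and with slope below 1.\<close>

definition cut_half :: "real => real => real" where
 "cut_half \<epsilon> t = (max 0 t)\<^sup>2 / (max 0 t + \<epsilon>)"

definition cut_half' :: "real => real => real" where
 "cut_half' \<epsilon> t = 1 - \<epsilon>\<^sup>2 / (max 0 t + \<epsilon>)\<^sup>2"

lemma cut_half_derivative:
 assumes e: "\<epsilon> > 0"
 shows "(cut_half \<epsilon> has_real_derivative cut_half' \<epsilon> t) (at t)"
proof -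
 consider "t > 0" | "t < 0" | "t = 0" by linarith
 then show ?thesis
 proof cases
  case 1
  have D: "((%t. t\<^sup>2 / (t + \<epsilon>)) has_real_derivative cut_half' \<epsilon> t) (at t)"
  proof -
   have ne: "t + \<epsilon> \<noteq> 0" using 1 e by simp
   have "((%t. t\<^sup>2 / (t + \<epsilon>)) has_real_derivative (2 * t * (t + \<epsilon>) - t\<^sup>2) / (t + \<epsilon>)\<^sup>2) (at t)"
    using ne by (auto intro!: derivative_eq_intros simp: power2_eq_square)
   also have "2 * t * (t + \<epsilon>) - t\<^sup>2 = (t + \<epsilon>)\<^sup>2 - \<epsilon>\<^sup>2" by algebra
   finally show ?thesis using ne 1 by (simp add: cut_half'_def diff_divide_distrib)
  qed
  show ?thesis
   by (rule has_field_derivative_transform_within_open[OF D, of "{0<..}"])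
     (use 1 in \<open>auto simp: cut_half_def\<close>)
 next
  case 2
  have D: "((%t. 0) has_real_derivative cut_half' \<epsilon> t) (at t)"
   using 2 e by (simp add: cut_half'_def)
  show ?thesis
   by (rule has_field_derivative_transform_within_open[OF D, of "{..<0}"])
     (use 2 in \<open>auto simp: cut_half_def\<close>)
 next
  case 3
  have "((%t. cut_half \<epsilon> t / t) \<longlongrightarrow> 0) (at 0)"
  proof (rule Lim_null_comparison)
   show "\<forall>\<^sub>F t in at 0. norm (cut_half \<epsilon> t / t) \<le> \<bar>t\<bar> / \<epsilon>"
   proof (intro always_eventually allI)
    fix t :: real
    show "norm (cut_half \<epsilon> t / t) \<le> \<bar>t\<bar> / \<epsilon>"
    proof (cases "t > 0")
     case True
     then have "t / (t + \<epsilon>) \<le> t / \<epsilon>" using e by (intro divide_left_mono) auto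
     then show ?thesis using True e by (simp add: cut_half_def power2_eq_square)
    next
     case False
     then show ?thesis using e by (simp add: cut_half_def divide_nonpos_pos)
    qed
   qed
   show "((%t. \<bar>t\<bar> / \<epsilon>) \<longlongrightarrow> 0) (at 0)" using e by (auto intro!: tendsto_eq_intros)
  qed
  then show ?thesis using 3 e by (simp add: has_field_derivative_iff cut_half_def cut_half'_def)
 qed
qed

text \<open>A \<open>C\<^sup>1\<close> shrinkage towards zero that vanishes on \<open>[-\<epsilon>, \<epsilon>]\<close>; for \<open>s > \<epsilon>\<close> it is \<open>(s - \<epsilon>)\<^sup>2 / s\<close>.\<close>

definition shrink :: "real => real => real" where
 "shrink \<epsilon> s = cut_half \<epsilon> (s - \<epsilon>) - cut_half \<epsilon> (- s - \<epsilon>)"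

definition shrink' :: "real => real => real" where
 "shrink' \<epsilon> s = cut_half' \<epsilon> (s - \<epsilon>) + cut_half' \<epsilon> (- s - \<epsilon>)"

lemma shrink_props:
 assumes e: "\<epsilon> > 0"
 shows "(shrink \<epsilon> has_real_derivative shrink' \<epsilon> s) (at s)" "continuous_on UNIV (shrink' \<epsilon>)"
  "\<bar>shrink' \<epsilon> s\<bar> \<le> 1" "\<bar>s\<bar> \<le> \<epsilon> ==> shrink \<epsilon> s = 0" "\<bar>shrink \<epsilon> s - s\<bar> \<le> 2 * \<epsilon>"
  "\<epsilon> < \<bar>s\<bar> ==> shrink' \<epsilon> s = 1 - \<epsilon>\<^sup>2 / s\<^sup>2" "\<bar>s\<bar> \<le> \<epsilon> ==> shrink' \<epsilon> s = 0"
proof -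
 show "(shrink \<epsilon> has_real_derivative shrink' \<epsilon> s) (at s)"
 proof -
  have 1: "((%s. cut_half \<epsilon> (s - \<epsilon>)) has_real_derivative cut_half' \<epsilon> (s - \<epsilon>) * 1) (at s)"
   by (rule DERIV_chain2[OF cut_half_derivative[OF e]]) (auto intro!: derivative_eq_intros)
  have 2: "((%s. cut_half \<epsilon> (- s - \<epsilon>)) has_real_derivative cut_half' \<epsilon> (- s - \<epsilon>) * (- 1)) (at s)"
   by (rule DERIV_chain2[OF cut_half_derivative[OF e]]) (auto intro!: derivative_eq_intros)
  from DERIV_diff[OF 1 2] show ?thesis by (simp add: shrink_def[abs_def] shrink'_def)
 qed
 have pos: "max 0 t + \<epsilon> > 0" for t using e by linarith
 show "continuous_on UNIV (shrink' \<epsilon>)"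
  unfolding shrink'_def cut_half'_def using pos
  by (intro continuous_intros) (auto simp: less_imp_neq[symmetric])
 have c0: "cut_half' \<epsilon> t = 0" if "t \<le> 0" for t using that e by (simp add: cut_half'_def)
 have c1: "0 \<le> cut_half' \<epsilon> t" "cut_half' \<epsilon> t \<le> 1" for t
 proof -
  have "\<epsilon>\<^sup>2 \<le> (max 0 t + \<epsilon>)\<^sup>2" using e by (intro power_mono) auto
  then have "\<epsilon>\<^sup>2 / (max 0 t + \<epsilon>)\<^sup>2 \<le> 1" using pos[of t] by (simp add: divide_le_eq_1)
  then show "0 \<le> cut_half' \<epsilon> t" "cut_half' \<epsilon> t \<le> 1" by (auto simp: cut_half'_def)
 qed
 show "\<bar>shrink' \<epsilon> s\<bar> \<le> 1"
 proof (cases "s \<ge> 0")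
  case True
  then have "cut_half' \<epsilon> (- s - \<epsilon>) = 0" using e by (intro c0) simp
  then show ?thesis using c1[of "s - \<epsilon>"] by (simp add: shrink'_def)
 next
  case False
  then have "cut_half' \<epsilon> (s - \<epsilon>) = 0" using e by (intro c0) simp
  then show ?thesis using c1[of "- s - \<epsilon>"] by (simp add: shrink'_def)
 qed
 show z: "shrink \<epsilon> s = 0" if "\<bar>s\<bar> \<le> \<epsilon>" for s using that by (simp add: shrink_def cut_half_def)
 \<comment> \<open>For s > \<epsilon> the value is s - 2 \<epsilon> + \<epsilon>^2 / s.\<close>
 have p: "\<bar>cut_half \<epsilon> (s - \<epsilon>) - s\<bar> \<le> 2 * \<epsilon>" if "\<epsilon> < s" for s
 proof -
  have "cut_half \<epsilon> (s - \<epsilon>) - s = \<epsilon> * (\<epsilon> / s) - 2 * \<epsilon>"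
   using that e by (simp add: cut_half_def field_simps power2_eq_square)
  moreover have "\<epsilon> / s \<le> 1" using that e by simp
  then have "\<epsilon> * (\<epsilon> / s) \<le> \<epsilon> * 1" using e by (intro mult_left_mono) auto
  moreover have "0 \<le> \<epsilon> * (\<epsilon> / s)" using that e by simp
  ultimately show ?thesis using e by linarith
 qed
 show "\<bar>shrink \<epsilon> s - s\<bar> \<le> 2 * \<epsilon>"
 proof -
  consider "\<bar>s\<bar> \<le> \<epsilon>" | "s > \<epsilon>" | "- s > \<epsilon>" by linarith
  then show ?thesis
  proof cases
   case 1 then show ?thesis using z e by simp
  next
   case 2
   then have "cut_half \<epsilon> (- s - \<epsilon>) = 0" using e by (simp add: cut_half_def)
   then show ?thesis using p[OF 2] by (simp add: shrink_def)
  next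
   case 3
   then have "cut_half \<epsilon> (s - \<epsilon>) = 0" using e by (simp add: cut_half_def)
   then show ?thesis using p[OF 3] by (simp add: shrink_def abs_le_iff)
  qed
 qed
 show "shrink' \<epsilon> s = 1 - \<epsilon>\<^sup>2 / s\<^sup>2" if s: "\<epsilon> < \<bar>s\<bar>"
 proof (cases "s > 0")
  case True
  then have "cut_half' \<epsilon> (- s - \<epsilon>) = 0" using e by (intro c0) simp
  then have "shrink' \<epsilon> s = cut_half' \<epsilon> (s - \<epsilon>)" by (simp add: shrink'_def)
  then show ?thesis using True s by (simp add: cut_half'_def)
 next
  case False
  then have "cut_half' \<epsilon> (s - \<epsilon>) = 0" using e by (intro c0) simp
  then have "shrink' \<epsilon> s = cut_half' \<epsilon> (- s - \<epsilon>)" by (simp add: shrink'_def)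
  then show ?thesis using False s by (simp add: cut_half'_def)
 qed
 show "shrink' \<epsilon> s = 0" if "\<bar>s\<bar> \<le> \<epsilon>" using that c0[of "s - \<epsilon>"] c0[of "- s - \<epsilon>"] by (simp add: shrink'_def)
qed

text \<open>Shrinking the values of v towards 0 annihilates it near the boundary, where |v| is
  small, and so yields compactly supported functions; they converge to v with their gradients as
  \<epsilon> tends to 0.\<close>

theorem H10_continuous_zero_boundary:
 fixes v :: "'a::euclidean_space => real"
 assumes U: "open U" "bounded U" and v: "v \<in> H1 U"
  and cont: "continuous_on (closure U) v" and bd: "\<And>x. x \<in> frontier U ==> v x = 0"
 shows "v \<in> H10 U"
proof (rule H10_limit[OF U(1) v])
 have Ub: "U \<in> sets borel" using U by simp
 define \<epsilon> where "\<epsilon> n = 1 / real (Suc n)" for n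
 have \<epsilon>: "\<epsilon> n > 0" for n by (simp add: \<epsilon>_def)
 have \<epsilon>0: "\<epsilon> \<longlonglongrightarrow> 0" unfolding \<epsilon>_def by (rule LIMSEQ_Suc[OF lim_1_over_n])
 define w where "w n x = shrink (\<epsilon> n) (v x)" for n x
 note vL = H1_L2[OF v]
 have s0: "shrink (\<epsilon> n) 0 = 0" for n using shrink_props(4)[OF \<epsilon>, of 0 n] \<epsilon>[of n] by simp
 have d: "has_weak_deriv U (w n) b (%x. shrink' (\<epsilon> n) (v x) * wd U v b x)" "w n \<in> L2 U"
  "(%x. shrink' (\<epsilon> n) (v x) * wd U v b x) \<in> L2 U" if b: "b \<in> Basis" for n b
  unfolding w_def
  by (rule has_weak_deriv_chain[OF U(1) b vL weak_deriv_H1[OF v b] shrink_props(1,2,3)[OF \<epsilon>] s0])+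
 have wL: "w n \<in> L2 U" for n using d(2) nonempty_Basis by blast
 have wH1: "w n \<in> H1 U" for n
  by (rule H1I[OF wL, of "%b x. shrink' (\<epsilon> n) (v x) * wd U v b x"]) (use d in auto)
 have wH10: "w n \<in> H10 U" for n
 proof (rule H10_compact_support[OF U(1) wH1])
  \<comment> \<open>Closed by continuity up to the boundary, and disjoint from the frontier because
    v is 0 there.\<close>
  let ?K = "{x \<in> closure U. v x \<in> {..- \<epsilon> n} \<union> {\<epsilon> n..}}"
  have "closed ?K"
   using continuous_closed_preimage[OF cont closed_closure, of "{..- \<epsilon> n} \<union> {\<epsilon> n..}"]
   by (simp add: vimage_def Int_def closed_Un)
  moreover have "bounded ?K" using U(2) by (intro bounded_subset[OF bounded_closure[OF U(2)]]) auto
  ultimately show "compact ?K" by (simp add: compact_eq_bounded_closed)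
  show "?K \<subseteq> U"
  proof
   fix x assume x: "x \<in> ?K"
   show "x \<in> U"
   proof (rule ccontr)
    assume "x \<notin> U"
    then have "x \<in> frontier U" using x U(1) by (simp add: frontier_def interior_open)
    then show False using bd[of x] x \<epsilon>[of n] by auto
   qed
  qed
  show "w n x = 0" if "x \<in> U" "x \<notin> ?K" for x
  proof -
   have "x \<in> closure U" using that(1) closure_subset by blast
   then have "\<bar>v x\<bar> \<le> \<epsilon> n" using that(2) by auto
   then show ?thesis unfolding w_def by (rule shrink_props(4)[OF \<epsilon>])
  qed
 qed
 have w0: "(%n. L2_dist U (w n) v) \<longlonglongrightarrow> 0"
 proof (rule L2_dominated_convergence[OF wL vL L2_cmult[OF L2_abs[OF vL], of 2]])
  have lim: "(%n. shrink (\<epsilon> n) s) \<longlonglongrightarrow> s" for s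
  proof (rule LIM_zero_cancel, rule Lim_null_comparison)
   show "\<forall>\<^sub>F n in sequentially. norm (shrink (\<epsilon> n) s - s) \<le> 2 * \<epsilon> n"
    using shrink_props(5)[OF \<epsilon>] by (intro always_eventually allI) simp
   show "(%n. 2 * \<epsilon> n) \<longlonglongrightarrow> 0" using tendsto_mult_right_zero[OF \<epsilon>0] by blast
  qed
  then show "AE x in lborel. x \<in> U \<longrightarrow> (%k. w k x) \<longlonglongrightarrow> v x" by (simp add: w_def)
  fix k
  have "\<bar>shrink (\<epsilon> k) s\<bar> \<le> \<bar>s\<bar>" for s
   using field_differentiable_bound[of UNIV "shrink (\<epsilon> k)" "shrink' (\<epsilon> k)" 1 s 0]
    shrink_props(1,3)[OF \<epsilon>[of k]] s0[of k] by auto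
  then show "AE x in lborel. x \<in> U \<longrightarrow> \<bar>w k x - v x\<bar> \<le> 2 * \<bar>v x\<bar>"
   by (intro AE_I2 impI) (smt (verit) w_def)
 qed
 \<comment> \<open>The pointwise limit of the gradients. Closedness of weak differentiation shows
   that it is again a derivative of v, so the vanishing of the gradient on the zero set comes as a
   by-product.\<close>
 define g where "g b x = (if v x = 0 then 0 else wd U v b x)" for b x
 have gL: "g b \<in> L2 U" if b: "b \<in> Basis" for b
 proof -
  note dL = weak_deriv_H1(1)[OF v b]
  note [measurable] = L2_measurable[OF vL] L2_measurable[OF dL]
  have eq: "indicator U x * g b x = (if indicator U x * v x = 0 then 0 else indicator U x * wd U v b x)" for x
   by (simp add: g_def indicator_def)
  have m: "(%x. indicator U x * g b x) \<in> borel_measurable lborel" unfolding eq by measurable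
  show ?thesis by (rule L2_bound[OF m dL]) (simp add: g_def)
 qed
 have g0: "(%n. L2_norm U (%x. shrink' (\<epsilon> n) (v x) * wd U v b x - g b x)) \<longlonglongrightarrow> 0" if b: "b \<in> Basis" for b
 proof (rule L2_dominated_convergence[OF d(3)[OF b] gL[OF b] L2_cmult[OF L2_abs[OF weak_deriv_H1(1)[OF v b]], of 2]])
  have lim: "(%n. shrink' (\<epsilon> n) s * a) \<longlonglongrightarrow> (if s = 0 then 0 else a)" for s a
  proof (cases "s = 0")
   case True
   then have "shrink' (\<epsilon> n) s = 0" for n using shrink_props(7)[OF \<epsilon>, of s n] \<epsilon>[of n] by simp
   then show ?thesis using True by simp
  next
   case False
   have "(%n. 1 - (\<epsilon> n)\<^sup>2 / s\<^sup>2) \<longlonglongrightarrow> 1 - 0\<^sup>2 / s\<^sup>2"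
    by (intro tendsto_intros \<epsilon>0) (use False in simp)
   moreover have "\<forall>\<^sub>F n in sequentially. 1 - (\<epsilon> n)\<^sup>2 / s\<^sup>2 = shrink' (\<epsilon> n) s"
    using order_tendstoD(2)[OF \<epsilon>0, of "\<bar>s\<bar>"] False
    by (auto elim!: eventually_mono simp: shrink_props(6)[OF \<epsilon>])
   ultimately have "(%n. shrink' (\<epsilon> n) s) \<longlonglongrightarrow> 1"
    using Lim_transform_eventually by fastforce
   from tendsto_mult_right[OF this, of a] show ?thesis using False by simp
  qed
  show "AE x in lborel. x \<in> U \<longrightarrow> (%k. shrink' (\<epsilon> k) (v x) * wd U v b x) \<longlonglongrightarrow> g b x"
   unfolding g_def using lim by (intro AE_I2 impI)
  fix k
  show "AE x in lborel. x \<in> U \<longrightarrow> \<bar>shrink' (\<epsilon> k) (v x) * wd U v b x - g b x\<bar> \<le> 2 * \<bar>wd U v b x\<bar>"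
  proof (intro AE_I2 impI)
   fix x
   have "\<bar>shrink' (\<epsilon> k) (v x)\<bar> * \<bar>wd U v b x\<bar> \<le> 1 * \<bar>wd U v b x\<bar>"
    by (rule mult_right_mono[OF shrink_props(3)[OF \<epsilon>]]) simp
   then have "\<bar>shrink' (\<epsilon> k) (v x) * wd U v b x\<bar> \<le> \<bar>wd U v b x\<bar>" by (simp add: abs_mult)
   moreover have "\<bar>g b x\<bar> \<le> \<bar>wd U v b x\<bar>" by (simp add: g_def)
   ultimately show "\<bar>shrink' (\<epsilon> k) (v x) * wd U v b x - g b x\<bar> \<le> 2 * \<bar>wd U v b x\<bar>" by linarith
  qed
 qed
 have wg: "has_weak_deriv U v b (g b)" if b: "b \<in> Basis" for b
  by (rule has_weak_deriv_limit[OF Ub b wL vL w0 d(3)[OF b] gL[OF b] g0[OF b] d(1)[OF b]])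
 have G: "gdist U (w n) v \<le> (\<Sum>b\<in>Basis. L2_norm U (%x. shrink' (\<epsilon> n) (v x) * wd U v b x - g b x))" for n
  by (intro gnorm_diff_le_sum U(1) wL vL d gL wg)
 have G0: "(%n. \<Sum>b\<in>Basis. L2_norm U (%x. shrink' (\<epsilon> n) (v x) * wd U v b x - g b x)) \<longlonglongrightarrow> 0"
  by (rule tendsto_null_sum) (rule g0)
 fix e :: real assume e: "e > 0"
 have "\<forall>\<^sub>F n in sequentially. L2_dist U (w n) v < e \<and>
   (\<Sum>b\<in>Basis. L2_norm U (%x. shrink' (\<epsilon> n) (v x) * wd U v b x - g b x)) < e"
  by (intro eventually_conj order_tendstoD(2)[OF w0 e] order_tendstoD(2)[OF G0 e])
 then obtain n where n: "L2_dist U (w n) v < e \<and>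
   (\<Sum>b\<in>Basis. L2_norm U (%x. shrink' (\<epsilon> n) (v x) * wd U v b x - g b x)) < e"
  using eventually_happens[of _ sequentially] by auto
 show "\<exists>w\<in>H10 U. L2_dist U w v < e \<and> gdist U w v < e"
  by (rule bexI[OF _ wH10[of n]]) (use n G[of n] in linarith)
qed

section \<open>Iterated integrals and slices\<close>

lemma set_Fubini:
 fixes f :: "'a::euclidean_space \<times> 'b::euclidean_space => real"
 assumes "set_integrable lborel (A \<times> B) f"
 shows "(LINT p:A \<times> B|lborel. f p) = (LINT y:B|lborel. (LINT x:A|lborel. f (x, y)))"
  "(LINT p:A \<times> B|lborel. f p) = (LINT x:A|lborel. (LINT y:B|lborel. f (x, y)))"
  "AE y in lborel. y \<in> B \<longrightarrow> set_integrable lborel A (%x. f (x, y))"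
  "AE x in lborel. x \<in> A \<longrightarrow> set_integrable lborel B (%y. f (x, y))"
  "set_integrable lborel B (%y. LINT x:A|lborel. f (x, y))"
  "set_integrable lborel A (%x. LINT y:B|lborel. f (x, y))"
proof -
 define F where "F x y = indicator A x *\<^sub>R (indicator B y *\<^sub>R f (x, y))" for x y
 have F': "(%p. indicator (A \<times> B) p *\<^sub>R f p) = case_prod F"
  by (auto simp: F_def indicator_def fun_eq_iff)
 have i: "integrable (lborel \<Otimes>\<^sub>M lborel) (case_prod F)"
  using assms unfolding set_integrable_def F' lborel_prod .
 have S: "(LINT x|lborel. F x y) = indicator B y *\<^sub>R (LINT x:A|lborel. f (x, y))" for y
  unfolding F_def set_lebesgue_integral_def scaleR_left_commute[of _ "indicator B y"]
  by (rule integral_scaleR_right)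
 have R: "(LINT y|lborel. F x y) = indicator A x *\<^sub>R (LINT y:B|lborel. f (x, y))" for x
  unfolding F_def set_lebesgue_integral_def by (rule integral_scaleR_right)
 have I: "(LINT p:A \<times> B|lborel. f p) = integral\<^sup>L (lborel \<Otimes>\<^sub>M lborel) (case_prod F)"
  unfolding set_lebesgue_integral_def F' lborel_prod ..
 show "(LINT p:A \<times> B|lborel. f p) = (LINT y:B|lborel. (LINT x:A|lborel. f (x, y)))"
  unfolding I lborel_pair.integral_snd[OF i, symmetric] S by (simp add: set_lebesgue_integral_def)
 show "(LINT p:A \<times> B|lborel. f p) = (LINT x:A|lborel. (LINT y:B|lborel. f (x, y)))"
  unfolding I lborel_pair.integral_fst[OF i, symmetric] R by (simp add: set_lebesgue_integral_def)
 show "set_integrable lborel B (%y. LINT x:A|lborel. f (x, y))"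
  using lborel_pair.integrable_snd[OF i] by (simp add: S set_integrable_def)
 show "set_integrable lborel A (%x. LINT y:B|lborel. f (x, y))"
  using lborel_pair.integrable_fst[OF i] by (simp add: R set_integrable_def)
 show "AE y in lborel. y \<in> B \<longrightarrow> set_integrable lborel A (%x. f (x, y))"
  using lborel_pair.AE_integrable_snd[OF i]
  by eventually_elim (auto simp: F_def set_integrable_def)
 show "AE x in lborel. x \<in> A \<longrightarrow> set_integrable lborel B (%y. f (x, y))"
  using lborel_pair.AE_integrable_fst[OF i]
  by eventually_elim (auto simp: F_def set_integrable_def)
qed

lemma L2_sections:
 fixes f :: "'a::euclidean_space \<times> 'b::euclidean_space => real"
 assumes f: "f \<in> L2 (A \<times> B)"
 shows "AE x in lborel. x \<in> A \<longrightarrow> (%y. f (x, y)) \<in> L2 B"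
  "AE y in lborel. y \<in> B \<longrightarrow> (%x. f (x, y)) \<in> L2 A"
proof -
 have m[measurable]: "(%p. indicator (A \<times> B) p * f p) \<in> borel_measurable borel"
  using L2_measurable[OF f] by simp
 have m1: "(%y. indicator B y * f (x, y)) \<in> borel_measurable borel" if x: "x \<in> A" for x
 proof -
  have "(%y. indicator (A \<times> B) (x, y) * f (x, y)) \<in> borel_measurable borel" by measurable
  then show ?thesis using x by (simp add: indicator_times)
 qed
 have m2: "(%x. indicator A x * f (x, y)) \<in> borel_measurable borel" if y: "y \<in> B" for y
 proof -
  have "(%x. indicator (A \<times> B) (x, y) * f (x, y)) \<in> borel_measurable borel" by measurable
  then show ?thesis using y by (simp add: indicator_times)
 qed
 have i: "set_integrable lborel (A \<times> B) (%p. (f p)\<^sup>2)" using f by (simp add: L2_def)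
 show "AE x in lborel. x \<in> A \<longrightarrow> (%y. f (x, y)) \<in> L2 B"
  using set_Fubini(4)[OF i] by eventually_elim (use m1 in \<open>auto simp: L2_def set_borel_measurable_def\<close>)
 show "AE y in lborel. y \<in> B \<longrightarrow> (%x. f (x, y)) \<in> L2 A"
  using set_Fubini(3)[OF i] by eventually_elim (use m2 in \<open>auto simp: L2_def set_borel_measurable_def\<close>)
qed

lemma set_integral_cong_AE_integrable:
 assumes "set_integrable lborel U u" "set_integrable lborel U v" "AE x in lborel. x \<in> U \<longrightarrow> u x = (v x :: real)"
 shows "(LINT x:U|lborel. u x) = (LINT x:U|lborel. v x)"
 using assms by (intro set_integral_AE_cong) (auto simp: set_integrable_def)

section \<open>Space-time cylinders\<close>

locale spacetime =
 fixes \<Omega> :: "'a::euclidean_space set" and T :: real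
 assumes open_Omega: "open \<Omega>" and bounded_Omega: "bounded \<Omega>" and T_pos: "0 < T"
begin

abbreviation "Q \<equiv> cylQ \<Omega> T"
abbreviation "Qm \<equiv> cylQm \<Omega> T"
abbreviation "wpair \<equiv> wave_pair \<Omega> T"
abbreviation "HQs \<equiv> HQ \<Omega> T"
abbreviation "V_init \<equiv> H11_init \<Omega> T"
abbreviation "V_0init \<equiv> H11_0init \<Omega> T"

lemma open_Q: "open Q" "open Qm"
 by (simp_all add: cylQ_def cylQm_def open_Omega open_Times)

lemma bounded_Q: "bounded Q" "bounded Qm"
 by (simp_all add: cylQ_def cylQm_def bounded_Omega bounded_Times)

lemma borel_Q: "Q \<in> sets borel" "Qm \<in> sets borel" "\<Omega> \<in> sets borel"
 using open_Q open_Omega by simp_all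

lemma Q_subset_Qm: "Q \<subseteq> Qm"
 using T_pos by (auto simp: cylQ_def cylQm_def)

lemma time_Basis: "(0, 1) \<in> (Basis :: ('a \<times> real) set)"
 by (auto simp: Basis_prod_def)

lemma Basis_spacetime:
 fixes P :: "'a \<times> real => bool"
 assumes "\<And>b. b \<in> Basis ==> P (b, 0)" "P (0, 1)" "c \<in> Basis"
 shows "P c"
 using assms by (auto simp: Basis_prod_def)

lemma bounded_linear_slice:
 "bounded_linear (%x::'a. (x, 0::real))" "bounded_linear (%t::real. (0::'a, t))"
 by (intro bounded_linear_Pair bounded_linear_ident bounded_linear_zero)+

lemma C_diff_slice:
 fixes V :: "'a \<times> real => real"
 assumes V: "C_diff k V"
 shows "C_diff k (%x. V (x, t))" "C_diff k (%t. V (x, t))"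
 using C_diff_compose_affine[OF bounded_linear_slice(1) V, of "(0, t)"]
  C_diff_compose_affine[OF bounded_linear_slice(2) V, of "(x, 0)"] by simp_all

lemma pd_slice:
 fixes V :: "'a \<times> real => real"
 assumes V: "V differentiable (at (x, t))"
 shows "pd b (%x. V (x, t)) x = pd (b, 0) V (x, t)"
  "pd s (%t. V (x, t)) t = pd (0, s) V (x, t)"
 using pd_compose_affine[OF bounded_linear_slice(1), of V "(0, t)" x b]
  pd_compose_affine[OF bounded_linear_slice(2), of V "(x, 0)" t s] V by simp_all

lemma deriv_eq_pd:
 fixes \<eta> :: "real => real"
 assumes "C_diff 1 \<eta>"
 shows "deriv \<eta> = pd 1 \<eta>"
 using C_diff_1_directional[OF assms, of 0 1] by (auto simp: fun_eq_iff intro!: DERIV_imp_deriv)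

lemma test_fun_slice:
 fixes \<phi> :: "'a \<times> real => real"
 assumes \<phi>: "\<phi> \<in> test_fun (A \<times> B)"
 shows "(%x. \<phi> (x, t)) \<in> test_fun A" "(%t. \<phi> (x, t)) \<in> test_fun B"
proof -
 obtain K where K: "compact K" "K \<subseteq> A \<times> B" "\<And>x. x \<notin> K ==> \<phi> x = 0"
  using test_fun_support[OF \<phi>] by blast
 have c: "compact (fst ` K)" "compact (snd ` K)"
  using K(1) by (auto intro!: compact_continuous_image continuous_intros)
 show "(%x. \<phi> (x, t)) \<in> test_fun A"
  by (rule test_funI[OF C_diff_slice(1)[OF test_funD(1)[OF \<phi>]] c(1)]) (use K(2) in force, rule K(3), force)
 show "(%t. \<phi> (x, t)) \<in> test_fun B"
  by (rule test_funI[OF C_diff_slice(2)[OF test_funD(1)[OF \<phi>]] c(2)]) (use K(2) in force, rule K(3), force)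
qed

lemma C_diff_1_L2:
 fixes V :: "'a \<times> real => real"
 assumes V: "C_diff 1 V"
 shows "V \<in> L2 Q" "c \<in> Basis ==> pd c V \<in> L2 Q"
 using V C_diff_continuous[OF V] by (auto intro!: L2_continuous_bounded_set bounded_Q borel_Q)

lemma C_diff_1_membership:
 fixes V :: "'a \<times> real => real"
 assumes V: "C_diff 1 V"
 shows "(\<And>t. t \<in> {0<..<T} ==> (%x. V (x, t)) \<in> X) ==> V \<in> L2_time X \<Omega> T"
  and "(%x. V (x, t)) \<in> H1 \<Omega>"
  and "V \<in> H1_time \<Omega> T"
  and "s \<in> {0..T} ==> (\<And>x. x \<in> \<Omega> ==> V (x, s) = 0) ==> vanishes_at \<Omega> T s V"
  and "V \<in> H1 Q"
proof -
 have d: "V differentiable (at p)" for p by (rule C_diff_differentiable[OF V[unfolded One_nat_def]])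
 have B: "(b, 0) \<in> (Basis :: ('a \<times> real) set)" if "b \<in> Basis" for b
  using that by (auto simp: Basis_prod_def)
 have pd: "pd b (%x. V (x, t)) = (%x. pd (b, 0) V (x, t))" for b t
  by (rule ext) (rule pd_slice(1)[OF d])
 have w: "has_weak_deriv \<Omega> (%x. V (x, t)) b (%x. pd (b, 0) V (x, t))" if "b \<in> Basis" for b t
  using has_weak_deriv_C_diff[OF C_diff_slice(1)[OF V] that, of \<Omega> t] by (simp add: pd)
 have cont: "continuous_on UNIV V" by (rule C_diff_continuous[OF V])
 have sL: "(%x. V (x, t)) \<in> L2 \<Omega>" for t
  by (intro L2_continuous_bounded_set bounded_Omega borel_Q continuous_on_compose2[OF cont] continuous_intros) auto
 show "V \<in> L2_time X \<Omega> T" if "\<And>t. t \<in> {0<..<T} ==> (%x. V (x, t)) \<in> X"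
  unfolding L2_time_def using that w C_diff_1_L2[OF V] B
  by (auto intro!: exI[of _ "%b. pd (b, 0) V"])
 show "(%x. V (x, t)) \<in> H1 \<Omega>"
 proof (rule H1I[OF sL])
  fix b :: 'a assume b: "b \<in> Basis"
  have "continuous_on UNIV (pd b (%x. V (x, t)))" using C_diff_slice(1)[OF V, of t] b by simp
  then show "(%x. pd (b, 0) V (x, t)) \<in> L2 \<Omega>"
   by (intro L2_continuous_bounded_set bounded_Omega borel_Q) (simp add: pd)
  show "has_weak_deriv \<Omega> (%x. V (x, t)) b (%x. pd (b, 0) V (x, t))" by (rule w[OF b])
 qed
 show "V \<in> H1_time \<Omega> T"
  unfolding H1_time_def
 proof (intro CollectI conjI bexI[of _ "pd (0, 1) V"] ballI)
  fix \<eta> assume \<eta>: "\<eta> \<in> test_fun {0<..<T}"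
  have "pd 1 (%t. V (x, t)) = (%t. pd (0, 1) V (x, t))" for x
   by (rule ext) (rule pd_slice(2)[OF d])
  then have "(LINT t:{0<..<T}|lborel. V (x, t) * deriv \<eta> t) = - (LINT t:{0<..<T}|lborel. pd (0, 1) V (x, t) * \<eta> t)" for x
   using integration_by_parts[OF C_diff_slice(2)[OF V] \<eta>, of 1 x]
   by (simp add: deriv_eq_pd[OF test_funD(1)[OF \<eta>]])
  then show "ae_eq_on \<Omega> (%x. LINT t:{0<..<T}|lborel. V (x, t) * deriv \<eta> t)
    (%x. - (LINT t:{0<..<T}|lborel. pd (0, 1) V (x, t) * \<eta> t))" by (simp add: ae_eq_on_def)
 qed (use C_diff_1_L2[OF V] time_Basis in auto)
 show "V \<in> H1 Q"
  by (rule H1I[OF C_diff_1_L2[OF V] has_weak_deriv_C_diff[OF V]])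
 show "vanishes_at \<Omega> T s V" if s: "s \<in> {0..T}" "\<And>x. x \<in> \<Omega> ==> V (x, s) = 0"
  unfolding vanishes_at_def
 proof (intro exI[of _ "%t x. V (x, t)"] conjI ballI sL)
  show "AE t in lborel. t \<in> {0<..<T} \<longrightarrow> ae_eq_on \<Omega> (%x. V (x, t)) (%x. V (x, t))" by (simp add: ae_eq_on_refl)
  show "ae_eq_on \<Omega> (%x. V (x, s)) (%x. 0)" using s(2) by (auto simp: ae_eq_on_def)
  fix t assume t: "t \<in> {0..T}"
  \<comment> \<open>On a compact cylinder the slices depend continuously on time in the supremum
    norm, hence in L2 of the bounded domain.\<close>
  have "uniformly_continuous_on (closure \<Omega> \<times> {0..T}) V"
   by (intro compact_uniformly_continuous continuous_on_subset[OF cont] compact_Times)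
     (use bounded_Omega in auto)
  then have uc: "\<exists>d>0. \<forall>p\<in>closure \<Omega> \<times> {0..T}. \<forall>q\<in>closure \<Omega> \<times> {0..T}. dist q p < d \<longrightarrow> dist (V q) (V p) < e" if "e > 0" for e
   using that unfolding uniformly_continuous_on_def by blast
  have one: "(%x. c) \<in> L2 \<Omega>" for c
   by (intro L2_continuous_bounded_set bounded_Omega borel_Q continuous_intros)
  let ?N = "L2_norm \<Omega> (%x. 1)"
  show "((%\<tau>. L2_norm \<Omega> (%x. V (x, \<tau>) - V (x, t))) \<longlongrightarrow> 0) (at t within {0..T})"
  proof (rule tendstoI)
   fix e :: real assume e: "0 < e"
   define e' where "e' = e / (?N + 1)"
   have N: "?N \<ge> 0" by (rule L2_norm_nonneg)
   then have e': "e' > 0" using e by (simp add: e'_def)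
   obtain d where d: "d > 0" "\<And>p q. p \<in> closure \<Omega> \<times> {0..T} ==> q \<in> closure \<Omega> \<times> {0..T} ==> dist q p < d ==> dist (V q) (V p) < e'"
    using uc[OF e'] by blast
   have "L2_norm \<Omega> (%x. V (x, \<tau>) - V (x, t)) < e" if \<tau>: "\<tau> \<in> {0..T}" "dist \<tau> t < d" for \<tau>
   proof -
    have "L2_norm \<Omega> (%x. V (x, \<tau>) - V (x, t)) \<le> L2_norm \<Omega> (%x. e' * 1)"
    proof (rule L2_norm_mono[OF L2_diff[OF sL sL]])
     fix x assume x: "x \<in> \<Omega>"
     then have "x \<in> closure \<Omega>" using closure_subset by blast
     then have "dist (V (x, \<tau>)) (V (x, t)) < e'" using \<tau> t by (intro d(2)) (auto simp: dist_Pair_Pair)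
     then show "\<bar>V (x, \<tau>) - V (x, t)\<bar> \<le> \<bar>e' * 1\<bar>" by (simp add: dist_real_def)
    qed (use one in simp)
    also have "\<dots> = e' * ?N" using e' by (subst L2_norm_cmult) simp
    also have "\<dots> < e' * (?N + 1)" using e' by simp
    also have "\<dots> = e" using N by (simp add: e'_def)
    finally show ?thesis .
   qed
   then show "\<forall>\<^sub>F \<tau> in at t within {0..T}. dist (L2_norm \<Omega> (%x. V (x, \<tau>) - V (x, t))) 0 < e"
    using d(1) by (auto simp: eventually_at L2_norm_nonneg)
  qed
 qed
qed

text \<open>The integration by parts happens inside each time slice, so the test functions are
  unrestricted in time; in particular they may be nonzero at t = 0.\<close>

lemma L2_time_space_deriv:
 assumes v: "v \<in> L2_time X \<Omega> T"
 shows "\<exists>G. \<forall>b\<in>Basis. G b \<in> L2 Q \<and>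
  (\<forall>\<phi>\<in>test_fun (\<Omega> \<times> UNIV). ip Q v (pd (b, 0) \<phi>) = - ip Q (G b) \<phi>)"
proof -
 have vL: "v \<in> L2 Q" using v by (simp add: L2_time_def)
 obtain G where G: "\<And>b. b \<in> Basis ==> G b \<in> L2 Q"
  "\<And>b. b \<in> Basis ==> AE t in lborel. t \<in> {0<..<T} \<longrightarrow> has_weak_deriv \<Omega> (%x. v (x, t)) b (%x. G b (x, t))"
  using v unfolding L2_time_def by blast
 have "ip Q v (pd (b, 0) \<phi>) = - ip Q (G b) \<phi>" if b: "b \<in> Basis" and \<phi>: "\<phi> \<in> test_fun (\<Omega> \<times> UNIV)" for b \<phi>
 proof -
  have b': "(b, 0) \<in> (Basis :: ('a \<times> real) set)" using b by (auto simp: Basis_prod_def)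
  have d: "\<phi> differentiable (at p)" for p by (rule test_funD(7)[OF \<phi>])
  have i1: "set_integrable lborel (\<Omega> \<times> {0<..<T}) (%p. v p * pd (b, 0) \<phi> p)"
   using L2_mult_integrable[OF vL test_fun_L2[OF test_fun_pd[OF \<phi> b'] borel_Q(1)]] by (simp add: cylQ_def)
  have i2: "set_integrable lborel (\<Omega> \<times> {0<..<T}) (%p. G b p * \<phi> p)"
   using L2_mult_integrable[OF G(1)[OF b] test_fun_L2[OF \<phi> borel_Q(1)]] by (simp add: cylQ_def)
  have "ip Q v (pd (b, 0) \<phi>) = (LINT t:{0<..<T}|lborel. (LINT x:\<Omega>|lborel. v (x, t) * pd (b, 0) \<phi> (x, t)))"
   unfolding ip_def cylQ_def by (rule set_Fubini(1)[OF i1])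
  also have "\<dots> = (LINT t:{0<..<T}|lborel. - (LINT x:\<Omega>|lborel. G b (x, t) * \<phi> (x, t)))"
  proof (rule set_integral_cong_AE_integrable[OF set_Fubini(5)[OF i1]])
   show "set_integrable lborel {0<..<T} (%t. - (LINT x:\<Omega>|lborel. G b (x, t) * \<phi> (x, t)))"
    using set_integrable_mult_right[OF set_Fubini(5)[OF i2], of "-1"] by simp
   show "AE t in lborel. t \<in> {0<..<T} \<longrightarrow> (LINT x:\<Omega>|lborel. v (x, t) * pd (b, 0) \<phi> (x, t)) = - (LINT x:\<Omega>|lborel. G b (x, t) * \<phi> (x, t))"
    using G(2)[OF b]
   proof eventually_elim
    case (elim t)
    note h = elim
    show ?case
    proof
     assume "t \<in> {0<..<T}"
     then have "(LINT x:\<Omega>|lborel. v (x, t) * pd b (%x. \<phi> (x, t)) x) = - (LINT x:\<Omega>|lborel. G b (x, t) * \<phi> (x, t))"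
      using h test_fun_slice(1)[OF \<phi>, of t] unfolding has_weak_deriv_def by blast
     then show "(LINT x:\<Omega>|lborel. v (x, t) * pd (b, 0) \<phi> (x, t)) = - (LINT x:\<Omega>|lborel. G b (x, t) * \<phi> (x, t))"
      by (simp add: pd_slice(1)[OF d])
    qed
   qed
  qed
  also have "\<dots> = - ip Q (G b) \<phi>"
   unfolding ip_def cylQ_def set_Fubini(1)[OF i2] by (simp add: set_integral_uminus set_Fubini(5)[OF i2])
  finally show ?thesis .
 qed
 then show ?thesis using G(1) by (intro exI[of _ G]) blast
qed

text \<open>The exceptional null set in \<open>H1_time\<close> depends on \<open>\<eta>\<close>; testing with \<open>\<phi>(y, \<cdot>)\<close> for countably many
 \<open>y\<close> and letting \<open>y \<rightarrow> x\<close> gives the identity for \<open>\<phi>(x, \<cdot>)\<close> at almost every \<open>x\<close>.\<close>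

lemma H1_time_deriv:
 assumes v: "v \<in> H1_time \<Omega> T"
 shows "\<exists>D\<in>L2 Q. \<forall>\<phi>\<in>test_fun Q. ip Q v (pd (0, 1) \<phi>) = - ip Q D \<phi>"
proof -
 let ?I = "{0<..<T}"
 have vL: "v \<in> L2 Q" using v by (simp add: H1_time_def)
 obtain D where D: "D \<in> L2 Q" "\<And>\<eta>. \<eta> \<in> test_fun ?I ==>
   ae_eq_on \<Omega> (%x. LINT t:?I|lborel. v (x, t) * deriv \<eta> t) (%x. - (LINT t:?I|lborel. D (x, t) * \<eta> t))"
  using v unfolding H1_time_def by blast
 obtain Y :: "'a set" where Y: "countable Y" "\<And>S. open S ==> S \<noteq> {} ==> \<exists>y\<in>Y. y \<in> S"
  using countable_dense_setE by blast
 note e01 = time_Basis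
 have Ib: "?I \<in> sets borel" by simp
 have constI: "(%t. c) \<in> L2 ?I" for c :: real by (rule finite_measure_L2_const) (use T_pos in auto)
 have "ip Q v (pd (0, 1) \<phi>) = - ip Q D \<phi>" if \<phi>: "\<phi> \<in> test_fun Q" for \<phi>
 proof -
  note d\<phi> = test_fun_pd[OF \<phi> e01]
  have \<phi>s: "(%t. \<phi> (x, t)) \<in> test_fun ?I" "(%t. pd (0, 1) \<phi> (x, t)) \<in> test_fun ?I" for x
   using test_fun_slice(2)[OF \<phi>[unfolded cylQ_def]] test_fun_slice(2)[OF d\<phi>[unfolded cylQ_def]] by auto
  have der: "deriv (%t. \<phi> (x, t)) = (%t. pd (0, 1) \<phi> (x, t))" for x
   unfolding deriv_eq_pd[OF C_diff_slice(2)[OF test_funD(1)[OF \<phi>]]]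
   by (rule ext) (rule pd_slice(2)[OF test_funD(7)[OF \<phi>]])
  have "AE x in lborel. \<forall>y\<in>Y. x \<in> \<Omega> \<longrightarrow> ip ?I (%t. v (x, t)) (%t. pd (0, 1) \<phi> (y, t)) = - ip ?I (%t. D (x, t)) (%t. \<phi> (y, t))"
   using D(2)[OF \<phi>s(1)] Y(1) by (intro AE_ball_countable[THEN iffD2] ballI) (auto simp: ae_eq_on_def der ip_def)
  then have ae: "AE x in lborel. x \<in> \<Omega> \<longrightarrow> ip ?I (%t. v (x, t)) (%t. pd (0, 1) \<phi> (x, t)) = - ip ?I (%t. D (x, t)) (%t. \<phi> (x, t))"
   using L2_sections(1)[OF vL[unfolded cylQ_def]] L2_sections(1)[OF D(1)[unfolded cylQ_def]]
  proof eventually_elim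
   case (elim x)
   note h = elim
   show ?case
   proof
    assume x: "x \<in> \<Omega>"
    have "\<exists>y\<in>Y. y \<in> ball x (1 / Suc n)" for n :: nat by (rule Y(2)) auto
    then have "\<forall>n::nat. \<exists>y. y \<in> Y \<and> dist x y < 1 / Suc n" by auto
    from choice[OF this] obtain y where y: "\<forall>n::nat. y n \<in> Y \<and> dist x (y n) < 1 / Suc n" ..
    have "(%n. dist (y n) x) \<longlonglongrightarrow> 0"
     by (rule tendsto_sandwich[OF _ _ tendsto_const LIMSEQ_Suc[OF lim_1_over_n]])
       (use y in \<open>auto intro!: always_eventually simp: dist_commute less_imp_le\<close>)
    then have yx: "y \<longlonglongrightarrow> x" by (rule tendsto_dist_iff[THEN iffD2])
    have lim: "(%n. ip ?I (%t. f (y n, t)) u) \<longlonglongrightarrow> ip ?I (%t. f (x, t)) u"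
     if f: "f \<in> test_fun Q" and u: "u \<in> L2 ?I" for f u
    proof -
     obtain B where B: "\<And>p. \<bar>f p\<bar> \<le> B" using test_fun_bounded[OF f] by blast
     have fL: "(%t. f (z, t)) \<in> L2 ?I" for z
      by (rule test_fun_L2[OF test_fun_slice(2)[OF f[unfolded cylQ_def]] Ib])
     have "(%n. L2_norm ?I (%t. f (y n, t) - f (x, t))) \<longlonglongrightarrow> 0"
     proof (rule L2_dominated_convergence[OF fL fL constI[of "2 * B"]])
      have "(%n. f (y n, t)) \<longlonglongrightarrow> f (x, t)" for t
       by (rule continuous_on_tendsto_compose[OF test_funD(6)[OF f]]) (auto intro!: tendsto_Pair yx)
      then show "AE t in lborel. t \<in> ?I \<longrightarrow> (%n. f (y n, t)) \<longlonglongrightarrow> f (x, t)" by simp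
      show "AE t in lborel. t \<in> ?I \<longrightarrow> \<bar>f (y n, t) - f (x, t)\<bar> \<le> 2 * B" for n
      proof (intro AE_I2 impI)
       fix t show "\<bar>f (y n, t) - f (x, t)\<bar> \<le> 2 * B" using B[of "(y n, t)"] B[of "(x, t)"] by linarith
      qed
     qed
     from ip_tendsto[OF fL fL u this] show ?thesis .
    qed
    have eq: "ip ?I (%t. pd (0, 1) \<phi> (y n, t)) (%t. v (x, t)) = - ip ?I (%t. \<phi> (y n, t)) (%t. D (x, t))" for n
     using h(1) x y by (simp add: ip_commute)
    have "ip ?I (%t. pd (0, 1) \<phi> (x, t)) (%t. v (x, t)) = - ip ?I (%t. \<phi> (x, t)) (%t. D (x, t))"
     by (rule LIMSEQ_unique[OF lim[OF d\<phi>]])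
       (use h x in \<open>auto simp: eq intro!: tendsto_minus lim[OF \<phi>]\<close>)
    then show "ip ?I (%t. v (x, t)) (%t. pd (0, 1) \<phi> (x, t)) = - ip ?I (%t. D (x, t)) (%t. \<phi> (x, t))"
     by (simp add: ip_commute)
   qed
  qed
  have i1: "set_integrable lborel (\<Omega> \<times> ?I) (%p. v p * pd (0, 1) \<phi> p)"
   using L2_mult_integrable[OF vL test_fun_L2[OF d\<phi> borel_Q(1)]] by (simp add: cylQ_def)
  have i2: "set_integrable lborel (\<Omega> \<times> ?I) (%p. D p * \<phi> p)"
   using L2_mult_integrable[OF D(1) test_fun_L2[OF \<phi> borel_Q(1)]] by (simp add: cylQ_def)
  have "ip Q v (pd (0, 1) \<phi>) = (LINT x:\<Omega>|lborel. (LINT t:?I|lborel. v (x, t) * pd (0, 1) \<phi> (x, t)))"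
   unfolding ip_def cylQ_def by (rule set_Fubini(2)[OF i1])
  also have "\<dots> = (LINT x:\<Omega>|lborel. - (LINT t:?I|lborel. D (x, t) * \<phi> (x, t)))"
  proof (rule set_integral_cong_AE_integrable[OF set_Fubini(6)[OF i1]])
   show "set_integrable lborel \<Omega> (%x. - (LINT t:?I|lborel. D (x, t) * \<phi> (x, t)))"
    using set_integrable_mult_right[OF set_Fubini(6)[OF i2], of "-1"] by simp
  qed (use ae in \<open>simp add: ip_def\<close>)
  also have "\<dots> = - ip Q D \<phi>"
   unfolding ip_def cylQ_def set_Fubini(2)[OF i2] by (simp add: set_integral_uminus set_Fubini(6)[OF i2])
  finally show ?thesis .
 qed
 with D(1) show ?thesis by blast
qed

end

text \<open>The gluing takes place where g is already 0. It removes the negative times from a test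
  function that has been cut off near t = 0.\<close>

lemma C_diff_positive_part:
 fixes g :: "'a::euclidean_space \<times> real => real"
 assumes d: "d > 0"
 shows "C_diff k g ==> (\<And>p. \<bar>snd p\<bar> < d ==> g p = 0) ==> C_diff k (%p. if snd p > 0 then g p else 0)"
proof (induction k arbitrary: g)
 case 0
 have o: "open {p :: 'a \<times> real. 0 < snd p}" "open {p :: 'a \<times> real. snd p < d}"
  by (auto intro!: open_Collect_less continuous_intros)
 have "continuous_on ({p. 0 < snd p} \<union> {p. snd p < d}) (%p. if snd p > 0 then g p else 0)"
 proof (rule continuous_on_open_Un[OF o])
  have "continuous_on UNIV g" using 0 by simp
  then show "continuous_on {p. 0 < snd p} (%p. if snd p > 0 then g p else 0)"
   by (rule continuous_on_eq[OF continuous_on_subset]) auto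
  show "continuous_on {p. snd p < d} (%p. if snd p > 0 then g p else 0)"
   by (rule continuous_on_eq[OF continuous_on_const[of _ 0]]) (use 0(2) in auto)
 qed
 moreover have "{p :: 'a \<times> real. 0 < snd p} \<union> {p. snd p < d} = UNIV" using d by auto
 ultimately show ?case by simp
next
 case (Suc k)
 have o: "open {p :: 'a \<times> real. 0 < snd p}" "open {p :: 'a \<times> real. snd p < d}" "open {p :: 'a \<times> real. \<bar>snd p\<bar> < d}"
  by (auto intro!: open_Collect_less continuous_intros)
 have dg: "g differentiable (at p)" for p by (rule C_diff_differentiable[OF Suc.prems(1)])
 have pz: "pd b g p = 0" if "\<bar>snd p\<bar> < d" for b p
  by (rule pd_eq[of g "%_. 0"], rule has_derivative_transform_within_open[OF has_derivative_const[of 0] o(3)])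
    (use that Suc.prems(2) in auto)
 have D: "((%p. if snd p > 0 then g p else 0) has_derivative (%b. if snd p > 0 then pd b g p else 0)) (at p)" for p
 proof (cases "snd p > 0")
  case True
  have "((%p. if snd p > 0 then g p else 0) has_derivative (%b. pd b g p)) (at p)"
   by (rule has_derivative_transform_within_open[OF has_derivative_pd[OF dg] o(1)]) (use True in auto)
  then show ?thesis using True by simp
 next
  case False
  have "((%p. if snd p > 0 then g p else 0) has_derivative (%b. 0)) (at p)"
   by (rule has_derivative_transform_within_open[OF has_derivative_const[of 0] o(2)])
     (use False d Suc.prems(2) in auto)
  then show ?thesis using False by simp
 qed
 have pd: "pd b (%p. if snd p > 0 then g p else 0) = (%p. if snd p > 0 then pd b g p else 0)" for b
  by (rule ext) (rule pd_eq[OF D])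
 have "C_diff k (%p. if snd p > 0 then pd b g p else 0)" if "b \<in> Basis" for b
  by (rule Suc.IH) (use Suc.prems(1) that pz in auto)
 moreover have "(%p. if snd p > 0 then g p else 0) differentiable (at p)" for p
  unfolding differentiable_def by (rule exI) (rule D)
 ultimately show ?case unfolding C_diff.simps pd by blast
qed

section \<open>The initial condition in weak form\<close>

context spacetime
begin

text \<open>Since tests may be nonzero for t \<le> 0, this expresses that the extension by zero to
  earlier times has no jump at t = 0: the zero initial value in the form in which it is used from
  here on.\<close>

definition init_reg :: "('a \<times> real => real) => bool" where
 "init_reg u \<longleftrightarrow> u \<in> H1 Q \<and> (\<forall>c\<in>Basis. \<forall>\<phi>\<in>test_fun (\<Omega> \<times> {..<T}).
   ip Q u (pd c \<phi>) = - ip Q (wd Q u c) \<phi>)"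

text \<open>The weight m h(m t) lives on times up to 2 / m with bounded total mass, while the slices
  of \<open>u\<close> tend to 0 in L2 as t tends to 0.\<close>

lemma vanishing_cutoff_tendsto:
 assumes uL: "u \<in> L2 Q" and van: "vanishes_at \<Omega> T 0 u" and \<phi>: "\<phi> \<in> test_fun (\<Omega> \<times> {..<T})"
  and h: "continuous_on UNIV h" "\<And>s. \<bar>h s\<bar> \<le> C" "\<And>s. 2 \<le> \<bar>s\<bar> ==> h s = 0"
 shows "(%n. ip Q u (%p. real (Suc n) * h (real (Suc n) * snd p) * \<phi> p)) \<longlonglongrightarrow> 0"
proof -
 let ?I = "{0<..<T}"
 obtain w where w: "\<And>t. t \<in> {0..T} ==> w t \<in> L2 \<Omega> \<and> ((%\<tau>. L2_dist \<Omega> (w \<tau>) (w t)) \<longlongrightarrow> 0) (at t within {0..T})"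
  and wu: "AE t in lborel. t \<in> ?I \<longrightarrow> ae_eq_on \<Omega> (w t) (%x. u (x, t))" and w0: "ae_eq_on \<Omega> (w 0) (%x. 0)"
  using van unfolding vanishes_at_def by blast
 obtain B where B: "B > 0" "\<And>p. \<bar>\<phi> p\<bar> \<le> B" using test_fun_bounded[OF \<phi>] by blast
 have \<phi>s: "(%x. \<phi> (x, t)) \<in> L2 \<Omega>" for t by (rule test_fun_L2[OF test_fun_slice(1)[OF \<phi>] borel_Q(3)])
 have one: "(%x. c) \<in> L2 \<Omega>" for c
  by (intro L2_continuous_bounded_set bounded_Omega borel_Q continuous_intros)
 define M where "M = B * L2_norm \<Omega> (%x. 1) + 1"
 have M: "M > 0" using B(1) L2_norm_nonneg[of \<Omega> "%x. 1"] by (simp add: M_def add_nonneg_pos)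
 have \<phi>M: "L2_norm \<Omega> (%x. \<phi> (x, t)) \<le> M" for t
 proof -
  have "L2_norm \<Omega> (%x. \<phi> (x, t)) \<le> L2_norm \<Omega> (%x. B * 1)"
   by (rule L2_norm_mono[OF \<phi>s]) (use one B in auto)
  also have "\<dots> = B * L2_norm \<Omega> (%x. 1)" using B(1) by (subst L2_norm_cmult) simp
  finally show ?thesis by (simp add: M_def)
 qed
 have C: "C \<ge> 0" using h(2)[of 0] by linarith
 show ?thesis
 proof (rule LIMSEQ_I)
  fix e :: real assume e: "e > 0"
  \<comment> \<open>Height m C, time span 2 / m, slice norm e' and test norm M multiply to 2 C M e';
    the summand 1 keeps the divisor positive when C = 0.\<close>
  define e' where "e' = e / (2 * C * M + 1)"
  have CM: "2 * C * M \<ge> 0" using C M by simp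
  then have e': "e' > 0" using e by (simp add: e'_def)
  have "((%\<tau>. L2_dist \<Omega> (w \<tau>) (w 0)) \<longlongrightarrow> 0) (at 0 within {0..T})" using w[of 0] T_pos by simp
  then have "\<forall>\<^sub>F \<tau> in at 0 within {0..T}. L2_dist \<Omega> (w \<tau>) (w 0) < e'" by (rule order_tendstoD(2)[OF _ e'])
  then obtain d where d: "d > 0" "\<And>\<tau>. \<tau> \<in> {0..T} ==> \<tau> \<noteq> 0 ==> dist \<tau> 0 < d ==> L2_dist \<Omega> (w \<tau>) (w 0) < e'"
   unfolding eventually_at by blast
  have wt: "L2_norm \<Omega> (w t) \<le> e'" if t: "t \<in> ?I" "t < d" for t
  proof -
   have wL: "w t \<in> L2 \<Omega>" "w 0 \<in> L2 \<Omega>" using w[of t] w[of 0] t(1) by auto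
   have "L2_norm \<Omega> (%x. (w t x - w 0 x) + w 0 x) \<le> L2_dist \<Omega> (w t) (w 0) + L2_norm \<Omega> (w 0)"
    by (rule L2_norm_triangle[OF L2_diff[OF wL] wL(2)])
   moreover have "L2_norm \<Omega> (w 0) = 0" using L2_norm_eq_0_iff[OF wL(2)] w0 by simp
   moreover have "L2_dist \<Omega> (w t) (w 0) < e'" using t by (intro d(2)) auto
   ultimately show ?thesis by simp
  qed
  obtain N :: nat where N: "2 / d < real N" using reals_Archimedean2 by blast
  show "\<exists>N. \<forall>n\<ge>N. norm (ip Q u (%p. real (Suc n) * h (real (Suc n) * snd p) * \<phi> p) - 0) < e"
  proof (intro exI[of _ N] allI impI)
   fix n assume n: "N \<le> n"
   define m where "m = real (Suc n)"
   have m: "m > 0" "2 / m < d"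
   proof -
    show "m > 0" by (simp add: m_def)
    have "2 / d < m" using N n unfolding m_def by linarith
    then show "2 / m < d" using d(1) \<open>m > 0\<close> by (simp add: field_simps)
   qed
   let ?f = "%p. m * h (m * snd p) * \<phi> p"
   have hc: "continuous_on UNIV (%p::'a \<times> real. h (m * snd p))"
    by (rule continuous_on_compose2[OF h(1)]) (auto intro!: continuous_intros)
   have fL: "?f \<in> L2 Q"
    by (intro L2_continuous_bounded_set bounded_Q borel_Q continuous_intros hc test_funD(6)[OF \<phi>])
   have i: "set_integrable lborel (\<Omega> \<times> ?I) (%p. u p * ?f p)"
    using L2_mult_integrable[OF uL fL] by (simp add: cylQ_def)
   have "ip Q u ?f = (LINT t:?I|lborel. (LINT x:\<Omega>|lborel. u (x, t) * (m * h (m * t) * \<phi> (x, t))))"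
    unfolding ip_def cylQ_def set_Fubini(1)[OF i] by simp
   also have "\<bar>\<dots>\<bar> \<le> (LINT t|lborel. m * C * e' * M * indicator {0..2 / m} t)"
    unfolding set_lebesgue_integral_def[of lborel ?I] real_norm_def[symmetric]
   proof (rule order_trans[OF integral_norm_bound], rule integral_mono_AE)
    show "integrable lborel (%t. norm (indicator ?I t *\<^sub>R (LINT x:\<Omega>|lborel. u (x, t) * (m * h (m * t) * \<phi> (x, t)))))"
     using set_Fubini(5)[OF i] by (simp add: set_integrable_def)
    show "integrable lborel (%t. m * C * e' * M * indicator {0..2 / m} t)"
     by (rule integrable_mult_right, rule integrable_real_indicator) (use m(1) in auto)
    show "AE t in lborel. norm (indicator ?I t *\<^sub>R (LINT x:\<Omega>|lborel. u (x, t) * (m * h (m * t) * \<phi> (x, t))))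
      \<le> m * C * e' * M * indicator {0..2 / m} t"
     using wu L2_sections(2)[OF uL[unfolded cylQ_def]]
    proof eventually_elim
     fix t assume hy: "t \<in> ?I \<longrightarrow> ae_eq_on \<Omega> (w t) (%x. u (x, t))" "t \<in> ?I \<longrightarrow> (%x. u (x, t)) \<in> L2 \<Omega>"
     have nn: "0 \<le> m * C * e' * M * indicator {0..2 / m} t" using m(1) C e' M by simp
     show "norm (indicator ?I t *\<^sub>R (LINT x:\<Omega>|lborel. u (x, t) * (m * h (m * t) * \<phi> (x, t))))
      \<le> m * C * e' * M * indicator {0..2 / m} t"
     proof (cases "t \<in> ?I \<and> t < 2 / m")
      case False
      have "t \<notin> ?I \<or> h (m * t) = 0" using False m(1) by (auto intro!: h(3) simp: field_simps)
      then show ?thesis using nn by auto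
     next
      case True
      then have uLt: "(%x. u (x, t)) \<in> L2 \<Omega>" and wLt: "w t \<in> L2 \<Omega>" using hy w[of t] by auto
      have "L2_norm \<Omega> (%x. u (x, t)) = L2_norm \<Omega> (w t)"
       using L2_norm_cong_AE[OF wLt uLt] hy True by simp
      also have "\<dots> \<le> e'" using True m(2) by (intro wt) auto
      finally have ue: "L2_norm \<Omega> (%x. u (x, t)) \<le> e'" .
      have "\<bar>ip \<Omega> (%x. u (x, t)) (%x. \<phi> (x, t))\<bar> \<le> e' * M"
       by (rule order_trans[OF ip_CS[OF uLt \<phi>s]]) (intro mult_mono ue \<phi>M L2_norm_nonneg less_imp_le[OF e'])
      then have le: "\<bar>m * h (m * t)\<bar> * \<bar>ip \<Omega> (%x. u (x, t)) (%x. \<phi> (x, t))\<bar> \<le> (m * C) * (e' * M)"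
       using m(1) h(2)[of "m * t"] C by (intro mult_mono) (auto simp: abs_mult)
      have Z: "(LINT x:\<Omega>|lborel. u (x, t) * (m * h (m * t) * \<phi> (x, t))) = m * h (m * t) * ip \<Omega> (%x. u (x, t)) (%x. \<phi> (x, t))"
       unfolding ip_cmult_right[symmetric] by (simp add: ip_def)
      show ?thesis unfolding Z using le True by (simp add: abs_mult mult_ac)
     qed
    qed
   qed
   also have "\<dots> = m * C * e' * M * (2 / m)" using m(1) by simp
   also have "\<dots> = 2 * C * M * e'" using m(1) by simp
   also have "\<dots> < (2 * C * M + 1) * e'" using e' by (simp add: distrib_right)
   also have "\<dots> = e" using CM by (simp add: e'_def)
   finally show "norm (ip Q u (%p. real (Suc n) * h (real (Suc n) * snd p) * \<phi> p) - 0) < e" by (simp add: m_def)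
  qed
 qed
qed

text \<open>The test function is cut off near t = 0. The one new term carries the derivative of the
  cutoff, and the vanishing initial value makes it disappear in the limit.\<close>

lemma time_deriv_vanishing:
 assumes uL: "u \<in> L2 Q" and D: "D \<in> L2 Q"
  and der: "\<And>\<phi>. \<phi> \<in> test_fun Q ==> ip Q u (pd (0, 1) \<phi>) = - ip Q D \<phi>"
  and van: "vanishes_at \<Omega> T 0 u" and \<phi>: "\<phi> \<in> test_fun (\<Omega> \<times> {..<T})"
 shows "ip Q u (pd (0, 1) \<phi>) = - ip Q D \<phi>"
proof -
 note e01 = time_Basis
 have "\<exists>h \<delta>. h \<in> test_fun (ball 0 2) \<and> (\<forall>x. 0 \<le> h x \<and> h x \<le> 1) \<and> \<delta> > 0 \<and>
  (\<forall>x\<in>cball (0::real) 1. \<forall>z. norm z < \<delta> \<longrightarrow> h (x + z) = 1)"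
  by (rule smooth_cutoff) auto
 then obtain h \<delta> where h: "h \<in> test_fun (ball (0::real) 2)" "\<And>x. 0 \<le> h x \<and> h x \<le> 1"
  and \<delta>: "\<delta> > 0" "\<And>x z. x \<in> cball (0::real) 1 ==> norm z < \<delta> ==> h (x + z) = 1" by blast
 have h1: "h s = 1" if "\<bar>s\<bar> \<le> 1" for s using \<delta>(2)[of s 0] \<delta>(1) that by simp
 have h0: "h s = 0" if "2 \<le> \<bar>s\<bar>" for s by (rule test_funD(5)[OF h(1)]) (use that in auto)
 define h' where "h' = pd 1 h"
 have h't: "h' \<in> test_fun (ball 0 2)" unfolding h'_def by (rule test_fun_pd[OF h(1)]) simp
 have h'0: "h' s = 0" if "2 \<le> \<bar>s\<bar>" for s by (rule test_funD(5)[OF h't]) (use that in auto)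
 obtain C where C: "\<And>s. \<bar>h' s\<bar> \<le> C" using test_fun_bounded[OF h't] by blast
 \<comment> \<open>Zero for |t| \<le> 1 / Suc n and one for |t| \<ge> 2 / Suc n.\<close>
 define \<kappa> where "\<kappa> n p = 1 - h (real (Suc n) * snd p)" for n and p :: "'a \<times> real"
 \<comment> \<open>\<phi> may live at negative times as well; that part is discarded to obtain a
   test function on Q.\<close>
 define \<psi> where "\<psi> n p = (if snd p > 0 then \<kappa> n p * \<phi> p else 0)" for n p
 have bl: "bounded_linear (%p::'a \<times> real. c * snd p)" for c
  by (rule bounded_linear_compose[OF bounded_linear_mult_right bounded_linear_snd])
 have C\<kappa>: "C_diff k (\<kappa> n)" for k n
  unfolding \<kappa>_def[abs_def] using C_diff_compose_affine[OF bl test_funD(1)[OF h(1)], of k 0]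
  by (intro C_diff_diff C_diff_const) simp
 have \<psi>z: "\<kappa> n p = 0" if "\<bar>snd p\<bar> < 1 / real (Suc n)" for n p
 proof -
  have "\<bar>real (Suc n) * snd p\<bar> = real (Suc n) * \<bar>snd p\<bar>" by (simp add: abs_mult)
  also have "\<dots> \<le> real (Suc n) * (1 / real (Suc n))" using that by (intro mult_left_mono) auto
  finally show ?thesis by (simp add: \<kappa>_def h1)
 qed
 have \<psi>t: "\<psi> n \<in> test_fun Q" for n
 proof -
  obtain K where K: "compact K" "K \<subseteq> \<Omega> \<times> {..<T}" "\<And>x. x \<notin> K ==> \<phi> x = 0"
   using test_fun_support[OF \<phi>] by blast
  show ?thesis
  proof (rule test_funI)
   show "C_diff k (\<psi> n)" for k
    unfolding \<psi>_def[abs_def]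
    by (rule C_diff_positive_part[of "1 / real (Suc n)"]) (use \<psi>z in \<open>auto intro!: C_diff_mult C\<kappa> test_funD(1)[OF \<phi>] simp del: C_diff.simps\<close>)
   show "compact (K \<inter> {p. 1 / real (Suc n) \<le> snd p})"
    by (intro compact_Int_closed K closed_Collect_le continuous_intros)
   show "K \<inter> {p. 1 / real (Suc n) \<le> snd p} \<subseteq> Q"
   proof
    fix p assume p: "p \<in> K \<inter> {p. 1 / real (Suc n) \<le> snd p}"
    have "0 < 1 / real (Suc n)" by simp
    then have "0 < snd p" by (rule less_le_trans) (use p in blast)
    then show "p \<in> Q" using p K(2) by (cases p) (auto simp: cylQ_def)
   qed
   show "\<psi> n p = 0" if "p \<notin> K \<inter> {p. 1 / real (Suc n) \<le> snd p}" for p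
    using that K(3)[of p] \<psi>z[of p n] by (auto simp: \<psi>_def simp del: of_nat_Suc)
  qed
 qed
 have pd: "pd (0, 1) (\<psi> n) p = \<kappa> n p * pd (0, 1) \<phi> p - real (Suc n) * h' (real (Suc n) * snd p) * \<phi> p"
  if p: "p \<in> Q" for n p
 proof -
  have sp: "snd p > 0" using p by (auto simp: cylQ_def)
  have dh: "(%p::'a \<times> real. h (real (Suc n) * snd p)) differentiable (at p)"
   using C_diff_differentiable[OF C_diff_compose_affine[OF bl test_funD(1)[OF h(1)]], of 0] by (simp only: add_0_left)
  have lin: "linear (%v. pd v h (real (Suc n) * snd p))"
   using has_derivative_pd[OF test_funD(7)[OF h(1)]] has_derivative_linear by blast
  have "pd (0, 1) (%p::'a \<times> real. h (real (Suc n) * snd p)) p = pd (real (Suc n) *\<^sub>R 1) h (real (Suc n) * snd p)"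
   using pd_compose_affine[OF bl, of h 0 "real (Suc n)" p "(0, 1)"] test_funD(7)[OF h(1)] by simp
  also have "\<dots> = real (Suc n) * h' (real (Suc n) * snd p)" unfolding h'_def using linear_scale[OF lin, of "real (Suc n)" 1] by (simp only: real_scaleR_def)
  finally have pdh: "pd (0, 1) (\<kappa> n) p = - (real (Suc n) * h' (real (Suc n) * snd p))"
   unfolding \<kappa>_def[abs_def] by (subst pd_diff[OF _ dh]) (auto intro: pd_eq simp: pd_eq[OF has_derivative_const])
  have dk: "\<kappa> n differentiable (at p)" by (rule C_diff_differentiable[OF C\<kappa>])
  have o: "open {p :: 'a \<times> real. 0 < snd p}" by (auto intro!: open_Collect_less continuous_intros)
  have "((%p. \<kappa> n p * \<phi> p) has_derivative (%b. pd b (%p. \<kappa> n p * \<phi> p) p)) (at p)"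
   by (intro has_derivative_pd differentiable_mult dk test_funD(7)[OF \<phi>])
  then have "(\<psi> n has_derivative (%b. pd b (%p. \<kappa> n p * \<phi> p) p)) (at p)"
   by (rule has_derivative_transform_within_open[OF _ o]) (use sp in \<open>auto simp: \<psi>_def\<close>)
  from pd_eq[OF this]
  show ?thesis by (simp add: pd_mult[OF dk test_funD(7)[OF \<phi>]] pdh)
 qed
 have \<kappa>lim: "(%n. ip Q v (%p. \<kappa> n p * f p)) \<longlonglongrightarrow> ip Q v f" and \<kappa>L: "(%p. \<kappa> n p * f p) \<in> L2 Q"
  if f: "f \<in> test_fun (\<Omega> \<times> {..<T})" and v: "v \<in> L2 Q" for f v n
 proof -
  have fL: "f \<in> L2 Q" by (rule test_fun_L2[OF f borel_Q(1)])
  show kL: "(%p. \<kappa> n p * f p) \<in> L2 Q" for n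
   by (rule test_fun_L2[OF test_fun_mult[OF f C\<kappa>] borel_Q(1)])
  have "(%n. L2_norm Q (%p. \<kappa> n p * f p - f p)) \<longlonglongrightarrow> 0"
  proof (rule L2_dominated_convergence[OF kL fL L2_abs[OF fL]])
   show "AE p in lborel. p \<in> Q \<longrightarrow> (%n. \<kappa> n p * f p) \<longlonglongrightarrow> f p"
   proof (intro AE_I2 impI)
    fix p assume "p \<in> Q"
    then have sp: "snd p > 0" by (auto simp: cylQ_def)
    obtain N :: nat where N: "2 / snd p < real N" using reals_Archimedean2 by blast
    have "\<kappa> n p * f p = f p" if "n \<ge> N" for n
    proof -
     have "2 / snd p < real (Suc n)" using N that by linarith
     then have "2 \<le> \<bar>real (Suc n) * snd p\<bar>" using sp by (simp add: field_simps)
     then show ?thesis by (simp add: \<kappa>_def h0)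
    qed
    then show "(%n. \<kappa> n p * f p) \<longlonglongrightarrow> f p"
     by (intro tendsto_eventually) (auto simp: eventually_sequentially)
   qed
   show "AE p in lborel. p \<in> Q \<longrightarrow> \<bar>\<kappa> n p * f p - f p\<bar> \<le> \<bar>f p\<bar>" for n
   proof (intro AE_I2 impI)
    fix p
    have "\<bar>h (real (Suc n) * snd p)\<bar> * \<bar>f p\<bar> \<le> 1 * \<bar>f p\<bar>"
     using h(2)[of "real (Suc n) * snd p"] by (intro mult_right_mono) auto
    then show "\<bar>\<kappa> n p * f p - f p\<bar> \<le> \<bar>f p\<bar>" by (simp add: \<kappa>_def left_diff_distrib abs_mult)
   qed
  qed
  from ip_tendsto[OF kL fL v this] show "(%n. ip Q v (%p. \<kappa> n p * f p)) \<longlonglongrightarrow> ip Q v f"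
   by (simp add: ip_commute[of Q v])
 qed
 note d\<phi> = test_fun_pd[OF \<phi> e01]
 define r where "r n p = real (Suc n) * h' (real (Suc n) * snd p) * \<phi> p" for n p
 have rL: "r n \<in> L2 Q" for n
  unfolding r_def[abs_def]
  by (intro L2_continuous_bounded_set bounded_Q borel_Q continuous_intros test_funD(6)[OF \<phi>]
    continuous_on_compose2[OF test_funD(6)[OF h't]]) auto
 have "ip Q u (%p. \<kappa> n p * pd (0, 1) \<phi> p) - ip Q u (r n) = - ip Q D (%p. \<kappa> n p * \<phi> p)" for n
 proof -
  have "ip Q u (pd (0, 1) (\<psi> n)) = ip Q u (%p. \<kappa> n p * pd (0, 1) \<phi> p - r n p)"
   unfolding ip_def by (rule set_lebesgue_integral_cong) (use borel_Q pd in \<open>auto simp: r_def\<close>)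
  also have "\<dots> = ip Q u (%p. \<kappa> n p * pd (0, 1) \<phi> p) - ip Q u (r n)"
   by (rule ip_diff_right[OF \<kappa>L[OF d\<phi> uL] rL uL])
  moreover have "ip Q D (\<psi> n) = ip Q D (%p. \<kappa> n p * \<phi> p)"
   unfolding ip_def by (rule set_lebesgue_integral_cong) (use borel_Q in \<open>auto simp: \<psi>_def cylQ_def\<close>)
  ultimately show ?thesis using der[OF \<psi>t] by simp
 qed
 then have eq: "ip Q u (%p. \<kappa> n p * pd (0, 1) \<phi> p) = - ip Q D (%p. \<kappa> n p * \<phi> p) + ip Q u (r n)" for n
  by (simp add: algebra_simps)
 have "(%n. ip Q u (r n)) \<longlonglongrightarrow> 0"
  unfolding r_def[abs_def] by (rule vanishing_cutoff_tendsto[OF uL van \<phi> test_funD(6)[OF h't] C h'0])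
 then have "(%n. - ip Q D (%p. \<kappa> n p * \<phi> p) + ip Q u (r n)) \<longlonglongrightarrow> - ip Q D \<phi> + 0"
  by (intro tendsto_intros \<kappa>lim[OF \<phi> D])
 moreover have "(%n. - ip Q D (%p. \<kappa> n p * \<phi> p) + ip Q u (r n)) \<longlonglongrightarrow> ip Q u (pd (0, 1) \<phi>)"
  unfolding eq[symmetric] by (rule \<kappa>lim[OF d\<phi> uL])
 ultimately show ?thesis using LIMSEQ_unique by fastforce
qed

text \<open>Spatial derivatives come from the slices, the time derivative from the cutoff argument.
  The slice space \<open>X\<close> is general so that both \<open>H1\<close> and \<open>H10\<close>
  are covered.\<close>

theorem init_reg_H11:
 assumes u: "u \<in> L2_time X \<Omega> T" "u \<in> H1_time \<Omega> T" "vanishes_at \<Omega> T 0 u"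
 shows "init_reg u"
proof -
 have uL: "u \<in> L2 Q" using u(1) by (simp add: L2_time_def)
 obtain G where G: "\<And>b. b \<in> Basis ==> G b \<in> L2 Q"
  "\<And>b \<phi>. b \<in> Basis ==> \<phi> \<in> test_fun (\<Omega> \<times> UNIV) ==> ip Q u (pd (b, 0) \<phi>) = - ip Q (G b) \<phi>"
  using L2_time_space_deriv[OF u(1)] by blast
 obtain D where D: "D \<in> L2 Q" "\<And>\<phi>. \<phi> \<in> test_fun Q ==> ip Q u (pd (0, 1) \<phi>) = - ip Q D \<phi>"
  using H1_time_deriv[OF u(2)] by blast
 define g where "g c = (if snd c = 0 then G (fst c) else D)" for c :: "'a \<times> real"
 have gL: "g c \<in> L2 Q" if "c \<in> Basis" for c
  by (rule Basis_spacetime[OF _ _ that, of "%c. g c \<in> L2 Q"]) (auto simp: g_def G D)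
 have id: "ip Q u (pd c \<phi>) = - ip Q (g c) \<phi>" if c: "c \<in> Basis" and \<phi>: "\<phi> \<in> test_fun (\<Omega> \<times> {..<T})" for c \<phi>
 proof (rule Basis_spacetime[OF _ _ c, of "%c. ip Q u (pd c \<phi>) = - ip Q (g c) \<phi>"])
  show "ip Q u (pd (0, 1) \<phi>) = - ip Q (g (0, 1)) \<phi>"
   using time_deriv_vanishing[OF uL D u(3) \<phi>] by (simp add: g_def)
  show "ip Q u (pd (b, 0) \<phi>) = - ip Q (g (b, 0)) \<phi>" if "b \<in> Basis" for b
   using G(2)[OF that test_fun_mono[OF \<phi>]] by (auto simp: g_def)
 qed
 have sub: "Q \<subseteq> \<Omega> \<times> {..<T}" by (auto simp: cylQ_def)
 have w: "has_weak_deriv Q u c (g c)" if "c \<in> Basis" for c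
  unfolding has_weak_deriv_ip using id[OF that test_fun_mono[OF _ sub]] by blast
 have uH: "u \<in> H1 Q" by (rule H1I[OF uL gL w])
 have "ip Q u (pd c \<phi>) = - ip Q (wd Q u c) \<phi>" if c: "c \<in> Basis" and \<phi>: "\<phi> \<in> test_fun (\<Omega> \<times> {..<T})" for c \<phi>
  using id[OF that] ip_cong_AE[OF weak_deriv_eq(2)[OF open_Q(1) gL[OF c] w[OF c]] gL[OF c]
    test_fun_L2[OF \<phi> borel_Q(1)] weak_deriv_eq(1)[OF open_Q(1) gL[OF c] w[OF c]]] by simp
 with uH show ?thesis by (simp add: init_reg_def)
qed

end

lemma H1_subset:
 assumes U: "open U" and V: "open V" "V \<subseteq> U" and u: "u \<in> H1 U"
 shows "u \<in> H1 V" "b \<in> Basis ==> ae_eq_on V (wd V u b) (wd U u b)" "gnorm V u \<le> gnorm U u"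
proof -
 have Vb: "V \<in> sets borel" using V by simp
 have g: "wd U u b \<in> L2 V" "has_weak_deriv V u b (wd U u b)" if "b \<in> Basis" for b
  using L2_subset[OF weak_deriv_H1(1)[OF u that] V(2) Vb] has_weak_deriv_subset[OF weak_deriv_H1(2)[OF u that] V(2)] by auto
 show "u \<in> H1 V" by (rule H1I[OF L2_subset[OF H1_L2[OF u] V(2) Vb] g])
 show "ae_eq_on V (wd V u b) (wd U u b)" if "b \<in> Basis"
  by (rule weak_deriv_eq(1)[OF V(1) g[OF that]])
 have "gnorm V u = L2_set (%b. L2_norm V (wd U u b)) Basis" by (rule gnorm_eq[OF V(1) g])
 also have "\<dots> \<le> gnorm U u" unfolding gnorm_def
  by (rule L2_set_mono) (auto intro!: L2_norm_subset weak_deriv_H1[OF u] V Vb L2_norm_nonneg)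
 finally show "gnorm V u \<le> gnorm U u" .
qed

lemma wform_cong:
 assumes U: "open U" and u: "u \<in> H1 U" and v: "v \<in> H1 U" and w: "w \<in> L2 U" "ae_eq_on U v w"
 shows "w \<in> H1 U" "wform \<sigma> U u w = wform \<sigma> U u v" "gnorm U w = gnorm U v"
proof -
 have Ub: "U \<in> sets borel" using U by simp
 have d: "has_weak_deriv U w b (wd U v b)" if "b \<in> Basis" for b
  by (rule has_weak_deriv_cong_AE[OF Ub that H1_L2[OF v] w weak_deriv_H1(2)[OF v that]])
 show "w \<in> H1 U" by (rule H1I[OF w(1) weak_deriv_H1(1)[OF v] d])
 note e = weak_deriv_eq[OF U weak_deriv_H1(1)[OF v] d]
 show "gnorm U w = gnorm U v"
  unfolding gnorm_def by (rule L2_set_cong) (auto intro!: L2_norm_cong_AE e weak_deriv_H1[OF v])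
 have "ip U (wd U w b) (wd U u b) = ip U (wd U v b) (wd U u b)" if b: "b \<in> Basis" for b
  by (rule ip_cong_AE[OF e(2)[OF b b] weak_deriv_H1(1)[OF v b] weak_deriv_H1(1)[OF u b] e(1)[OF b b]])
 then show "wform \<sigma> U u w = wform \<sigma> U u v"
  unfolding wform_commute[of \<sigma> U u] by (simp add: wform_def)
qed

lemma energy_norm_eq: "energy_norm U v = gnorm U v"
proof -
 have "(\<Sum>c\<in>Basis. (L2_norm U (wd U v c))\<^sup>2) =
   (\<Sum>b\<in>Basis. (L2_norm U (wd U v (b, 0)))\<^sup>2) + (L2_norm U (wd U v (0, 1)))\<^sup>2"
  by (simp add: Basis_prod_def sum.union_disjoint sum.reindex inj_on_def disjoint_iff image_iff)
 then show ?thesis by (simp add: energy_norm_def gnorm_def L2_set_def)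
qed

section \<open>Reversal of time\<close>

lemma lborel_distr_time_reflect:
 "distr lborel borel (%p. (fst p, T - snd p)) = (lborel :: ('a::euclidean_space \<times> real) measure)"
proof -
 define c where "c j = (if snd j = 0 then 1 else -1 :: real)" for j :: "'a \<times> real"
 have "(0, T) + (\<Sum>j\<in>Basis. (c j * (x \<bullet> j)) *\<^sub>R j) = (fst x, T - snd x)" for x :: "'a \<times> real"
 proof (rule euclidean_eqI)
  fix b :: "'a \<times> real" assume b: "b \<in> Basis"
  have "((0, T) + (\<Sum>j\<in>Basis. (c j * (x \<bullet> j)) *\<^sub>R j)) \<bullet> b = (0, T) \<bullet> b + c b * (x \<bullet> b)"
   using b by (simp add: inner_add_left inner_sum_left inner_Basis if_distrib[of "%a. _ * a"] sum.delta cong: if_cong)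
  also have "\<dots> = (fst x, T - snd x) \<bullet> b"
   using b by (auto simp: c_def Basis_prod_def inner_prod_def)
  finally show "((0, T) + (\<Sum>j\<in>Basis. (c j * (x \<bullet> j)) *\<^sub>R j)) \<bullet> b = (fst x, T - snd x) \<bullet> b" .
 qed
 moreover have "lborel = density (distr lborel borel (%x. (0, T) + (\<Sum>j\<in>Basis. (c j * (x \<bullet> j)) *\<^sub>R j))) (%_. \<Prod>j\<in>Basis. \<bar>c j\<bar>)"
  by (rule lborel_affine_euclidean) (simp add: c_def)
 moreover have "(\<Prod>j\<in>Basis. \<bar>c j\<bar>) = 1" by (rule prod.neutral) (simp add: c_def)
 ultimately show ?thesis by (simp add: density_1)
qed

lemma AE_reflect:
 assumes "AE t in lborel. P t"
 shows "AE t in lborel. P (T - t :: real)"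
proof (rule AE_distrD[of "%t. T - t" lborel borel P])
 show "AE t in distr lborel borel (%t. T - t). P t"
  unfolding lborel_distr_reflect by (rule assms)
qed simp

context spacetime
begin

definition rv :: "('a \<times> real => real) => 'a \<times> real => real" where
 "rv u = (%p. u (fst p, T - snd p))"

text \<open>It has two uses: the signature of the wave form, and the factor that a derivative
  acquires under time reversal. In a form evaluated at two reversed functions these factors square
  to 1.\<close>

definition tsign :: "'a \<times> real => real" where
 "tsign c = (if snd c = 0 then 1 else -1)"

abbreviation "wave_form \<equiv> wform tsign Q"

lemma tsign_simps: "\<bar>tsign c\<bar> = 1" "tsign c * tsign c = 1" "tsign c * (tsign c * a) = a"
 by (auto simp: tsign_def)

lemma rv_apply [simp]: "rv u (x, t) = u (x, T - t)"
 by (simp add: rv_def)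

lemma rv_rv [simp]: "rv (rv u) = u"
 by (simp add: rv_def)

lemma rv_linear: "rv (%p. u p + v p) = (%p. rv u p + rv v p)" "rv (%p. u p - v p) = (%p. rv u p - rv v p)"
 "rv (%p. c * u p) = (%p. c * rv u p)"
 by (auto simp: rv_def)

lemma measurable_time_reflect: "(%p::'a \<times> real. (fst p, T - snd p)) \<in> borel_measurable borel"
 by (intro borel_measurable_continuous_onI continuous_intros)

lemma indicator_rv: "indicator Q (fst p, T - snd p) = indicator Q p"
 by (cases p) (auto simp: indicator_def cylQ_def)

lemma rv_integral:
 assumes "(%p. indicator Q p * f p) \<in> borel_measurable borel"
 shows "(LINT p:Q|lborel. rv f p) = (LINT p:Q|lborel. f p)"
proof -
 have "(LINT p:Q|lborel. f p) = (LINT p|distr lborel borel (%p. (fst p, T - snd p)). indicator Q p * f p)"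
  by (simp add: lborel_distr_time_reflect set_lebesgue_integral_def)
 also have "\<dots> = (LINT p|lborel. indicator Q (fst p, T - snd p) * f (fst p, T - snd p))"
  by (rule integral_distr) (use assms measurable_time_reflect in auto)
 finally show ?thesis by (simp add: indicator_rv set_lebesgue_integral_def rv_def)
qed

lemma rv_L2:
 assumes f: "f \<in> L2 Q"
 shows "rv f \<in> L2 Q"
proof -
 have m[measurable]: "(%p. indicator Q p * f p) \<in> borel_measurable borel"
  using L2_measurable[OF f] by simp
 have eq: "indicator Q p * rv f p = (%p. indicator Q p * f p) (fst p, T - snd p)" for p
  by (simp add: indicator_rv rv_def)
 have "(%p. indicator Q p * rv f p) \<in> borel_measurable borel" 
  unfolding eq by (rule measurable_compose[OF measurable_time_reflect m])
 moreover have "integrable (distr lborel borel (%p. (fst p, T - snd p))) (%p. (indicator Q p * f p)\<^sup>2)"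
  using f by (simp add: lborel_distr_time_reflect L2_iff)
 then have "integrable lborel (%p. ((%p. indicator Q p * f p) (fst p, T - snd p))\<^sup>2)"
  using integrable_distr[of "%p. (fst p, T - snd p)" lborel borel "%p. (indicator Q p * f p)\<^sup>2"]
   measurable_time_reflect m by simp
 ultimately show ?thesis by (simp add: L2_iff eq)
qed

lemma rv_ip:
 assumes "f \<in> L2 Q"
 shows "g \<in> L2 Q ==> ip Q (rv f) (rv g) = ip Q f g" "L2_norm Q (rv f) = L2_norm Q f"
proof -
 have i: "ip Q (rv f) (rv g) = ip Q f g" if "f \<in> L2 Q" "g \<in> L2 Q" for f g
  using rv_integral[of "%p. f p * g p"] borel_measurable_integrable[OF L2_mult_integrable[OF that, unfolded set_integrable_def]]
  by (simp add: ip_def rv_def)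
 show "g \<in> L2 Q ==> ip Q (rv f) (rv g) = ip Q f g" "L2_norm Q (rv f) = L2_norm Q f"
  using i assms by (auto simp: L2_norm_ip)
qed

lemma C_diff_rv:
 assumes "C_diff k u"
 shows "C_diff k (rv u)"
proof -
 have bl: "bounded_linear (%p::'a \<times> real. (fst p, - snd p))"
  by (intro bounded_linear_Pair bounded_linear_fst bounded_linear_minus bounded_linear_snd)
 show ?thesis using C_diff_compose_affine[OF bl assms, of "(0, T)"] by (simp add: rv_def)
qed

lemma pd_rv:
 assumes u: "\<And>p. u differentiable (at p)" and c: "c \<in> Basis"
 shows "pd c (rv u) = (%p. tsign c * rv (pd c u) p)"
proof
 fix p
 have bl: "bounded_linear (%p::'a \<times> real. (fst p, - snd p))"
  by (intro bounded_linear_Pair bounded_linear_fst bounded_linear_minus bounded_linear_snd)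
 have "pd c (rv u) p = pd (fst c, - snd c) u (fst p, T - snd p)"
  using pd_compose_affine[OF bl, of u "(0, T)" p c] u by (simp add: rv_def)
 also have "(fst c, - snd c) = (if snd c = 0 then c else - c)"
  using c by (auto simp: Basis_prod_def)
 finally show "pd c (rv u) p = tsign c * rv (pd c u) p"
  using pd_minus[OF u] by (simp add: tsign_def rv_def)
qed

lemma test_fun_rv:
 assumes \<phi>: "\<phi> \<in> test_fun Q"
 shows "rv \<phi> \<in> test_fun Q"
proof -
 obtain K where K: "compact K" "K \<subseteq> Q" "\<And>x. x \<notin> K ==> \<phi> x = 0"
  using test_fun_support[OF \<phi>] by blast
 show ?thesis
 proof (rule test_funI)
  show "C_diff k (rv \<phi>)" for k by (rule C_diff_rv[OF test_funD(1)[OF \<phi>]])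
  show "compact ((%p. (fst p, T - snd p)) ` K)"
   by (intro compact_continuous_image K(1) continuous_intros)
  show "(%p. (fst p, T - snd p)) ` K \<subseteq> Q" using K(2) by (auto simp: cylQ_def)
  show "rv \<phi> p = 0" if "p \<notin> (%p. (fst p, T - snd p)) ` K" for p
  proof -
   have "(fst p, T - snd p) \<notin> K" using that by (force simp: image_iff)
   then show ?thesis by (simp add: rv_def K(3))
  qed
 qed
qed

lemma has_weak_deriv_rv:
 assumes u: "u \<in> L2 Q" "g \<in> L2 Q" and w: "has_weak_deriv Q u c g" and c: "c \<in> Basis"
 shows "has_weak_deriv Q (rv u) c (%p. tsign c * rv g p)"
 unfolding has_weak_deriv_ip
proof
 fix \<phi> assume \<phi>: "\<phi> \<in> test_fun Q"
 note rt = test_fun_rv[OF \<phi>]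
 have L: "rv \<phi> \<in> L2 Q" "pd c (rv \<phi>) \<in> L2 Q" "\<phi> \<in> L2 Q"
  using test_fun_L2[OF rt borel_Q(1)] test_fun_L2[OF test_fun_pd[OF rt c] borel_Q(1)] test_fun_L2[OF \<phi> borel_Q(1)] by auto
 have "pd c \<phi> = (%p. tsign c * rv (pd c (rv \<phi>)) p)"
  using pd_rv[OF test_funD(7)[OF rt] c] by simp
 then have "ip Q (rv u) (pd c \<phi>) = tsign c * ip Q u (pd c (rv \<phi>))"
  using rv_ip(1)[OF u(1) L(2)] by (simp add: ip_cmult_right)
 also have "\<dots> = - (tsign c * ip Q g (rv \<phi>))" using w rt by (simp add: has_weak_deriv_ip)
 also have "ip Q g (rv \<phi>) = ip Q (rv g) \<phi>" using rv_ip(1)[OF rv_L2[OF u(2)] L(3)] by simp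
 finally show "ip Q (rv u) (pd c \<phi>) = - ip Q (%p. tsign c * rv g p) \<phi>" by (simp add: ip_cmult_left)
qed

lemma H1_rv:
 assumes u: "u \<in> H1 Q"
 shows "rv u \<in> H1 Q" "c \<in> Basis ==> ae_eq_on Q (wd Q (rv u) c) (%p. tsign c * rv (wd Q u c) p)"
  "gnorm Q (rv u) = gnorm Q u"
proof -
 have g: "(%p. tsign c * rv (wd Q u c) p) \<in> L2 Q"
  "has_weak_deriv Q (rv u) c (%p. tsign c * rv (wd Q u c) p)" if c: "c \<in> Basis" for c
  by (rule L2_cmult[OF rv_L2[OF weak_deriv_H1(1)[OF u c]]],
    rule has_weak_deriv_rv[OF H1_L2[OF u] weak_deriv_H1[OF u c] c])
 show "rv u \<in> H1 Q" by (rule H1I[OF rv_L2[OF H1_L2[OF u]] g])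
 show "ae_eq_on Q (wd Q (rv u) c) (%p. tsign c * rv (wd Q u c) p)" if "c \<in> Basis"
  by (rule weak_deriv_eq(1)[OF open_Q(1) g[OF that]])
 have "gnorm Q (rv u) = L2_set (%c. L2_norm Q (%p. tsign c * rv (wd Q u c) p)) Basis"
  by (rule gnorm_eq[OF open_Q(1) g])
 also have "\<dots> = gnorm Q u" unfolding gnorm_def
  by (rule L2_set_cong) (auto simp: L2_norm_cmult tsign_simps rv_ip(2) weak_deriv_H1[OF u])
 finally show "gnorm Q (rv u) = gnorm Q u" .
qed

lemma wform_rv:
 assumes u: "u \<in> H1 Q" and w: "w \<in> H1 Q"
 shows "wform \<sigma> Q (rv u) (rv w) = wform \<sigma> Q u w"
proof -
 have "ip Q (wd Q (rv u) c) (wd Q (rv w) c) = ip Q (wd Q u c) (wd Q w c)" if c: "c \<in> Basis" for c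
 proof -
  let ?f = "%u p. tsign c * rv (wd Q u c) p"
  have L: "?f u \<in> L2 Q" "?f w \<in> L2 Q" "wd Q (rv u) c \<in> L2 Q" "wd Q (rv w) c \<in> L2 Q"
   by (auto intro!: L2_cmult rv_L2 weak_deriv_H1[OF u c] weak_deriv_H1[OF w c] weak_deriv_H1[OF H1_rv(1)[OF u] c] weak_deriv_H1[OF H1_rv(1)[OF w] c])
  have "ip Q (wd Q (rv u) c) (wd Q (rv w) c) = ip Q (?f u) (wd Q (rv w) c)"
   by (rule ip_cong_AE[OF L(3,1,4) H1_rv(2)[OF u c]])
  also have "\<dots> = ip Q (wd Q (rv w) c) (?f u)" by (rule ip_commute)
  also have "\<dots> = ip Q (?f w) (?f u)" by (rule ip_cong_AE[OF L(4,2,1) H1_rv(2)[OF w c]])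
  also have "\<dots> = ip Q (rv (wd Q w c)) (rv (wd Q u c))"
   by (simp add: ip_cmult_left ip_cmult_right tsign_simps)
  also have "\<dots> = ip Q (wd Q w c) (wd Q u c)"
   by (rule rv_ip(1)[OF weak_deriv_H1(1)[OF w c] weak_deriv_H1(1)[OF u c]])
  finally show ?thesis by (simp add: ip_commute)
 qed
 then show ?thesis by (simp add: wform_def)
qed

lemma H11_rv:
 shows "v \<in> L2_time X \<Omega> T ==> rv v \<in> L2_time X \<Omega> T"
  and "v \<in> H1_time \<Omega> T ==> rv v \<in> H1_time \<Omega> T"
  and "vanishes_at \<Omega> T s v ==> vanishes_at \<Omega> T (T - s) (rv v)"
proof -
 show "rv v \<in> L2_time X \<Omega> T" if v: "v \<in> L2_time X \<Omega> T"
 proof -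
  obtain G where G: "\<forall>b\<in>Basis. G b \<in> L2 Q \<and>
    (AE t in lborel. t \<in> {0<..<T} \<longrightarrow> has_weak_deriv \<Omega> (%x. v (x, t)) b (%x. G b (x, t)))"
   using v unfolding L2_time_def by blast
  have "AE t in lborel. t \<in> {0<..<T} \<longrightarrow> (%x. v (x, t)) \<in> X" using v by (simp add: L2_time_def)
  then have "AE t in lborel. t \<in> {0<..<T} \<longrightarrow> (%x. rv v (x, t)) \<in> X"
   by (rule eventually_mono[OF AE_reflect[of _ T]]) auto
  moreover have "\<forall>b\<in>Basis. rv (G b) \<in> L2 Q \<and>
    (AE t in lborel. t \<in> {0<..<T} \<longrightarrow> has_weak_deriv \<Omega> (%x. rv v (x, t)) b (%x. rv (G b) (x, t)))"
  proof
   fix b :: 'a assume "b \<in> Basis"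
   with G have "G b \<in> L2 Q" and a: "AE t in lborel. t \<in> {0<..<T} \<longrightarrow> has_weak_deriv \<Omega> (%x. v (x, t)) b (%x. G b (x, t))"
    by auto
   then show "rv (G b) \<in> L2 Q \<and>
    (AE t in lborel. t \<in> {0<..<T} \<longrightarrow> has_weak_deriv \<Omega> (%x. rv v (x, t)) b (%x. rv (G b) (x, t)))"
    by (intro conjI rv_L2 eventually_mono[OF AE_reflect[OF a, of T]]) auto
  qed
  moreover have "rv v \<in> L2 Q" using v rv_L2 by (simp add: L2_time_def)
  ultimately show ?thesis unfolding L2_time_def by (intro CollectI conjI exI[of _ "%b. rv (G b)"])
 qed
 show "rv v \<in> H1_time \<Omega> T" if v: "v \<in> H1_time \<Omega> T"
 proof -
  obtain D where D: "D \<in> L2 Q" "\<And>\<eta>. \<eta> \<in> test_fun {0<..<T} ==>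
   ae_eq_on \<Omega> (%x. LINT t:{0<..<T}|lborel. v (x, t) * deriv \<eta> t) (%x. - (LINT t:{0<..<T}|lborel. D (x, t) * \<eta> t))"
   using v unfolding H1_time_def by blast
  have refl: "(LINT t:{0<..<T}|lborel. f (T - t)) = (LINT t:{0<..<T}|lborel. f t)" for f :: "real => real"
  proof -
   have "(LINT t:{0<..<T}|lborel. f t) = (LINT t|lborel. indicator {0<..<T} (T - t) * f (T - t))"
    using lborel_integral_real_affine[of "-1" "%t. indicator {0<..<T} t * f t" T] by (simp add: set_lebesgue_integral_def)
   also have "(%t. indicator {0<..<T} (T - t) * f (T - t)) = (%t. indicator {0<..<T} t * f (T - t))"
    by (auto simp: indicator_def fun_eq_iff)
   finally show ?thesis by (simp add: set_lebesgue_integral_def)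
  qed
  have "ae_eq_on \<Omega> (%x. LINT t:{0<..<T}|lborel. rv v (x, t) * deriv \<eta> t)
    (%x. - (LINT t:{0<..<T}|lborel. - rv D (x, t) * \<eta> t))" if \<eta>: "\<eta> \<in> test_fun {0<..<T}" for \<eta>
  proof -
   have bl: "bounded_linear (%t::real. - t)" by (rule bounded_linear_minus[OF bounded_linear_ident])
   obtain K where K: "compact K" "K \<subseteq> {0<..<T}" "\<And>x. x \<notin> K ==> \<eta> x = 0"
    using test_fun_support[OF \<eta>] by blast
   have t: "(%t. \<eta> (T - t)) \<in> test_fun {0<..<T}"
   proof (rule test_funI)
    show "C_diff k (%t. \<eta> (T - t))" for k
     using C_diff_compose_affine[OF bl test_funD(1)[OF \<eta>], of k T] by simp
    show "compact ((%t. T - t) ` K)" by (intro compact_continuous_image K(1) continuous_intros)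
    show "(%t. T - t) ` K \<subseteq> {0<..<T}" using K(2) by auto
    show "\<eta> (T - t) = 0" if "t \<notin> (%t. T - t) ` K" for t
     using that by (intro K(3)) (force simp: image_iff)
   qed
   have "deriv (%t. \<eta> (T - t)) t = - deriv \<eta> (T - t)" for t
    unfolding deriv_eq_pd[OF test_funD(1)[OF \<eta>]] deriv_eq_pd[OF test_funD(1)[OF t]]
    using pd_compose_affine[OF bl, of \<eta> T t 1] test_funD(7)[OF \<eta>] pd_minus[of \<eta> "T - t" 1] by simp
   then have "ae_eq_on \<Omega> (%x. LINT t:{0<..<T}|lborel. - (rv v (x, T - t) * deriv \<eta> (T - t))) (%x. - (LINT t:{0<..<T}|lborel. rv D (x, T - t) * \<eta> (T - t)))"
    using D(2)[OF t] by simp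
   then show ?thesis
    unfolding refl[of "%t. - (rv v (_, t) * deriv \<eta> t)"] refl[of "%t. rv D (_, t) * \<eta> t"]
    by (simp add: ae_eq_on_def set_lebesgue_integral_def minus_equation_iff eq_commute)
  qed
  then show ?thesis unfolding H1_time_def
   using v rv_L2[of v] L2_uminus[OF rv_L2[OF D(1)]]
   by (intro CollectI conjI bexI[of _ "%p. - rv D p"] ballI) (auto simp: H1_time_def)
 qed
 show "vanishes_at \<Omega> T (T - s) (rv v)" if v: "vanishes_at \<Omega> T s v"
 proof -
  obtain w where w: "\<And>t. t \<in> {0..T} ==> w t \<in> L2 \<Omega> \<and> ((%\<tau>. L2_dist \<Omega> (w \<tau>) (w t)) \<longlongrightarrow> 0) (at t within {0..T})"
   and wu: "AE t in lborel. t \<in> {0<..<T} \<longrightarrow> ae_eq_on \<Omega> (w t) (%x. v (x, t))" and ws: "ae_eq_on \<Omega> (w s) (%x. 0)"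
   using v unfolding vanishes_at_def by blast
  show ?thesis unfolding vanishes_at_def
  proof (intro exI[of _ "%t. w (T - t)"] conjI ballI)
   show "AE t in lborel. t \<in> {0<..<T} \<longrightarrow> ae_eq_on \<Omega> (w (T - t)) (%x. rv v (x, t))"
    by (rule eventually_mono[OF AE_reflect[OF wu, of T]]) auto
   show "ae_eq_on \<Omega> (w (T - (T - s))) (%x. 0)" using ws by simp
   fix t assume t: "t \<in> {0..T}"
   then have t': "T - t \<in> {0..T}" by auto
   show "w (T - t) \<in> L2 \<Omega>" using w[OF t'] by simp
   have fl: "filterlim (%\<tau>. T - \<tau>) (at (T - t) within {0..T}) (at t within {0..T})"
    by (auto simp: filterlim_at eventually_at intro!: tendsto_intros exI[of _ 1])
   show "((%\<tau>. L2_dist \<Omega> (w (T - \<tau>)) (w (T - t))) \<longlongrightarrow> 0) (at t within {0..T})"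
    using filterlim_compose[OF conjunct2[OF w[OF t']] fl] .
  qed
 qed
qed

lemma H11_0_rv:
 "u \<in> V_0init ==> rv u \<in> H11_0term \<Omega> T" "u \<in> H11_0term \<Omega> T ==> rv u \<in> V_0init"
 using H11_rv(1)[of u "H10 \<Omega>"] H11_rv(2)[of u] H11_rv(3)[of 0 u] H11_rv(3)[of T u]
 unfolding H11_0init_def H11_0term_def by auto

end

section \<open>The inf-sup estimate\<close>

text \<open>By the substitution r = t s the expression is the integral of k from 0 to t.\<close>

lemma antiderivative_scaled:
 fixes k :: "real => real"
 assumes k: "continuous_on UNIV k" and t: "0 \<le> t" "t \<le> T"
 shows "((%t. integral {0..1} (%s. t * k (t * s))) has_real_derivative k t) (at t within {0..T})"
proof -
 define K where "K t = integral {0..t} k" for t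
 have c: "continuous_on {0..T} k" by (rule continuous_on_subset[OF k]) simp
 have DK: "(K has_real_derivative k t) (at t within {0..T})" if "t \<in> {0..T}" for t
  using integral_has_vector_derivative[OF c that]
  by (simp add: K_def[abs_def] has_real_derivative_iff_has_vector_derivative)
 have eq: "integral {0..1} (%s. t * k (t * s)) = K t" if t: "t \<in> {0..T}" for t
 proof -
  have "((%s. t * k (t * s)) has_integral K (t * 1) - K (t * 0)) {0..1}"
  proof (rule fundamental_theorem_of_calculus)
   fix s :: real assume s: "s \<in> {0..1}"
   have im: "(%s. t * s) ` {0..1} \<subseteq> {0..T}"
    using t mult_left_le[of _ t] by (force intro: order_trans)
   then have ts: "t * s \<in> {0..T}" using s by blast
   have "((%s. K (t * s)) has_real_derivative k (t * s) * t) (at s within {0..1})"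
    using DERIV_image_chain[OF DERIV_subset[OF DK[OF ts] im], of t] by (auto simp: o_def intro!: derivative_eq_intros)
   then show "((%s. K (t * s)) has_vector_derivative t * k (t * s)) (at s within {0..1})"
    by (simp add: has_real_derivative_iff_has_vector_derivative mult.commute)
  qed simp
  moreover have "K 0 = 0" by (simp add: K_def)
  ultimately show ?thesis using integral_unique by (metis diff_zero mult.right_neutral mult_zero_right)
 qed
 show ?thesis
  by (rule has_field_derivative_transform_within[OF DK zero_less_one]) (use t eq in auto)
qed

text \<open>The integral of H(x, r) for r from 0 to t, moved to a fixed interval: differentiation in
  x and t becomes the Leibniz rule, and negative t need no separate case.\<close>

definition volterra :: "('a::euclidean_space \<times> real => real) => 'a \<times> real => real" where
 "volterra H p = integral {0..1} (%s. snd p * H (fst p, snd p * s))"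

lemma C_diff_snd: "C_diff k (%p::'a::euclidean_space \<times> real. snd p)"
proof -
 have "(%p::'a \<times> real. snd p) = (%p. p \<bullet> (0, 1))" by (auto simp: inner_prod_def)
 then show ?thesis using C_diff_inner[of k "(0 :: 'a, 1 :: real)"] by (simp del: C_diff.simps)
qed

lemma volterra_C_diff:
 fixes H :: "'a::euclidean_space \<times> real => real"
 assumes H: "C_diff 1 H"
 shows "C_diff 1 (volterra H)"
  "b \<in> Basis ==> pd (b, 0) (volterra H) = volterra (pd (b, 0) H)"
  "pd (0, 1) (volterra H) = H"
proof -
 have d: "H differentiable (at p)" for p by (rule C_diff_differentiable[OF H[unfolded One_nat_def]])
 note cH = C_diff_continuous[OF H]
 have cd: "continuous_on UNIV (pd c H)" if "c \<in> Basis" for c using H that by simp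
 define f where "f p s = snd p * H (fst p, snd p * s)" for p and s :: real
 define f' where "f' p s v = snd p * pd (fst v, snd v * s) H (fst p, snd p * s) + snd v * H (fst p, snd p * s)"
  for p v :: "'a \<times> real" and s
 have D: "((%p. f p s) has_derivative f' p s) (at p)" for p s
 proof -
  have l: "((%p. (fst p, snd p * s)) has_derivative (%v. (fst v, snd v * s))) (at p)"
   by (auto intro!: derivative_eq_intros)
  have "((%p. H (fst p, snd p * s)) has_derivative (%v. pd (fst v, snd v * s) H (fst p, snd p * s))) (at p)"
   by (rule has_derivative_compose[OF l has_derivative_pd[OF d]])
  note D = has_derivative_mult[OF has_derivative_snd[OF has_derivative_ident] this]
  have "f' p s = (%v. snd p * pd (fst v, snd v * s) H (fst p, snd p * s) + snd v * H (fst p, snd p * s))"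
   by (rule ext) (simp add: f'_def)
  with D show ?thesis by (simp add: f_def)
 qed
 have blin: "bounded_linear (f' p s)" for p s by (rule has_derivative_bounded_linear[OF D])
 \<comment> \<open>The Leibniz rule takes operator-valued derivatives; their continuity is checked
   on basis vectors.\<close>
 define F where "F p s = Blinfun (f' p s)" for p s
 have F: "blinfun_apply (F p s) = f' p s" for p s
  unfolding F_def by (rule bounded_linear_Blinfun_apply[OF blin])
 have f'b: "f' p s (b, 0) = snd p * pd (b, 0) H (fst p, snd p * s)" for p s b by (simp add: f'_def)
 have f't: "f' p s (0, 1) = snd p * (s * pd (0, 1) H (fst p, snd p * s)) + H (fst p, snd p * s)" for p s
 proof -
  have lin: "linear (%v. pd v H (fst p, snd p * s))"
   using has_derivative_pd[OF d] has_derivative_linear by blast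
  have "pd (s *\<^sub>R (0, 1)) H (fst p, snd p * s) = s *\<^sub>R pd (0, 1) H (fst p, snd p * s)"
   by (rule linear_scale[OF lin])
  then show ?thesis by (simp add: f'_def)
 qed
 have cH2: "continuous_on A (%z. G (fst (fst z), snd (fst z) * snd z))" if "continuous_on UNIV G" for G :: "'a \<times> real => real" and A
  by (rule continuous_on_compose2[OF that]) (auto intro!: continuous_intros)
 have "continuous_on (UNIV \<times> cbox 0 1) (%z. F (fst z) (snd z))"
 proof (rule continuous_on_blinfun_componentwise)
  fix c :: "'a \<times> real" assume c: "c \<in> Basis"
  consider b where "b \<in> Basis" "c = (b, 0)" | "c = (0, 1)" using c by (auto simp: Basis_prod_def)
  then show "continuous_on (UNIV \<times> cbox 0 1) (%z. F (fst z) (snd z) c)"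
   by cases (auto simp: F f'b f't Basis_prod_def intro!: continuous_intros cH2 cH cd)
 qed
 then have cF: "continuous_on (UNIV \<times> cbox 0 1) (%(p, s). F p s)" by (simp add: case_prod_beta)
 have fi: "f p integrable_on cbox 0 1" for p
  unfolding f_def by (intro integrable_continuous continuous_intros continuous_on_compose2[OF cH]) auto
 have V: "volterra H = (%p. integral (cbox 0 1) (f p))"
  by (rule ext) (simp only: volterra_def f_def[abs_def] cbox_interval)
 have DV: "(volterra H has_derivative blinfun_apply (integral (cbox 0 1) (F p))) (at p)" for p
  unfolding V using leibniz_rule[of UNIV 0 1 f F p] D fi cF by (simp add: F)
 have Fi: "F p integrable_on cbox 0 1" for p
  by (intro integrable_continuous continuous_on_compose2[OF cF, of _ "%s. (p, s)", simplified]) (auto intro!: continuous_intros)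
 have pd: "pd c (volterra H) p = integral {0..1} (%s. f' p s c)" for c p
  using pd_eq[OF DV] blinfun_apply_integral[OF Fi] by (simp add: F)
 show pb: "pd (b, 0) (volterra H) = volterra (pd (b, 0) H)" for b
  by (simp add: fun_eq_iff pd f'b volterra_def)
 show pt: "pd (0, 1) (volterra H) = H"
 proof
  fix p
  \<comment> \<open>The integrand is the s-derivative of s H(x, t s), namely H + s t times the time
    derivative of H.\<close>
  have "((%s. f' p s (0, 1)) has_integral (1 * H (fst p, snd p * 1) - 0 * H (fst p, snd p * 0))) {0..1}"
  proof (rule fundamental_theorem_of_calculus)
   fix s :: real assume "s \<in> {0..1}"
   have "((%t. H ((fst p, 0) + t *\<^sub>R (0, 1))) has_real_derivative pd (0, 1) H (fst p, snd p * s)) (at (snd p * s))"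
    using C_diff_1_directional[OF H, of "(fst p, 0)" "(0, 1)" "snd p * s"] by simp
   then have "((%s. H (fst p, snd p * s)) has_real_derivative pd (0, 1) H (fst p, snd p * s) * snd p) (at s)"
    using DERIV_chain2[of "%t. H (fst p, t)" _ "%s. snd p * s" s "snd p" UNIV]
    by (auto intro!: derivative_eq_intros)
   from DERIV_mult[OF DERIV_ident this]
   show "((%s. s * H (fst p, snd p * s)) has_vector_derivative f' p s (0, 1)) (at s within {0..1})"
    by (auto simp: f't has_real_derivative_iff_has_vector_derivative[symmetric] mult_ac add_ac intro: has_field_derivative_at_within)
  qed simp
  then show "pd (0, 1) (volterra H) p = H p" by (simp add: pd integral_unique)
 qed
 have cV: "continuous_on UNIV (volterra G)" if G: "continuous_on UNIV G" for G :: "'a \<times> real => real"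
  unfolding volterra_def[abs_def] cbox_interval[symmetric]
  by (rule integral_continuous_on_param) (auto simp: case_prod_beta intro!: continuous_intros cH2[OF G])
 have "continuous_on UNIV (pd c (volterra H))" if c: "c \<in> Basis" for c
 proof -
  consider b where "b \<in> Basis" "c = (b, 0)" | "c = (0, 1)" using c by (auto simp: Basis_prod_def)
  then show ?thesis by cases (auto simp: pb pt cH Basis_prod_def intro!: cV cd)
 qed
 moreover have "volterra H differentiable (at p)" for p using DV[of p] unfolding differentiable_def by blast
 ultimately show "C_diff 1 (volterra H)" unfolding One_nat_def C_diff.simps by blast
qed

section \<open>Smooth trial and test classes and the inf-sup inequality\<close>

context spacetime
begin

text \<open>One compact set serves all times, which survives integration in time as well as time
  reversal; \<open>C^1\<close> is exactly what \<open>volterra_C_diff\<close> preserves.\<close>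

definition Cspatial :: "('a \<times> real => real) set" where
 "Cspatial = {V. C_diff 1 V \<and> (\<exists>K. compact K \<and> K \<subseteq> \<Omega> \<and> (\<forall>x t. x \<notin> K \<longrightarrow> V (x, t) = 0))}"

definition C_init :: "('a \<times> real => real) set" where
 "C_init = {V \<in> Cspatial. \<forall>x. V (x, 0) = 0}"

definition C_term :: "('a \<times> real => real) set" where
 "C_term = {V \<in> Cspatial. \<forall>x. V (x, T) = 0}"

lemma Cspatial_lin:
 assumes "u \<in> Cspatial" "v \<in> Cspatial"
 shows "(%p. u p + c * v p) \<in> Cspatial"
proof -
 obtain K where K: "compact K" "K \<subseteq> \<Omega>" "\<And>x t. x \<notin> K ==> u (x, t) = 0" using assms(1) unfolding Cspatial_def by blast
 obtain L where L: "compact L" "L \<subseteq> \<Omega>" "\<And>x t. x \<notin> L ==> v (x, t) = 0" using assms(2) unfolding Cspatial_def by blast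
 have "C_diff 1 (%p. u p + c * v p)" using assms by (intro C_diff_add C_diff_cmult) (auto simp: Cspatial_def)
 then show ?thesis unfolding Cspatial_def using K L
  by (intro CollectI conjI exI[of _ "K \<union> L"]) auto
qed

lemma C_lin:
 "u \<in> C_init ==> v \<in> C_init ==> (%p. u p + c * v p) \<in> C_init"
 "u \<in> C_term ==> v \<in> C_term ==> (%p. u p + c * v p) \<in> C_term"
 using Cspatial_lin by (auto simp: C_init_def C_term_def)

lemma Cspatial_rv:
 assumes "V \<in> Cspatial"
 shows "rv V \<in> Cspatial"
proof -
 obtain K where K: "compact K" "K \<subseteq> \<Omega>" "\<forall>x t. x \<notin> K \<longrightarrow> V (x, t) = 0" and C: "C_diff 1 V"
  using assms unfolding Cspatial_def by blast
 have "\<forall>x t. x \<notin> K \<longrightarrow> rv V (x, t) = 0" using K(3) by (simp add: rv_apply)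
 with K(1,2) C_diff_rv[OF C] show ?thesis unfolding Cspatial_def by blast
qed

lemma C_rv: "V \<in> C_init ==> rv V \<in> C_term" "V \<in> C_term ==> rv V \<in> C_init"
 using Cspatial_rv by (auto simp: C_init_def C_term_def)

lemma Cspatial_H1: "V \<in> Cspatial ==> V \<in> H1 Q"
 using C_diff_1_membership(5) by (auto simp: Cspatial_def)

lemma C_H1: "V \<in> C_init ==> V \<in> H1 Q" "V \<in> C_term ==> V \<in> H1 Q"
 using Cspatial_H1 by (auto simp: C_init_def C_term_def)

lemma Cspatial_slice_H10:
 assumes "V \<in> Cspatial"
 shows "(%x. V (x, t)) \<in> H10 \<Omega>"
proof -
 obtain K where K: "compact K" "K \<subseteq> \<Omega>" "\<And>x t. x \<notin> K ==> V (x, t) = 0" and C: "C_diff 1 V"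
  using assms unfolding Cspatial_def by blast
 show ?thesis
  by (rule H10_compact_support[OF open_Omega C_diff_1_membership(2)[OF C] K(1,2)]) (rule K(3))
qed

lemma C_H11: "V \<in> C_init ==> V \<in> V_0init" "V \<in> C_term ==> V \<in> H11_0term \<Omega> T"
 using Cspatial_slice_H10 C_diff_1_membership(1,3,4)[of V] T_pos
 by (auto simp: C_init_def C_term_def H11_0init_def H11_0term_def Cspatial_def less_imp_le)

text \<open>Compact support in \<open>Qm\<close> forces the value 0 at t = T and leaves the values
  at t = 0 free.\<close>

lemma test_fun_C_term:
 assumes \<phi>: "\<phi> \<in> test_fun Qm"
 shows "\<phi> \<in> C_term"
proof -
 obtain K where K: "compact K" "K \<subseteq> Qm" "\<And>x. x \<notin> K ==> \<phi> x = 0" using test_fun_support[OF \<phi>] by blast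
 have "\<phi> (x, T) = 0" for x by (rule test_funD(5)[OF \<phi>]) (simp add: cylQm_def)
 moreover have "C_diff 1 \<phi>" by (rule test_funD(1)[OF \<phi>])
 moreover have "compact (fst ` K)" "fst ` K \<subseteq> \<Omega>" "\<forall>x t. x \<notin> fst ` K \<longrightarrow> \<phi> (x, t) = 0"
  using K by (auto intro!: compact_continuous_image continuous_intros simp: cylQm_def image_iff) force
 ultimately show ?thesis unfolding C_term_def Cspatial_def by blast
qed

lemma wform_C_diff:
 assumes u: "C_diff 1 u" and v: "C_diff 1 v"
 shows "wform \<sigma> Q u v = (\<Sum>c\<in>Basis. \<sigma> c * ip Q (pd c u) (pd c v))"
proof -
 have "ip Q (wd Q u c) (wd Q v c) = ip Q (pd c u) (pd c v)" if c: "c \<in> Basis" for c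
 proof -
  note U = C_diff_1_L2(2)[OF u c] and V = C_diff_1_L2(2)[OF v c]
  note eu = weak_deriv_eq[OF open_Q(1) U has_weak_deriv_C_diff[OF u c]]
  note ev = weak_deriv_eq[OF open_Q(1) V has_weak_deriv_C_diff[OF v c]]
  show ?thesis using ip_cong_AE[OF eu(2) U ev(2) eu(1)] ip_cong_AE[OF ev(2) V U ev(1)] by (simp add: ip_commute)
 qed
 then show ?thesis by (simp add: wform_def)
qed

text \<open>Pairing \<open>\<psi>\<close> with \<open>J(\<cdot>, t) = \<integral>\<^sub>0\<^sup>t (T + r) \<psi>(\<cdot>, r) dr\<close>: the integrand of the wave form equals a total time
 derivative plus a positive term, because \<open>\<partial>\<^sub>t J = \<rho> \<psi>\<close> with \<open>\<rho>(t) = T + t\<close>, \<open>\<rho>' > 0 > (1 / \<rho>)'\<close>.\<close>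

lemma inf_sup_pointwise:
 fixes \<psi> :: "'a \<times> real => real"
 assumes \<psi>: "C_diff 1 \<psi>" and \<psi>T: "\<psi> (x, T) = 0"
 defines "H \<equiv> %p. (T + snd p) * \<psi> p"
 shows "(LINT t:{0<..<T}|lborel. 1 / 2 * (\<psi> (x, t))\<^sup>2 + 1 / (8 * T\<^sup>2) * (\<Sum>b\<in>Basis. (volterra (pd (b, 0) H) (x, t))\<^sup>2))
  \<le> (LINT t:{0<..<T}|lborel. - (H (x, t) * pd (0, 1) \<psi> (x, t)) +
    (\<Sum>b\<in>Basis. volterra (pd (b, 0) H) (x, t) * pd (b, 0) \<psi> (x, t)))"
proof -
 have CH: "C_diff 1 H"
  unfolding H_def by (intro C_diff_mult C_diff_add C_diff_const C_diff_snd \<psi>)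
 note VC = volterra_C_diff[OF CH]
 have B: "(b, 0) \<in> (Basis :: ('a \<times> real) set)" if "b \<in> Basis" for b using that by (auto simp: Basis_prod_def)
 define J where "J b t = volterra (pd (b, 0) H) (x, t)" for b t
 define q where "q t = \<psi> (x, t)" for t
 define q' where "q' t = pd (0, 1) \<psi> (x, t)" for t
 define qb where "qb b t = pd (b, 0) \<psi> (x, t)" for b t
 have d\<psi>: "\<psi> differentiable (at p)" for p by (rule C_diff_differentiable[OF \<psi>[unfolded One_nat_def]])
 have Hb: "pd (b, 0) H (x, t) = (T + t) * qb b t" for b t
 proof -
  have D: "((%p::'a \<times> real. T + snd p) has_derivative snd) (at (x, t))"
   by (auto intro!: derivative_eq_intros)
  from pd_eq[OF has_derivative_mult[OF D has_derivative_pd[OF d\<psi>]], of "(b, 0)"]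
  show ?thesis by (simp add: H_def qb_def)
 qed
 have slice: "continuous_on A (%t. G (x, t))" if "continuous_on UNIV G" for G :: "'a \<times> real => real" and A
  by (rule continuous_on_compose2[OF that]) (auto intro!: continuous_intros)
 have cq: "continuous_on A q" "continuous_on A q'" "b \<in> Basis ==> continuous_on A (qb b)" "b \<in> Basis ==> continuous_on A (J b)" for A b
  unfolding q_def q'_def qb_def J_def using \<psi> VC(1) B time_Basis C_diff_continuous[OF \<psi>]
  by (auto intro!: slice simp flip: VC(2))
 have Dq: "(q has_real_derivative q' t) (at t within {0..T})" for t
  using C_diff_1_directional[OF \<psi>, of "(x, 0)" "(0, 1)" t]
  by (auto simp: q_def[abs_def] q'_def intro: has_field_derivative_at_within)
 have DJ: "(J b has_real_derivative (T + t) * qb b t) (at t within {0..T})" if b: "b \<in> Basis" and t: "t \<in> {0..T}" for b t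
 proof -
  have "continuous_on UNIV (pd (b, 0) H)" using CH B[OF b] by simp
  from antiderivative_scaled[OF slice[OF this, of UNIV], of t T] t
  show ?thesis by (simp add: J_def[abs_def] volterra_def Hb)
 qed
 \<comment> \<open>The total derivative part: E' = L - R with L the integrand of the wave form at
   fixed x and R a sum of squares.\<close>
 define E where "E t = - (1 / 2 * (T + t) * (q t)\<^sup>2) + 1 / 2 * (\<Sum>b\<in>Basis. (J b t)\<^sup>2) / (T + t)" for t
 define L where "L t = - ((T + t) * q t * q' t) + (\<Sum>b\<in>Basis. J b t * qb b t)" for t
 define R where "R t = 1 / 2 * (q t)\<^sup>2 + 1 / 2 * (\<Sum>b\<in>Basis. (J b t)\<^sup>2) / (T + t)\<^sup>2" for t
 have combine: "((%t. - (1 / 2 * (T + t) * (q t)\<^sup>2) + 1 / 2 * S t / (T + t)) has_real_derivative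
   (- (1 / 2 * (q t)\<^sup>2 + 1 / 2 * (T + t) * (2 * q t * q1)) + ((1 / 2 * S1) * (T + t) - 1 / 2 * S t) / (T + t)\<^sup>2)) (at t within A)"
  if "(q has_real_derivative q1) (at t within A)" "(S has_real_derivative S1) (at t within A)" "T + t \<noteq> 0" for q S q1 S1 t A
  by (rule derivative_eq_intros that refl | simp add: that)+ (simp add: power2_eq_square)
 have DE: "(E has_real_derivative L t - R t) (at t within {0..T})" if t: "t \<in> {0..T}" for t
 proof -
  have ne: "T + t \<noteq> 0" using t T_pos by auto
  have "((%t. \<Sum>b\<in>Basis. (J b t)\<^sup>2) has_real_derivative (\<Sum>b\<in>Basis. 2 * J b t * ((T + t) * qb b t))) (at t within {0..T})"
   using DJ[OF _ t] by (auto intro!: derivative_eq_intros simp: mult_ac)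
  then have "(E has_real_derivative (- (1 / 2 * (q t)\<^sup>2 + 1 / 2 * (T + t) * (2 * q t * q' t)) +
    ((1 / 2 * (\<Sum>b\<in>Basis. 2 * J b t * ((T + t) * qb b t))) * (T + t) - 1 / 2 * (\<Sum>b\<in>Basis. (J b t)\<^sup>2)) / (T + t)\<^sup>2)) (at t within {0..T})"
   unfolding E_def[abs_def]
   by (rule combine[OF Dq _ ne])
  moreover have "(\<Sum>b\<in>Basis. 2 * J b t * ((T + t) * qb b t)) = 2 * (T + t) * (\<Sum>b\<in>Basis. J b t * qb b t)"
   unfolding sum_distrib_left by (rule sum.cong) auto
  moreover have "- (1 / 2 * (q t)\<^sup>2 + 1 / 2 * (T + t) * (2 * q t * q' t)) +
    ((1 / 2 * (2 * (T + t) * s)) * (T + t) - 1 / 2 * r) / (T + t)\<^sup>2 =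
    (- ((T + t) * q t * q' t) + s) - (1 / 2 * (q t)\<^sup>2 + 1 / 2 * r / (T + t)\<^sup>2)" for s r
   using ne by (simp add: diff_divide_distrib power2_eq_square)
  ultimately show ?thesis unfolding L_def R_def by (simp only:)
 qed
 have cL: "continuous_on {0..T} L" unfolding L_def[abs_def] by (intro continuous_intros cq) auto
 have cR: "continuous_on {0..T} R" unfolding R_def[abs_def]
  by (intro continuous_intros cq) (use T_pos in auto)
 \<comment> \<open>J vanishes at 0 and \<psi> at T, so each end retains only its term of favourable
   sign.\<close>
 have Eb: "E T - E 0 \<ge> 0"
 proof -
  have "J b 0 = 0" for b by (simp add: J_def volterra_def)
  then have "E 0 \<le> 0" using T_pos by (simp add: E_def)
  moreover have "E T \<ge> 0" using \<psi>T T_pos by (simp add: E_def q_def sum_nonneg)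
  ultimately show ?thesis by simp
 qed
 have "(LINT t|lborel. indicator {0..T} t *\<^sub>R (L t - R t)) = E T - E 0"
  by (rule integral_FTC_Icc) (use T_pos DE cL cR in \<open>auto simp: has_real_derivative_iff_has_vector_derivative[symmetric] intro: continuous_intros\<close>)
 moreover have iL: "integrable lborel (%t. indicator {0..T} t *\<^sub>R L t)" "integrable lborel (%t. indicator {0..T} t *\<^sub>R R t)"
  by (rule borel_integrable_compact[OF compact_Icc cL], rule borel_integrable_compact[OF compact_Icc cR])
 ultimately have LR: "(LINT t|lborel. indicator {0..T} t *\<^sub>R R t) \<le> (LINT t|lborel. indicator {0..T} t *\<^sub>R L t)"
  using Eb by (simp add: right_diff_distrib)
 have IccIoo: "AE t in lborel. indicator {0..T} t = (indicator {0<..<T} t :: real)"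
  using AE_lborel_singleton[of 0] AE_lborel_singleton[of T]
  by eventually_elim (auto simp: indicator_def)
 have I: "(LINT t:{0<..<T}|lborel. f t) = (LINT t|lborel. indicator {0..T} t *\<^sub>R f t)"
  if "integrable lborel (%t. indicator {0..T} t *\<^sub>R f t)" for f :: "real => real"
 proof -
  have m: "(%t. indicator {0..T} t *\<^sub>R f t) \<in> borel_measurable lborel" using that by auto
  have "(%t. indicator {0<..<T} t *\<^sub>R (indicator {0..T} t *\<^sub>R f t)) \<in> borel_measurable lborel"
   using m by measurable
  also have "(%t. indicator {0<..<T} t *\<^sub>R (indicator {0..T} t *\<^sub>R f t)) = (%t. indicator {0<..<T} t *\<^sub>R f t)"
   by (auto simp: indicator_def fun_eq_iff)
  finally show ?thesis unfolding set_lebesgue_integral_def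
   by (intro integral_cong_AE m) (use IccIoo in \<open>auto elim!: eventually_mono\<close>)
 qed
 define R' where "R' t = 1 / 2 * (q t)\<^sup>2 + 1 / (8 * T\<^sup>2) * (\<Sum>b\<in>Basis. (J b t)\<^sup>2)" for t
 have iR': "integrable lborel (%t. indicator {0..T} t *\<^sub>R R' t)"
  unfolding R'_def by (rule borel_integrable_compact[OF compact_Icc]) (intro continuous_intros cq, auto)
 have "(LINT t|lborel. indicator {0..T} t *\<^sub>R R' t) \<le> (LINT t|lborel. indicator {0..T} t *\<^sub>R R t)"
 proof (rule integral_mono[OF iR' iL(2)])
  fix t
  show "indicator {0..T} t *\<^sub>R R' t \<le> indicator {0..T} t *\<^sub>R R t"
  proof (cases "t \<in> {0..T}")
   case True
   \<comment> \<open>T + t \<le> 2 T replaces the variable weight 1 / (2 (T + t)^2) by the constant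
     1 / (8 T^2).\<close>
   have "(T + t)\<^sup>2 \<le> (2 * T)\<^sup>2" using True T_pos by (intro power_mono) auto
   then have "1 / (4 * T\<^sup>2) \<le> 1 / (T + t)\<^sup>2" using True T_pos by (intro divide_left_mono) (auto simp: power_mult_distrib)
   then have "1 / (4 * T\<^sup>2) * (\<Sum>b\<in>Basis. (J b t)\<^sup>2) \<le> 1 / (T + t)\<^sup>2 * (\<Sum>b\<in>Basis. (J b t)\<^sup>2)"
    by (intro mult_right_mono sum_nonneg) auto
   then show ?thesis using True by (simp add: R_def R'_def)
  qed simp
 qed
 also note LR
 finally have "(LINT t:{0<..<T}|lborel. R' t) \<le> (LINT t:{0<..<T}|lborel. L t)"
  using I[OF iR'] I[OF iL(1)] by simp
 then show ?thesis by (simp add: R'_def L_def J_def q_def q'_def qb_def H_def mult_ac)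
qed

text \<open>Integration over x of the inequality on vertical lines. The spatial derivatives of J are
  controlled directly, its time derivative is (T + t) \<psi> and hence controlled by \<psi>; the
  bound T + t \<le> 2 T enters in both.\<close>

theorem inf_sup:
 assumes \<psi>: "\<psi> \<in> C_term"
 shows "\<exists>J\<in>C_init. (L2_norm Q \<psi>)\<^sup>2 \<le> 2 * wave_form J \<psi> \<and> (gnorm Q J)\<^sup>2 \<le> 8 * T\<^sup>2 * wave_form J \<psi>"
proof -
 obtain K where K: "compact K" "K \<subseteq> \<Omega>" "\<And>x t. x \<notin> K ==> \<psi> (x, t) = 0" and C: "C_diff 1 \<psi>" and z: "\<And>x. \<psi> (x, T) = 0"
  using \<psi> unfolding C_term_def Cspatial_def by blast
 define H where "H p = (T + snd p) * \<psi> p" for p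
 have CH: "C_diff 1 H"
  unfolding H_def[abs_def] by (intro C_diff_mult C_diff_add C_diff_const C_diff_snd C)
 define J where "J = volterra H"
 note VC = volterra_C_diff[OF CH, folded J_def]
 have "J (x, t) = 0" if "x \<notin> K" for x t using K(3)[OF that] by (simp add: J_def volterra_def H_def)
 then have J: "J \<in> C_init" unfolding C_init_def Cspatial_def using VC(1) K(1,2)
  by (auto simp: J_def volterra_def)
 have B: "(b, 0) \<in> (Basis :: ('a \<times> real) set)" if "b \<in> Basis" for b using that by (auto simp: Basis_prod_def)
 define A where "A = wave_form J \<psi>"
 let ?Jb = "%b. pd (b, 0) J"
 have split: "(\<Sum>c\<in>Basis. g c) = (\<Sum>b\<in>Basis. g (b, 0)) + g (0, 1)" for g :: "'a \<times> real => real"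
  by (simp add: Basis_prod_def sum.union_disjoint sum.reindex inj_on_def disjoint_iff image_iff)
 have Aeq: "A = (\<Sum>b\<in>Basis. ip Q (?Jb b) (pd (b, 0) \<psi>)) - ip Q H (pd (0, 1) \<psi>)"
  unfolding A_def wform_C_diff[OF VC(1) C] split by (simp add: tsign_def VC(3))
 define L where "L p = - (H p * pd (0, 1) \<psi> p) + (\<Sum>b\<in>Basis. ?Jb b p * pd (b, 0) \<psi> p)" for p
 define R where "R p = 1 / 2 * (\<psi> p)\<^sup>2 + 1 / (8 * T\<^sup>2) * (\<Sum>b\<in>Basis. (?Jb b p)\<^sup>2)" for p
 have iP: "set_integrable lborel Q (%p. f p * g p)" if "f \<in> L2 Q" "g \<in> L2 Q" for f g
  by (rule L2_mult_integrable[OF that])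
 note l = C_diff_1_L2[OF VC(1)] C_diff_1_L2[OF C] C_diff_1_L2[OF CH] time_Basis B
 have si: "set_integrable lborel Q (%p. \<Sum>b\<in>I. f b p)" "(LINT p:Q|lborel. (\<Sum>b\<in>I. f b p)) = (\<Sum>b\<in>I. LINT p:Q|lborel. f b p)"
  if "\<And>b. b \<in> I ==> set_integrable lborel Q (f b)" for f :: "'a => 'a \<times> real => real" and I
  using that unfolding set_integrable_def set_lebesgue_integral_def scaleR_sum_right by auto
 have iL1: "set_integrable lborel Q (%p. - (H p * pd (0, 1) \<psi> p))"
  using set_integrable_mult_right[OF iP[OF l(5) l(4)[OF time_Basis]], of "-1"] by simp
 have iL2: "set_integrable lborel Q (%p. \<Sum>b\<in>Basis. ?Jb b p * pd (b, 0) \<psi> p)"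
  by (rule si(1)) (intro iP l)
 have iL: "set_integrable lborel Q L" unfolding L_def by (rule set_integral_add(1)[OF iL1 iL2])
 have LA: "(LINT p:Q|lborel. L p) = A"
 proof -
  have "(LINT p:Q|lborel. L p) = (LINT p:Q|lborel. - (H p * pd (0, 1) \<psi> p)) + (LINT p:Q|lborel. (\<Sum>b\<in>Basis. ?Jb b p * pd (b, 0) \<psi> p))"
   unfolding L_def by (rule set_integral_add(2)[OF iL1 iL2])
  also have "(LINT p:Q|lborel. (\<Sum>b\<in>Basis. ?Jb b p * pd (b, 0) \<psi> p)) = (\<Sum>b\<in>Basis. ip Q (?Jb b) (pd (b, 0) \<psi>))"
   unfolding ip_def by (rule si(2)) (intro iP l)
  also have "(LINT p:Q|lborel. - (H p * pd (0, 1) \<psi> p)) = - ip Q H (pd (0, 1) \<psi>)"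
   by (simp add: ip_def set_lebesgue_integral_def)
  finally show ?thesis by (simp add: Aeq)
 qed
 have iR1: "set_integrable lborel Q (%p. 1 / 2 * (\<psi> p)\<^sup>2)"
  using iP[OF l(3,3)] by (intro set_integrable_mult_right) (simp add: power2_eq_square)
 have iR2: "set_integrable lborel Q (%p. \<Sum>b\<in>Basis. (?Jb b p)\<^sup>2)"
  unfolding power2_eq_square by (rule si(1)) (intro iP l)
 have iR: "set_integrable lborel Q R" unfolding R_def
  by (rule set_integral_add(1)[OF iR1 set_integrable_mult_right[OF iR2]])
 have R: "(LINT p:Q|lborel. R p) = 1 / 2 * (L2_norm Q \<psi>)\<^sup>2 + 1 / (8 * T\<^sup>2) * (\<Sum>b\<in>Basis. (L2_norm Q (?Jb b))\<^sup>2)"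
 proof -
  have "(LINT p:Q|lborel. R p) = (LINT p:Q|lborel. 1 / 2 * (\<psi> p)\<^sup>2) + (LINT p:Q|lborel. 1 / (8 * T\<^sup>2) * (\<Sum>b\<in>Basis. (?Jb b p)\<^sup>2))"
   unfolding R_def by (rule set_integral_add(2)[OF iR1 set_integrable_mult_right[OF iR2]])
  also have "(LINT p:Q|lborel. 1 / (8 * T\<^sup>2) * (\<Sum>b\<in>Basis. (?Jb b p)\<^sup>2)) = 1 / (8 * T\<^sup>2) * (LINT p:Q|lborel. (\<Sum>b\<in>Basis. (?Jb b p)\<^sup>2))"
   by (rule set_integral_mult_right)
  also have "(LINT p:Q|lborel. (\<Sum>b\<in>Basis. (?Jb b p)\<^sup>2)) = (\<Sum>b\<in>Basis. (L2_norm Q (?Jb b))\<^sup>2)"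
   unfolding L2_norm_sq ip_def unfolding power2_eq_square by (rule si(2)) (intro iP l)
  also have "(LINT p:Q|lborel. 1 / 2 * (\<psi> p)\<^sup>2) = 1 / 2 * (L2_norm Q \<psi>)\<^sup>2"
   unfolding L2_norm_sq ip_def unfolding power2_eq_square by (rule set_integral_mult_right)
  finally show ?thesis .
 qed
 have pw: "(LINT t:{0<..<T}|lborel. R (x, t)) \<le> (LINT t:{0<..<T}|lborel. L (x, t))" for x
  using inf_sup_pointwise[OF C z] unfolding R_def L_def J_def H_def
  by (simp add: volterra_C_diff(2)[OF CH[unfolded H_def[abs_def]]])
 have "(LINT p:Q|lborel. R p) \<le> (LINT p:Q|lborel. L p)"
  unfolding cylQ_def set_Fubini(2)[OF iR[unfolded cylQ_def]] set_Fubini(2)[OF iL[unfolded cylQ_def]]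
  by (rule set_integral_mono[OF set_Fubini(6)[OF iR[unfolded cylQ_def]] set_Fubini(6)[OF iL[unfolded cylQ_def]] pw])
 then have main: "1 / 2 * (L2_norm Q \<psi>)\<^sup>2 + 1 / (8 * T\<^sup>2) * (\<Sum>b\<in>Basis. (L2_norm Q (?Jb b))\<^sup>2) \<le> A"
  unfolding R LA .
 define S where "S = (\<Sum>b\<in>Basis. (L2_norm Q (?Jb b))\<^sup>2)"
 have S0: "S \<ge> 0" by (simp add: S_def sum_nonneg)
 have T2: "T\<^sup>2 > 0" using T_pos by simp
 have "(L2_norm Q \<psi>)\<^sup>2 + S / (4 * T\<^sup>2) \<le> 2 * A" using main by (simp add: S_def)
 moreover have "0 \<le> S / (4 * T\<^sup>2)" using S0 T2 by simp
 ultimately have 1: "(L2_norm Q \<psi>)\<^sup>2 \<le> 2 * A" by linarith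
 \<comment> \<open>H is the time derivative of J; with S for the spatial part, S + 4 T^2 times the
   squared norm of \<psi> is 8 T^2 times the left side of \<open>main\<close>.\<close>
 have "L2_norm Q H \<le> L2_norm Q (%p. (2 * T) * \<psi> p)"
  by (rule L2_norm_mono[OF l(5) L2_cmult[OF l(3)]])
    (use T_pos in \<open>auto simp: H_def abs_mult cylQ_def intro!: mult_right_mono\<close>)
 then have "(L2_norm Q H)\<^sup>2 \<le> (2 * T * L2_norm Q \<psi>)\<^sup>2"
  using T_pos by (intro power_mono) (auto simp: L2_norm_cmult L2_norm_nonneg)
 then have "(L2_norm Q H)\<^sup>2 \<le> 4 * T\<^sup>2 * (L2_norm Q \<psi>)\<^sup>2" by (simp add: power_mult_distrib)
 moreover have "(gnorm Q J)\<^sup>2 = S + (L2_norm Q H)\<^sup>2"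
  unfolding gnorm_sq wform_C_diff[OF VC(1) VC(1)] split by (simp add: S_def L2_norm_sq VC(3))
 moreover have "S + 4 * T\<^sup>2 * (L2_norm Q \<psi>)\<^sup>2 \<le> 8 * T\<^sup>2 * A"
 proof -
  have "8 * T\<^sup>2 * (1 / 2 * (L2_norm Q \<psi>)\<^sup>2 + 1 / (8 * T\<^sup>2) * S) \<le> 8 * T\<^sup>2 * A"
   using main T2 by (intro mult_left_mono) (auto simp: S_def)
  then show ?thesis using T2 by (simp add: distrib_left)
 qed
 ultimately have "(gnorm Q J)\<^sup>2 \<le> 8 * T\<^sup>2 * A" by linarith
 with 1 J show ?thesis unfolding A_def by blast
qed

end

section \<open>Density of the range of a bilinear form\<close>

text \<open>If \<open>a(u, x) = 0\<close> for all \<open>u \<in> Y\<close> forces \<open>x = 0\<close> in the completion of \<open>X\<close>, the functionals \<open>a(u, \<cdot>)\<close> are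
 dense in the dual of \<open>X\<close>. Minimising sequences for the dual norm of \<open>f - a(u, \<cdot>)\<close>, with near maximisers
 \<open>x\<close> of \<open>2 r(x) - B(x, x)\<close> in place of Riesz representers, avoid constructing the completion.\<close>

locale dense_range =
 fixes X Y :: "('b => real) set" and B a :: "('b => real) => ('b => real) => real"
 assumes X0: "(%_. 0) \<in> X" and Y0: "(%_. 0) \<in> Y"
  and X_lin: "\<And>x y c. x \<in> X ==> y \<in> X ==> (%p. x p + c * y p) \<in> X"
  and Y_lin: "\<And>x y c. x \<in> Y ==> y \<in> Y ==> (%p. x p + c * y p) \<in> Y"
  and B_lin: "\<And>x y z c. x \<in> X ==> y \<in> X ==> z \<in> X ==> B (%p. x p + c * y p) z = B x z + c * B y z"
  and B_commute: "\<And>x y. x \<in> X ==> y \<in> X ==> B x y = B y x"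
  and B_nonneg: "\<And>x. x \<in> X ==> 0 \<le> B x x"
  and a_lin_left: "\<And>u v x c. u \<in> Y ==> v \<in> Y ==> x \<in> X ==> a (%p. u p + c * v p) x = a u x + c * a v x"
  and a_lin_right: "\<And>u x y c. u \<in> Y ==> x \<in> X ==> y \<in> X ==> a u (%p. x p + c * y p) = a u x + c * a u y"
  and a_bounded: "\<And>u. u \<in> Y ==> \<exists>C. \<forall>x\<in>X. \<bar>a u x\<bar> \<le> C * sqrt (B x x)"
  and a_injective: "\<And>x. (\<And>k. x k \<in> X) ==>
   (\<And>e. e > 0 ==> \<exists>M. \<forall>m\<ge>M. \<forall>n\<ge>M. B (%p. x m p - x n p) (%p. x m p - x n p) < e) ==>
   (\<And>u. u \<in> Y ==> (%k. a u (x k)) \<longlonglongrightarrow> 0) ==> (%k. B (x k) (x k)) \<longlonglongrightarrow> 0"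
begin

definition bounded_functional :: "(('b => real) => real) => bool" where
 "bounded_functional r \<longleftrightarrow> (\<forall>x\<in>X. \<forall>y\<in>X. \<forall>c. r (%p. x p + c * y p) = r x + c * r y) \<and>
  (\<exists>C. \<forall>x\<in>X. \<bar>r x\<bar> \<le> C * sqrt (B x x))"

text \<open>The squared dual norm in a form suited to variation: for r = B(x, .) the supremum is
  attained at x with value B(x, x).\<close>

definition dual_sq :: "(('b => real) => real) => real" where
 "dual_sq r = (SUP x\<in>X. 2 * r x - B x x)"

lemma B_expand:
 assumes "x \<in> X" "y \<in> X"
 shows "B (%p. x p + c * y p) (%p. x p + c * y p) = B x x + 2 * c * B x y + c\<^sup>2 * B y y"
 using assms X_lin[OF assms, of c]
 by (simp add: B_lin B_commute[of _ "%p. x p + c * y p"] B_commute[of y x] power2_eq_square algebra_simps)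

lemma functional_lin: "bounded_functional r ==> x \<in> X ==> y \<in> X ==> r (%p. x p + c * y p) = r x + c * r y"
 unfolding bounded_functional_def by blast

lemma functional_zero: "bounded_functional r ==> r (%_. 0) = 0"
 using functional_lin[OF _ X0 X0, of r "-1"] by simp

lemma B_zero: "B (%_. 0) (%_. 0) = 0"
 using B_lin[OF X0 X0 X0, of "-1"] by simp

lemma B_CS:
 assumes x: "x \<in> X" and y: "y \<in> X"
 shows "\<bar>B x y\<bar> \<le> sqrt (B x x) * sqrt (B y y)"
proof -
 have "0 \<le> B x x + 2 * t * B x y + t\<^sup>2 * B y y" for t
  using B_nonneg[OF X_lin[OF x y, of t]] by (simp add: B_expand[OF x y])
 then show ?thesis by (rule quadratic_nonneg_imp_discriminant[OF _ B_nonneg[OF y]])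
qed

lemma dual_sq_bdd:
 assumes "bounded_functional r"
 shows "bdd_above ((%x. 2 * r x - B x x) ` X)"
proof -
 obtain C where C: "\<And>x. x \<in> X ==> \<bar>r x\<bar> \<le> C * sqrt (B x x)"
  using assms unfolding bounded_functional_def by blast
 have "2 * r x - B x x \<le> C\<^sup>2" if x: "x \<in> X" for x
 proof -
  have "0 \<le> (C - sqrt (B x x))\<^sup>2" by simp
  then have "2 * (C * sqrt (B x x)) \<le> C\<^sup>2 + B x x" using B_nonneg[OF x] by (simp add: power2_diff)
  then show ?thesis using C[OF x] by linarith
 qed
 then show ?thesis by (auto simp: bdd_above_def)
qed

lemma dual_sq_upper: "bounded_functional r ==> x \<in> X ==> 2 * r x - B x x \<le> dual_sq r"
 unfolding dual_sq_def by (rule cSUP_upper[OF _ dual_sq_bdd])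

lemma dual_sq_nonneg: "bounded_functional r ==> 0 \<le> dual_sq r"
 using dual_sq_upper[OF _ X0] by (simp add: functional_zero B_zero)

lemma dual_sq_le: "(\<And>x. x \<in> X ==> 2 * r x - B x x \<le> M) ==> dual_sq r \<le> M"
 unfolding dual_sq_def using X0 by (intro cSUP_least) auto

lemma near_maximiser_ex:
 assumes "bounded_functional r" "\<delta> > 0"
 shows "\<exists>x\<in>X. dual_sq r - \<delta> \<le> 2 * r x - B x x"
proof (rule ccontr)
 assume "\<not> ?thesis"
 then have "dual_sq r \<le> dual_sq r - \<delta>" by (intro dual_sq_le) (auto simp: not_le less_imp_le)
 with \<open>\<delta> > 0\<close> show False by simp
qed

text \<open>The Euler equation of the maximisation up to \<delta>: along the line x + t h the
  functional cannot gain more than \<delta>, and the discriminant turns this into an error of order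
  sqrt \<delta>.\<close>

lemma near_maximiser:
 assumes r: "bounded_functional r" and x: "x \<in> X" and \<delta>: "\<And>y. y \<in> X ==> 2 * r y - B y y \<le> 2 * r x - B x x + \<delta>"
  and h: "h \<in> X"
 shows "\<bar>r h - B x h\<bar> \<le> sqrt \<delta> * sqrt (B h h)"
proof -
 have "0 \<le> \<delta> + 2 * t * - (r h - B x h) + t\<^sup>2 * B h h" for t
  using \<delta>[OF X_lin[OF x h, of t]] by (simp add: B_expand[OF x h] functional_lin[OF r x h] algebra_simps)
 from quadratic_nonneg_imp_discriminant[OF this B_nonneg[OF h]] show ?thesis by (simp only: abs_minus_cancel)
qed

lemma residual_bounded:
 assumes f: "bounded_functional f" and u: "u \<in> Y"
 shows "bounded_functional (%x. f x - a u x)"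
proof -
 obtain C where C: "\<And>x. x \<in> X ==> \<bar>f x\<bar> \<le> C * sqrt (B x x)"
  using f unfolding bounded_functional_def by blast
 obtain D where D: "\<And>x. x \<in> X ==> \<bar>a u x\<bar> \<le> D * sqrt (B x x)" using a_bounded[OF u] by blast
 have "\<bar>f x - a u x\<bar> \<le> (C + D) * sqrt (B x x)" if "x \<in> X" for x
  using C[OF that] D[OF that] by (simp add: distrib_right)
 then show ?thesis unfolding bounded_functional_def
  by (intro conjI exI[of _ "C + D"]) (auto simp: functional_lin[OF f] a_lin_right[OF u] algebra_simps)
qed

theorem range_dense:
 assumes f: "bounded_functional f" and e: "e > 0"
 shows "\<exists>u\<in>Y. \<forall>x\<in>X. \<bar>f x - a u x\<bar> \<le> e * sqrt (B x x)"
proof -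
 define R where "R u = (%x. f x - a u x)" for u
 have R: "bounded_functional (R u)" if "u \<in> Y" for u unfolding R_def by (rule residual_bounded[OF f that])
 \<comment> \<open>The squared dual distance from f to the range. Representers of residuals nearly
   attaining it will tend to 0, which forces the residuals themselves to be small.\<close>
 define m where "m = (INF u\<in>Y. dual_sq (R u))"
 have bd: "bdd_below ((%u. dual_sq (R u)) ` Y)" using dual_sq_nonneg[OF R] by (auto simp: bdd_below_def)
 have m: "m \<le> dual_sq (R u)" if "u \<in> Y" for u unfolding m_def by (rule cINF_lower[OF bd that])
 define \<delta> where "\<delta> k = inverse (real (Suc k))" for k
 have \<delta>: "\<delta> k > 0" for k by (simp add: \<delta>_def)
 have "\<exists>u\<in>Y. dual_sq (R u) < m + \<delta> k" for k
 proof -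
  have "Inf ((%u. dual_sq (R u)) ` Y) < m + \<delta> k" using \<delta>[of k] by (simp add: m_def)
  then show ?thesis using cInf_less_iff[OF _ bd] Y0 by blast
 qed
 then obtain u where u: "\<And>k. u k \<in> Y" and um: "\<And>k. dual_sq (R (u k)) < m + \<delta> k" by metis
 have "\<exists>x\<in>X. dual_sq (R (u k)) - \<delta> k \<le> 2 * R (u k) x - B x x" for k
  by (rule near_maximiser_ex[OF R[OF u] \<delta>])
 then obtain x where x: "\<And>k. x k \<in> X"
  and xm: "\<And>k. dual_sq (R (u k)) - \<delta> k \<le> 2 * R (u k) (x k) - B (x k) (x k)" by metis
 have xm': "2 * R (u k) y - B y y \<le> 2 * R (u k) (x k) - B (x k) (x k) + \<delta> k" if "y \<in> X" for y k
  using dual_sq_upper[OF R[OF u] that, of k] xm[of k] by linarith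
 have near: "\<bar>R (u k) h - B (x k) h\<bar> \<le> sqrt (\<delta> k) * sqrt (B h h)" if "h \<in> X" for h k
  by (rule near_maximiser[OF R[OF u] x xm' that])
 \<comment> \<open>A parallelogram argument: the residual at the midpoint of \<open>u k\<close> and
   \<open>u l\<close> cannot fall below m, so two nearly minimal residuals are close to each
   other.\<close>
 have close: "\<bar>R (u k) h - R (u l) h\<bar> \<le> 2 * sqrt d * sqrt (B h h)" if h: "h \<in> X" and d: "\<delta> k \<le> d" "\<delta> l \<le> d" for h k l d
 proof -
  define v where "v = (%p. u l p + 1 / 2 * (u k p + (-1) * u l p))"
  have v: "v \<in> Y" unfolding v_def by (intro Y_lin u)
  have Rv: "R v y = (R (u k) y + R (u l) y) / 2" if y: "y \<in> X" for y
   unfolding v_def R_def a_lin_left[OF u Y_lin[OF u u] y] a_lin_left[OF u u y] by (simp add: field_simps)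
  define s where "s y = (R (u k) y - R (u l) y) / 2" for y
  have ls: "s (%p. y p + c * z p) = s y + c * s z" if "y \<in> X" "z \<in> X" for y z c
   using that by (simp add: s_def functional_lin[OF R[OF u]] field_simps)
  have main: "2 * s y - B y y \<le> d" if y: "y \<in> X" for y
  proof (rule field_le_epsilon)
   fix \<eta> :: real assume "\<eta> > 0"
   then obtain z where z: "z \<in> X" "dual_sq (R v) - \<eta> \<le> 2 * R v z - B z z"
    using near_maximiser_ex[OF R[OF v]] by blast
   \<comment> \<open>One residual is evaluated at z + y, the other at z - y; in the sum the mixed
     terms of \<open>B\<close> cancel.\<close>
   note U = dual_sq_upper[OF R[OF u] X_lin[OF z(1) y, of 1], of k]
    dual_sq_upper[OF R[OF u] X_lin[OF z(1) y, of "-1"], of l]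
   have "m \<le> dual_sq (R v)" by (rule m[OF v])
   then show "2 * s y - B y y \<le> d + \<eta>"
    using U z(2) um[of k] um[of l] d
    unfolding B_expand[OF z(1) y] functional_lin[OF R[OF u] z(1) y] Rv[OF z(1)] s_def
    by (simp add: field_simps)
  qed
  have bs: "bounded_functional s"
  proof -
   obtain C where C: "\<And>x. x \<in> X ==> \<bar>R (u k) x\<bar> \<le> C * sqrt (B x x)" using R[OF u, of k] unfolding bounded_functional_def by blast
   obtain D where D: "\<And>x. x \<in> X ==> \<bar>R (u l) x\<bar> \<le> D * sqrt (B x x)" using R[OF u, of l] unfolding bounded_functional_def by blast
   have "\<bar>s x\<bar> \<le> (C + D) / 2 * sqrt (B x x)" if "x \<in> X" for x
    using C[OF that] D[OF that] by (simp add: s_def field_simps)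
   then show ?thesis unfolding bounded_functional_def using ls by blast
  qed
  have "\<bar>s h - B (%_. 0) h\<bar> \<le> sqrt d * sqrt (B h h)"
   by (rule near_maximiser[OF bs X0 _ h]) (use main in \<open>simp add: functional_zero[OF bs] B_zero\<close>)
  moreover have "B (%_. 0) h = 0" using B_lin[OF X0 X0 h, of "-1"] by simp
  ultimately show ?thesis by (simp add: s_def)
 qed
 have cauchy: "B (%p. x k p - x l p) (%p. x k p - x l p) \<le> 16 * d" if d: "\<delta> k \<le> d" "\<delta> l \<le> d" for k l d
 proof -
  define h where "h = (%p. x k p + (-1) * x l p)"
  have h: "h \<in> X" unfolding h_def by (intro X_lin x)
  have "B h h = B (x k) h - B (x l) h" unfolding h_def using B_lin[OF x x h[unfolded h_def], of k "-1" l] by simp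
  also have "\<dots> \<le> sqrt (\<delta> k) * sqrt (B h h) + sqrt (\<delta> l) * sqrt (B h h) + 2 * sqrt d * sqrt (B h h)"
   using near[OF h, of k] near[OF h, of l] close[OF h d] by linarith
  also have "\<dots> \<le> sqrt d * sqrt (B h h) + sqrt d * sqrt (B h h) + 2 * sqrt d * sqrt (B h h)"
   using d by (intro add_mono mult_right_mono order_refl) (auto simp: B_nonneg[OF h])
  finally have le: "B h h \<le> 4 * sqrt d * sqrt (B h h)" by simp
  have "sqrt (B h h) \<le> 4 * sqrt d"
  proof (cases "sqrt (B h h) = 0")
   case True then show ?thesis using d \<delta>[of k] by simp
  next
   case False
   then have "sqrt (B h h) > 0" using B_nonneg[OF h] by simp
   moreover have "sqrt (B h h) * sqrt (B h h) \<le> 4 * sqrt d * sqrt (B h h)" using le B_nonneg[OF h] by simp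
   ultimately show ?thesis by (simp only: mult_le_cancel_right_pos)
  qed
  then have "(sqrt (B h h))\<^sup>2 \<le> (4 * sqrt d)\<^sup>2" by (intro power_mono) (auto simp: B_nonneg[OF h])
  then show ?thesis using B_nonneg[OF h] d \<delta>[of k] by (simp add: h_def power_mult_distrib)
 qed
 have \<delta>0: "\<delta> \<longlonglongrightarrow> 0" unfolding \<delta>_def[abs_def] by (rule LIMSEQ_inverse_real_of_nat)
 \<comment> \<open>First variation at a near minimiser: replacing \<open>u k\<close> by
   \<open>u k + t v\<close> lowers the value by 2 t a v (x k) up to small terms, yet never below
   m.\<close>
 have lim: "(%k. a v (x k)) \<longlonglongrightarrow> 0" if v: "v \<in> Y" for v
 proof -
  obtain C' where C': "\<And>y. y \<in> X ==> \<bar>a v y\<bar> \<le> C' * sqrt (B y y)" using a_bounded[OF v] by blast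
  define C where "C = max C' 0"
  have C: "\<bar>a v y\<bar> \<le> C * sqrt (B y y)" "C \<ge> 0" if "y \<in> X" for y
   using C'[OF that] mult_right_mono[of C' C "sqrt (B y y)"] B_nonneg[OF that] by (auto simp: C_def)
  have est: "2 * t * a v (x k) \<le> \<delta> k + (sqrt (\<delta> k) + \<bar>t\<bar> * C)\<^sup>2" for t k
  proof -
   define w where "w = (%p. u k p + t * v p)"
   have w: "w \<in> Y" unfolding w_def by (intro Y_lin u v)
   have collect: "2 * (b + r - \<alpha> - \<beta>) - (c + 2 * b' + n) \<le> m + \<delta> k + P - 2 * \<alpha>"
    if "r - b' \<le> p" "2 * b - c \<le> m + \<delta> k" "- \<beta> \<le> q" "2 * (p + q) \<le> P + n"
    for b r \<alpha> \<beta> c b' n P p q :: real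
    using that by argo
   have "dual_sq (R w) \<le> m + \<delta> k + (sqrt (\<delta> k) + \<bar>t\<bar> * C)\<^sup>2 - 2 * t * a v (x k)"
   proof (rule dual_sq_le)
    fix y assume y: "y \<in> X"
    define h where "h = (%p. y p + (-1) * x k p)"
    have h: "h \<in> X" unfolding h_def by (intro X_lin x y)
    have yh: "y = (%p. x k p + 1 * h p)" by (simp add: h_def)
    have 1: "R w y = R (u k) (x k) + R (u k) h - t * a v (x k) - t * a v h"
    proof -
     have "R w y = R (u k) y - t * a v y" unfolding w_def R_def by (simp add: a_lin_left u v y)
     moreover have "R (u k) y = R (u k) (x k) + R (u k) h" unfolding yh using functional_lin[OF R[OF u] x h, of k k 1] by simp
     moreover have "a v y = a v (x k) + a v h" unfolding yh using a_lin_right[OF v x h, of k 1] by simp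
     ultimately show ?thesis by (simp add: algebra_simps)
    qed
    have 2: "B y y = B (x k) (x k) + 2 * B (x k) h + B h h" unfolding yh B_expand[OF x h] by simp
    have 3: "2 * R (u k) (x k) - B (x k) (x k) \<le> m + \<delta> k" using dual_sq_upper[OF R[OF u] x, of k k] um[of k] by linarith
    have 4: "- (t * a v h) \<le> \<bar>t\<bar> * C * sqrt (B h h)"
    proof -
     have "- (t * a v h) \<le> \<bar>t\<bar> * \<bar>a v h\<bar>" by (metis abs_ge_minus_self abs_mult)
     also have "\<dots> \<le> \<bar>t\<bar> * (C * sqrt (B h h))" by (intro mult_left_mono C h) auto
     finally show ?thesis by simp
    qed
    have 5: "2 * ((sqrt (\<delta> k) + \<bar>t\<bar> * C) * sqrt (B h h)) \<le> (sqrt (\<delta> k) + \<bar>t\<bar> * C)\<^sup>2 + B h h"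
     using sum_squares_bound[of "sqrt (\<delta> k) + \<bar>t\<bar> * C" "sqrt (B h h)"] B_nonneg[OF h] by (simp only: mult.assoc real_sqrt_pow2)
    have "R (u k) h - B (x k) h \<le> sqrt (\<delta> k) * sqrt (B h h)" using near[OF h, of k] by linarith
    then show "2 * R w y - B y y \<le> m + \<delta> k + (sqrt (\<delta> k) + \<bar>t\<bar> * C)\<^sup>2 - 2 * t * a v (x k)"
     using collect[OF _ 3 4 5[unfolded distrib_right]] unfolding 1 2 mult.assoc by simp
   qed
   with m[OF w] show ?thesis by linarith
  qed
  have bound: "\<bar>a v (x k)\<bar> \<le> sqrt (\<delta> k) * ((1 + (1 + C)\<^sup>2) / 2)" for k
  proof -
   \<comment> \<open>The choice t = s or t = - s makes all error terms of order s^2, so after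
     division by s the bound on \<open>a v (x k)\<close> is of order s.\<close>
   define s where "s = sqrt (\<delta> k)"
   have s: "s > 0" "\<delta> k = s\<^sup>2" using \<delta>[of k] by (auto simp: s_def)
   have r: "\<delta> k + (s + s * C)\<^sup>2 = s * (s * (1 + (1 + C)\<^sup>2))" by (simp add: s(2) power2_eq_square algebra_simps)
   have ring: "s * (2 * z) = 2 * s * z" "s * (2 * - z) = 2 * - s * z" for z by simp_all
   have as: "\<bar>s\<bar> = s" "\<bar>- s\<bar> = s" using s(1) by auto
   have e: "2 * s * a v (x k) \<le> \<delta> k + (s + s * C)\<^sup>2" "2 * - s * a v (x k) \<le> \<delta> k + (s + s * C)\<^sup>2"
    using est[of s k] est[of "- s" k] unfolding as s_def[symmetric] .
   have "s * (2 * a v (x k)) \<le> s * (s * (1 + (1 + C)\<^sup>2))" "s * (2 * - a v (x k)) \<le> s * (s * (1 + (1 + C)\<^sup>2))"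
    unfolding ring(1)[of "a v (x k)"] ring(2)[of "a v (x k)"] using e unfolding r .
   then have "2 * a v (x k) \<le> s * (1 + (1 + C)\<^sup>2)" "2 * - a v (x k) \<le> s * (1 + (1 + C)\<^sup>2)"
    using s(1) by (auto simp only: mult_le_cancel_left_pos)
   then show ?thesis unfolding s_def[symmetric] times_divide_eq_right by linarith
  qed
  have "(%k. sqrt (\<delta> k) * ((1 + (1 + C)\<^sup>2) / 2)) \<longlonglongrightarrow> 0"
   using tendsto_mult_right[OF tendsto_real_sqrt[OF \<delta>0], of "(1 + (1 + C)\<^sup>2) / 2"] by simp
  then show ?thesis by (rule Lim_null_comparison[OF always_eventually, rotated]) (use bound in simp)
 qed
 \<comment> \<open>The near-representers form a Cauchy sequence annihilated in the limit by every
   \<open>a v\<close>, which is the situation of \<open>a_injective\<close>.\<close>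
 have B0: "(%k. B (x k) (x k)) \<longlonglongrightarrow> 0"
 proof (rule a_injective[OF x _ lim])
  fix e :: real assume "e > 0"
  then have "eventually (%k. \<delta> k < e / 32) sequentially" by (intro order_tendstoD(2)[OF \<delta>0]) simp
  then obtain M where M: "\<And>k. k \<ge> M ==> \<delta> k < e / 32" by (auto simp: eventually_sequentially)
  have "B (%p. x k p - x l p) (%p. x k p - x l p) < e" if "k \<ge> M" "l \<ge> M" for k l
   using cauchy[of k "e / 32" l] M[OF that(1)] M[OF that(2)] \<open>e > 0\<close> by simp
  then show "\<exists>M. \<forall>m\<ge>M. \<forall>n\<ge>M. B (%p. x m p - x n p) (%p. x m p - x n p) < e" by blast
 qed
 have "(%k. sqrt (B (x k) (x k)) + sqrt (\<delta> k)) \<longlonglongrightarrow> 0"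
  using tendsto_add[OF tendsto_real_sqrt[OF B0] tendsto_real_sqrt[OF \<delta>0]] by simp
 then obtain k where k: "sqrt (B (x k) (x k)) + sqrt (\<delta> k) < e"
  using order_tendstoD(2)[OF _ e] by (metis (mono_tags, lifting) eventually_sequentially order_refl)
 have "\<bar>f h - a (u k) h\<bar> \<le> e * sqrt (B h h)" if h: "h \<in> X" for h
 proof -
  have "\<bar>R (u k) h\<bar> \<le> (sqrt (B (x k) (x k)) + sqrt (\<delta> k)) * sqrt (B h h)"
   using near[OF h, of k] B_CS[OF x h, of k] by (simp add: distrib_right)
  also have "\<dots> \<le> e * sqrt (B h h)" using k B_nonneg[OF h] by (intro mult_right_mono) auto
  finally show ?thesis by (simp add: R_def)
 qed
 then show ?thesis using u by blast
qed

end

lemma gnorm_sqrt: "sqrt (wform (%_. 1) U v v) = gnorm U v"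
 by (simp add: gnorm_sq[symmetric] gnorm_nonneg)

lemma weak_deriv_diff:
 assumes U: "open U" and u: "u \<in> H1 U" and v: "v \<in> H1 U" and b: "b \<in> Basis"
 shows "ae_eq_on U (wd U (%x. u x - v x) b) (%x. wd U u b x - wd U v b x)"
  "L2_dist U (wd U u b) (wd U v b) \<le> gdist U u v"
proof -
 have Ub: "U \<in> sets borel" using U by simp
 note L = weak_deriv_H1(1)[OF u b] weak_deriv_H1(1)[OF v b]
 note W = weak_deriv_eq[OF U L2_diff[OF L] has_weak_deriv_diff[OF Ub b H1_L2[OF u] H1_L2[OF v] L weak_deriv_H1(2)[OF u b] weak_deriv_H1(2)[OF v b]]]
 show "ae_eq_on U (wd U (%x. u x - v x) b) (%x. wd U u b x - wd U v b x)" by (rule W(1))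
 show "L2_dist U (wd U u b) (wd U v b) \<le> gdist U u v"
  using L2_norm_cong_AE[OF W(2) L2_diff[OF L] W(1)] L2_norm_weak_deriv_le[OF b, of U "%x. u x - v x"] by simp
qed

text \<open>By completeness the gradients have an L2 limit; tested against \<phi> it equals a limit
  of integrals of \<open>x k\<close> times derivatives of \<phi>, which is 0.\<close>

lemma gradient_closable:
 assumes U: "open U" "emeasure lborel U < \<infinity>" and x: "\<And>k. x k \<in> H1 U"
  and L: "(%k. L2_norm U (x k)) \<longlonglongrightarrow> 0"
  and C: "\<And>e. e > 0 ==> \<exists>M. \<forall>m\<ge>M. \<forall>n\<ge>M. gdist U (x m) (x n) < e"
 shows "(%k. gnorm U (x k)) \<longlonglongrightarrow> 0"
proof -
 have Ub: "U \<in> sets borel" using U(1) by simp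
 have d0: "(%k. L2_norm U (wd U (x k) b)) \<longlonglongrightarrow> 0" if b: "b \<in> Basis" for b
 proof -
  let ?d = "%k. wd U (x k) b"
  have dL: "?d k \<in> L2 U" for k by (rule weak_deriv_H1(1)[OF x b])
  have "\<exists>g\<in>L2 U. (%k. L2_dist U (?d k) g) \<longlonglongrightarrow> 0"
  proof (rule L2_complete[OF Ub U(2) dL])
   fix e :: real assume "e > 0"
   from C[OF this] show "\<exists>N. \<forall>i\<ge>N. \<forall>j\<ge>N. L2_dist U (?d i) (?d j) < e"
    using weak_deriv_diff(2)[OF U(1) x x b] by (meson le_less_trans)
  qed
  then obtain g where g: "g \<in> L2 U" "(%k. L2_dist U (?d k) g) \<longlonglongrightarrow> 0" by blast
  have "ae_eq_on U g (%x. 0)"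
  proof (rule fundamental_lemma[OF U(1) g(1)])
   fix \<phi> assume \<phi>: "\<phi> \<in> test_fun U"
   note \<phi>L = test_fun_L2[OF \<phi> Ub] test_fun_L2[OF test_fun_pd[OF \<phi> b] Ub]
   have 1: "(%k. ip U (?d k) \<phi>) \<longlonglongrightarrow> ip U g \<phi>" by (rule ip_tendsto[OF dL g(1) \<phi>L(1) g(2)])
   have "ip U (?d k) \<phi> = - ip U (x k) (pd b \<phi>)" for k
    using weak_deriv_H1(2)[OF x b] \<phi> unfolding has_weak_deriv_ip by simp
   moreover have "(%k. ip U (x k) (pd b \<phi>)) \<longlonglongrightarrow> ip U (%_. 0) (pd b \<phi>)"
    by (rule ip_tendsto[OF H1_L2[OF x] L2_zero \<phi>L(2)]) (use L in simp)
   moreover have "ip U (%_. 0) (pd b \<phi>) = 0" by (simp add: ip_def set_lebesgue_integral_def)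
   ultimately have "(%k. ip U (?d k) \<phi>) \<longlonglongrightarrow> 0" using tendsto_minus by fastforce
   from LIMSEQ_unique[OF 1 this] show "(LINT x:U|lborel. g x * \<phi> x) = 0" by (simp add: ip_def)
  qed
  then have eq: "ae_eq_on U (%p. ?d k p - g p) (?d k)" for k
   unfolding ae_eq_on_def by eventually_elim auto
  have "L2_dist U (?d k) g = L2_norm U (?d k)" for k
   by (rule L2_norm_cong_AE[OF L2_diff[OF dL g(1)] dL eq])
  with g(2) show ?thesis by simp
 qed
 have "(%k. \<Sum>b\<in>Basis. L2_norm U (wd U (x k) b)) \<longlonglongrightarrow> 0"
  using tendsto_sum[of Basis "%b k. L2_norm U (wd U (x k) b)" "%_. 0" sequentially] d0 by simp
 then show ?thesis
  by (rule Lim_null_comparison[OF always_eventually, rotated]) (simp add: gnorm_nonneg gnorm_le_sum)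
qed

section \<open>Approximate solvability in the smooth class\<close>

context spacetime
begin

lemma wform_tsign_CS: "u \<in> H1 Q ==> v \<in> H1 Q ==> \<bar>wave_form u v\<bar> \<le> gnorm Q u * gnorm Q v"
 by (rule wform_CS) (auto simp: tsign_simps)

lemma wform_lin:
 assumes u: "u \<in> H1 Q" and v: "v \<in> H1 Q" and w: "w \<in> H1 Q"
 shows "wform \<sigma> Q (%p. u p + c * v p) w = wform \<sigma> Q u w + c * wform \<sigma> Q v w"
 using wform_add_left[OF open_Q(1) u H1_cmult[OF v] w, of \<sigma> c] wform_cmult_left[OF open_Q(1) v w] by simp

lemma finite_Q: "emeasure lborel Q < \<infinity>"
 using emeasure_bounded_finite[OF bounded_Q(1)] by simp

text \<open>Combining the two bounds of \<open>inf_sup\<close> with Cauchy-Schwarz for the wave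
  form. The factor 4 T is the root of 2 times 8 T^2. The bound on \<open>gnorm Q J\<close> makes
  partners of a bounded sequence bounded; the product bound drives the a priori estimate.\<close>

lemma inf_sup_norms:
 assumes \<psi>: "\<psi> \<in> C_term"
 shows "\<exists>J\<in>C_init. (L2_norm Q \<psi>)\<^sup>2 \<le> 2 * wave_form J \<psi> \<and> gnorm Q J \<le> 8 * T\<^sup>2 * gnorm Q \<psi>
  \<and> L2_norm Q \<psi> * gnorm Q J \<le> 4 * T * wave_form J \<psi>"
proof -
 obtain J where J: "J \<in> C_init" "(L2_norm Q \<psi>)\<^sup>2 \<le> 2 * wave_form J \<psi>" "(gnorm Q J)\<^sup>2 \<le> 8 * T\<^sup>2 * wave_form J \<psi>"
  using inf_sup[OF \<psi>] by blast
 define a where "a = wave_form J \<psi>"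
 have a0: "a \<ge> 0" using J(2) zero_le_power2[of "L2_norm Q \<psi>"] unfolding a_def by linarith
 have T2: "0 < 8 * T\<^sup>2" using T_pos by simp
 have "a \<le> gnorm Q J * gnorm Q \<psi>" unfolding a_def
  using wform_tsign_CS[OF C_H1(1)[OF J(1)] C_H1(2)[OF \<psi>]] by linarith
 then have "8 * T\<^sup>2 * a \<le> 8 * T\<^sup>2 * (gnorm Q J * gnorm Q \<psi>)" using T2 by (simp only: mult_le_cancel_left_pos)
 with J(3) have g: "gnorm Q J * gnorm Q J \<le> gnorm Q J * (8 * T\<^sup>2 * gnorm Q \<psi>)" unfolding a_def power2_eq_square[of "gnorm Q J"]
  by (simp add: mult_ac)
 have 1: "gnorm Q J \<le> 8 * T\<^sup>2 * gnorm Q \<psi>"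
 proof (cases "gnorm Q J = 0")
  case True then show ?thesis using T2 gnorm_nonneg[of Q \<psi>] by simp
 next
  case False
  then have "gnorm Q J > 0" using gnorm_nonneg[of Q J] by simp
  with g show ?thesis by (simp only: mult_le_cancel_left_pos)
 qed
 have "(L2_norm Q \<psi> * gnorm Q J)\<^sup>2 \<le> (2 * a) * (8 * T\<^sup>2 * a)"
  unfolding power_mult_distrib a_def using J(2,3) a0 by (intro mult_mono) (auto simp: a_def)
 also have "\<dots> = (4 * T * a)\<^sup>2" by (simp add: power2_eq_square)
 finally have "L2_norm Q \<psi> * gnorm Q J \<le> 4 * T * a" by (rule power2_le_imp_le) (use T_pos a0 in simp)
 with 1 J show ?thesis unfolding a_def by blast
qed

text \<open>Injectivity on the completion is the point: a Cauchy sequence annihilated in the limit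
  by all a(u, .) tends to 0 in L2 by \<open>inf_sup_norms\<close>, then in the energy norm by
  closability.\<close>

theorem approximate_solution:
 assumes lin: "\<And>x y c. x \<in> C_term ==> y \<in> C_term ==> F (%p. x p + c * y p) = F x + c * F y"
  and bd: "\<And>x. x \<in> C_term ==> \<bar>F x\<bar> \<le> C * gnorm Q x" and e: "e > 0"
 shows "\<exists>u\<in>C_init. \<forall>v\<in>C_term. \<bar>F v - wave_form u v\<bar> \<le> e * gnorm Q v"
proof -
 have zero: "(%_. 0) \<in> C_init" "(%_. 0) \<in> C_term"
  by (auto simp: C_init_def C_term_def Cspatial_def intro!: C_diff_const exI[of _ "{}"] simp del: C_diff.simps One_nat_def)
 have "dense_range C_term C_init (wform (%_. 1) Q) (wave_form)"
 proof
  show "(%_. 0) \<in> C_term" "(%_. 0) \<in> C_init" by (rule zero)+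
  show "\<And>x y c. x \<in> C_term ==> y \<in> C_term ==> (%p. x p + c * y p) \<in> C_term" by (rule C_lin(2))
  show "\<And>x y c. x \<in> C_init ==> y \<in> C_init ==> (%p. x p + c * y p) \<in> C_init" by (rule C_lin(1))
  show "wform (%_. 1) Q (%p. x p + c * y p) z = wform (%_. 1) Q x z + c * wform (%_. 1) Q y z"
   if "x \<in> C_term" "y \<in> C_term" "z \<in> C_term" for x y z c by (intro wform_lin C_H1(2) that)
  show "wform (%_. 1) Q x y = wform (%_. 1) Q y x" for x y by (rule wform_commute)
  show "0 \<le> wform (%_. 1) Q x x" for x by (simp add: gnorm_sq[symmetric])
  show "wave_form (%p. u p + c * v p) x = wave_form u x + c * wave_form v x"
   if "u \<in> C_init" "v \<in> C_init" "x \<in> C_term" for u v x c by (intro wform_lin C_H1 that)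
  show "wave_form u (%p. x p + c * y p) = wave_form u x + c * wave_form u y"
   if "u \<in> C_init" "x \<in> C_term" "y \<in> C_term" for u x y c
   using wform_lin[OF C_H1(2)[OF that(2)] C_H1(2)[OF that(3)] C_H1(1)[OF that(1)]] by (simp only: wform_commute)
  show "\<exists>C. \<forall>x\<in>C_term. \<bar>wave_form u x\<bar> \<le> C * sqrt (wform (%_. 1) Q x x)" if "u \<in> C_init" for u
   unfolding gnorm_sqrt using wform_tsign_CS[OF C_H1(1)[OF that] C_H1(2)] by blast
 next
  fix x :: "nat => 'a \<times> real => real"
  assume x: "\<And>k. x k \<in> C_term"
   and C: "\<And>e. e > 0 ==> \<exists>M. \<forall>m\<ge>M. \<forall>n\<ge>M. wform (%_. 1) Q (%p. x m p - x n p) (%p. x m p - x n p) < e"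
   and A: "\<And>u. u \<in> C_init ==> (%k. wave_form u (x k)) \<longlonglongrightarrow> 0"
  note xH = C_H1(2)[OF x]
  have C': "\<exists>M. \<forall>m\<ge>M. \<forall>n\<ge>M. gdist Q (x m) (x n) < e" if e: "e > 0" for e
  proof -
   have "gdist Q (x m) (x n) < e" if "wform (%_. 1) Q (%p. x m p - x n p) (%p. x m p - x n p) < e\<^sup>2" for m n
    using that e by (intro power2_less_imp_less[of _ e]) (auto simp: gnorm_sq)
   with C[of "e\<^sup>2"] e show ?thesis by (meson zero_less_power)
  qed
  have L0: "(%k. (L2_norm Q (x k))\<^sup>2) \<longlonglongrightarrow> 0"
  proof (rule LIMSEQ_I)
   fix r :: real assume r: "r > 0"
   obtain N where N: "\<And>m n. m \<ge> N ==> n \<ge> N ==> gdist Q (x m) (x n) < 1"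
    using C'[of 1] by auto
   define M where "M = 1 + gnorm Q (x N)"
   have M: "M > 0" using gnorm_nonneg[of Q "x N"] by (simp add: M_def)
   have Mb: "gnorm Q (x j) \<le> M" if "j \<ge> N" for j
   proof -
    have "gnorm Q (%p. (x j p - x N p) + x N p) \<le> gdist Q (x j) (x N) + gnorm Q (x N)"
     by (rule gnorm_triangle[OF open_Q(1) H1_diff[OF open_Q(1) xH xH] xH])
    then show ?thesis using N[OF that order_refl] by (simp add: M_def)
   qed
   define K where "K = 2 * (8 * T\<^sup>2 * M)"
   have K: "K > 0" using T_pos M by (simp add: K_def)
   obtain N' where N': "\<And>m n. m \<ge> N' ==> n \<ge> N' ==> gdist Q (x m) (x n) < r / (2 * K)"
    using C'[of "r / (2 * K)"] r K by auto
   have "(L2_norm Q (x j))\<^sup>2 \<le> r / 2" if j: "j \<ge> max N N'" for j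
   proof -
    obtain J where J: "J \<in> C_init" "(L2_norm Q (x j))\<^sup>2 \<le> 2 * wave_form J (x j)" "gnorm Q J \<le> 8 * T\<^sup>2 * gnorm Q (x j)"
     using inf_sup_norms[OF x] by blast
    have gJ: "2 * gnorm Q J \<le> K"
    proof -
     have "8 * T\<^sup>2 * gnorm Q (x j) \<le> 8 * T\<^sup>2 * M" using Mb[of j] j by (intro mult_left_mono) auto
     from order_trans[OF J(3) this] show ?thesis unfolding K_def by (rule mult_left_mono) simp
    qed
    \<comment> \<open>The partner J depends on j, so j is kept fixed while k tends to infinity.
      Passing from \<open>x j\<close> to \<open>x k\<close> costs the bounded norm of J times a
      Cauchy difference.\<close>
    have est: "(L2_norm Q (x j))\<^sup>2 \<le> 2 * wave_form J (x k) + r / 2" if k: "k \<ge> N'" for k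
    proof -
     have "wave_form J (x j) - wave_form J (x k) = wave_form J (%p. x j p - x k p)"
      using wform_diff_left[OF open_Q(1) xH xH C_H1(1)[OF J(1)]] by (simp only: wform_commute)
     moreover have "\<bar>wave_form J (%p. x j p - x k p)\<bar> \<le> gnorm Q J * gdist Q (x j) (x k)"
      by (intro wform_tsign_CS C_H1(1) J(1) H1_diff open_Q(1) xH)
     moreover have "2 * (gnorm Q J * gdist Q (x j) (x k)) \<le> K * (r / (2 * K))"
      unfolding mult.assoc[symmetric] using gJ N'[of j k] j k K
      by (intro mult_mono) (auto simp: gnorm_nonneg)
     moreover have "K * (r / (2 * K)) = r / 2" using K by simp
     ultimately show ?thesis using J(2) by linarith
    qed
    have "(%k. 2 * wave_form J (x k) + r / 2) \<longlonglongrightarrow> 2 * 0 + r / 2"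
     by (intro tendsto_intros A J(1))
    then show ?thesis using est by (intro LIMSEQ_le_const[of _ "r / 2"]) auto
   qed
   then show "\<exists>no. \<forall>n\<ge>no. norm ((L2_norm Q (x n))\<^sup>2 - 0) < r"
    using r by (intro exI[of _ "max N N'"]) (fastforce intro: le_less_trans)
  qed
  have "(%k. L2_norm Q (x k)) \<longlonglongrightarrow> 0"
   using tendsto_real_sqrt[OF L0] by (simp add: L2_norm_nonneg)
  from gradient_closable[OF open_Q(1) finite_Q xH this C'] have "(%k. gnorm Q (x k)) \<longlonglongrightarrow> 0" .
  from tendsto_power[OF this, of 2] show "(%k. wform (%_. 1) Q (x k) (x k)) \<longlonglongrightarrow> 0"
   by (simp add: gnorm_sq)
 qed
 then interpret D: dense_range C_term C_init "wform (%_. 1) Q" "wave_form" .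
 have "D.bounded_functional F"
  unfolding D.bounded_functional_def gnorm_sqrt using lin bd by blast
 from D.range_dense[OF this e] show ?thesis unfolding gnorm_sqrt .
qed

end

section \<open>Dual norms and linear structure of the function spaces\<close>

lemma dual_norm_ge:
 assumes bd: "\<And>v. v \<in> V ==> \<bar>G v\<bar> \<le> C * N v" and N: "\<And>v. v \<in> V ==> 0 \<le> N v" and v: "v \<in> V"
 shows "\<bar>G v\<bar> \<le> dual_norm V N G * N v"
proof (cases "N v = 0")
 case True then show ?thesis using bd[OF v] by simp
next
 case False
 have pos: "N w > 0" if "w \<in> V" "N w \<noteq> 0" for w using N[OF that(1)] that(2) by simp
 have "bdd_above ((%w. \<bar>G w\<bar> / N w) ` {w \<in> V. N w \<noteq> 0})"
  by (rule bdd_aboveI2[of _ _ C]) (use bd pos in \<open>auto simp: divide_le_eq\<close>)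
 then have "\<bar>G v\<bar> / N v \<le> dual_norm V N G"
  unfolding dual_norm_def by (rule cSUP_upper[rotated]) (use v False in simp)
 then show ?thesis using pos[OF v False] by (simp add: divide_le_eq)
qed

text \<open>An element of nonzero norm is demanded because a supremum over the empty set would be an
  unspecified real number.\<close>

lemma dual_norm_le:
 assumes bd: "\<And>v. v \<in> V ==> \<bar>G v\<bar> \<le> C * N v" and N: "\<And>v. v \<in> V ==> 0 \<le> N v" and ne: "\<exists>v\<in>V. N v \<noteq> 0"
 shows "dual_norm V N G \<le> C"
proof -
 have pos: "N w > 0" if "w \<in> V" "N w \<noteq> 0" for w using N[OF that(1)] that(2) by simp
 show ?thesis unfolding dual_norm_def
  by (rule cSUP_least) (use ne bd pos in \<open>auto simp: divide_le_eq\<close>)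
qed

lemma dual_space_subset:
 "F \<in> dual_space V N ==> W \<subseteq> V ==> F \<in> dual_space W N"
 unfolding dual_space_def by blast

lemma dual_space_lin:
 assumes F: "F \<in> dual_space V N" and v: "v \<in> V" and w: "w \<in> V" "(%x. c * w x) \<in> V"
 shows "F (%x. v x + c * w x) = F v + c * F w"
 using assms unfolding dual_space_def by auto

lemma L2_time_lin:
 assumes X: "X \<subseteq> L2 \<Omega>" "\<And>f g. f \<in> X ==> g \<in> X ==> (%x. f x + c * g x) \<in> X" and O: "\<Omega> \<in> sets borel"
  and u: "u \<in> L2_time X \<Omega> T" and v: "v \<in> L2_time X \<Omega> T"
 shows "(%p. u p + c * v p) \<in> L2_time X \<Omega> T"
proof -
 obtain G where G: "\<And>b. b \<in> Basis ==> G b \<in> L2 (cylQ \<Omega> T)"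
  "\<And>b. b \<in> Basis ==> AE t in lborel. t \<in> {0<..<T} \<longrightarrow> has_weak_deriv \<Omega> (%x. u (x, t)) b (%x. G b (x, t))"
  using u unfolding L2_time_def by blast
 obtain H where H: "\<And>b. b \<in> Basis ==> H b \<in> L2 (cylQ \<Omega> T)"
  "\<And>b. b \<in> Basis ==> AE t in lborel. t \<in> {0<..<T} \<longrightarrow> has_weak_deriv \<Omega> (%x. v (x, t)) b (%x. H b (x, t))"
  using v unfolding L2_time_def by blast
 have sX: "AE t in lborel. t \<in> {0<..<T} \<longrightarrow> (%x. u (x, t)) \<in> X" "AE t in lborel. t \<in> {0<..<T} \<longrightarrow> (%x. v (x, t)) \<in> X"
  using u v unfolding L2_time_def by blast+
 have "AE t in lborel. t \<in> {0<..<T} \<longrightarrow>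
   has_weak_deriv \<Omega> (%x. u (x, t) + c * v (x, t)) b (%x. G b (x, t) + c * H b (x, t))" if b: "b \<in> Basis" for b
  using sX G(2)[OF b] H(2)[OF b] L2_sections(2)[OF G(1)[OF b, unfolded cylQ_def]] L2_sections(2)[OF H(1)[OF b, unfolded cylQ_def]]
  by eventually_elim (use X(1) in \<open>auto intro!: has_weak_deriv_add[OF O b] has_weak_deriv_cmult L2_cmult\<close>)
 moreover have "AE t in lborel. t \<in> {0<..<T} \<longrightarrow> (%x. u (x, t) + c * v (x, t)) \<in> X"
  using sX by eventually_elim (use X(2) in auto)
 moreover have "(%p. u p + c * v p) \<in> L2 (cylQ \<Omega> T)" "\<And>b. b \<in> Basis ==> (%p. G b p + c * H b p) \<in> L2 (cylQ \<Omega> T)"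
  using u v G(1) H(1) by (auto simp: L2_time_def intro!: L2_add L2_cmult)
 ultimately show ?thesis unfolding L2_time_def
  by (intro CollectI conjI exI[of _ "%b p. G b p + c * H b p"]) auto
qed

lemma vanishes_at_lin:
 assumes u: "vanishes_at \<Omega> T s u" and v: "vanishes_at \<Omega> T s v"
 shows "vanishes_at \<Omega> T s (%p. u p + c * v p)"
proof -
 obtain w :: "real => 'a => real" where w: "\<And>t. t \<in> {0..T} ==> w t \<in> L2 \<Omega>"
  "\<And>t. t \<in> {0..T} ==> ((%\<tau>. L2_dist \<Omega> (w \<tau>) (w t)) \<longlongrightarrow> 0) (at t within {0..T})"
  "AE t in lborel. t \<in> {0<..<T} \<longrightarrow> ae_eq_on \<Omega> (w t) (%x. u (x, t))" "ae_eq_on \<Omega> (w s) (%x. 0)"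
  using u unfolding vanishes_at_def by blast
 obtain z :: "real => 'a => real" where z: "\<And>t. t \<in> {0..T} ==> z t \<in> L2 \<Omega>"
  "\<And>t. t \<in> {0..T} ==> ((%\<tau>. L2_dist \<Omega> (z \<tau>) (z t)) \<longlongrightarrow> 0) (at t within {0..T})"
  "AE t in lborel. t \<in> {0<..<T} \<longrightarrow> ae_eq_on \<Omega> (z t) (%x. v (x, t))" "ae_eq_on \<Omega> (z s) (%x. 0)"
  using v unfolding vanishes_at_def by blast
 have ae: "ae_eq_on \<Omega> (%x. f x + c * g x) (%x. f' x + c * g' x)" if "ae_eq_on \<Omega> f f'" "ae_eq_on \<Omega> g g'" for f g f' g'
  using that unfolding ae_eq_on_def by eventually_elim auto
 have "((%\<tau>. L2_norm \<Omega> (%x. (w \<tau> x + c * z \<tau> x) - (w t x + c * z t x))) \<longlongrightarrow> 0) (at t within {0..T})" if t: "t \<in> {0..T}" for t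
 proof (rule Lim_null_comparison)
  have "((%\<tau>. L2_dist \<Omega> (w \<tau>) (w t) + \<bar>c\<bar> * L2_dist \<Omega> (z \<tau>) (z t)) \<longlongrightarrow> 0 + \<bar>c\<bar> * 0) (at t within {0..T})"
   by (intro tendsto_intros w(2) z(2) t)
  then show "((%\<tau>. L2_dist \<Omega> (w \<tau>) (w t) + \<bar>c\<bar> * L2_dist \<Omega> (z \<tau>) (z t)) \<longlongrightarrow> 0) (at t within {0..T})" by simp
  have "L2_norm \<Omega> (%x. (w \<tau> x + c * z \<tau> x) - (w t x + c * z t x)) \<le> L2_dist \<Omega> (w \<tau>) (w t) + \<bar>c\<bar> * L2_dist \<Omega> (z \<tau>) (z t)"
   if \<tau>: "\<tau> \<in> {0..T}" for \<tau>
  proof -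
   have eq: "(w \<tau> x + c * z \<tau> x) - (w t x + c * z t x) = (w \<tau> x - w t x) + c * (z \<tau> x - z t x)" for x
    by (simp add: algebra_simps)
   show ?thesis unfolding eq L2_norm_cmult[symmetric]
    by (intro L2_norm_triangle L2_diff L2_cmult w(1) z(1) t \<tau>)
  qed
  then show "\<forall>\<^sub>F \<tau> in at t within {0..T}. norm (L2_norm \<Omega> (%x. (w \<tau> x + c * z \<tau> x) - (w t x + c * z t x)))
    \<le> L2_dist \<Omega> (w \<tau>) (w t) + \<bar>c\<bar> * L2_dist \<Omega> (z \<tau>) (z t)"
   unfolding eventually_at_filter by (intro always_eventually allI impI) (simp add: L2_norm_nonneg)
 qed
 moreover have "AE t in lborel. t \<in> {0<..<T} \<longrightarrow> ae_eq_on \<Omega> (%x. w t x + c * z t x) (%x. u (x, t) + c * v (x, t))"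
  using w(3) z(3) by eventually_elim (use ae in auto)
 moreover have "ae_eq_on \<Omega> (%x. w s x + c * z s x) (%x. 0)" using ae[OF w(4) z(4)] by simp
 moreover have "(%x. w t x + c * z t x) \<in> L2 \<Omega>" if "t \<in> {0..T}" for t using w(1) z(1) that by (intro L2_add L2_cmult)
 ultimately show ?thesis unfolding vanishes_at_def by (intro exI[of _ "%t x. w t x + c * z t x"]) auto
qed

section \<open>The wave operator on $H(Q)$\<close>

context spacetime
begin

lemma H1_time_lin:
 assumes u: "u \<in> H1_time \<Omega> T" and v: "v \<in> H1_time \<Omega> T"
 shows "(%p. u p + c * v p) \<in> H1_time \<Omega> T"
proof -
 obtain D where D: "D \<in> L2 (cylQ \<Omega> T)" "\<And>\<eta>. \<eta> \<in> test_fun {0<..<T} ==> AE x in lborel. x \<in> \<Omega> \<longrightarrow>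
   (LINT t:{0<..<T}|lborel. u (x, t) * deriv \<eta> t) = - (LINT t:{0<..<T}|lborel. D (x, t) * \<eta> t)"
  using u unfolding H1_time_def ae_eq_on_def by blast
 obtain D' where D': "D' \<in> L2 (cylQ \<Omega> T)" "\<And>\<eta>. \<eta> \<in> test_fun {0<..<T} ==> AE x in lborel. x \<in> \<Omega> \<longrightarrow>
   (LINT t:{0<..<T}|lborel. v (x, t) * deriv \<eta> t) = - (LINT t:{0<..<T}|lborel. D' (x, t) * \<eta> t)"
  using v unfolding H1_time_def ae_eq_on_def by blast
 have uv: "u \<in> L2 (cylQ \<Omega> T)" "v \<in> L2 (cylQ \<Omega> T)" using u v by (auto simp: H1_time_def)
 have lin: "(LINT t:{0<..<T}|lborel. (f t + c * g t) * h t) = (LINT t:{0<..<T}|lborel. f t * h t) + c * (LINT t:{0<..<T}|lborel. g t * h t)"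
  if "f \<in> L2 {0<..<T}" "g \<in> L2 {0<..<T}" "h \<in> L2 {0<..<T}" for f g h :: "real => real"
  using ip_add_left[OF that(1) L2_cmult[OF that(2), of c] that(3)] ip_cmult_left[of "{0<..<T}" c g h] by (simp add: ip_def)
 have "AE x in lborel. x \<in> \<Omega> \<longrightarrow>
   (LINT t:{0<..<T}|lborel. (u (x, t) + c * v (x, t)) * deriv \<eta> t) = - (LINT t:{0<..<T}|lborel. (D (x, t) + c * D' (x, t)) * \<eta> t)"
  if \<eta>: "\<eta> \<in> test_fun {0<..<T}" for \<eta>
 proof -
  have "pd 1 \<eta> \<in> test_fun {0<..<T}" by (rule test_fun_pd[OF \<eta>]) simp
  moreover have "deriv \<eta> = pd 1 \<eta>" by (rule deriv_eq_pd[OF test_funD(1)[OF \<eta>]])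
  ultimately have d: "deriv \<eta> \<in> L2 {0<..<T}" "\<eta> \<in> L2 {0<..<T}" using test_fun_L2[of _ _ "{0<..<T}"] \<eta> by auto
  show ?thesis
   using D(2)[OF \<eta>] D'(2)[OF \<eta>] L2_sections(1)[OF uv(1)[unfolded cylQ_def]] L2_sections(1)[OF uv(2)[unfolded cylQ_def]]
    L2_sections(1)[OF D(1)[unfolded cylQ_def]] L2_sections(1)[OF D'(1)[unfolded cylQ_def]]
  proof eventually_elim
   case (elim x)
   show ?case
   proof
    assume x: "x \<in> \<Omega>"
    note e = elim[THEN mp, OF x]
    show "(LINT t:{0<..<T}|lborel. (u (x, t) + c * v (x, t)) * deriv \<eta> t) = - (LINT t:{0<..<T}|lborel. (D (x, t) + c * D' (x, t)) * \<eta> t)"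
     unfolding lin[OF e(3,4) d(1)] lin[OF e(5,6) d(2)] e(1,2) by simp
   qed
  qed
 qed
 moreover have "(%p. u p + c * v p) \<in> L2 (cylQ \<Omega> T)" "(%p. D p + c * D' p) \<in> L2 (cylQ \<Omega> T)"
  using uv D(1) D'(1) by (auto intro!: L2_add L2_cmult)
 ultimately show ?thesis unfolding H1_time_def ae_eq_on_def
  by (intro CollectI conjI bexI[of _ "%p. D p + c * D' p"]) auto
qed

lemma H11_lin:
 "u \<in> V_init ==> v \<in> V_init ==> (%p. u p + c * v p) \<in> V_init"
 "u \<in> H11_0term \<Omega> T ==> v \<in> H11_0term \<Omega> T ==> (%p. u p + c * v p) \<in> H11_0term \<Omega> T"
 "u \<in> V_0init ==> v \<in> V_0init ==> (%p. u p + c * v p) \<in> V_0init"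
proof -
 have 1: "H1 \<Omega> \<subseteq> L2 \<Omega>" "H10 \<Omega> \<subseteq> L2 \<Omega>" using H1_L2 H10_H1 by blast+
 have 2: "(%x. f x + c * g x) \<in> H1 \<Omega>" if "f \<in> H1 \<Omega>" "g \<in> H1 \<Omega>" for f g using that by (intro H1_add H1_cmult open_Omega)
 have 3: "(%x. f x + c * g x) \<in> H10 \<Omega>" if "f \<in> H10 \<Omega>" "g \<in> H10 \<Omega>" for f g using that by (intro H10_add H10_cmult open_Omega)
 note L = L2_time_lin[OF 1(1) 2 borel_Q(3)] L2_time_lin[OF 1(2) 3 borel_Q(3)] H1_time_lin vanishes_at_lin
 show "u \<in> V_init ==> v \<in> V_init ==> (%p. u p + c * v p) \<in> V_init"
  "u \<in> H11_0term \<Omega> T ==> v \<in> H11_0term \<Omega> T ==> (%p. u p + c * v p) \<in> H11_0term \<Omega> T"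
  "u \<in> V_0init ==> v \<in> V_0init ==> (%p. u p + c * v p) \<in> V_0init"
  unfolding H11_init_def H11_0term_def H11_0init_def by (simp_all add: L)
qed

lemma zero_ext_ip: "(LINT p:Qm|lborel. zero_ext \<Omega> T u p * g p) = ip Q u g"
proof -
 have "indicator Qm p *\<^sub>R (zero_ext \<Omega> T u p * g p) = indicator Q p *\<^sub>R (u p * g p)" for p
  using Q_subset_Qm by (auto simp: indicator_def zero_ext_def)
 then show ?thesis unfolding ip_def set_lebesgue_integral_def by presburger
qed

lemma wave_op_eq: "wave_op \<phi> = (%p. - (\<Sum>c\<in>Basis. tsign c * pd c (pd c \<phi>) p))"
proof -
 have "(\<Sum>c\<in>Basis. g c) = (\<Sum>b\<in>Basis. g (b, 0)) + g (0, 1)" for g :: "'a \<times> real => real"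
  by (simp add: Basis_prod_def sum.union_disjoint sum.reindex inj_on_def disjoint_iff image_iff)
 then show ?thesis by (simp add: fun_eq_iff wave_op_def tsign_def)
qed

lemma test_fun_second_L2:
 assumes \<phi>: "\<phi> \<in> test_fun Qm" and c: "c \<in> Basis"
 shows "pd c (pd c \<phi>) \<in> L2 Q"
 by (intro test_fun_L2[OF test_fun_pd[OF test_fun_pd[OF \<phi> c] c]] borel_Q)

lemma wave_op_L2: "\<phi> \<in> test_fun Qm ==> wave_op \<phi> \<in> L2 Q"
 unfolding wave_op_eq by (intro L2_uminus L2_sum L2_cmult test_fun_second_L2)

lemma ip_wave_op:
 assumes u: "u \<in> L2 Q" and \<phi>: "\<phi> \<in> test_fun Qm"
 shows "ip Q u (wave_op \<phi>) = - (\<Sum>c\<in>Basis. tsign c * ip Q u (pd c (pd c \<phi>)))"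
proof -
 have "ip Q u (%p. \<Sum>c\<in>I. tsign c * pd c (pd c \<phi>) p) = (\<Sum>c\<in>I. tsign c * ip Q u (pd c (pd c \<phi>)))"
  if "I \<subseteq> Basis" "finite I" for I
  using that(2,1)
 proof (induction I)
  case empty then show ?case by (simp add: ip_def set_lebesgue_integral_def)
 next
  case (insert c I)
  then have "ip Q u (%p. tsign c * pd c (pd c \<phi>) p + (\<Sum>c\<in>I. tsign c * pd c (pd c \<phi>) p)) =
   ip Q u (%p. tsign c * pd c (pd c \<phi>) p) + ip Q u (%p. \<Sum>c\<in>I. tsign c * pd c (pd c \<phi>) p)"
   by (intro ip_add_right u L2_sum L2_cmult test_fun_second_L2[OF \<phi>]) auto
  with insert show ?case by (simp add: ip_cmult_right)
 qed
 from this[OF order_refl finite_Basis] show ?thesis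
  unfolding wave_op_eq by (subst ip_commute, subst ip_minus_left) (simp add: ip_commute)
qed

text \<open>One integration by parts against the derivatives of \<phi>, which do not vanish at t =
  0; \<open>init_reg\<close> is what keeps an initial term from appearing.\<close>

lemma init_reg_wave_op:
 assumes u: "init_reg u" and \<phi>: "\<phi> \<in> test_fun Qm"
 shows "ip Q u (wave_op \<phi>) = wave_form u \<phi>"
proof -
 have uH: "u \<in> H1 Q" using u by (simp add: init_reg_def)
 have sub: "Qm \<subseteq> \<Omega> \<times> {..<T}" by (auto simp: cylQm_def)
 have "ip Q u (pd c (pd c \<phi>)) = - ip Q (wd Q u c) (wd Q \<phi> c)" if c: "c \<in> Basis" for c
 proof -
  note d\<phi> = test_fun_pd[OF \<phi> c]
  have "ip Q u (pd c (pd c \<phi>)) = - ip Q (wd Q u c) (pd c \<phi>)"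
   using u c test_fun_mono[OF d\<phi> sub] unfolding init_reg_def by blast
  moreover have "ip Q (pd c \<phi>) (wd Q u c) = ip Q (wd Q \<phi> c) (wd Q u c)"
  proof (rule ip_cong_AE)
   note w = weak_deriv_eq[OF open_Q(1) test_fun_L2[OF d\<phi> borel_Q(1)] has_weak_deriv_C_diff[OF test_funD(1)[OF \<phi>] c]]
   show "wd Q \<phi> c \<in> L2 Q" "ae_eq_on Q (pd c \<phi>) (wd Q \<phi> c)" using w ae_eq_on_sym by blast+
  qed (use test_fun_L2[OF d\<phi> borel_Q(1)] weak_deriv_H1(1)[OF uH c] in auto)
  ultimately show ?thesis by (simp add: ip_commute)
 qed
 then show ?thesis by (simp add: ip_wave_op[OF H1_L2[OF uH] \<phi>] wform_def sum_negf)
qed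

lemma represents_wave_iff:
 "represents_wave \<Omega> T u F \<longleftrightarrow> F \<in> dual_space (H10 Qm) (gnorm Qm) \<and> (\<forall>\<phi>\<in>test_fun Qm. F \<phi> = ip Q u (wave_op \<phi>))"
 by (simp add: represents_wave_def zero_ext_ip energy_norm_eq[abs_def])

lemma H10_Qm_Q:
 assumes "w \<in> H10 Qm"
 shows "w \<in> H1 Qm" "w \<in> H1 Q" "gnorm Q w \<le> gnorm Qm w"
 using H1_subset[OF open_Q(2) open_Q(1) Q_subset_Qm H10_H1[OF assms]] H10_H1[OF assms] by auto

lemma init_reg_represents:
 assumes u: "init_reg u"
 shows "represents_wave \<Omega> T u (wave_form u)"
proof -
 have uH: "u \<in> H1 Q" using u by (simp add: init_reg_def)
 have "\<bar>wave_form u w\<bar> \<le> gnorm Q u * gnorm Qm w" if w: "w \<in> H10 Qm" for w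
  using wform_tsign_CS[OF uH H10_Qm_Q(2)[OF w]] mult_left_mono[OF H10_Qm_Q(3)[OF w] gnorm_nonneg[of Q u]] by linarith
 moreover have "wave_form u (%p. v p + w p) = wave_form u v + wave_form u w" if "v \<in> H10 Qm" "w \<in> H10 Qm" for v w
  using wform_add_left[OF open_Q(1) H10_Qm_Q(2)[OF that(1)] H10_Qm_Q(2)[OF that(2)] uH] by (simp only: wform_commute)
 moreover have "wave_form u (%p. c * w p) = c * wave_form u w" if "w \<in> H10 Qm" for c w
  using wform_cmult_left[OF open_Q(1) H10_Qm_Q(2)[OF that] uH] by (simp only: wform_commute)
 ultimately show ?thesis unfolding represents_wave_iff dual_space_def using init_reg_wave_op[OF u] by auto
qed

lemma dual_H10_diff:
 assumes F: "F \<in> dual_space (H10 Qm) (gnorm Qm)" and v: "v \<in> H10 Qm" "w \<in> H10 Qm"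
 shows "F (%p. v p - w p) = F v - F w"
 using dual_space_lin[OF F v H10_cmult[OF open_Q(2) v(2), of "-1"]] by simp

lemma dual_H10_bound:
 assumes F: "F \<in> dual_space (H10 Qm) (gnorm Qm)"
 shows "\<exists>C>0. \<forall>w\<in>H10 Qm. \<bar>F w\<bar> \<le> C * gnorm Qm w"
proof -
 obtain C where C: "\<And>w. w \<in> H10 Qm ==> \<bar>F w\<bar> \<le> C * gnorm Qm w" using F unfolding dual_space_def by blast
 have "\<bar>F w\<bar> \<le> (\<bar>C\<bar> + 1) * gnorm Qm w" if "w \<in> H10 Qm" for w
  using C[OF that] mult_right_mono[of C "\<bar>C\<bar> + 1" "gnorm Qm w"] gnorm_nonneg[of Qm w] by linarith
 then show ?thesis by (intro exI[of _ "\<bar>C\<bar> + 1"]) auto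
qed

text \<open>Test functions are dense in \<open>H10 Qm\<close>. This uniqueness makes the chosen
  functional \<open>wpair\<close> computable from any representing one.\<close>

lemma dual_H10_determined:
 assumes F: "F \<in> dual_space (H10 Qm) (gnorm Qm)" "G \<in> dual_space (H10 Qm) (gnorm Qm)"
  and eq: "\<And>\<phi>. \<phi> \<in> test_fun Qm ==> F \<phi> = G \<phi>" and w: "w \<in> H10 Qm"
 shows "F w = G w"
proof -
 obtain C where C: "C > 0" "\<And>w. w \<in> H10 Qm ==> \<bar>F w\<bar> \<le> C * gnorm Qm w" using dual_H10_bound[OF F(1)] by blast
 obtain D where D: "D > 0" "\<And>w. w \<in> H10 Qm ==> \<bar>G w\<bar> \<le> D * gnorm Qm w" using dual_H10_bound[OF F(2)] by blast
 have "\<bar>F w - G w\<bar> \<le> 0 + e" if e: "e > 0" for e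
 proof -
  have "e / (C + D) > 0" using e C(1) D(1) by simp
  from H10_approx[OF open_Q(2) w this] obtain \<phi> where \<phi>: "\<phi> \<in> test_fun Qm" "gdist Qm \<phi> w < e / (C + D)"
   by (elim exE conjE)
  note \<phi>H = test_fun_H10[OF open_Q(2) \<phi>(1)]
  have "F w - G w = G (%p. \<phi> p - w p) - F (%p. \<phi> p - w p)"
   unfolding dual_H10_diff[OF F(1) \<phi>H w] dual_H10_diff[OF F(2) \<phi>H w] eq[OF \<phi>(1)] by simp
  also have "\<bar>\<dots>\<bar> \<le> (C + D) * gdist Qm \<phi> w"
   using C(2)[OF H10_diff[OF open_Q(2) \<phi>H w]] D(2)[OF H10_diff[OF open_Q(2) \<phi>H w]] by (simp add: distrib_right)
  also have "\<dots> \<le> (C + D) * (e / (C + D))" using \<phi>(2) C(1) D(1) by (intro mult_left_mono) auto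
  finally show ?thesis using C(1) D(1) by simp
 qed
 then have "\<bar>F w - G w\<bar> \<le> 0" by (rule field_le_epsilon)
 then show ?thesis by simp
qed

lemma HQ_wave_pair:
 assumes "u \<in> HQs"
 shows "wpair u \<in> dual_space (H10 Qm) (gnorm Qm)"
  "\<phi> \<in> test_fun Qm ==> wpair u \<phi> = ip Q u (wave_op \<phi>)" "u \<in> L2 Q"
proof -
 obtain F where "represents_wave \<Omega> T u F" using assms by (auto simp: HQ_def)
 then have "represents_wave \<Omega> T u (wpair u)" unfolding wave_pair_def by (rule someI[of "represents_wave \<Omega> T u"])
 then show "wpair u \<in> dual_space (H10 Qm) (gnorm Qm)" "\<phi> \<in> test_fun Qm ==> wpair u \<phi> = ip Q u (wave_op \<phi>)"
  by (auto simp: represents_wave_iff)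
 show "u \<in> L2 Q" using assms by (simp add: HQ_def)
qed

lemma wave_pair_eq:
 assumes u: "u \<in> L2 Q" and F: "F \<in> dual_space (H10 Qm) (gnorm Qm)"
  and eq: "\<And>\<phi>. \<phi> \<in> test_fun Qm ==> F \<phi> = ip Q u (wave_op \<phi>)"
 shows "u \<in> HQs" "w \<in> H10 Qm ==> wpair u w = F w"
proof -
 show h: "u \<in> HQs" unfolding HQ_def represents_wave_iff using assms by blast
 show "wpair u w = F w" if "w \<in> H10 Qm"
  by (rule dual_H10_determined[OF HQ_wave_pair(1)[OF h] F _ that]) (simp add: HQ_wave_pair(2)[OF h] eq)
qed

text \<open>\<open>wpair\<close> is a choice and so not linear by construction: the combination of
  the two chosen functionals represents the combined element, and uniqueness identifies it with the
  chosen one.\<close>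

lemma HQ_lin:
 assumes u: "u \<in> HQs" and v: "v \<in> HQs"
 shows "(%p. u p + c * v p) \<in> HQs"
  "w \<in> H10 Qm ==> wpair (%p. u p + c * v p) w = wpair u w + c * wpair v w"
proof -
 note hu = HQ_wave_pair[OF u] and hv = HQ_wave_pair[OF v]
 define F where "F w = wpair u w + c * wpair v w" for w
 obtain C where C: "C > 0" "\<And>w. w \<in> H10 Qm ==> \<bar>wpair u w\<bar> \<le> C * gnorm Qm w" using dual_H10_bound[OF hu(1)] by blast
 obtain D where D: "D > 0" "\<And>w. w \<in> H10 Qm ==> \<bar>wpair v w\<bar> \<le> D * gnorm Qm w" using dual_H10_bound[OF hv(1)] by blast
 have bd: "\<bar>F w\<bar> \<le> (C + \<bar>c\<bar> * D) * gnorm Qm w" if w: "w \<in> H10 Qm" for w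
 proof -
  have "\<bar>c * wpair v w\<bar> \<le> \<bar>c\<bar> * (D * gnorm Qm w)"
   unfolding abs_mult by (intro mult_left_mono D(2) w) simp
  with C(2)[OF w] show ?thesis by (simp add: F_def distrib_right)
 qed
 have "F \<in> dual_space (H10 Qm) (gnorm Qm)"
  unfolding dual_space_def
 proof (intro CollectI conjI ballI allI)
  show "F (%x. w x + z x) = F w + F z" if "w \<in> H10 Qm" "z \<in> H10 Qm" for w z
   using hu(1) hv(1) that unfolding dual_space_def F_def by (auto simp: algebra_simps)
  show "F (%x. d * w x) = d * F w" if "w \<in> H10 Qm" for d w
   using hu(1) hv(1) that unfolding dual_space_def F_def by (auto simp: algebra_simps)
  show "\<exists>C. \<forall>v\<in>H10 Qm. \<bar>F v\<bar> \<le> C * gnorm Qm v" using bd by blast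
 qed
 moreover have "F \<phi> = ip Q (%p. u p + c * v p) (wave_op \<phi>)" if \<phi>: "\<phi> \<in> test_fun Qm" for \<phi>
  using ip_add_left[OF hu(3) L2_cmult[OF hv(3), of c] wave_op_L2[OF \<phi>]]
  by (simp add: F_def hu(2)[OF \<phi>] hv(2)[OF \<phi>] ip_cmult_left)
 moreover have "(%p. u p + c * v p) \<in> L2 Q" by (intro L2_add L2_cmult hu(3) hv(3))
 ultimately show "(%p. u p + c * v p) \<in> HQs"
  "w \<in> H10 Qm ==> wpair (%p. u p + c * v p) w = wpair u w + c * wpair v w"
  using wave_pair_eq[of "%p. u p + c * v p" F] unfolding F_def by blast+
qed

lemma HQ_diff:
 assumes u: "u \<in> HQs" and v: "v \<in> HQs"
 shows "(%p. u p - v p) \<in> HQs"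
  "w \<in> H10 Qm ==> wpair (%p. u p - v p) w = wpair u w - wpair v w"
 using HQ_lin[OF u v, where c = "-1"] by simp_all

lemma init_reg_HQ:
 assumes u: "init_reg u"
 shows "u \<in> HQs" "w \<in> H10 Qm ==> wpair u w = wave_form u w"
 using init_reg_represents[OF u] wave_pair_eq[of u "wave_form u"] H1_L2[of u Q] u
 unfolding represents_wave_iff init_reg_def by auto

lemma init_reg_lin:
 assumes u: "init_reg u" and v: "init_reg v"
 shows "init_reg (%p. u p + c * v p)"
proof -
 have uH: "u \<in> H1 Q" and vH: "v \<in> H1 Q" using u v by (auto simp: init_reg_def)
 note cvH = H1_cmult[OF vH, of c]
 have uvH: "(%p. u p + c * v p) \<in> H1 Q" by (rule H1_add[OF open_Q(1) uH cvH])
 show ?thesis unfolding init_reg_def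
 proof (intro conjI ballI uvH)
  fix b \<phi> assume b: "b \<in> (Basis :: ('a \<times> real) set)" and \<phi>: "\<phi> \<in> test_fun (\<Omega> \<times> {..<T})"
  note \<phi>L = test_fun_L2[OF \<phi> borel_Q(1)] test_fun_L2[OF test_fun_pd[OF \<phi> b] borel_Q(1)]
  note d = weak_deriv_H1(1)[OF uH b] weak_deriv_H1(1)[OF vH b]
  have ae: "ae_eq_on Q (wd Q (%p. u p + c * v p) b) (%p. wd Q u b p + c * wd Q v b p)"
   using weak_deriv_add(1)[OF open_Q(1) uH cvH b] weak_deriv_cmult(1)[OF open_Q(1) vH b, of c]
   unfolding ae_eq_on_def by eventually_elim auto
  have "ip Q (wd Q (%p. u p + c * v p) b) \<phi> = ip Q (%p. wd Q u b p + c * wd Q v b p) \<phi>"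
   by (rule ip_cong_AE[OF weak_deriv_H1(1)[OF uvH b] _ \<phi>L(1) ae]) (intro L2_add L2_cmult d)
  also have "\<dots> = ip Q (wd Q u b) \<phi> + c * ip Q (wd Q v b) \<phi>"
   using ip_add_left[OF d(1) L2_cmult[OF d(2)] \<phi>L(1)] by (simp add: ip_cmult_left)
  also have "\<dots> = - (ip Q u (pd b \<phi>) + c * ip Q v (pd b \<phi>))"
   using u v b \<phi> unfolding init_reg_def by (auto simp: algebra_simps)
  also have "\<dots> = - ip Q (%p. u p + c * v p) (pd b \<phi>)"
   using ip_add_left[OF H1_L2[OF uH] L2_cmult[OF H1_L2[OF vH]] \<phi>L(2)] by (simp add: ip_cmult_left)
  finally show "ip Q (%p. u p + c * v p) (pd b \<phi>) = - ip Q (wd Q (%p. u p + c * v p) b) \<phi>" by simp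
 qed
qed

lemma init_reg_diff: "init_reg u ==> init_reg v ==> init_reg (%p. u p - v p)"
 using init_reg_lin[of u v "-1"] by simp

lemma init_reg_H11_init: "u \<in> V_init ==> init_reg u" "u \<in> V_0init ==> init_reg u" "u \<in> C_init ==> init_reg u"
proof -
 show "u \<in> V_init ==> init_reg u" and 1: "u \<in> V_0init ==> init_reg u"
  using init_reg_H11 by (auto simp: H11_init_def H11_0init_def)
 show "u \<in> C_init ==> init_reg u" using 1 C_H11(1) by blast
qed

lemma H11_0term_L2: "v \<in> H11_0term \<Omega> T ==> v \<in> L2 Q"
 by (simp add: H11_0term_def L2_time_def)

end

section \<open>The extension operator and the wave norm\<close>

locale wave_setting = spacetime \<Omega> T for \<Omega> :: "'a::euclidean_space set" and T +
 fixes E :: "('a \<times> real => real) => ('a \<times> real => real)"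
 assumes ext: "extension_operator \<Omega> T E" and Omega_nonempty: "\<Omega> \<noteq> {}"
begin

abbreviation "V0 \<equiv> H11_0term \<Omega> T"
abbreviation "wnorm \<equiv> wave_norm \<Omega> T E"
abbreviation "wdist u v \<equiv> wnorm (%p. u p - v p)"
abbreviation "tends \<equiv> HQ_tends \<Omega> T E"
abbreviation "ltrace \<equiv> lateral_trace \<Omega> T E"

lemma E_H10: "v \<in> V0 ==> E v \<in> H10 Qm"
 using ext unfolding extension_operator_def by blast

lemma E_add_AE: "v \<in> V0 ==> w \<in> V0 ==> ae_eq_on Qm (E (%p. v p + w p)) (%p. E v p + E w p)"
 using ext unfolding extension_operator_def by blast

lemma E_cmult_AE: "v \<in> V0 ==> ae_eq_on Qm (E (%p. c * v p)) (%p. c * E v p)"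
 using ext unfolding extension_operator_def by blast

lemma E_restrict: "v \<in> V0 ==> ae_eq_on Q (E v) v"
 using ext unfolding extension_operator_def by blast

lemma E_bounded: "\<exists>C>0. \<forall>v\<in>V0. gnorm Qm (E v) \<le> C * gnorm Q v"
proof -
 obtain C where C: "\<And>v. v \<in> V0 ==> gnorm Qm (E v) \<le> C * gnorm Q v"
  using ext unfolding extension_operator_def energy_norm_eq by blast
 have "gnorm Qm (E v) \<le> (\<bar>C\<bar> + 1) * gnorm Q v" if "v \<in> V0" for v
  using C[OF that] mult_right_mono[of C "\<bar>C\<bar> + 1" "gnorm Q v"] gnorm_nonneg[of Q v] by linarith
 then show ?thesis by (intro exI[of _ "\<bar>C\<bar> + 1"]) auto
qed

text \<open>Joint regularity in space and time is read off from \<open>E v\<close>, which lies in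
  \<open>H1 Qm\<close> and agrees with v almost everywhere on Q.\<close>

lemma V0_H1:
 assumes v: "v \<in> V0"
 shows "v \<in> H1 Q" "gnorm Q (E v) = gnorm Q v" "u \<in> H1 Q ==> wform \<sigma> Q u (E v) = wform \<sigma> Q u v"
proof -
 note Ev = H10_Qm_Q(2)[OF E_H10[OF v]]
 note c = wform_cong[OF open_Q(1) _ Ev H11_0term_L2[OF v] E_restrict[OF v]]
 show vH: "v \<in> H1 Q" using c(1)[OF Ev] .
 show "gnorm Q (E v) = gnorm Q v" using c(3)[OF Ev] by simp
 show "u \<in> H1 Q ==> wform \<sigma> Q u (E v) = wform \<sigma> Q u v" using c(2)[of u] by simp
qed

text \<open>Test functions approximating \<open>E v\<close> on \<open>Qm\<close> approximate v after
  restriction to Q; their values at t = 0 are unrestricted, as are those of v.\<close>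

lemma V0_approx:
 assumes v: "v \<in> V0" and e: "e > 0"
 shows "\<exists>\<phi>\<in>test_fun Qm. L2_dist Q \<phi> v < e \<and> gdist Q \<phi> v < e"
proof -
 note EH = E_H10[OF v]
 from H10_approx[OF open_Q(2) EH e] obtain \<phi> where \<phi>: "\<phi> \<in> test_fun Qm"
  "L2_dist Qm \<phi> (E v) < e" "gdist Qm \<phi> (E v) < e" by (elim exE conjE)
 note d = H10_diff[OF open_Q(2) test_fun_H10[OF open_Q(2) \<phi>(1)] EH]
 have \<phi>H: "\<phi> \<in> H1 Q" by (rule H10_Qm_Q(2)[OF test_fun_H10[OF open_Q(2) \<phi>(1)]])
 have ae: "ae_eq_on Q (%p. \<phi> p - E v p) (%p. \<phi> p - v p)"
  using E_restrict[OF v] unfolding ae_eq_on_def by eventually_elim auto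
 have vL: "(%p. \<phi> p - v p) \<in> L2 Q" by (intro L2_diff H1_L2[OF \<phi>H] H11_0term_L2[OF v])
 have "L2_dist Q \<phi> v = L2_dist Q \<phi> (E v)"
  using L2_norm_cong_AE[OF H1_L2[OF H10_Qm_Q(2)[OF d]] vL ae] by simp
 also have "\<dots> \<le> L2_dist Qm \<phi> (E v)" by (rule L2_norm_subset[OF H1_L2[OF H10_H1[OF d]] Q_subset_Qm borel_Q(1)])
 finally have 1: "L2_dist Q \<phi> v < e" using \<phi>(2) by simp
 have "gdist Q \<phi> v = gdist Q \<phi> (E v)"
  by (rule wform_cong(3)[OF open_Q(1) \<phi>H H10_Qm_Q(2)[OF d] vL ae])
 also have "\<dots> \<le> gdist Qm \<phi> (E v)" by (rule H10_Qm_Q(3)[OF d])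
 finally show ?thesis using 1 \<phi>(1,3) by auto
qed

text \<open>\<open>E\<close> is linear only up to null sets, so the pairing must ignore them. It
  does: a function vanishing almost everywhere has gradient norm 0, which bounds the
  functional.\<close>

lemma wave_pair_AE:
 assumes u: "u \<in> HQs" and w: "w \<in> H10 Qm" "z \<in> H10 Qm" "ae_eq_on Qm w z"
 shows "wpair u w = wpair u z"
proof -
 note F = HQ_wave_pair(1)[OF u]
 obtain C where C: "\<And>w. w \<in> H10 Qm ==> \<bar>wpair u w\<bar> \<le> C * gnorm Qm w" using dual_H10_bound[OF F] by blast
 note d = H10_diff[OF open_Q(2) w(1,2)]
 have "ae_eq_on Qm (%p. w p - z p) (%p. 0 * w p)" using w(3) unfolding ae_eq_on_def by eventually_elim auto
 from wform_cong(3)[OF open_Q(2) H10_H1[OF d] H10_H1[OF d] L2_cmult[OF H1_L2[OF H10_H1[OF w(1)]]] this]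
 have "gdist Qm w z = 0" using gnorm_cmult[OF open_Q(2) H10_H1[OF w(1)], of 0] by simp
 with C[OF d] show ?thesis by (simp add: dual_H10_diff[OF F w(1,2)])
qed

lemma wave_pair_E_lin:
 assumes u: "u \<in> HQs" and v: "v \<in> V0" "w \<in> V0" "(%p. c * w p) \<in> V0" "(%p. v p + c * w p) \<in> V0"
 shows "wpair u (E (%p. v p + c * w p)) = wpair u (E v) + c * wpair u (E w)"
proof -
 note H = E_H10[OF v(1)] E_H10[OF v(2)]
 have "ae_eq_on Qm (E (%p. v p + c * w p)) (%p. E v p + c * E w p)"
  using E_add_AE[OF v(1,3)] E_cmult_AE[OF v(2), of c] unfolding ae_eq_on_def by eventually_elim auto
 then have "wpair u (E (%p. v p + c * w p)) = wpair u (%p. E v p + c * E w p)"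
  by (intro wave_pair_AE u E_H10 v H10_add H10_cmult open_Q H)
 also have "\<dots> = wpair u (E v) + c * wpair u (E w)"
  by (rule dual_space_lin[OF HQ_wave_pair(1)[OF u] H H10_cmult[OF open_Q(2) H(2)]])
 finally show ?thesis .
qed

text \<open>A cutoff equal to 1 near a point of Q works: zero energy would give zero L2 norm by the
  inf-sup inequality. This keeps the suprema in the dual and operator norms over nonempty
  sets.\<close>

lemma V0_nontrivial: "\<exists>v\<in>V0. gnorm Q v \<noteq> 0"
proof -
 obtain x where x: "x \<in> \<Omega>" using Omega_nonempty by blast
 define p where "p = (x, T / 2)"
 have p: "p \<in> Q" using x T_pos by (simp add: p_def cylQ_def)
 have "compact {p}" "{p} \<subseteq> Qm" using p Q_subset_Qm by auto
 from smooth_cutoff[OF this(1) open_Q(2) this(2)] obtain \<kappa> \<delta> where \<kappa>: "\<kappa> \<in> test_fun Qm" "\<delta> > 0"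
  "\<forall>y\<in>{p}. \<forall>z. norm z < \<delta> \<longrightarrow> \<kappa> (y + z) = 1" by (elim exE conjE)
 have \<kappa>C: "\<kappa> \<in> C_term" by (rule test_fun_C_term[OF \<kappa>(1)])
 have "gnorm Q \<kappa> \<noteq> 0"
 proof
  assume g: "gnorm Q \<kappa> = 0"
  obtain J where J: "J \<in> C_init" "(L2_norm Q \<kappa>)\<^sup>2 \<le> 2 * wave_form J \<kappa>" using inf_sup[OF \<kappa>C] by blast
  have "wave_form J \<kappa> = 0" using wform_tsign_CS[OF C_H1(1)[OF J(1)] C_H1(2)[OF \<kappa>C]] g by simp
  then have "L2_norm Q \<kappa> = 0" using J(2) by simp
  then have ae: "AE y in lborel. y \<in> Q \<longrightarrow> \<kappa> y = 0"
   using L2_norm_eq_0_iff[OF H1_L2[OF C_H1(2)[OF \<kappa>C]]] by (simp add: ae_eq_on_def)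
  obtain r where r: "r > 0" "ball p r \<subseteq> Q" using open_Q(1) p openE by blast
  have "AE y in lborel. y \<notin> ball p (min r \<delta>)"
   using ae
  proof eventually_elim
   case (elim y)
   show ?case
   proof
    assume y: "y \<in> ball p (min r \<delta>)"
    then have "\<kappa> y = 1" using \<kappa>(3)[rule_format, of p "y - p"] by (simp add: dist_norm norm_minus_commute)
    moreover have "y \<in> Q" using y r(2) by auto
    ultimately show False using elim by simp
   qed
  qed
  then have "ball p (min r \<delta>) \<in> null_sets lborel" by (simp add: AE_iff_null_sets)
  then have "negligible (ball p (min r \<delta>))" by (simp add: negligible_iff_null_sets null_sets_completionI)
  then show False using open_not_negligible[of "ball p (min r \<delta>)"] r(1) \<kappa>(2) by auto
 qed
 then show ?thesis using C_H11(2)[OF \<kappa>C] by blast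
qed

text \<open>On Q alone \<open>E v\<close> already has the energy of v.\<close>

lemma extension_norm_ge_1: "1 \<le> extension_norm \<Omega> T E"
proof -
 obtain C where C: "C > 0" "\<And>v. v \<in> V0 ==> gnorm Qm (E v) \<le> C * gnorm Q v" using E_bounded by blast
 obtain v where v: "v \<in> V0" "gnorm Q v \<noteq> 0" using V0_nontrivial by blast
 have pos: "gnorm Q w > 0" if "gnorm Q w \<noteq> 0" for w using gnorm_nonneg[of Q w] that by simp
 have "1 \<le> gnorm Qm (E v) / gnorm Q v"
  using H10_Qm_Q(3)[OF E_H10[OF v(1)]] V0_H1(2)[OF v(1)] pos[OF v(2)] by simp
 also have "\<dots> \<le> extension_norm \<Omega> T E" unfolding extension_norm_def energy_norm_eq
 proof (rule cSUP_upper)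
  show "bdd_above ((%v. gnorm Qm (E v) / gnorm Q v) ` {v \<in> V0. gnorm Q v \<noteq> 0})"
   by (rule bdd_aboveI2[of _ _ C]) (use C pos in \<open>auto simp: divide_le_eq\<close>)
 qed (use v in simp)
 finally show ?thesis .
qed

lemma wave_norm_def': "wnorm u = dual_norm V0 (gnorm Q) (%v. wpair u (E v))"
 by (simp add: wave_norm_def energy_norm_eq[abs_def])

lemma wave_norm_ge:
 assumes u: "u \<in> HQs" and v: "v \<in> V0"
 shows "\<bar>wpair u (E v)\<bar> \<le> wnorm u * gnorm Q v"
proof -
 obtain C where C: "C > 0" "\<And>w. w \<in> H10 Qm ==> \<bar>wpair u w\<bar> \<le> C * gnorm Qm w"
  using dual_H10_bound[OF HQ_wave_pair(1)[OF u]] by blast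
 obtain D where D: "D > 0" "\<And>v. v \<in> V0 ==> gnorm Qm (E v) \<le> D * gnorm Q v" using E_bounded by blast
 have "\<bar>wpair u (E v)\<bar> \<le> C * D * gnorm Q v" if "v \<in> V0" for v
  using order_trans[OF C(2)[OF E_H10[OF that]] mult_left_mono[OF D(2)[OF that]]] C(1) by (simp add: mult.assoc)
 then show ?thesis unfolding wave_norm_def' by (rule dual_norm_ge) (auto simp: gnorm_nonneg v)
qed

lemma wave_norm_le:
 assumes "\<And>v. v \<in> V0 ==> \<bar>wpair u (E v)\<bar> \<le> C * gnorm Q v"
 shows "wnorm u \<le> C"
 unfolding wave_norm_def' by (rule dual_norm_le[OF assms]) (auto simp: gnorm_nonneg V0_nontrivial)

lemma wave_norm_nonneg: assumes u: "u \<in> HQs" shows "0 \<le> wnorm u"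
proof -
 obtain v where v: "v \<in> V0" "gnorm Q v \<noteq> 0" using V0_nontrivial by blast
 have "gnorm Q v > 0" using gnorm_nonneg[of Q v] v(2) by simp
 moreover have "0 \<le> wnorm u * gnorm Q v" using wave_norm_ge[OF u v(1)] by linarith
 ultimately show ?thesis by (simp add: zero_le_mult_iff)
qed

lemma wave_norm_diff_le:
 assumes u: "u \<in> HQs" and v: "v \<in> HQs" and w: "w \<in> HQs"
 shows "wdist u w \<le> wdist u v + wdist v w"
proof (rule wave_norm_le)
 fix z assume z: "z \<in> V0"
 have "wpair (%p. u p - w p) (E z) = wpair (%p. u p - v p) (E z) + wpair (%p. v p - w p) (E z)"
  by (simp add: HQ_diff(2)[OF _ _ E_H10[OF z]] u v w)
 then show "\<bar>wpair (%p. u p - w p) (E z)\<bar> \<le> (wdist u v + wdist v w) * gnorm Q z"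
  using wave_norm_ge[OF HQ_diff(1)[OF u v] z] wave_norm_ge[OF HQ_diff(1)[OF v w] z] by (simp add: distrib_right)
qed

lemma wave_norm_init_reg:
 assumes u: "init_reg u"
 shows "wnorm u \<le> gnorm Q u"
proof (rule wave_norm_le)
 fix v assume v: "v \<in> V0"
 have uH: "u \<in> H1 Q" using u by (simp add: init_reg_def)
 show "\<bar>wpair u (E v)\<bar> \<le> gnorm Q u * gnorm Q v"
  using wform_tsign_CS[OF uH V0_H1(1)[OF v]] by (simp add: init_reg_HQ(2)[OF u E_H10[OF v]] V0_H1(3)[OF v uH])
qed

lemma HQ_norm_bounds:
 "L2_norm Q u \<le> HQ_norm \<Omega> T E u" "\<bar>wnorm u\<bar> \<le> HQ_norm \<Omega> T E u"
 "HQ_norm \<Omega> T E u \<le> L2_norm Q u + \<bar>wnorm u\<bar>"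
proof -
 show "L2_norm Q u \<le> HQ_norm \<Omega> T E u" unfolding HQ_norm_def by (rule real_le_rsqrt) simp
 show "\<bar>wnorm u\<bar> \<le> HQ_norm \<Omega> T E u" unfolding HQ_norm_def by (rule real_le_rsqrt) simp
 show "HQ_norm \<Omega> T E u \<le> L2_norm Q u + \<bar>wnorm u\<bar>"
  unfolding HQ_norm_def using sqrt_sum_squares_le_sum_abs[of "L2_norm Q u" "wnorm u"] by (simp add: L2_norm_nonneg)
qed

lemma HQ_tends_iff:
 "tends V u \<longleftrightarrow> (%k. L2_dist Q (V k) u) \<longlonglongrightarrow> 0 \<and> (%k. wdist (V k) u) \<longlonglongrightarrow> 0"
proof
 assume h: "tends V u"
 have "(%k. L2_dist Q (V k) u) \<longlonglongrightarrow> 0"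
  by (rule Lim_null_comparison[OF always_eventually h[unfolded HQ_tends_def]]) (simp add: L2_norm_nonneg HQ_norm_bounds)
 moreover have "(%k. wdist (V k) u) \<longlonglongrightarrow> 0"
  by (rule Lim_null_comparison[OF always_eventually h[unfolded HQ_tends_def]]) (simp add: HQ_norm_bounds)
 ultimately show "(%k. L2_dist Q (V k) u) \<longlonglongrightarrow> 0 \<and> (%k. wdist (V k) u) \<longlonglongrightarrow> 0" ..
next
 assume h: "(%k. L2_dist Q (V k) u) \<longlonglongrightarrow> 0 \<and> (%k. wdist (V k) u) \<longlonglongrightarrow> 0"
 have "(%k. L2_dist Q (V k) u + \<bar>wdist (V k) u\<bar>) \<longlonglongrightarrow> 0"
  using tendsto_add[OF conjunct1[OF h] tendsto_rabs_zero[OF conjunct2[OF h]]] by simp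
 moreover have "0 \<le> HQ_norm \<Omega> T E w" for w by (simp add: HQ_norm_def)
 ultimately show "tends V u" unfolding HQ_tends_def
  by (elim Lim_null_comparison[OF always_eventually, rotated]) (simp add: HQ_norm_bounds)
qed

end

section \<open>The a priori bound for smooth functions and density arguments\<close>

context spacetime
begin

text \<open>The reversed function lies in \<open>C_term\<close> and has a partner J; the form is
  invariant under reversing both arguments, so the reversed J is an admissible test function for d
  itself.\<close>

lemma C_init_L2_bound:
 assumes d: "d \<in> C_init" and B: "\<And>v. v \<in> C_term ==> \<bar>wave_form d v\<bar> \<le> B * gnorm Q v" "0 \<le> B"
 shows "L2_norm Q d \<le> 4 * T * B"
proof -
 note r = C_rv(1)[OF d]
 obtain J where J: "J \<in> C_init" "(L2_norm Q (rv d))\<^sup>2 \<le> 2 * wave_form J (rv d)"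
  "L2_norm Q (rv d) * gnorm Q J \<le> 4 * T * wave_form J (rv d)" using inf_sup_norms[OF r] by blast
 note JH = C_H1(1)[OF J(1)] and dH = C_H1(1)[OF d]
 have L: "L2_norm Q (rv d) = L2_norm Q d" by (rule rv_ip(2)[OF H1_L2[OF dH]])
 have "wave_form J (rv d) = wave_form d (rv J)"
  using wform_rv[OF H1_rv(1)[OF JH] dH] by (simp add: wform_commute)
 then have W: "wave_form J (rv d) \<le> B * gnorm Q J" using B(1)[OF C_rv(1)[OF J(1)]] H1_rv(3)[OF JH] by simp
 show ?thesis
 proof (cases "gnorm Q J = 0")
  case True
  then have "wave_form J (rv d) \<le> 0" using W by simp
  then have "(L2_norm Q d)\<^sup>2 \<le> 0" using J(2) unfolding L by linarith
  then show ?thesis using T_pos B(2) by simp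
 next
  case False
  then have "gnorm Q J > 0" using gnorm_nonneg[of Q J] by simp
  moreover have "L2_norm Q d * gnorm Q J \<le> (4 * T * B) * gnorm Q J"
   using order_trans[OF J(3) mult_left_mono[OF W, of "4 * T"]] T_pos unfolding L by (simp add: mult.assoc)
  ultimately show ?thesis by (simp only: mult_le_cancel_right_pos)
 qed
qed

text \<open>The closing epsilon argument in isolation; it is applied to elements of
  \<open>H10 Qm\<close> and of \<open>V0\<close> with the test functions on \<open>Qm\<close> as
  dense set.\<close>

lemma bound_by_density:
 assumes v: "v \<in> H1 Q" and S: "\<And>\<phi>. \<phi> \<in> S ==> \<phi> \<in> H1 Q" and approx: "\<And>e. e > 0 ==> \<exists>\<phi>\<in>S. gdist Q \<phi> v < e"
  and cont: "\<And>\<phi>. \<phi> \<in> S ==> \<bar>L v - L \<phi>\<bar> \<le> D * gdist Q \<phi> v"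
  and bd: "\<And>\<phi>. \<phi> \<in> S ==> \<bar>L \<phi>\<bar> \<le> B * gnorm Q \<phi>" and B: "0 \<le> B"
 shows "\<bar>L v\<bar> \<le> B * gnorm Q v"
proof (rule field_le_epsilon)
 fix e :: real assume e: "e > 0"
 define D' where "D' = \<bar>D\<bar> + B + 1"
 have D': "D' > 0" using B by (simp add: D'_def)
 obtain \<phi> where \<phi>: "\<phi> \<in> S" "gdist Q \<phi> v < e / D'" using approx[of "e / D'"] e D' by auto
 define g where "g = gdist Q \<phi> v"
 have g0: "0 \<le> g" by (simp add: g_def gnorm_nonneg)
 have "gnorm Q \<phi> \<le> gnorm Q v + g"
  using gnorm_triangle[OF open_Q(1) v H1_diff[OF open_Q(1) S[OF \<phi>(1)] v]] by (simp add: g_def)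
 then have "B * gnorm Q \<phi> \<le> B * gnorm Q v + B * g" using B mult_left_mono[of "gnorm Q \<phi>" "gnorm Q v + g" B] by (simp add: distrib_left)
 moreover have "D * g \<le> \<bar>D\<bar> * g" using g0 by (intro mult_right_mono) auto
 ultimately have "\<bar>L v\<bar> \<le> B * gnorm Q v + (\<bar>D\<bar> + B) * g"
  using cont[OF \<phi>(1)] bd[OF \<phi>(1)] unfolding g_def[symmetric] distrib_right by linarith
 also have "(\<bar>D\<bar> + B) * g \<le> D' * g" using g0 by (intro mult_right_mono) (auto simp: D'_def)
 also have "D' * g \<le> D' * (e / D')" using \<phi>(2) D' by (intro mult_left_mono) (auto simp: g_def)
 finally show "\<bar>L v\<bar> \<le> B * gnorm Q v + e" using D' by simp
qed

lemma wform_diff_right: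
 assumes "u \<in> H1 Q" "v \<in> H1 Q" "w \<in> H1 Q"
 shows "wform \<sigma> Q u (%p. v p - w p) = wform \<sigma> Q u v - wform \<sigma> Q u w"
 using wform_diff_left[OF open_Q(1) assms(2,3,1)] by (simp only: wform_commute)

lemma wform_bound_H10:
 assumes u: "u \<in> H1 Q" and bd: "\<And>\<phi>. \<phi> \<in> C_term ==> \<bar>wave_form u \<phi>\<bar> \<le> B * gnorm Q \<phi>" "0 \<le> B" and w: "w \<in> H10 Qm"
 shows "\<bar>wave_form u w\<bar> \<le> B * gnorm Q w"
proof (rule bound_by_density[where S = "test_fun Qm"])
 show wH: "w \<in> H1 Q" by (rule H10_Qm_Q(2)[OF w])
 show \<phi>H: "\<phi> \<in> H1 Q" if "\<phi> \<in> test_fun Qm" for \<phi> by (rule C_H1(2)[OF test_fun_C_term[OF that]])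
 show "\<exists>\<phi>\<in>test_fun Qm. gdist Q \<phi> w < e" if "e > 0" for e
 proof -
  from H10_approx[OF open_Q(2) w that] obtain \<phi> where \<phi>: "\<phi> \<in> test_fun Qm" "gdist Qm \<phi> w < e" by (elim exE conjE)
  have "gdist Q \<phi> w \<le> gdist Qm \<phi> w"
   by (rule H10_Qm_Q(3)[OF H10_diff[OF open_Q(2) test_fun_H10[OF open_Q(2) \<phi>(1)] w]])
  with \<phi> show ?thesis by force
 qed
 show "\<bar>wave_form u w - wave_form u \<phi>\<bar> \<le> gnorm Q u * gdist Q \<phi> w" if "\<phi> \<in> test_fun Qm" for \<phi>
  using wform_tsign_CS[OF u H1_diff[OF open_Q(1) \<phi>H[OF that] wH]] by (simp add: wform_diff_right u \<phi>H[OF that] wH abs_minus_commute)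
qed (use bd test_fun_C_term in auto)

end

section \<open>Existence with zero initial and lateral data\<close>

context wave_setting
begin

lemma V0_lin: "v \<in> V0 ==> w \<in> V0 ==> (%p. v p + c * w p) \<in> V0"
 by (rule H11_lin(2))

lemma V0_cmult: assumes "w \<in> V0" shows "(%p. c * w p) \<in> V0"
 using V0_lin[OF assms assms, of "c - 1"] by (simp add: algebra_simps)

text \<open>Approximate solutions with residual \<open>\<delta> k\<close> are Cauchy in L2 by the a
  priori bound and Cauchy as functionals by their residuals. The sequence is part of the result
  because it carries the zero data: adding it changes neither closure membership nor traces.\<close>

theorem homogeneous_solution:
 assumes lin: "\<And>v w c. v \<in> V0 ==> w \<in> V0 ==> F (%p. v p + c * w p) = F v + c * F w"
  and bd: "\<And>v. v \<in> V0 ==> \<bar>F v\<bar> \<le> C * gnorm Q v"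
 shows "\<exists>u0 y. u0 \<in> HQs \<and> (\<forall>v\<in>V0. wpair u0 (E v) = F v) \<and> (\<forall>k. y k \<in> C_init) \<and> tends y u0"
proof -
 define \<delta> where "\<delta> k = inverse (real (Suc k))" for k
 have \<delta>: "\<delta> k > 0" "\<delta> k \<le> 1" for k by (auto simp: \<delta>_def inverse_le_1_iff)
 have \<delta>0: "\<delta> \<longlonglongrightarrow> 0" unfolding \<delta>_def[abs_def] by (rule LIMSEQ_inverse_real_of_nat)
 have "\<exists>y\<in>C_init. \<forall>v\<in>C_term. \<bar>F v - wave_form y v\<bar> \<le> \<delta> k * gnorm Q v" for k
  by (rule approximate_solution[OF _ _ \<delta>(1)]) (use lin bd C_H11(2) in blast)+
 then obtain y where y: "\<And>k. y k \<in> C_init" and yF: "\<And>k v. v \<in> C_term ==> \<bar>F v - wave_form (y k) v\<bar> \<le> \<delta> k * gnorm Q v"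
  by metis
 note yH = C_H1(1)[OF y]
 \<comment> \<open>The residual bound is known on smooth functions and is carried to all of
   \<open>V0\<close> by density.\<close>
 have yV: "\<bar>F v - wave_form (y k) v\<bar> \<le> \<delta> k * gnorm Q v" if v: "v \<in> V0" for v k
 proof (rule bound_by_density[where S = "test_fun Qm"])
  show vH: "v \<in> H1 Q" by (rule V0_H1(1)[OF v])
  show "\<exists>\<phi>\<in>test_fun Qm. gdist Q \<phi> v < e" if "e > 0" for e using V0_approx[OF v that] by blast
  show "\<bar>(F v - wave_form (y k) v) - (F \<phi> - wave_form (y k) \<phi>)\<bar> \<le> (C + gnorm Q (y k)) * gdist Q \<phi> v"
   if \<phi>: "\<phi> \<in> test_fun Qm" for \<phi>
  proof -
   note \<phi>C = test_fun_C_term[OF \<phi>]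
   have d: "(%p. \<phi> p - v p) \<in> V0" "F (%p. \<phi> p - v p) = F \<phi> - F v"
    using V0_lin[OF C_H11(2)[OF \<phi>C] v, of "-1"] lin[OF C_H11(2)[OF \<phi>C] v, of "-1"] by simp_all
   show ?thesis using bd[OF d(1)] wform_tsign_CS[OF yH V0_H1(1)[OF d(1)], of k]
    unfolding d(2) wform_diff_right[OF yH C_H1(2)[OF \<phi>C] vH] distrib_right by linarith
  qed
  show "\<phi> \<in> H1 Q" if "\<phi> \<in> test_fun Qm" for \<phi> by (rule C_H1(2)[OF test_fun_C_term[OF that]])
  show "\<bar>F \<phi> - wave_form (y k) \<phi>\<bar> \<le> \<delta> k * gnorm Q \<phi>" if "\<phi> \<in> test_fun Qm" for \<phi> by (rule yF[OF test_fun_C_term[OF that]])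
  show "0 \<le> \<delta> k" using \<delta>(1) by (rule less_imp_le)
 qed
 have dC: "(%p. y k p - y l p) \<in> C_init" for k l using C_lin(1)[OF y y, of k "-1" l] by simp
 have dC_bd: "\<bar>wave_form (%p. y k p - y l p) v\<bar> \<le> (\<delta> k + \<delta> l) * gnorm Q v" if v: "v \<in> C_term" for k l v
  using yF[OF v, of k] yF[OF v, of l] unfolding wform_diff_left[OF open_Q(1) yH yH C_H1(2)[OF v]] distrib_right by linarith
 have d0: "0 \<le> \<delta> k + \<delta> l" for k l using \<delta>(1)[of k] \<delta>(1)[of l] by simp
 have small: "\<exists>N. \<forall>i\<ge>N. \<forall>j\<ge>N. c * (\<delta> i + \<delta> j) < e" if e: "e > 0" and c: "c \<ge> 0" for c e
 proof -
  have "(%k. 2 * c * \<delta> k) \<longlonglongrightarrow> 0" using tendsto_mult_left[OF \<delta>0, of "2 * c"] by simp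
  from order_tendstoD(2)[OF this e] obtain N where N: "\<And>k. k \<ge> N ==> 2 * c * \<delta> k < e" by (auto simp: eventually_sequentially)
  have "c * (\<delta> i + \<delta> j) < e" if "i \<ge> N" "j \<ge> N" for i j
   using N[OF that(1)] N[OF that(2)] unfolding distrib_left by linarith
  then show ?thesis by blast
 qed
 have "\<exists>u\<in>L2 Q. (%k. L2_dist Q (y k) u) \<longlonglongrightarrow> 0"
 proof (rule L2_complete[OF borel_Q(1) finite_Q H1_L2[OF yH]])
  fix e :: real assume e: "e > 0"
  have "L2_dist Q (y k) (y l) \<le> 4 * T * (\<delta> k + \<delta> l)" for k l by (rule C_init_L2_bound[OF dC dC_bd d0])
  moreover obtain N where "\<And>i j. i \<ge> N ==> j \<ge> N ==> 4 * T * (\<delta> i + \<delta> j) < e"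
   using small[OF e, of "4 * T"] T_pos by auto
  ultimately have "L2_dist Q (y i) (y j) < e" if "i \<ge> N" "j \<ge> N" for i j
   using le_less_trans that by blast
  then show "\<exists>N. \<forall>i\<ge>N. \<forall>j\<ge>N. L2_dist Q (y i) (y j) < e" by blast
 qed
 then obtain u where u: "u \<in> L2 Q" "(%k. L2_dist Q (y k) u) \<longlonglongrightarrow> 0" by blast
 \<comment> \<open>The wave functionals converge pointwise on \<open>H10 Qm\<close>; the limit is
   bounded there and agrees with the distribution of \<open>u\<close> on test functions, so
   \<open>u\<close> belongs to \<open>HQs\<close>.\<close>
 define G where "G w = lim (%k. wave_form (y k) w)" for w
 have w_bd: "\<bar>wave_form (y k) w - wave_form (y l) w\<bar> \<le> (\<delta> k + \<delta> l) * gnorm Q w" if w: "w \<in> H10 Qm" for w k l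
  using wform_bound_H10[OF H1_diff[OF open_Q(1) yH yH] dC_bd d0 w] by (simp add: wform_diff_left[OF open_Q(1) yH yH H10_Qm_Q(2)[OF w]])
 have lim: "(%k. wave_form (y k) w) \<longlonglongrightarrow> G w" if w: "w \<in> H10 Qm" for w
 proof -
  have "Cauchy (%k. wave_form (y k) w)"
  proof (rule CauchyI)
   fix e :: real assume e: "e > 0"
   from small[OF e gnorm_nonneg[of Q w]] obtain N where N: "\<And>i j. i \<ge> N ==> j \<ge> N ==> gnorm Q w * (\<delta> i + \<delta> j) < e" by blast
   have "norm (wave_form (y i) w - wave_form (y j) w) < e" if "i \<ge> N" "j \<ge> N" for i j
    using w_bd[OF w, of i j] N[OF that] by (simp add: mult.commute)
   then show "\<exists>M. \<forall>m\<ge>M. \<forall>n\<ge>M. norm (wave_form (y m) w - wave_form (y n) w) < e" by blast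
  qed
  then show ?thesis unfolding G_def by (simp add: Cauchy_convergent convergent_LIMSEQ_iff[symmetric])
 qed
 have G_dual: "G \<in> dual_space (H10 Qm) (gnorm Qm)"
  unfolding dual_space_def
 \<comment> \<open>Every \<open>y k\<close> is compared with \<open>y 0\<close>, at a cost of at
   most \<open>\<delta> k + \<delta> 0\<close>, which is at most 2.\<close>
 proof (intro CollectI conjI ballI allI exI[of _ "gnorm Q (y 0) + 2"])
  fix v w assume v: "v \<in> H10 Qm" and w: "w \<in> H10 Qm"
  note vQ = H10_Qm_Q(2)[OF v] and wQ = H10_Qm_Q(2)[OF w]
  have eq: "wave_form (y k) (%p. v p + w p) = wave_form (y k) v + wave_form (y k) w" for k
   using wform_add_left[OF open_Q(1) vQ wQ yH] by (simp only: wform_commute)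
  have "(%k. wave_form (y k) (%p. v p + w p)) \<longlonglongrightarrow> G v + G w" unfolding eq by (intro tendsto_add lim v w)
  from LIMSEQ_unique[OF lim[OF H10_add[OF open_Q(2) v w]] this] show "G (%p. v p + w p) = G v + G w" .
 next
  fix c w assume w: "w \<in> H10 Qm"
  have eq: "wave_form (y k) (%p. c * w p) = c * wave_form (y k) w" for k
   using wform_cmult_left[OF open_Q(1) H10_Qm_Q(2)[OF w] yH] by (simp only: wform_commute)
  have "(%k. wave_form (y k) (%p. c * w p)) \<longlonglongrightarrow> c * G w" unfolding eq by (intro tendsto_mult_left lim w)
  from LIMSEQ_unique[OF lim[OF H10_cmult[OF open_Q(2) w]] this] show "G (%p. c * w p) = c * G w" .
 next
  fix w assume w: "w \<in> H10 Qm"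
  have "\<bar>wave_form (y k) w\<bar> \<le> (gnorm Q (y 0) + 2) * gnorm Qm w" for k
  proof -
   have "(\<delta> k + \<delta> 0) * gnorm Q w \<le> 2 * gnorm Q w" using \<delta>(2)[of k] \<delta>(2)[of 0] by (intro mult_right_mono) (auto simp: gnorm_nonneg)
   then have "\<bar>wave_form (y k) w\<bar> \<le> (gnorm Q (y 0) + 2) * gnorm Q w"
    using w_bd[OF w, of k 0] wform_tsign_CS[OF yH[of 0] H10_Qm_Q(2)[OF w]] unfolding distrib_right by linarith
   also have "\<dots> \<le> (gnorm Q (y 0) + 2) * gnorm Qm w" by (intro mult_left_mono H10_Qm_Q(3)[OF w]) (simp add: gnorm_nonneg)
   finally show ?thesis .
  qed
  then show "\<bar>G w\<bar> \<le> (gnorm Q (y 0) + 2) * gnorm Qm w"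
   by (intro LIMSEQ_le_const2[OF tendsto_rabs[OF lim[OF w]]]) auto
 qed
 have G_test: "G \<phi> = ip Q u (wave_op \<phi>)" if \<phi>: "\<phi> \<in> test_fun Qm" for \<phi>
 proof -
  have "(%k. ip Q (y k) (wave_op \<phi>)) \<longlonglongrightarrow> ip Q u (wave_op \<phi>)"
   by (rule ip_tendsto[OF H1_L2[OF yH] u(1) wave_op_L2[OF \<phi>] u(2)])
  then have "(%k. wave_form (y k) \<phi>) \<longlonglongrightarrow> ip Q u (wave_op \<phi>)"
   by (simp add: init_reg_wave_op[OF init_reg_H11_init(3)[OF y] \<phi>])
  from LIMSEQ_unique[OF lim[OF test_fun_H10[OF open_Q(2) \<phi>]] this] show ?thesis .
 qed
 have uHQ: "u \<in> HQs" "\<And>w. w \<in> H10 Qm ==> wpair u w = G w"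
  using wave_pair_eq[OF u(1) G_dual G_test] by blast+
 have sol: "wpair u (E v) = F v" if v: "v \<in> V0" for v
 proof -
  have "(%k. wave_form (y k) v) \<longlonglongrightarrow> G (E v)"
   using lim[OF E_H10[OF v]] by (simp add: V0_H1(3)[OF v yH])
  moreover have "(%k. wave_form (y k) v - F v) \<longlonglongrightarrow> 0"
  proof (rule Lim_null_comparison[OF always_eventually])
   show "(%k. \<delta> k * gnorm Q v) \<longlonglongrightarrow> 0" using tendsto_mult_right[OF \<delta>0, of "gnorm Q v"] by simp
  qed (use yV[OF v] in \<open>simp add: abs_minus_commute\<close>)
  then have "(%k. wave_form (y k) v) \<longlonglongrightarrow> F v" by (simp only: LIM_zero_iff)
  ultimately show ?thesis using LIMSEQ_unique by (simp add: uHQ(2)[OF E_H10[OF v]]) blast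
 qed
 have yHQ: "y k \<in> HQs" for k by (rule init_reg_HQ(1)[OF init_reg_H11_init(3)[OF y]])
 have "wdist (y k) u \<le> \<delta> k" for k
 proof (rule wave_norm_le)
  fix v assume v: "v \<in> V0"
  have "wpair (%p. y k p - u p) (E v) = wave_form (y k) v - F v"
   unfolding HQ_diff(2)[OF yHQ uHQ(1) E_H10[OF v]] sol[OF v]
   by (simp add: init_reg_HQ(2)[OF init_reg_H11_init(3)[OF y] E_H10[OF v]] V0_H1(3)[OF v yH])
  then show "\<bar>wpair (%p. y k p - u p) (E v)\<bar> \<le> \<delta> k * gnorm Q v" using yV[OF v, of k] by (simp add: abs_minus_commute)
 qed
 then have "(%k. wdist (y k) u) \<longlonglongrightarrow> 0"
  by (intro Lim_null_comparison[OF always_eventually \<delta>0]) (simp add: wave_norm_nonneg[OF HQ_diff(1)[OF yHQ uHQ(1)]])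
 then have "tends y u" using u(2) by (simp add: HQ_tends_iff)
 then show ?thesis using uHQ(1) sol y by blast
qed

end

context spacetime
begin

lemma H11_0_subset: "V_0init \<subseteq> V_init" "H11_0term \<Omega> T \<subseteq> H11_term \<Omega> T"
proof -
 have "v \<in> L2_time (H1 \<Omega>) \<Omega> T" if v: "v \<in> L2_time (H10 \<Omega>) \<Omega> T" for v
 proof -
  have "AE t in lborel. t \<in> {0<..<T} \<longrightarrow> (%x. v (x, t)) \<in> H10 \<Omega>" using v unfolding L2_time_def by blast
  then have "AE t in lborel. t \<in> {0<..<T} \<longrightarrow> (%x. v (x, t)) \<in> H1 \<Omega>"
   by eventually_elim (auto intro: H10_H1)
  with v show ?thesis unfolding L2_time_def by blast
 qed
 then show "V_0init \<subseteq> V_init" "H11_0term \<Omega> T \<subseteq> H11_term \<Omega> T"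
  unfolding H11_0init_def H11_init_def H11_0term_def H11_term_def by blast+
qed

end

section \<open>Uniqueness and traces\<close>

context wave_setting
begin

lemma HQ_tends_lin:
 assumes V: "\<And>k. V k \<in> HQs" "u \<in> HQs" "tends V u"
  and W: "\<And>k. W k \<in> HQs" "w \<in> HQs" "tends W w"
 shows "tends (%k p. V k p + c * W k p) (%p. u p + c * w p)"
proof -
 have eq: "(%p. (V k p + c * W k p) - (u p + c * w p)) = (%p. (V k p - u p) + c * (W k p - w p))" for k
  by (simp add: fun_eq_iff algebra_simps)
 note dV = HQ_diff(1)[OF V(1,2)] and dW = HQ_diff(1)[OF W(1,2)]
 note lV = V(3)[unfolded HQ_tends_iff] and lW = W(3)[unfolded HQ_tends_iff]
 have "L2_norm Q (%p. (V k p - u p) + c * (W k p - w p)) \<le> L2_dist Q (V k) u + \<bar>c\<bar> * L2_dist Q (W k) w" for k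
  unfolding L2_norm_cmult[symmetric] by (intro L2_norm_triangle L2_cmult HQ_wave_pair(3) dV dW)
 moreover have "(%k. L2_dist Q (V k) u + \<bar>c\<bar> * L2_dist Q (W k) w) \<longlonglongrightarrow> 0"
  using tendsto_add[OF conjunct1[OF lV] tendsto_mult_left[OF conjunct1[OF lW], of "\<bar>c\<bar>"]] by simp
 ultimately have 1: "(%k. L2_norm Q (%p. (V k p - u p) + c * (W k p - w p))) \<longlonglongrightarrow> 0"
  by (elim Lim_null_comparison[OF always_eventually, rotated]) (simp add: L2_norm_nonneg)
 have "wnorm (%p. (V k p - u p) + c * (W k p - w p)) \<le> wdist (V k) u + \<bar>c\<bar> * wdist (W k) w" for k
 proof (rule wave_norm_le)
  fix z assume z: "z \<in> V0"
  have "\<bar>c * wpair (%p. W k p - w p) (E z)\<bar> \<le> \<bar>c\<bar> * (wdist (W k) w * gnorm Q z)"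
   unfolding abs_mult by (intro mult_left_mono wave_norm_ge dW z) simp
  then show "\<bar>wpair (%p. (V k p - u p) + c * (W k p - w p)) (E z)\<bar>
    \<le> (wdist (V k) u + \<bar>c\<bar> * wdist (W k) w) * gnorm Q z"
   using wave_norm_ge[OF dV z, of k] unfolding HQ_lin(2)[OF dV dW E_H10[OF z]] distrib_right by (simp only: mult.assoc)
 qed
 moreover have "(%k. wdist (V k) u + \<bar>c\<bar> * wdist (W k) w) \<longlonglongrightarrow> 0"
  using tendsto_add[OF conjunct2[OF lV] tendsto_mult_left[OF conjunct2[OF lW], of "\<bar>c\<bar>"]] by simp
 moreover have "0 \<le> wnorm (%p. (V k p - u p) + c * (W k p - w p))" for k
  by (rule wave_norm_nonneg[OF HQ_lin(1)[OF dV dW]])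
 ultimately have "(%k. wnorm (%p. (V k p - u p) + c * (W k p - w p))) \<longlonglongrightarrow> 0"
  by (elim Lim_null_comparison[OF always_eventually, rotated]) simp
 with 1 show ?thesis unfolding HQ_tends_iff eq by blast
qed

lemma C_init_wave_bound:
 assumes y: "y \<in> C_init"
 shows "L2_norm Q y \<le> 4 * T * wnorm y"
proof (rule C_init_L2_bound[OF y])
 note r = init_reg_H11_init(3)[OF y]
 note HQ = init_reg_HQ(1)[OF r]
 show "0 \<le> wnorm y" by (rule wave_norm_nonneg[OF HQ])
 show "\<bar>wave_form y v\<bar> \<le> wnorm y * gnorm Q v" if "v \<in> C_term" for v
  using wave_norm_ge[OF HQ C_H11(2)[OF that]] C_H11(2)[OF that]
  by (simp add: init_reg_HQ(2)[OF r E_H10] V0_H1(3)[OF _ C_H1(1)[OF y]])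
qed

text \<open>Reversed in time, d lies in \<open>V0\<close>, where test functions are dense; reversing
  an approximation gives an element of \<open>C_init\<close>, for which the bound holds. In the
  gradient norm this approximation also controls the wave norm.\<close>

lemma H11_0init_wave_bound:
 assumes d: "d \<in> V_0init"
 shows "L2_norm Q d \<le> 4 * T * wnorm d"
proof (rule field_le_epsilon)
 fix e :: real assume e: "e > 0"
 \<comment> \<open>The L2 error contributes e' and the wave error 4 T e'.\<close>
 define e' where "e' = e / (1 + 4 * T)"
 have e': "e' > 0" using e T_pos by (simp add: e'_def)
 note rd = H11_0_rv(1)[OF d]
 from V0_approx[OF rd e'] obtain \<phi> where \<phi>: "\<phi> \<in> test_fun Qm" "L2_dist Q \<phi> (rv d) < e'" "gdist Q \<phi> (rv d) < e'"
  by blast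
 define y where "y = rv \<phi>"
 have y: "y \<in> C_init" unfolding y_def by (rule C_rv(2)[OF test_fun_C_term[OF \<phi>(1)]])
 have yd: "(%p. y p - d p) = rv (%p. \<phi> p - rv d p)" unfolding rv_linear by (simp add: y_def)
 have dH: "(%p. \<phi> p - rv d p) \<in> H1 Q"
  by (rule H1_diff[OF open_Q(1) C_H1(2)[OF test_fun_C_term[OF \<phi>(1)]] V0_H1(1)[OF rd]])
 note ir = init_reg_H11_init(3)[OF y] init_reg_H11_init(2)[OF d]
 note HQy = init_reg_HQ(1)[OF ir(1)] and HQd = init_reg_HQ(1)[OF ir(2)]
 have L: "L2_dist Q y d < e'" unfolding yd using \<phi>(2) by (simp add: rv_ip(2)[OF H1_L2[OF dH]])
 have W: "wdist y d < e'"
  using wave_norm_init_reg[OF init_reg_diff[OF ir]] \<phi>(3) unfolding yd by (simp add: H1_rv(3)[OF dH])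
 have "L2_norm Q d \<le> L2_norm Q y + L2_dist Q y d"
  using L2_norm_triangle_diff[OF HQ_wave_pair(3)[OF HQy] HQ_wave_pair(3)[OF HQ_diff(1)[OF HQy HQd]]] by simp
 moreover have "wnorm y \<le> wnorm d + wdist y d"
 proof (rule wave_norm_le)
  fix z assume z: "z \<in> V0"
  show "\<bar>wpair y (E z)\<bar> \<le> (wnorm d + wdist y d) * gnorm Q z"
   using wave_norm_ge[OF HQd z] wave_norm_ge[OF HQ_diff(1)[OF HQy HQd] z]
   unfolding HQ_diff(2)[OF HQy HQd E_H10[OF z]] distrib_right by linarith
 qed
 then have "4 * T * wnorm y \<le> 4 * T * (wnorm d + e')"
  using W T_pos by (intro mult_left_mono) auto
 moreover note C_init_wave_bound[OF y] L
 moreover have "4 * T * (wnorm d + e') + e' = 4 * T * wnorm d + e"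
 proof -
  have "(1 + 4 * T) * e' = e" using T_pos by (simp add: e'_def)
  then show ?thesis by (simp add: algebra_simps)
 qed
 ultimately show "L2_norm Q d \<le> 4 * T * wnorm d + e" by linarith
qed

text \<open>Both sides are continuous for \<open>HQ_norm\<close>, so the bound passes to the
  closure. On it the wave norm alone detects zero, which is uniqueness.\<close>

theorem HQ_0init_wave_bound:
 assumes u: "u \<in> HQ_0init \<Omega> T E"
 shows "L2_norm Q u \<le> 4 * T * wnorm u"
proof -
 obtain V where V: "\<And>k. V k \<in> V_0init" "\<And>k. V k \<in> HQs" "tends V u" and uHQ: "u \<in> HQs"
  using u unfolding HQ_0init_def HQ_closure_def by blast
 note l = V(3)[unfolded HQ_tends_iff]
 note d = HQ_diff(1)[OF V(2) uHQ]
 have le: "L2_norm Q u \<le> 4 * T * (wnorm u + wdist (V k) u) + L2_dist Q (V k) u" for k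
 proof -
  have "L2_norm Q u \<le> L2_norm Q (V k) + L2_dist Q (V k) u"
   using L2_norm_triangle_diff[OF HQ_wave_pair(3)[OF V(2)] HQ_wave_pair(3)[OF d], of k k] by simp
  moreover have "wnorm (V k) \<le> wnorm u + wdist (V k) u"
  proof (rule wave_norm_le)
   fix z assume z: "z \<in> V0"
   show "\<bar>wpair (V k) (E z)\<bar> \<le> (wnorm u + wdist (V k) u) * gnorm Q z"
    using wave_norm_ge[OF uHQ z] wave_norm_ge[OF d z, of k]
    unfolding HQ_diff(2)[OF V(2) uHQ E_H10[OF z]] distrib_right by linarith
  qed
  then have "4 * T * wnorm (V k) \<le> 4 * T * (wnorm u + wdist (V k) u)"
   using T_pos by (intro mult_left_mono) auto
  ultimately show ?thesis using H11_0init_wave_bound[OF V(1), of k] by linarith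
 qed
 have "(%k. 4 * T * (wnorm u + wdist (V k) u) + L2_dist Q (V k) u)
  \<longlonglongrightarrow> 4 * T * (wnorm u + 0) + 0"
  by (intro tendsto_intros conjunct1[OF l] conjunct2[OF l])
 from LIMSEQ_le_const[OF this] le show ?thesis by simp
qed

lemma closure_Q: "closure Q = closure \<Omega> \<times> {0..T}"
 using T_pos by (simp add: cylQ_def closure_Times)

text \<open>The zero lateral trace acts slice by slice: almost every slice is in \<open>H1\<close>,
  continuous up to the boundary and zero there.\<close>

lemma zero_lateral_H11_0init:
 assumes d: "d \<in> V_init" and c: "continuous_on (closure Q) d" and z: "\<And>p. p \<in> lateral \<Omega> T ==> d p = 0"
 shows "d \<in> V_0init"
proof -
 have L: "d \<in> L2_time (H1 \<Omega>) \<Omega> T" using d by (simp add: H11_init_def)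
 have "(%x. d (x, t)) \<in> H10 \<Omega>" if t: "t \<in> {0<..<T}" and h: "(%x. d (x, t)) \<in> H1 \<Omega>" for t
 proof (rule H10_continuous_zero_boundary[OF open_Omega bounded_Omega h])
  show "continuous_on (closure \<Omega>) (%x. d (x, t))"
   by (rule continuous_on_compose2[OF c]) (use t in \<open>auto simp: closure_Q intro!: continuous_intros\<close>)
  show "\<And>x. x \<in> frontier \<Omega> ==> d (x, t) = 0" using z t by (simp add: lateral_def)
 qed
 moreover have "AE t in lborel. t \<in> {0<..<T} \<longrightarrow> (%x. d (x, t)) \<in> H1 \<Omega>" using L unfolding L2_time_def by blast
 ultimately have "AE t in lborel. t \<in> {0<..<T} \<longrightarrow> (%x. d (x, t)) \<in> H10 \<Omega>"
  by (auto elim: eventually_mono)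
 then have "d \<in> L2_time (H10 \<Omega>) \<Omega> T" using L unfolding L2_time_def by blast
 with d show ?thesis by (simp add: H11_init_def H11_0init_def)
qed

text \<open>A common sequence of boundary restrictions comes from two approximating sequences that
  agree on the lateral boundary, so their differences have zero lateral values. Nonemptiness is
  essential, since two empty classes would be equal without relating u and v.\<close>

lemma same_trace_diff:
 assumes u: "u \<in> HQs" and v: "v \<in> HQs"
  and tr: "ltrace u = ltrace v" and ne: "ltrace u \<noteq> {}"
 shows "(%p. u p - v p) \<in> HQ_0init \<Omega> T E"
proof -
 obtain w where w: "w \<in> ltrace u" "w \<in> ltrace v" using tr ne by blast
 obtain V where V: "\<And>k. V k \<in> V_init" "\<And>k. continuous_on (closure Q) (V k)" "tends V u"
  "\<And>k. w k = restrict (V k) (lateral \<Omega> T)" using w(1) unfolding lateral_trace_def by blast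
 obtain W where W: "\<And>k. W k \<in> V_init" "\<And>k. continuous_on (closure Q) (W k)" "tends W v"
  "\<And>k. w k = restrict (W k) (lateral \<Omega> T)" using w(2) unfolding lateral_trace_def by blast
 note VHQ = init_reg_HQ(1)[OF init_reg_H11_init(1)[OF V(1)]] and WHQ = init_reg_HQ(1)[OF init_reg_H11_init(1)[OF W(1)]]
 define d where "d k = (%p. V k p + (-1) * W k p)" for k
 have "d k \<in> V_0init" for k
 proof (rule zero_lateral_H11_0init)
  show "d k \<in> V_init" unfolding d_def by (rule H11_lin(1)[OF V(1) W(1)])
  show "continuous_on (closure Q) (d k)" unfolding d_def by (intro continuous_intros V(2) W(2))
  show "d k p = 0" if "p \<in> lateral \<Omega> T" for p
   using fun_cong[OF trans[OF V(4)[symmetric] W(4)], of k p] that by (simp add: d_def)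
 qed
 moreover have "d k \<in> HQs" for k unfolding d_def by (rule HQ_lin(1)[OF VHQ WHQ])
 moreover have "tends d (%p. u p + (-1) * v p)"
  using HQ_tends_lin[OF VHQ u V(3) WHQ v W(3), of "-1"] by (simp add: d_def[abs_def])
 moreover have "(%p. u p + (-1) * v p) \<in> HQs" by (rule HQ_lin(1)[OF u v])
 ultimately have "(%p. u p + (-1) * v p) \<in> HQ_0init \<Omega> T E" unfolding HQ_0init_def HQ_closure_def by blast
 then show ?thesis by simp
qed

text \<open>Each \<open>y k\<close> vanishes outside \<Omega>, hence on the lateral boundary, so
  adding it changes the limit but not the restrictions. The inclusion for general c gives equality
  by taking c = 1 and c = -1.\<close>

lemma trace_shift:
 assumes u: "u \<in> HQs" and u0: "u0 \<in> HQs" and y: "\<And>k. y k \<in> C_init" "tends y u0"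
 shows "ltrace u \<subseteq> ltrace (%p. u p + c * u0 p)"
proof
 fix w assume "w \<in> ltrace u"
 then obtain V where V: "\<And>k. V k \<in> V_init" "\<And>k. continuous_on (closure Q) (V k)" "tends V u"
  "\<And>k. w k = restrict (V k) (lateral \<Omega> T)" unfolding lateral_trace_def by blast
 have y0: "y k \<in> V_init" for k using C_H11(1)[OF y(1)] H11_0_subset(1) by blast
 have yc: "continuous_on A (y k)" for k A
  using y(1)[of k] C_diff_continuous continuous_on_subset[of UNIV "y k" A] unfolding C_init_def Cspatial_def by blast
 have yz: "y k p = 0" if p: "p \<in> lateral \<Omega> T" for k p
 proof -
  obtain K where K: "K \<subseteq> \<Omega>" "\<And>x t. x \<notin> K ==> y k (x, t) = 0" using y(1)[of k] unfolding C_init_def Cspatial_def by blast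
  have "fst p \<notin> \<Omega>" using p open_Omega by (auto simp: lateral_def frontier_def interior_open)
  then show ?thesis using K by (cases p) auto
 qed
 define W where "W k = (%p. V k p + c * y k p)" for k
 have "W k \<in> V_init" for k unfolding W_def by (rule H11_lin(1)[OF V(1) y0])
 moreover have "continuous_on (closure Q) (W k)" for k unfolding W_def by (intro continuous_intros V(2) yc)
 moreover have "tends W (%p. u p + c * u0 p)" unfolding W_def[abs_def]
  by (rule HQ_tends_lin[OF _ u V(3) _ u0 y(2)]) (intro init_reg_HQ(1) init_reg_H11_init(1) V(1) y0)+
 moreover have "w k = restrict (W k) (lateral \<Omega> T)" for k
  unfolding V(4) by (rule restrict_ext) (simp add: W_def yz)
 ultimately show "w \<in> ltrace (%p. u p + c * u0 p)" unfolding lateral_trace_def by blast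
qed

lemma trace_add:
 assumes u: "u \<in> HQs" and u0: "u0 \<in> HQs" and y: "\<And>k. y k \<in> C_init" "tends y u0"
 shows "ltrace (%p. u p + u0 p) = ltrace u"
proof
 have s: "(%p. u p + u0 p) \<in> HQs" using HQ_lin(1)[OF u u0, of 1] by simp
 show "ltrace u \<subseteq> ltrace (%p. u p + u0 p)" using trace_shift[OF u u0 y, of 1] by simp
 show "ltrace (%p. u p + u0 p) \<subseteq> ltrace u" using trace_shift[OF s u0 y, of "-1"] by simp
qed

text \<open>The geometry of \<Omega> is concentrated in the assumption that traces of
  \<open>HQ_init\<close> elements are nonempty; everything else is functional analysis.\<close>

theorem well_posed:
 assumes ne: "\<And>u. u \<in> HQ_init \<Omega> T E ==> ltrace u \<noteq> {}"
  and f: "f \<in> dual_space (H11_term \<Omega> T) (energy_norm Q)" and g: "g \<in> HSigma \<Omega> T E"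
 shows "\<exists>u. dirichlet_solution \<Omega> T E f g u \<and> (\<forall>u'. dirichlet_solution \<Omega> T E f g u' \<longrightarrow> ae_eq_on Q u' u)"
  and "dirichlet_solution \<Omega> T E f g u ==> ug \<in> HQ_init \<Omega> T E ==> ltrace ug = g ==>
   HQ_norm \<Omega> T E ug = HSigma_norm \<Omega> T E g ==> (%p. u p - ug p) \<in> HQ_0init \<Omega> T E \<and>
    wdist u ug \<le> dual_norm V0 (energy_norm Q) f + extension_norm \<Omega> T E * HSigma_norm \<Omega> T E g"
proof -
 have HQ: "u \<in> HQs" if "u \<in> HQ_init \<Omega> T E" for u using that by (simp add: HQ_init_def HQ_closure_def)
 have f0: "f \<in> dual_space V0 (gnorm Q)" using dual_space_subset[OF f H11_0_subset(2)] by (simp add: energy_norm_eq[abs_def])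
 then obtain C where C: "\<And>v. v \<in> V0 ==> \<bar>f v\<bar> \<le> C * gnorm Q v" unfolding dual_space_def by blast
 obtain ug where ug: "ug \<in> HQ_init \<Omega> T E" "ltrace ug = g" using g unfolding HSigma_def by blast
 note ugHQ = HQ[OF ug(1)]
 \<comment> \<open>The data left for the homogeneous problem once the lifting \<open>ug\<close> has
   absorbed g.\<close>
 define F where "F v = f v - wpair ug (E v)" for v
 have "\<exists>u0 y. u0 \<in> HQs \<and> (\<forall>v\<in>V0. wpair u0 (E v) = F v) \<and> (\<forall>k. y k \<in> C_init) \<and> tends y u0"
 proof (rule homogeneous_solution)
  show "F (%p. v p + c * w p) = F v + c * F w" if "v \<in> V0" "w \<in> V0" for v w c
   using dual_space_lin[OF f0 that V0_cmult[OF that(2)], of c] wave_pair_E_lin[OF ugHQ that V0_cmult[OF that(2)] V0_lin[OF that], of c]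
   by (simp add: F_def algebra_simps)
  show "\<bar>F v\<bar> \<le> (C + wnorm ug) * gnorm Q v" if "v \<in> V0" for v
   using C[OF that] wave_norm_ge[OF ugHQ that] unfolding F_def distrib_right by linarith
 qed
 then obtain u0 y where u0: "u0 \<in> HQs" "\<And>v. v \<in> V0 ==> wpair u0 (E v) = F v" and y: "\<And>k. y k \<in> C_init" "tends y u0"
  by blast
 define u where "u p = ug p + u0 p" for p
 have u_eq: "u = (%p. ug p + 1 * u0 p)" by (simp add: u_def fun_eq_iff)
 have uHQ: "u \<in> HQs" unfolding u_eq by (rule HQ_lin(1)[OF ugHQ u0(1)])
 obtain V where V: "\<And>k. V k \<in> V_init" "\<And>k. V k \<in> HQs" "tends V ug"
  using ug(1) unfolding HQ_init_def HQ_closure_def by blast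
 have y0: "y k \<in> V_init" for k using C_H11(1)[OF y(1)] H11_0_subset(1) by blast
 note yHQ = init_reg_HQ(1)[OF init_reg_H11_init(1)[OF y0]]
 have "tends (%k p. V k p + 1 * y k p) u" unfolding u_eq by (rule HQ_tends_lin[OF V(2) ugHQ V(3) yHQ u0(1) y(2)])
 moreover have "(%p. V k p + 1 * y k p) \<in> V_init \<inter> HQs" for k using H11_lin(1)[OF V(1) y0] HQ_lin(1)[OF V(2) yHQ] by blast
 ultimately have uI: "u \<in> HQ_init \<Omega> T E" unfolding HQ_init_def HQ_closure_def using uHQ
  by (intro CollectI conjI exI[of _ "%k p. V k p + 1 * y k p"] allI)
 have utr: "ltrace u = g" using trace_add[OF ugHQ u0(1) y] ug(2) by (simp add: u_def[abs_def])
 have "wpair u (E v) = f v" if v: "v \<in> V0" for v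
  unfolding u_eq HQ_lin(2)[OF ugHQ u0(1) E_H10[OF v]] u0(2)[OF v] by (simp add: F_def)
 with uI utr have sol: "dirichlet_solution \<Omega> T E f g u" unfolding dirichlet_solution_def by blast
 have "ae_eq_on Q u' u" if u': "dirichlet_solution \<Omega> T E f g u'" for u'
 proof -
  have u'I: "u' \<in> HQ_init \<Omega> T E" "ltrace u' = g" "\<And>v. v \<in> V0 ==> wpair u' (E v) = f v"
   using u' unfolding dirichlet_solution_def by auto
  note u'HQ = HQ[OF u'I(1)]
  have d: "(%p. u' p - u p) \<in> HQ_0init \<Omega> T E" using same_trace_diff[OF u'HQ uHQ _ ne[OF u'I(1)]] u'I(2) utr by simp
  have "wdist u' u \<le> 0"
  proof (rule wave_norm_le)
   fix v assume v: "v \<in> V0"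
   have "wpair u (E v) = f v" using sol v unfolding dirichlet_solution_def by blast
   then show "\<bar>wpair (%p. u' p - u p) (E v)\<bar> \<le> 0 * gnorm Q v"
    unfolding HQ_diff(2)[OF u'HQ uHQ E_H10[OF v]] u'I(3)[OF v] by simp
  qed
  then have "4 * T * wdist u' u \<le> 0" using T_pos by (simp add: mult_nonneg_nonpos)
  with HQ_0init_wave_bound[OF d] have "L2_dist Q u' u = 0"
   using L2_norm_nonneg[of Q "%p. u' p - u p"] by linarith
  then show ?thesis using L2_norm_diff_eq_0_iff[OF HQ_wave_pair(3)[OF u'HQ] HQ_wave_pair(3)[OF uHQ]] by simp
 qed
 with sol show "\<exists>u. dirichlet_solution \<Omega> T E f g u \<and> (\<forall>u'. dirichlet_solution \<Omega> T E f g u' \<longrightarrow> ae_eq_on Q u' u)" by blast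
next
 assume u: "dirichlet_solution \<Omega> T E f g u" and ug: "ug \<in> HQ_init \<Omega> T E" "ltrace ug = g"
  and nrm: "HQ_norm \<Omega> T E ug = HSigma_norm \<Omega> T E g"
 have uI: "u \<in> HQ_init \<Omega> T E" "ltrace u = g" "\<And>v. v \<in> V0 ==> wpair u (E v) = f v"
  using u unfolding dirichlet_solution_def by auto
 have uHQ: "u \<in> HQs" and ugHQ: "ug \<in> HQs" using uI(1) ug(1) by (auto simp: HQ_init_def HQ_closure_def)
 have f0: "f \<in> dual_space V0 (gnorm Q)" using dual_space_subset[OF f H11_0_subset(2)] by (simp add: energy_norm_eq[abs_def])
 then obtain C where C: "\<And>v. v \<in> V0 ==> \<bar>f v\<bar> \<le> C * gnorm Q v" unfolding dual_space_def by blast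
 have fb: "\<bar>f v\<bar> \<le> dual_norm V0 (gnorm Q) f * gnorm Q v" if "v \<in> V0" for v
  by (rule dual_norm_ge[OF C _ that]) (auto simp: gnorm_nonneg)
 have "wdist u ug \<le> dual_norm V0 (gnorm Q) f + HQ_norm \<Omega> T E ug"
 proof (rule wave_norm_le)
  fix v assume v: "v \<in> V0"
  have "wnorm ug * gnorm Q v \<le> HQ_norm \<Omega> T E ug * gnorm Q v"
   using HQ_norm_bounds(2)[of ug] by (intro mult_right_mono) (auto simp: gnorm_nonneg)
  then show "\<bar>wpair (%p. u p - ug p) (E v)\<bar> \<le> (dual_norm V0 (gnorm Q) f + HQ_norm \<Omega> T E ug) * gnorm Q v"
   using fb[OF v] wave_norm_ge[OF ugHQ v]
   unfolding HQ_diff(2)[OF uHQ ugHQ E_H10[OF v]] uI(3)[OF v] distrib_right by linarith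
 qed
 \<comment> \<open>The wave norm is defined by pairing through \<open>E\<close>, so the argument
   itself gives the factor 1, which the operator norm dominates.\<close>
 moreover have "HQ_norm \<Omega> T E ug \<le> extension_norm \<Omega> T E * HQ_norm \<Omega> T E ug"
  using mult_right_mono[OF extension_norm_ge_1, of "HQ_norm \<Omega> T E ug"] by (simp add: HQ_norm_def)
 ultimately show "(%p. u p - ug p) \<in> HQ_0init \<Omega> T E \<and>
   wdist u ug \<le> dual_norm V0 (energy_norm Q) f + extension_norm \<Omega> T E * HSigma_norm \<Omega> T E g"
  using same_trace_diff[OF uHQ ugHQ _ ne[OF uI(1)]] uI(2) ug(2) nrm by (simp add: energy_norm_eq[abs_def])
qed

end

section \<open>Functions continuous up to the boundary\<close>

text \<open>The room c \<delta>, proportional to the shift \<delta>, is what a kernel of radius c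
  \<delta> needs after the shift. Intervals and Lipschitz domains share this property.\<close>

definition inward_shiftable :: "'a::euclidean_space set => bool" where
 "inward_shiftable \<Omega> \<longleftrightarrow> (\<forall>p\<in>closure \<Omega>. \<exists>e. \<exists>\<rho>>0. \<exists>c>0. \<exists>\<delta>\<^sub>0>0. \<forall>x\<in>\<Omega>. \<forall>\<delta> z.
   dist x p < \<rho> \<and> 0 < \<delta> \<and> \<delta> < \<delta>\<^sub>0 \<and> norm z \<le> c * \<delta> \<longrightarrow> x + \<delta> *\<^sub>R e + z \<in> \<Omega>)"

text \<open>Points near p are pushed towards the centre q of an interior ball.\<close>

lemma convex_inward_shiftable:
 fixes \<Omega> :: "'a::euclidean_space set"
 assumes "open \<Omega>" "convex \<Omega>" "\<Omega> \<noteq> {}"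
 shows "inward_shiftable \<Omega>"
 unfolding inward_shiftable_def
proof
 fix p assume "p \<in> closure \<Omega>"
 obtain q r where q: "r > 0" "ball q r \<subseteq> \<Omega>" using assms openE by blast
 have "x + \<delta> *\<^sub>R (q - p) + z \<in> \<Omega>"
  if x: "x \<in> \<Omega>" and h: "dist x p < r / 2 \<and> 0 < \<delta> \<and> \<delta> < 1 \<and> norm z \<le> r / 2 * \<delta>" for x \<delta> z
 proof -
  \<comment> \<open>Chosen so that the shifted and perturbed point is the convex combination (1 -
    \<delta>) x + \<delta> y, with y in the ball around q.\<close>
  define y where "y = q + ((x - p) + (1 / \<delta>) *\<^sub>R z)"
  have "norm ((1 / \<delta>) *\<^sub>R z) \<le> r / 2" using h by (simp add: divide_le_eq)
  moreover have "norm (x - p) < r / 2" using h by (simp add: dist_norm)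
  ultimately have "norm ((x - p) + (1 / \<delta>) *\<^sub>R z) < r" by (intro order_le_less_trans[OF norm_triangle_ineq]) linarith
  then have "dist y q < r" by (simp add: y_def dist_norm)
  then have "y \<in> ball q r" by (simp add: dist_commute)
  then have "(1 - \<delta>) *\<^sub>R x + \<delta> *\<^sub>R y \<in> \<Omega>" using assms(2) x q(2) h by (intro convexD) auto
  moreover have "(1 - \<delta>) *\<^sub>R x + \<delta> *\<^sub>R y = x + \<delta> *\<^sub>R (q - p) + z" using h by (simp add: y_def algebra_simps)
  ultimately show ?thesis by simp
 qed
 then show "\<exists>e. \<exists>\<rho>>0. \<exists>c>0. \<exists>\<delta>\<^sub>0>0. \<forall>x\<in>\<Omega>. \<forall>\<delta> z.
   dist x p < \<rho> \<and> 0 < \<delta> \<and> \<delta> < \<delta>\<^sub>0 \<and> norm z \<le> c * \<delta> \<longrightarrow> x + \<delta> *\<^sub>R e + z \<in> \<Omega>"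
  using q(1) by (intro exI[of _ "q - p"] exI[of _ "r / 2"] exI[of _ 1] conjI) auto
qed

text \<open>A shift by \<delta> along e raises the height above the graph by \<delta>, while a
  perturbation z alters the graph by at most 2 L |z| and the height by at most |z|.\<close>

lemma lipschitz_inward_shiftable:
 fixes \<Omega> :: "'a::euclidean_space set"
 assumes op: "open \<Omega>" and lip: "lipschitz_boundary \<Omega>"
 shows "inward_shiftable \<Omega>"
 unfolding inward_shiftable_def
proof
 fix p assume p: "p \<in> closure \<Omega>"
 show "\<exists>e. \<exists>\<rho>>0. \<exists>c>0. \<exists>\<delta>\<^sub>0>0. \<forall>x\<in>\<Omega>. \<forall>\<delta> z.
   dist x p < \<rho> \<and> 0 < \<delta> \<and> \<delta> < \<delta>\<^sub>0 \<and> norm z \<le> c * \<delta> \<longrightarrow> x + \<delta> *\<^sub>R e + z \<in> \<Omega>"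
 proof (cases "p \<in> \<Omega>")
  case True
  then obtain r where r: "r > 0" "ball p r \<subseteq> \<Omega>" using op openE by blast
  have "x + \<delta> *\<^sub>R 0 + z \<in> \<Omega>" if h: "dist x p < r / 2 \<and> 0 < \<delta> \<and> \<delta> < r / 2 \<and> norm z \<le> 1 * \<delta>" for x \<delta> z
  proof -
   have "dist p (x + z) \<le> dist x p + norm z"
    using norm_triangle_ineq[of "x - p" z] by (simp add: dist_norm norm_minus_commute algebra_simps)
   then have "x + z \<in> ball p r" using h by simp
   then show ?thesis using r(2) by auto
  qed
  then show ?thesis using r(1) by (intro exI[of _ 0] exI[of _ "r / 2"] exI[of _ 1] conjI) auto
 next
  case False
  then have "p \<in> frontier \<Omega>" using p op by (simp add: frontier_def interior_open)
  then obtain e r h L and \<psi> :: "'a => real" where e: "norm e = 1" "r > 0" "h > 0" "L-lipschitz_on {y. y \<bullet> e = 0} \<psi>"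
   and graph: "\<And>y s. y \<bullet> e = 0 ==> norm y < r ==> \<bar>s\<bar> < h ==> p + y + s *\<^sub>R e \<in> \<Omega> \<longleftrightarrow> \<psi> y < s"
   using lip unfolding lipschitz_boundary_def by blast
  have L: "L \<ge> 0" by (rule lipschitz_on_nonneg[OF e(4)])
  \<comment> \<open>This makes (2 L + 1) c \<le> 1, so the gain \<delta> absorbs both losses; the 2
    comes from the crude bound |P v| \<le> 2 |v|.\<close>
  define c where "c = 1 / (2 * L + 2)"
  \<comment> \<open>Keeps the shifted and perturbed point inside the coordinate patch.\<close>
  define \<rho> where "\<rho> = min r h / 8"
  have c: "c > 0" "c \<le> 1" "(2 * L + 1) * c \<le> 1" using L by (auto simp: c_def divide_simps)
  have \<rho>: "\<rho> > 0" "8 * \<rho> \<le> r" "8 * \<rho> \<le> h" using e by (auto simp: \<rho>_def)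
  have ee: "e \<bullet> e = 1" using e(1) by (simp add: dot_square_norm)
  define P where "P v = v - (v \<bullet> e) *\<^sub>R e" for v
  have P0: "P v \<bullet> e = 0" for v by (simp add: P_def inner_diff_left ee)
  have ve: "\<bar>v \<bullet> e\<bar> \<le> norm v" for v using Cauchy_Schwarz_ineq2[of v e] e(1) by simp
  have Pn: "norm (P v) \<le> 2 * norm v" for v
   using norm_triangle_ineq4[of v "(v \<bullet> e) *\<^sub>R e"] ve[of v] e(1) by (simp add: P_def)
  have "x + \<delta> *\<^sub>R e + z \<in> \<Omega>"
   if x: "x \<in> \<Omega>" and hh: "dist x p < \<rho> \<and> 0 < \<delta> \<and> \<delta> < \<rho> \<and> norm z \<le> c * \<delta>" for x \<delta> z
  proof -
   define y s where "y = P (x - p)" and "s = (x - p) \<bullet> e"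
   have xp: "norm (x - p) < \<rho>" using hh by (simp add: dist_norm)
   have z\<delta>: "norm z \<le> \<delta>" using hh mult_right_mono[OF c(2), of \<delta>] by linarith
   have "p + y + s *\<^sub>R e = x" by (simp add: y_def s_def P_def)
   moreover have yr: "norm y < 2 * \<rho>" using Pn[of "x - p"] xp unfolding y_def by linarith
   moreover have sh: "\<bar>s\<bar> < \<rho>" using ve[of "x - p"] xp unfolding s_def by linarith
   ultimately have "\<psi> y < s" using graph[of y s] x P0 \<rho> by (auto simp: y_def)
   define y' s' where "y' = y + P z" and "s' = s + \<delta> + z \<bullet> e"
   have y'0: "y' \<bullet> e = 0" by (simp add: y'_def y_def inner_add_left P0)
   have "dist (\<psi> y') (\<psi> y) \<le> L * dist y' y"
    by (rule lipschitz_onD[OF e(4)]) (use y'0 P0 in \<open>auto simp: y_def\<close>)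
   also have "dist y' y \<le> 2 * norm z" using Pn[of z] by (simp add: y'_def dist_norm)
   finally have "dist (\<psi> y') (\<psi> y) \<le> L * (2 * norm z)" using L by (simp add: mult_left_mono)
   then have "\<psi> y' \<le> \<psi> y + 2 * L * norm z" by (simp add: dist_real_def mult_ac)
   moreover have "2 * L * norm z + norm z \<le> \<delta>"
   proof -
    have "(2 * L + 1) * norm z \<le> (2 * L + 1) * (c * \<delta>)" using hh L by (intro mult_left_mono) auto
    also have "\<dots> \<le> 1 * \<delta>" unfolding mult.assoc[symmetric] using hh c(3) by (intro mult_right_mono) auto
    finally show ?thesis by (simp add: distrib_right)
   qed
   ultimately have "\<psi> y' < s'" using \<open>\<psi> y < s\<close> ve[of z] unfolding s'_def by linarith
   moreover have "norm y' < r" using norm_triangle_ineq[of y "P z"] Pn[of z] yr z\<delta> hh \<rho> unfolding y'_def by linarith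
   moreover have "\<bar>s'\<bar> < h" using sh ve[of z] z\<delta> hh \<rho> unfolding s'_def by linarith
   ultimately have "p + y' + s' *\<^sub>R e \<in> \<Omega>" using graph[OF y'0] by blast
   moreover have "p + y' + s' *\<^sub>R e = x + \<delta> *\<^sub>R e + z"
    by (simp add: y'_def s'_def y_def s_def P_def algebra_simps)
   ultimately show ?thesis by simp
  qed
  then show ?thesis using c(1) \<rho>(1) by (intro exI[of _ e] exI[of _ \<rho>] exI[of _ c] conjI) auto
 qed
qed

lemma admissible_domain_props:
 fixes \<Omega> :: "'a::euclidean_space set"
 assumes "admissible_domain \<Omega>"
 shows "open \<Omega>" "bounded \<Omega>" "\<Omega> \<noteq> {}" "inward_shiftable \<Omega>"
proof -
 consider a b where "\<Omega> \<noteq> {}" "\<Omega> = box a b" | "bounded_lipschitz_domain \<Omega>"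
  using assms unfolding admissible_domain_def by blast
 then have "open \<Omega> \<and> bounded \<Omega> \<and> \<Omega> \<noteq> {} \<and> inward_shiftable \<Omega>"
 proof cases
  case 1
  then show ?thesis using convex_inward_shiftable[OF open_box convex_box(2), of a b] by (simp add: bounded_box open_box)
 next
  case 2
  then show ?thesis using lipschitz_inward_shiftable[of \<Omega>] by (auto simp: bounded_lipschitz_domain_def)
 qed
 then show "open \<Omega>" "bounded \<Omega>" "\<Omega> \<noteq> {}" "inward_shiftable \<Omega>" by auto
qed

text \<open>Two scales in this order: \<delta> small enough for the translation error of every
  \<open>f i\<close>, then a kernel inside the ball of radius c \<delta>. Translation preserves the
  L2 norm, so the two errors simply add.\<close>

lemma shifted_mollification:
 fixes f :: "'i => 'a::euclidean_space => real"
 assumes f: "\<And>i. i \<in> I ==> f i \<in> L2 UNIV" and I: "finite I" and e: "e > 0" and d0: "\<delta>\<^sub>0 > 0" and c: "c > 0"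
 shows "\<exists>\<delta> \<eta>. 0 < \<delta> \<and> \<delta> < \<delta>\<^sub>0 \<and> \<eta> \<in> test_fun (ball 0 (c * \<delta>)) \<and>
  (\<forall>i\<in>I. (%x. conv (f i) \<eta> (\<delta> *\<^sub>R a + x)) \<in> L2 UNIV \<and> L2_norm UNIV (%x. conv (f i) \<eta> (\<delta> *\<^sub>R a + x) - f i x) < e)"
proof -
 have e2: "e / 2 > 0" using e by simp
 have "eventually (%\<delta>. L2_norm UNIV (%x. f i (x - (- (\<delta> *\<^sub>R a))) - f i x) < e / 2) (at_right 0)" if i: "i \<in> I" for i
 proof -
  obtain d where d: "d > 0" "\<And>z. norm z < d ==> L2_norm UNIV (%x. f i (x - z) - f i x) < e / 2"
   using L2_translation_continuous[OF f[OF i]] e2 unfolding transl_cont_def by blast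
  have "eventually (%\<delta>. norm (- (\<delta> *\<^sub>R a)) < d) (at_right 0)"
   by (rule order_tendstoD(2)[OF _ d(1)]) (auto intro!: tendsto_eq_intros)
  then show ?thesis by (rule eventually_mono) (rule d(2))
 qed
 then have "eventually (%\<delta>. \<forall>i\<in>I. L2_norm UNIV (%x. f i (x - (- (\<delta> *\<^sub>R a))) - f i x) < e / 2) (at_right 0)"
  by (intro eventually_ball_finite I ballI)
 moreover have "eventually (%\<delta>::real. 0 < \<delta> \<and> \<delta> < \<delta>\<^sub>0) (at_right 0)" using d0 eventually_at_right_real[OF d0] by simp
 ultimately have "eventually (%\<delta>. (0 < \<delta> \<and> \<delta> < \<delta>\<^sub>0) \<and> (\<forall>i\<in>I. L2_norm UNIV (%x. f i (x - (- (\<delta> *\<^sub>R a))) - f i x) < e / 2)) (at_right 0)"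
  by (rule eventually_elim2) blast
 from eventually_happens[OF this] obtain \<delta> where \<delta>: "0 < \<delta>" "\<delta> < \<delta>\<^sub>0"
  "\<And>i. i \<in> I ==> L2_norm UNIV (%x. f i (x - (- (\<delta> *\<^sub>R a))) - f i x) < e / 2" by auto
 have c\<delta>: "c * \<delta> > 0" using c \<delta>(1) by simp
 from mollifier_sequence[of I f, OF f I c\<delta>] obtain \<eta> where \<eta>: "\<And>n::nat. \<eta> n \<in> test_fun (ball 0 (c * \<delta> / Suc n))"
  "\<And>i n. i \<in> I ==> conv (f i) (\<eta> n) \<in> L2 UNIV"
  "\<And>i. i \<in> I ==> (%n. L2_dist UNIV (conv (f i) (\<eta> n)) (f i)) \<longlonglongrightarrow> 0" by blast
 have "eventually (%n. \<forall>i\<in>I. L2_dist UNIV (conv (f i) (\<eta> n)) (f i) < e / 2) sequentially"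
  by (intro eventually_ball_finite I ballI order_tendstoD(2)[OF \<eta>(3) e2])
 then obtain n where n: "\<And>i. i \<in> I ==> L2_dist UNIV (conv (f i) (\<eta> n)) (f i) < e / 2"
  by (auto simp: eventually_sequentially)
 have "ball 0 (c * \<delta> / Suc n) \<subseteq> (ball 0 (c * \<delta>) :: 'a set)"
  using c\<delta> divide_left_mono[of 1 "real (Suc n)" "c * \<delta>"] by (intro subset_ball) simp
 then have t: "\<eta> n \<in> test_fun (ball 0 (c * \<delta>))" by (rule test_fun_mono[OF \<eta>(1)])
 have "(%x. conv (f i) (\<eta> n) (\<delta> *\<^sub>R a + x)) \<in> L2 UNIV \<and> L2_norm UNIV (%x. conv (f i) (\<eta> n) (\<delta> *\<^sub>R a + x) - f i x) < e" if i: "i \<in> I" for i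
 proof -
  have shift: "x - (- (\<delta> *\<^sub>R a)) = \<delta> *\<^sub>R a + x" for x :: 'a by (simp add: add.commute)
  note g = L2_translate[OF \<eta>(2)[OF i], of n "- (\<delta> *\<^sub>R a)", unfolded shift]
  note h = L2_translate[OF f[OF i], of "- (\<delta> *\<^sub>R a)", unfolded shift]
  have "L2_norm UNIV (%x. conv (f i) (\<eta> n) (\<delta> *\<^sub>R a + x) - f i x) \<le>
   L2_norm UNIV (%x. conv (f i) (\<eta> n) (\<delta> *\<^sub>R a + x) - f i (\<delta> *\<^sub>R a + x)) + L2_norm UNIV (%x. f i (\<delta> *\<^sub>R a + x) - f i x)"
   by (rule L2_norm_triangle3[OF g(1) h(1) f[OF i]])
  also have "L2_norm UNIV (%x. conv (f i) (\<eta> n) (\<delta> *\<^sub>R a + x) - f i (\<delta> *\<^sub>R a + x)) = L2_dist UNIV (conv (f i) (\<eta> n)) (f i)"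
   using L2_translate(2)[OF L2_diff[OF \<eta>(2)[OF i] f[OF i]], of n "- (\<delta> *\<^sub>R a)"] unfolding shift .
  finally show ?thesis using n[OF i] \<delta>(3)[OF i] g(1) unfolding shift by auto
 qed
 with \<delta>(1,2) t show ?thesis by blast
qed

section \<open>Approximation by smooth functions vanishing at the initial time\<close>

context spacetime
begin

text \<open>Closeness is asked in the L2 and gradient norms, which dominate the \<open>H(Q)\<close>
  norm for regular initial data; \<zeta> depends on space only, so that localisation does not
  disturb the initial condition.\<close>

definition cont_approx :: "('a \<times> real => real) => ('a => real) => bool" where
 "cont_approx u \<zeta> \<longleftrightarrow> (\<forall>e>0. \<exists>V. C_diff 1 V \<and> (\<forall>x. V (x, 0) = 0) \<and>
   L2_norm Q (%p. V p - \<zeta> (fst p) * u p) < e \<and> gnorm Q (%p. V p - \<zeta> (fst p) * u p) < e)"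

lemma smooth_fst:
 fixes \<zeta> :: "'a => real"
 assumes "\<And>k. C_diff k \<zeta>"
 shows "C_diff k (%p::'a \<times> real. \<zeta> (fst p))"
 using C_diff_compose_affine[OF bounded_linear_fst assms, of k 0] by simp

lemma continuous_bounded_Q:
 fixes g :: "'a \<times> real => real"
 assumes "continuous_on UNIV g"
 shows "\<exists>M\<ge>1. \<forall>p\<in>Q. \<bar>g p\<bar> \<le> M"
proof -
 have "compact (closure Q)" using bounded_Q(1) by (simp add: compact_closure)
 then have "bounded (g ` closure Q)"
  by (intro compact_imp_bounded compact_continuous_image continuous_on_subset[OF assms]) auto
 then obtain M where "\<And>p. p \<in> closure Q ==> \<bar>g p\<bar> \<le> M" by (auto simp: bounded_iff)
 then have "\<forall>p\<in>Q. \<bar>g p\<bar> \<le> max M 1" using closure_subset[of Q] by (meson max.coboundedI1 subsetD)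
 then show ?thesis by (intro exI[of _ "max M 1"]) auto
qed

lemma mult_smooth_H1:
 assumes u: "u \<in> H1 Q" and \<zeta>: "\<And>k. C_diff k (\<theta> :: 'a \<times> real => real)"
 shows "(%p. \<theta> p * u p) \<in> L2 Q" "(%p. \<theta> p * u p) \<in> H1 Q"
  "c \<in> Basis ==> (%p. \<theta> p * wd Q u c p + pd c \<theta> p * u p) \<in> L2 Q"
  "c \<in> Basis ==> has_weak_deriv Q (%p. \<theta> p * u p) c (%p. \<theta> p * wd Q u c p + pd c \<theta> p * u p)"
proof -
 have ml: "(%p. g p * v p) \<in> L2 Q" if g: "continuous_on UNIV g" and v: "v \<in> L2 Q" for g v :: "'a \<times> real => real"
 proof -
  obtain M where "\<And>p. p \<in> Q ==> \<bar>g p\<bar> \<le> M" using continuous_bounded_Q[OF g] by blast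
  then show ?thesis by (rule L2_mult_bounded(1)[OF v borel_measurable_continuous_onI[OF g]])
 qed
 have c\<theta>: "continuous_on UNIV \<theta>" by (rule C_diff_continuous[OF \<zeta>])
 have cd: "continuous_on UNIV (pd c \<theta>)" if "c \<in> Basis" for c using \<zeta>[of 1] that by simp
 show 1: "(%p. \<theta> p * u p) \<in> L2 Q" by (rule ml[OF c\<theta> H1_L2[OF u]])
 show 2: "(%p. \<theta> p * wd Q u c p + pd c \<theta> p * u p) \<in> L2 Q" if c: "c \<in> Basis" for c
  by (intro L2_add ml c\<theta> cd c weak_deriv_H1(1)[OF u c] H1_L2[OF u])
 show 3: "has_weak_deriv Q (%p. \<theta> p * u p) c (%p. \<theta> p * wd Q u c p + pd c \<theta> p * u p)" if c: "c \<in> Basis" for c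
  by (rule has_weak_deriv_mult_smooth[OF borel_Q(1) c H1_L2[OF u] weak_deriv_H1[OF u c] \<zeta>])
 show "(%p. \<theta> p * u p) \<in> H1 Q" by (rule H1I[OF 1 2 3])
qed

text \<open>Translating into \<open>\<Omega>\<close> and forward in time by \<open>\<delta>\<close> before mollifying at a scale below \<open>c \<delta>\<close> only
 evaluates \<open>u\<close> where its zero extension to \<open>\<Omega> \<times> (-\<infinity>, T)\<close> is weakly differentiable.\<close>

lemma local_cont_approx:
 assumes u: "init_reg u" and \<zeta>: "\<And>k. C_diff k \<zeta>"
  and supp: "\<And>x. x \<in> \<Omega> ==> \<zeta> x \<noteq> 0 ==> dist x p\<^sub>0 < \<rho>"
  and c: "c > 0" and d0: "\<delta>\<^sub>0 > 0"
  and shift: "\<And>x \<delta> z. x \<in> \<Omega> ==> dist x p\<^sub>0 < \<rho> ==> 0 < \<delta> ==> \<delta> < \<delta>\<^sub>0 ==> norm z \<le> c * \<delta> ==> x + \<delta> *\<^sub>R e + z \<in> \<Omega>"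
 shows "cont_approx u \<zeta>"
 unfolding cont_approx_def
proof (intro allI impI)
 fix \<epsilon> :: real assume \<epsilon>: "\<epsilon> > 0"
 have uH: "u \<in> H1 Q" using u by (simp add: init_reg_def)
 note uL = H1_L2[OF uH]
 define Z where "Z p = \<zeta> (fst p)" for p :: "'a \<times> real"
 have CZ: "C_diff k Z" for k unfolding Z_def[abs_def] by (rule smooth_fst[OF \<zeta>])
 have cZ: "continuous_on UNIV Z" by (rule C_diff_continuous[OF CZ])
 have cdZ: "continuous_on UNIV (pd b Z)" if "b \<in> Basis" for b using CZ[of 1] that by simp
 obtain M0 where M0: "M0 \<ge> 1" "\<And>p. p \<in> Q ==> \<bar>Z p\<bar> \<le> M0" using continuous_bounded_Q[OF cZ] by blast
 have "\<forall>b\<in>Basis. \<exists>M. \<forall>p\<in>Q. \<bar>pd b Z p\<bar> \<le> M" using continuous_bounded_Q[OF cdZ] by blast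
 from bchoice[OF this] obtain MB where MB: "\<And>b p. b \<in> Basis ==> p \<in> Q ==> \<bar>pd b Z p\<bar> \<le> MB b" by blast
 define M where "M = M0 + (\<Sum>b\<in>Basis. \<bar>MB b\<bar>)"
 have MBs: "\<bar>MB b\<bar> \<le> (\<Sum>b\<in>Basis. \<bar>MB b\<bar>)" if "b \<in> Basis" for b by (rule member_le_sum[OF that]) auto
 have Ms: "0 \<le> (\<Sum>b\<in>Basis. \<bar>MB b\<bar>)" by (rule sum_nonneg) simp
 have M: "M \<ge> 1" using M0(1) Ms unfolding M_def by linarith
 have ZM: "\<bar>Z p\<bar> \<le> M" if "p \<in> Q" for p using M0(2)[OF that] Ms unfolding M_def by linarith
 have dZM: "\<bar>pd b Z p\<bar> \<le> M" if "b \<in> Basis" "p \<in> Q" for b p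
  using MB[OF that] MBs[OF that(1)] M0(1) unfolding M_def by linarith
 define n where "n = real (card (Basis :: ('a \<times> real) set))"
 \<comment> \<open>Each of the n coordinate derivatives costs at most 2 M e', so the total stays
   strictly below \<epsilon>.\<close>
 define e' where "e' = \<epsilon> / (2 * M * (n + 1))"
 have n0: "n \<ge> 0" by (simp add: n_def)
 have e': "e' > 0" using \<epsilon> M n0 by (simp add: e'_def)
 \<comment> \<open>The index 0, which is not a basis vector, stands for the function and basis
   vectors for its derivatives, so that one kernel serves all.\<close>
 define f where "f b p = indicator Q p * (if b = 0 then u p else wd Q u b p)" for b p :: "'a \<times> real"
 have f0: "f 0 = (%p. indicator Q p * u p)" by (simp add: f_def[abs_def])
 have fb: "f b = (%p. indicator Q p * wd Q u b p)" if "b \<in> Basis" for b using nonzero_Basis[OF that] by (simp add: f_def[abs_def])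
 have fL: "f b \<in> L2 UNIV" if "b \<in> insert 0 Basis" for b
  using that uL weak_deriv_H1(1)[OF uH, of b] by (auto simp: f0 fb L2_indicator[OF borel_Q(1)] simp del: split_paired_All)
 \<comment> \<open>The value at time t is taken from around time t - \<delta>, which moves the graph
   forward in time.\<close>
 define a where "a = (e, -1::real)"
 \<comment> \<open>The bound by 1 keeps the temporal radius of the kernel below the time shift
   \<delta>.\<close>
 define c' where "c' = min c 1"
 have c': "c' > 0" "c' \<le> c" "c' \<le> 1" using c by (auto simp: c'_def)
 have "\<exists>\<delta> \<eta>. 0 < \<delta> \<and> \<delta> < \<delta>\<^sub>0 \<and> \<eta> \<in> test_fun (ball 0 (c' * \<delta>)) \<and> (\<forall>b\<in>insert 0 Basis.
   (%x. conv (f b) \<eta> (\<delta> *\<^sub>R a + x)) \<in> L2 UNIV \<and> L2_norm UNIV (%x. conv (f b) \<eta> (\<delta> *\<^sub>R a + x) - f b x) < e')"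
  by (rule shifted_mollification[OF fL _ e' d0 c'(1)]) auto
 then obtain \<delta> \<eta> where \<delta>: "0 < \<delta>" "\<delta> < \<delta>\<^sub>0" and \<eta>: "\<eta> \<in> test_fun (ball 0 (c' * \<delta>))"
  and ap: "\<And>b. b \<in> insert 0 Basis ==> (%x. conv (f b) \<eta> (\<delta> *\<^sub>R a + x)) \<in> L2 UNIV"
  "\<And>b. b \<in> insert 0 Basis ==> L2_norm UNIV (%x. conv (f b) \<eta> (\<delta> *\<^sub>R a + x) - f b x) < e'"
  by (elim exE conjE) blast
 define W where "W b p = conv (f b) \<eta> (\<delta> *\<^sub>R a + p)" for b p
 define w where "w = W 0"
 define V where "V p = Z p * w p" for p
 have \<eta>U: "\<eta> \<in> test_fun UNIV" by (rule test_fun_mono[OF \<eta>]) simp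
 have Cc: "C_diff k (conv (f 0) \<eta>)" for k by (rule C_diff_conv[OF fL \<eta>U]) simp
 have Cw: "C_diff k w" for k
  unfolding w_def W_def[abs_def] using C_diff_compose_affine[OF bounded_linear_ident Cc] .
 have CV: "C_diff 1 V" unfolding V_def[abs_def] by (rule C_diff_mult[OF CZ Cw])
 define U where "U = \<Omega> \<times> {..<T}"
 have QU: "Q \<subseteq> U" by (auto simp: U_def cylQ_def)
 have wU: "has_weak_deriv U (f 0) b (f b)" if b: "b \<in> Basis" for b
  unfolding has_weak_deriv_def
 proof
  fix \<phi> assume \<phi>: "\<phi> \<in> test_fun U"
  have iU: "(LINT x:U|lborel. (indicator Q x * g x) * h x) = ip Q g h" for g h :: "'a \<times> real => real"
  proof -
   have "indicator U x *\<^sub>R ((indicator Q x * g x) * h x) = indicator Q x *\<^sub>R (g x * h x)" for x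
    using QU by (auto simp: indicator_def)
   then show ?thesis unfolding ip_def set_lebesgue_integral_def by presburger
  qed
  show "(LINT x:U|lborel. f 0 x * pd b \<phi> x) = - (LINT x:U|lborel. f b x * \<phi> x)"
   unfolding f0 fb[OF b] iU using u b \<phi> unfolding init_reg_def U_def by blast
 qed
 \<comment> \<open>The derivative of the mollification is identified only where the shifted kernel
   ball fits into U; elsewhere in Q the factor \<open>Z\<close> is 0.\<close>
 have dw: "pd b w p = W b p" if p: "p \<in> Q" "dist (fst p) p\<^sub>0 < \<rho>" and b: "b \<in> Basis" for p b
 proof -
  have "pd b w p = pd b (conv (f 0) \<eta>) (\<delta> *\<^sub>R a + p)"
   unfolding w_def W_def[abs_def]
   using pd_compose_affine[OF bounded_linear_ident C_diff_differentiable[OF Cc]] .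
  also have "\<dots> = conv (f 0) (pd b \<eta>) (\<delta> *\<^sub>R a + p)"
   using pd_conv[OF fL \<eta>U b, of 0] by simp
  also have "f 0 = (%y. indicator U y * f 0 y)" using QU by (auto simp: f0 indicator_def fun_eq_iff)
  also have "conv (%y. indicator U y * f 0 y) (pd b \<eta>) (\<delta> *\<^sub>R a + p) = conv (%y. indicator U y * f b y) \<eta> (\<delta> *\<^sub>R a + p)"
  proof (rule conv_weak_deriv[OF wU[OF b] \<eta>])
   show "ball (\<delta> *\<^sub>R a + p) (c' * \<delta>) \<subseteq> U"
   proof
    fix y assume y: "y \<in> ball (\<delta> *\<^sub>R a + p) (c' * \<delta>)"
    define z where "z = y - (\<delta> *\<^sub>R a + p)"
    have "norm z < c' * \<delta>" using y by (simp add: z_def dist_norm norm_minus_commute)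
    moreover have "c' * \<delta> \<le> c * \<delta>" "c' * \<delta> \<le> 1 * \<delta>" using c' \<delta> by (auto intro!: mult_right_mono)
    ultimately have z: "norm (fst z) \<le> c * \<delta>" "norm (snd z) < \<delta>" using norm_fst_le[of "fst z" "snd z"] norm_snd_le[of "snd z" "fst z"] unfolding prod.collapse by linarith+
    have "fst y = fst p + \<delta> *\<^sub>R e + fst z" "snd y = snd p - \<delta> + snd z" by (auto simp: z_def a_def)
    moreover have "fst p + \<delta> *\<^sub>R e + fst z \<in> \<Omega>" by (rule shift[OF _ p(2) \<delta> z(1)]) (use p(1) in \<open>auto simp: cylQ_def\<close>)
    moreover have "snd p < T" using p(1) by (auto simp: cylQ_def)
    ultimately show "y \<in> U" using z(2) by (auto simp: U_def mem_Times_iff)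
   qed
  qed
  also have "(%y. indicator U y * f b y) = f b" using QU by (auto simp: fb[OF b] indicator_def fun_eq_iff)
  finally show ?thesis by (simp add: W_def)
 qed
 \<comment> \<open>At t = 0 the kernel reaches only negative times, where the zero extension
   vanishes.\<close>
 have V0: "V (x, 0) = 0" for x
 proof -
  have "w (x, 0) = 0" unfolding w_def W_def
  proof (rule conv_zero)
   fix y assume "f 0 y \<noteq> 0"
   then have "snd y > 0" by (auto simp: f0 indicator_def cylQ_def split: if_splits)
   then have "norm (snd (\<delta> *\<^sub>R a + (x, 0) - y)) \<ge> \<delta>" using \<delta>(1) by (simp add: a_def)
   then have "norm (\<delta> *\<^sub>R a + (x, 0) - y) \<ge> 1 * \<delta>" using norm_snd_le[of "snd (\<delta> *\<^sub>R a + (x, 0) - y)" "fst (\<delta> *\<^sub>R a + (x, 0) - y)"] unfolding prod.collapse by linarith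
   moreover have "c' * \<delta> \<le> 1 * \<delta>" using c' \<delta> by (intro mult_right_mono) auto
   ultimately show "\<eta> (\<delta> *\<^sub>R a + (x, 0) - y) = 0" by (intro test_funD(5)[OF \<eta>]) simp
  qed
  then show ?thesis by (simp add: V_def)
 qed
 have LW: "(%p. W b p - g p) \<in> L2 Q" "L2_dist Q (W b) g < e'"
  if b: "b \<in> insert 0 Basis" and g: "\<And>p. p \<in> Q ==> f b p = g p" for b g
 proof -
  have L: "(%p. W b p - f b p) \<in> L2 UNIV" unfolding W_def by (intro L2_diff ap(1) fL b)
  have "(%p. W b p - f b p) \<in> L2 Q" by (rule L2_subset[OF L _ borel_Q(1)]) simp
  then show "(%p. W b p - g p) \<in> L2 Q" by (subst L2_cong[of _ _ "%p. W b p - f b p"]) (auto simp: g)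
  have "L2_dist Q (W b) g = L2_dist Q (W b) (f b)" by (rule L2_norm_cong) (simp add: g)
  also have "\<dots> \<le> L2_dist UNIV (W b) (f b)" by (rule L2_norm_subset[OF L _ borel_Q(1)]) simp
  finally show "L2_dist Q (W b) g < e'" using ap(2)[OF b] by (simp add: W_def)
 qed
 have Lw: "(%p. w p - u p) \<in> L2 Q" "L2_dist Q w u < e'"
  unfolding w_def using LW[of 0 u] by (auto simp: f0)
 have LWb: "(%p. W b p - wd Q u b p) \<in> L2 Q" "L2_dist Q (W b) (wd Q u b) < e'" if "b \<in> Basis" for b
  using LW[of b "wd Q u b"] that by (auto simp: fb)
 note mZ = mult_smooth_H1[OF uH CZ]
 have M1: "M * e' < \<epsilon>" "n * (2 * M * e') < \<epsilon>"
 proof -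
  have k: "2 * M * (n + 1) * e' = \<epsilon>" using M n0 by (simp add: e'_def)
  have "0 < M * e'" using M e' by simp
  moreover have "0 \<le> n * (M * e')" using M e' n0 by simp
  moreover have "2 * (M * e') + 2 * (n * (M * e')) = \<epsilon>" using k by (simp add: algebra_simps)
  ultimately show "M * e' < \<epsilon>" "n * (2 * M * e') < \<epsilon>" by (simp_all add: algebra_simps)
 qed
 have 1: "L2_norm Q (%p. V p - Z p * u p) < \<epsilon>"
 proof -
  have eq: "V p - Z p * u p = Z p * (w p - u p)" for p by (simp add: V_def algebra_simps)
  have "L2_norm Q (%p. Z p * (w p - u p)) \<le> M * L2_dist Q w u"
   by (rule L2_mult_bounded(2)[OF Lw(1) borel_measurable_continuous_onI[OF cZ] ZM])
  also have "\<dots> \<le> M * e'" using Lw(2) M by (intro mult_left_mono) auto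
  finally show ?thesis unfolding eq using M1(1) by linarith
 qed
 define D where "D b p = pd b V p - (Z p * wd Q u b p + pd b Z p * u p)" for b p
 have Dn: "L2_norm Q (D b) \<le> 2 * M * e'" if b: "b \<in> Basis" for b
 proof -
  have Deq: "D b p = pd b Z p * (w p - u p) + Z p * (W b p - wd Q u b p)" if p: "p \<in> Q" for p
  proof -
   have "pd b V p = pd b Z p * w p + Z p * pd b w p"
    unfolding V_def[abs_def] by (rule pd_mult[OF C_diff_differentiable[OF CZ] C_diff_differentiable[OF Cw]])
   moreover have "Z p * pd b w p = Z p * W b p"
   proof (cases "Z p = 0")
    case False
    then have "dist (fst p) p\<^sub>0 < \<rho>" using supp[of "fst p"] p by (auto simp: Z_def cylQ_def)
    then show ?thesis using dw[OF p _ b] by simp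
   qed simp
   ultimately show ?thesis by (simp add: D_def algebra_simps)
  qed
  note A = L2_mult_bounded[OF Lw(1) borel_measurable_continuous_onI[OF cdZ[OF b]] dZM[OF b], simplified]
  note B = L2_mult_bounded[OF LWb(1)[OF b] borel_measurable_continuous_onI[OF cZ] ZM, simplified]
  have "L2_norm Q (D b) = L2_norm Q (%p. pd b Z p * (w p - u p) + Z p * (W b p - wd Q u b p))"
   by (rule L2_norm_cong[OF Deq])
  also have "\<dots> \<le> L2_norm Q (%p. pd b Z p * (w p - u p)) + L2_norm Q (%p. Z p * (W b p - wd Q u b p))"
   by (rule L2_norm_triangle[OF A(1) B(1)])
  also have "\<dots> \<le> M * e' + M * e'"
  proof (rule add_mono)
   have "M * L2_dist Q w u \<le> M * e'" using Lw(2) M by (intro mult_left_mono) auto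
   then show "L2_norm Q (%p. pd b Z p * (w p - u p)) \<le> M * e'" by (rule order_trans[OF A(2)])
   have "M * L2_dist Q (W b) (wd Q u b) \<le> M * e'" using LWb(2)[OF b] M by (intro mult_left_mono) auto
   then show "L2_norm Q (%p. Z p * (W b p - wd Q u b p)) \<le> M * e'" by (rule order_trans[OF B(2)])
  qed
  finally show ?thesis by simp
 qed
 have "gnorm Q (%p. V p - Z p * u p) \<le> (\<Sum>b\<in>Basis. L2_norm Q (D b))" unfolding D_def[abs_def]
  by (intro gnorm_diff_le_sum open_Q(1) mZ C_diff_1_L2[OF CV] has_weak_deriv_C_diff[OF CV])
 also have "\<dots> \<le> (\<Sum>b\<in>(Basis :: ('a \<times> real) set). 2 * M * e')" by (rule sum_mono[OF Dn])
 also have "\<dots> = n * (2 * M * e')" by (simp add: n_def)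
 finally have "gnorm Q (%p. V p - Z p * u p) < \<epsilon>" using M1(2) by linarith
 with CV V0 1 show "\<exists>V. C_diff 1 V \<and> (\<forall>x. V (x, 0) = 0) \<and>
   L2_norm Q (%p. V p - \<zeta> (fst p) * u p) < \<epsilon> \<and> gnorm Q (%p. V p - \<zeta> (fst p) * u p) < \<epsilon>"
  unfolding Z_def by blast
qed

lemma cont_approx_add:
 assumes u: "init_reg u" and \<zeta>: "\<And>k. C_diff k \<zeta>" "\<And>k. C_diff k \<xi>" and a: "cont_approx u \<zeta>" "cont_approx u \<xi>"
 shows "cont_approx u (%x. \<zeta> x + \<xi> x)"
 unfolding cont_approx_def
proof (intro allI impI)
 fix e :: real assume "e > 0"
 then have e: "e / 2 > 0" by simp
 obtain V where V: "C_diff 1 V" "\<And>x. V (x, 0) = 0" "L2_norm Q (%p. V p - \<zeta> (fst p) * u p) < e / 2"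
  "gnorm Q (%p. V p - \<zeta> (fst p) * u p) < e / 2" using a(1) e unfolding cont_approx_def by blast
 obtain W where W: "C_diff 1 W" "\<And>x. W (x, 0) = 0" "L2_norm Q (%p. W p - \<xi> (fst p) * u p) < e / 2"
  "gnorm Q (%p. W p - \<xi> (fst p) * u p) < e / 2" using a(2) e unfolding cont_approx_def by blast
 have uH: "u \<in> H1 Q" using u by (simp add: init_reg_def)
 note H = H1_diff[OF open_Q(1) C_diff_1_membership(5)[OF V(1)] mult_smooth_H1(2)[OF uH smooth_fst[OF \<zeta>(1)]]]
  H1_diff[OF open_Q(1) C_diff_1_membership(5)[OF W(1)] mult_smooth_H1(2)[OF uH smooth_fst[OF \<zeta>(2)]]]
 have eq: "(V p + W p) - (\<zeta> (fst p) + \<xi> (fst p)) * u p = (V p - \<zeta> (fst p) * u p) + (W p - \<xi> (fst p) * u p)" for p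
  by (simp add: algebra_simps)
 have "L2_norm Q (%p. (V p + W p) - (\<zeta> (fst p) + \<xi> (fst p)) * u p) < e" "gnorm Q (%p. (V p + W p) - (\<zeta> (fst p) + \<xi> (fst p)) * u p) < e"
  unfolding eq using L2_norm_triangle[OF H1_L2[OF H(1)] H1_L2[OF H(2)]] gnorm_triangle[OF open_Q(1) H] V(3,4) W(3,4) by linarith+
 moreover have "C_diff 1 (%p. V p + W p)" by (rule C_diff_add[OF V(1) W(1)])
 ultimately show "\<exists>V. C_diff 1 V \<and> (\<forall>x. V (x, 0) = 0) \<and> L2_norm Q (%p. V p - (\<zeta> (fst p) + \<xi> (fst p)) * u p) < e \<and>
   gnorm Q (%p. V p - (\<zeta> (fst p) + \<xi> (fst p)) * u p) < e" using V(2) W(2) by (intro exI[of _ "%p. V p + W p"]) simp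
qed

text \<open>A finite cover of the closure by local patches, with the partition of unity built by
  peeling: \<zeta> splits into \<zeta> \<kappa>, supported in the patch of q, and \<zeta> (1 -
  \<kappa>), which needs one patch less.\<close>

theorem cont_approx_1:
 assumes u: "init_reg u" and sh: "inward_shiftable \<Omega>" and ne: "\<Omega> \<noteq> {}"
 shows "cont_approx u (%_. 1)"
proof -
 from sh have "\<forall>p\<in>closure \<Omega>. \<exists>\<rho>. \<rho> > 0 \<and> (\<exists>e. \<exists>c>0. \<exists>\<delta>\<^sub>0>0. \<forall>x\<in>\<Omega>. \<forall>\<delta> z.
   dist x p < \<rho> \<and> 0 < \<delta> \<and> \<delta> < \<delta>\<^sub>0 \<and> norm z \<le> c * \<delta> \<longrightarrow> x + \<delta> *\<^sub>R e + z \<in> \<Omega>)"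
  unfolding inward_shiftable_def by blast
 from bchoice[OF this] obtain \<rho> where \<rho>: "\<And>p. p \<in> closure \<Omega> ==> \<rho> p > 0"
  "\<And>p. p \<in> closure \<Omega> ==> \<exists>e. \<exists>c>0. \<exists>\<delta>\<^sub>0>0. \<forall>x\<in>\<Omega>. \<forall>\<delta> z.
   dist x p < \<rho> p \<and> 0 < \<delta> \<and> \<delta> < \<delta>\<^sub>0 \<and> norm z \<le> c * \<delta> \<longrightarrow> x + \<delta> *\<^sub>R e + z \<in> \<Omega>" by blast
 have loc: "cont_approx u \<zeta>" if p: "p \<in> closure \<Omega>" and \<zeta>: "\<And>k. C_diff k \<zeta>" "\<And>x. x \<in> \<Omega> ==> \<zeta> x \<noteq> 0 ==> dist x p < \<rho> p" for p \<zeta>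
 proof -
  from \<rho>(2)[OF p] obtain e c \<delta>\<^sub>0 where h: "c > 0" "\<delta>\<^sub>0 > 0" "\<forall>x\<in>\<Omega>. \<forall>\<delta> z.
   dist x p < \<rho> p \<and> 0 < \<delta> \<and> \<delta> < \<delta>\<^sub>0 \<and> norm z \<le> c * \<delta> \<longrightarrow> x + \<delta> *\<^sub>R e + z \<in> \<Omega>" by (elim exE conjE)
  show ?thesis by (rule local_cont_approx[OF u \<zeta> h(1,2)]) (use h(3) in blast)+
 qed
 obtain x0 where x0: "x0 \<in> closure \<Omega>" using ne closure_subset by blast
 have ind: "cont_approx u \<zeta>" if "finite S" "S \<subseteq> closure \<Omega>" "\<And>k. C_diff k \<zeta>" "\<And>x. x \<in> \<Omega> ==> \<zeta> x \<noteq> 0 ==> \<exists>q\<in>S. x \<in> cball q (\<rho> q / 2)" for S \<zeta>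
  using that
 proof (induction S arbitrary: \<zeta> rule: finite_induct)
  case empty
  \<comment> \<open>With no patches left \<zeta> is 0 on \<Omega>, so the support condition at an
    arbitrary base point holds vacuously.\<close>
  show ?case by (rule loc[OF x0 empty.prems(2)]) (use empty.prems(3) in blast)
 next
  case (insert q S)
  have q: "q \<in> closure \<Omega>" using insert.prems(1) by simp
  have "cball q (\<rho> q / 2) \<subseteq> ball q (\<rho> q)" using \<rho>(1)[OF q] by auto
  from smooth_cutoff[OF compact_cball open_ball this] obtain \<kappa> d where \<kappa>: "\<kappa> \<in> test_fun (ball q (\<rho> q))" "d > 0"
   "\<forall>x\<in>cball q (\<rho> q / 2). \<forall>z. norm z < d \<longrightarrow> \<kappa> (x + z) = 1" by (elim exE conjE)
  have \<kappa>1: "\<kappa> x = 1" if "x \<in> cball q (\<rho> q / 2)" for x using \<kappa>(3)[rule_format, OF that, of 0] \<kappa>(2) by simp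
  note C\<kappa> = test_funD(1)[OF \<kappa>(1)]
  have s1: "C_diff k (%x. \<zeta> x * \<kappa> x)" for k by (rule C_diff_mult[OF insert.prems(2) C\<kappa>])
  have s2: "C_diff k (%x. \<zeta> x * (1 - \<kappa> x))" for k by (rule C_diff_mult[OF insert.prems(2) C_diff_diff[OF C_diff_const C\<kappa>]])
  have a1: "cont_approx u (%x. \<zeta> x * \<kappa> x)"
  proof (rule loc[OF q s1])
   show "dist x q < \<rho> q" if "\<zeta> x * \<kappa> x \<noteq> 0" for x
    using test_funD(5)[OF \<kappa>(1), of x] that by (auto simp: dist_commute)
  qed
  have a2: "cont_approx u (%x. \<zeta> x * (1 - \<kappa> x))"
  proof (rule insert.IH[OF _ s2])
   show "\<exists>q\<in>S. x \<in> cball q (\<rho> q / 2)" if x: "x \<in> \<Omega>" "\<zeta> x * (1 - \<kappa> x) \<noteq> 0" for x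
    using insert.prems(3)[OF x(1)] x(2) \<kappa>1[of x] by auto
  qed (use insert.prems(1) in simp)
  have "(%x. \<zeta> x * \<kappa> x + \<zeta> x * (1 - \<kappa> x)) = \<zeta>" by (simp add: fun_eq_iff algebra_simps)
  with cont_approx_add[OF u s1 s2 a1 a2] show ?case by simp
 qed
 have "compact (closure \<Omega>)" using bounded_Omega by (simp add: compact_closure)
 moreover have "closure \<Omega> \<subseteq> (\<Union>p\<in>closure \<Omega>. ball p (\<rho> p / 2))" using \<rho>(1) by force
 ultimately obtain S where S: "S \<subseteq> closure \<Omega>" "finite S" "closure \<Omega> \<subseteq> (\<Union>p\<in>S. ball p (\<rho> p / 2))"
  using compactE_image[of "closure \<Omega>" "closure \<Omega>" "%p. ball p (\<rho> p / 2)"] by auto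
 show ?thesis
 proof (rule ind[OF S(2,1) C_diff_const])
  fix x assume "x \<in> \<Omega>"
  then have "x \<in> (\<Union>p\<in>S. ball p (\<rho> p / 2))" using S(3) closure_subset by blast
  then show "\<exists>q\<in>S. x \<in> cball q (\<rho> q / 2)" by (force intro: less_imp_le)
 qed
qed

end

section \<open>Every element has a lateral trace\<close>

context wave_setting
begin

text \<open>The k-th term of a sequence defining the closure is replaced by a \<open>C^1\<close>
  function within \<open>\<delta> k\<close> in L2 and in energy; the energy norm dominates the wave
  norm, so the new sequence has the same limit and is continuous up to the boundary.\<close>

lemma lateral_trace_nonempty:
 assumes sh: "inward_shiftable \<Omega>" and u: "u \<in> HQ_init \<Omega> T E"
 shows "ltrace u \<noteq> {}"
proof -
 obtain V where V: "\<And>k. V k \<in> V_init" "\<And>k. V k \<in> HQs" "tends V u" and uHQ: "u \<in> HQs"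
  using u unfolding HQ_init_def HQ_closure_def by blast
 define \<delta> where "\<delta> k = inverse (real (Suc k))" for k
 have \<delta>: "\<delta> k > 0" for k by (auto simp: \<delta>_def)
 have \<delta>0: "\<delta> \<longlonglongrightarrow> 0" unfolding \<delta>_def[abs_def] by (rule LIMSEQ_inverse_real_of_nat)
 have "\<exists>W. C_diff 1 W \<and> (\<forall>x. W (x, 0) = 0) \<and> L2_dist Q W (V k) < \<delta> k \<and> gdist Q W (V k) < \<delta> k" for k
  using cont_approx_1[OF init_reg_H11_init(1)[OF V(1)] sh Omega_nonempty, of k] \<delta>[of k] unfolding cont_approx_def by simp
 then obtain W where W: "\<And>k. C_diff 1 (W k)" "\<And>k x. W k (x, 0) = 0" "\<And>k. L2_dist Q (W k) (V k) < \<delta> k"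
  "\<And>k. gdist Q (W k) (V k) < \<delta> k" by metis
 have WH: "W k \<in> V_init" for k
  unfolding H11_init_def using C_diff_1_membership(1-4)[OF W(1)] W(2) T_pos by (auto simp: less_imp_le)
 note ir = init_reg_H11_init(1)[OF WH] and irV = init_reg_H11_init(1)[OF V(1)]
 note WHQ = init_reg_HQ(1)[OF ir]
 have "L2_dist Q (W k) u \<le> \<delta> k + L2_dist Q (V k) u" for k
  using L2_norm_triangle3[OF HQ_wave_pair(3)[OF WHQ] HQ_wave_pair(3)[OF V(2)] HQ_wave_pair(3)[OF uHQ], of k k] W(3)[of k] by linarith
 moreover have "(%k. \<delta> k + L2_dist Q (V k) u) \<longlonglongrightarrow> 0"
  using tendsto_add[OF \<delta>0 conjunct1[OF V(3)[unfolded HQ_tends_iff]]] by simp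
 ultimately have "(%k. L2_dist Q (W k) u) \<longlonglongrightarrow> 0"
  by (elim Lim_null_comparison[OF always_eventually, rotated]) (simp add: L2_norm_nonneg)
 moreover have "(%k. wdist (W k) u) \<longlonglongrightarrow> 0"
 proof -
  have b: "wdist (W k) u \<le> \<delta> k + wdist (V k) u" for k
   using wave_norm_diff_le[OF WHQ V(2) uHQ, of k k] wave_norm_init_reg[OF init_reg_diff[OF ir irV], of k k] W(4)[of k] by linarith
  have l: "(%k. \<delta> k + wdist (V k) u) \<longlonglongrightarrow> 0"
   using tendsto_add[OF \<delta>0 conjunct2[OF V(3)[unfolded HQ_tends_iff]]] by simp
  show ?thesis by (rule Lim_null_comparison[OF always_eventually l]) (use b in \<open>simp add: wave_norm_nonneg[OF HQ_diff(1)[OF WHQ uHQ]]\<close>)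
 qed
 ultimately have "tends W u" by (simp add: HQ_tends_iff)
 moreover have "continuous_on (closure Q) (W k)" for k
  by (rule continuous_on_subset[OF C_diff_continuous[OF W(1)]]) simp
 ultimately have "(%k. restrict (W k) (lateral \<Omega> T)) \<in> ltrace u"
  unfolding lateral_trace_def using WH by blast
 then show ?thesis by blast
qed

end

theorem mainTheorem6:
  fixes \<Omega> :: "'a::euclidean_space set" and T :: real
    and E :: "('a \<times> real \<Rightarrow> real) \<Rightarrow> ('a \<times> real \<Rightarrow> real)"
    and f :: "('a \<times> real \<Rightarrow> real) \<Rightarrow> real"
    and g :: "'a lateral_datum"
  assumes "admissible_domain \<Omega>"
    and "0 < T"
    and "extension_operator \<Omega> T E"
    and "f \<in> dual_space (H11_term \<Omega> T) (energy_norm (cylQ \<Omega> T))"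
    and "g \<in> HSigma \<Omega> T E"
  shows "(\<exists>u. dirichlet_solution \<Omega> T E f g u \<and>
            (\<forall>u'. dirichlet_solution \<Omega> T E f g u' \<longrightarrow> ae_eq_on (cylQ \<Omega> T) u' u)) \<and>
         (\<forall>u ug. dirichlet_solution \<Omega> T E f g u \<and> ug \<in> HQ_init \<Omega> T E \<and>
            lateral_trace \<Omega> T E ug = g \<and> HQ_norm \<Omega> T E ug = HSigma_norm \<Omega> T E g \<longrightarrow>
            (\<lambda>p. u p - ug p) \<in> HQ_0init \<Omega> T E \<and>
            wave_norm \<Omega> T E (\<lambda>p. u p - ug p) \<le>
              dual_norm (H11_0term \<Omega> T) (energy_norm (cylQ \<Omega> T)) f +
              extension_norm \<Omega> T E * HSigma_norm \<Omega> T E g)"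
proof -
 note \<Omega> = admissible_domain_props[OF assms(1)]
 interpret wave_setting \<Omega> T E
  by unfold_locales (use \<Omega> assms in auto)
 note W = well_posed[OF lateral_trace_nonempty[OF \<Omega>(4)] assms(4,5)]
 show ?thesis using W by blast
qed

end
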